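(* In the setting described in the context, for all $n\in\overline{\mathbb N}$, the ordered pair $(\mathfrak A_n,L_n)$ is a quantum compact metric space.
   Context: TORI. $\mathbb N_*=\mathbb N\setminus\{0,1\}$, $\overline{\mathbb N}=\mathbb N\cup\{\infty\}$, $\overline{\mathbb N}_*=\mathbb N_*\cup\{\infty\}$ (one-point compactification), $\mathbb T=\{z\in\mathbb C:|z|=1\}$. For $q\in\mathbb N_*$ and $k\in\overline{\mathbb N}_*^q$, $\mathbb Z^q_k=\prod_{j}\mathbb Z/k(j)\mathbb Z$ with $\infty\mathbb Z=\{0\}$; $\infty^q=(\infty,\dots,\infty)$; $e_j$ is the $j$-th canonical vector of $\mathbb Z^q$ or its class in $\mathbb Z^q_k$. A normalized 2-cocycle of an Abelian group $G$ is $\sigma:G\times G\to\mathbb T$ with $\sigma(x,y)\sigma(x+y,z)=\sigma(x,y+z)\sigma(y,z)$, $\sigma(0,x)=\sigma(x,0)=1$, $\sigma(x,-x)=1$. Cocycles of $\mathbb Z^q_k$ are viewed as cocycles of $\mathbb Z^q$ via the quotient map. $\Xi^q$ is the set of pairs $(k,\sigma)$ with $k\in\overline{\mathbb N}_*^q$ and $\sigma$ a normalized 2-cocycle of $\mathbb Z^q_k$, with the topology induced from the product of $\overline{\mathbb N}_*^q$ and the normalized 2-cocycles of $\mathbb Z^q$ with pointwise convergence. For $(k,\sigma)\in\Xi^q$, $m\in\mathbb Z^q_k$: $W^m_{k,\sigma}$ is the unitary on $\ell^2(\mathbb Z^q_k)$ with $(W^m_{k,\sigma}\xi)(p)=\sigma(m,p-m)\xi(p-m)$;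 $C^*(\mathbb Z^q_k,\sigma)$ is the C*-algebra generated by all $W^m_{k,\sigma}$. $\mathbb U^q_k=\{z\in\mathbb T^q: z_j^{k(j)}=1\text{ whenever }k(j)<\infty\}$, and $z^m=\prod_j z_j^{m_j}$ for $m\in\mathbb Z^q_k$, $z\in\mathbb U^q_k$. SETTING. Fix $d,d'\in\mathbb N_*$, $d\le d'$, and a fixed-point-free permutation $f$ of $\{1,\dots,d'\}$ of order $2$ with $\{d+1,\dots,d'\}\subseteq f(\{1,\dots,d\})$. For each $n\in\overline{\mathbb N}$ let $(k_n,\sigma_n)\in\Xi^d$, $(k_n',\sigma_n')\in\Xi^{d'}$ be such that: $(k_n,\sigma_n)\to(k_\infty,\sigma_\infty)$ with $k_\infty=\infty^d$; $(k'_n,\sigma'_n)\to(k'_\infty,\sigma'_\infty)$ with $k'_\infty=\infty^{d'}$; for each $j\le d$ either $k_n(j)<\infty$ for all $n\in\mathbb N$ or $k_n(j)=\infty$ for all $n\in\mathbb N$; $k'_n(f(j))=k'_n(j)=k_n(j)$ for $j\le d$; $\sigma_n$ is the restriction of $\sigma'_n$ to $\mathbb Z^d_{k_n}\times\{0\}$; and, with $U_{n,j}=W^{e_j}_{k'_n,\sigma'_n}$, for all $j\le d$, $s\le d'$: $U_{n,f(j)}U_{n,s}=\lambda\, U_{n,s}U_{n,f(j)}$, where $\lambda=\exp(2i\pi/k_n(j))$ if $s=j$, $k_n(j)<\infty$, $j<f(j)$; $\lambda=\exp(-2i\pi/k_n(j))$ if $s=j$, $k_n(j)<\infty$, $j>f(j)$;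 $\lambda=1$ otherwise. Put $\mathfrak B_n=C^*(\mathbb Z^{d'}_{k'_n},\sigma'_n)$, $\mathfrak A_n=C^*(U_{n,1},\dots,U_{n,d})\subseteq\mathfrak B_n$ (identified with $C^*(\mathbb Z^d_{k_n},\sigma_n)$), $\widehat{G_n}=\mathbb Z^{d'}_{k'_n}$, $G_n=\mathbb U^{d'}_{k'_n}$, $\mathcal H_n=\ell^2(\widehat{G_n})$, $(v_n^z\xi)(m)=z^m\xi(m)$ for $z\in G_n$. Let $z_{n,j}\in G_n$ have $j$-th entry $\exp(2i\pi/k'_n(j))$ (or $1$ if $k'_n(j)=\infty$) and other entries $1$. If $k_n'(j)=\infty$, $(\partial_{n,j}\xi)(m)=i m_j\xi(m)$. Let $(J_n\xi)(m)=\overline{\xi(-m)}$, $\xi\cdot a=J_na^*J_n\xi$, $[a,\xi]=a\xi-\xi\cdot a$ for $a\in\mathfrak B_n$, $\xi\in\mathcal H_n$. $\Re b=\frac{b+b^*}2$, $\Im b=\frac{b-b^*}{2i}$. DIRAC OPERATORS AND $L_n$. For $j\le d$: $X_{n,j}=\Re(U_{n,f(j)})$, $Y_{n,j}=\pm\Im(U_{n,f(j)})$ with sign $+$ if $f(j)>j$, $-$ if $f(j)<j$. For $j\le d$ with $k_n(j)=\infty$: $\Gamma_{n,j}=X_{n,j}\partial_{n,j}$, $\Gamma_{n,d+j}=Y_{n,j}\partial_{n,j}$. For $j\le d$ with $k_n(j)<\infty$: $\Gamma_{n,j}\xi=\frac{-k_n(j)}{2i\pi}[Y_{n,j},\xi]$,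 $\Gamma_{n,d+j}\xi=\frac{k_n(j)}{2i\pi}[X_{n,j},\xi]$. For $d<j\le d'$: $\Gamma_{n,d+j}=\partial_{n,j}$ if $k'_n(j)=\infty$, and $\Gamma_{n,d+j}=\frac{k'_n(j)}{2i\pi}\Im(1-v_n^{z_{n,j}})$ if $k_n'(j)<\infty$. Let $c$ be a fixed faithful *-representation on a finite dimensional Hilbert space $\mathcal S$ of the Clifford algebra generated by $\gamma_1,\dots,\gamma_{d+d'}$ with $\gamma_j^*=-\gamma_j$, $\gamma_j^2=-1$, $\gamma_j\gamma_s=-\gamma_s\gamma_j$ ($j\ne s$). Let $\mathcal J_n=\mathcal H_n\otimes\mathcal S=\ell^2(\widehat{G_n},\mathcal S)$, $a^\circ=a\otimes 1_{\mathcal S}$, $\langle m,m\rangle_n=\sum_{j:k'_n(j)=\infty}m_j^2$, $\mathrm{dom}(D_n)=\{\xi\in\mathcal J_n:\sum_m(1+\langle m,m\rangle_n)\|\xi(m)\|^2<\infty\}$ and $D_n=\sum_{j=1}^{d+d'}\Gamma_{n,j}\otimes c(\gamma_j)$ on $\mathrm{dom}(D_n)$. $L_n(a)=\|[D_n,a^\circ]\|$ on $\mathrm{dom}(L_n)=\{a\in\mathfrak{sa}(\mathfrak A_n):a^\circ\mathrm{dom}(D_n)\subseteq\mathrm{dom}(D_n),\ [D_n,a^\circ]\text{ bounded}\}$, and $L_n=\infty$ on the rest of the self-adjoint part $\mathfrak{sa}(\mathfrak A_n)$. QUANTUM COMPACT METRIC SPACE. A pair $(\mathfrak A,L)$ of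 a unital C*-algebra and a seminorm $L$ defined on a dense subspace $\mathrm{dom}(L)$ of $\mathfrak{sa}(\mathfrak A)$ such that: (1) for $a\in\mathrm{dom}(L)$, $L(a)=0$ iff $a\in\mathbb R1$; (2) $\mathsf{mk}_L(\varphi,\psi)=\sup\{|\varphi(a)-\psi(a)|:a\in\mathrm{dom}(L),L(a)\le1\}$ is a metric on the state space of $\mathfrak A$ inducing the weak* topology; (3) for $a,b\in\mathrm{dom}(L)$, $\frac{ab+ba}2,\frac{ab-ba}{2i}\in\mathrm{dom}(L)$ and $\max\{L(\frac{ab+ba}2),L(\frac{ab-ba}{2i})\}\le\|a\|L(b)+L(a)\|b\|$; (4) $\{a\in\mathrm{dom}(L):L(a)\le1\}$ is closed in $\mathfrak A$. *)

theory Defs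
  imports "HOL-Analysis.Analysis" "HOL-Algebra.Product_Groups" "HOL-Algebra.Ring"
    "HOL-Combinatorics.Permutations"
begin

section \<open>C*-algebras\<close>

record 'a cstar_algebra = "'a ring" +
  cscale :: "complex \<Rightarrow> 'a \<Rightarrow> 'a"
  cstar :: "'a \<Rightarrow> 'a"
  cnorm :: "'a \<Rightarrow> real"

text \<open>The distance is cut off outside the carrier because the locale \<^locale>\<open>Metric_space\<close>
  demands symmetry and nonnegativity on the whole type.\<close>

definition cdist :: "('a, 'm) cstar_algebra_scheme \<Rightarrow> 'a \<Rightarrow> 'a \<Rightarrow> real" where
  "cdist A x y = (if x \<in> carrier A \<and> y \<in> carrier A then cnorm A (x \<ominus>\<^bsub>A\<^esub> y) else 0)"

definition cstar_topology :: "('a, 'm) cstar_algebra_scheme \<Rightarrow> 'a topology" where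
  "cstar_topology A = Metric_space.mtopology (carrier A) (cdist A)"

locale unital_cstar_algebra = ring A for A :: "('a, 'm) cstar_algebra_scheme" (structure) +
  assumes scale_closed: "x \<in> carrier A \<Longrightarrow> cscale A s x \<in> carrier A"
    and scale_add_left:
      "x \<in> carrier A \<Longrightarrow> cscale A (s + t) x = cscale A s x \<oplus> cscale A t x"
    and scale_add_right:
      "x \<in> carrier A \<Longrightarrow> y \<in> carrier A \<Longrightarrow> cscale A s (x \<oplus> y) = cscale A s x \<oplus> cscale A s y"
    and scale_scale: "x \<in> carrier A \<Longrightarrow> cscale A s (cscale A t x) = cscale A (s * t) x"
    and scale_one: "x \<in> carrier A \<Longrightarrow> cscale A 1 x = x"
    and scale_mult_left:
      "x \<in> carrier A \<Longrightarrow> y \<in> carrier A \<Longrightarrow> cscale A s x \<otimes> y = cscale A s (x \<otimes> y)"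
    and scale_mult_right:
      "x \<in> carrier A \<Longrightarrow> y \<in> carrier A \<Longrightarrow> x \<otimes> cscale A s y = cscale A s (x \<otimes> y)"
    and star_closed: "x \<in> carrier A \<Longrightarrow> cstar A x \<in> carrier A"
    and star_star: "x \<in> carrier A \<Longrightarrow> cstar A (cstar A x) = x"
    and star_add:
      "x \<in> carrier A \<Longrightarrow> y \<in> carrier A \<Longrightarrow> cstar A (x \<oplus> y) = cstar A x \<oplus> cstar A y"
    and star_scale: "x \<in> carrier A \<Longrightarrow> cstar A (cscale A s x) = cscale A (cnj s) (cstar A x)"
    and star_mult:
      "x \<in> carrier A \<Longrightarrow> y \<in> carrier A \<Longrightarrow> cstar A (x \<otimes> y) = cstar A y \<otimes> cstar A x"
    and norm_nonneg: "x \<in> carrier A \<Longrightarrow> 0 \<le> cnorm A x"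
    and norm_eq_zero: "x \<in> carrier A \<Longrightarrow> cnorm A x = 0 \<longleftrightarrow> x = \<zero>"
    and norm_triangle:
      "x \<in> carrier A \<Longrightarrow> y \<in> carrier A \<Longrightarrow> cnorm A (x \<oplus> y) \<le> cnorm A x + cnorm A y"
    and norm_scale: "x \<in> carrier A \<Longrightarrow> cnorm A (cscale A s x) = cmod s * cnorm A x"
    and norm_mult:
      "x \<in> carrier A \<Longrightarrow> y \<in> carrier A \<Longrightarrow> cnorm A (x \<otimes> y) \<le> cnorm A x * cnorm A y"
    and cstar_identity: "x \<in> carrier A \<Longrightarrow> cnorm A (cstar A x \<otimes> x) = (cnorm A x)\<^sup>2"
    and complete: "Metric_space.mcomplete (carrier A) (cdist A)"

definition sa :: "('a, 'm) cstar_algebra_scheme \<Rightarrow> 'a set" where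
  "sa A = {a \<in> carrier A. cstar A a = a}"

definition re_part :: "('a, 'm) cstar_algebra_scheme \<Rightarrow> 'a \<Rightarrow> 'a" where
  "re_part A b = cscale A (1 / 2) (b \<oplus>\<^bsub>A\<^esub> cstar A b)"

definition im_part :: "('a, 'm) cstar_algebra_scheme \<Rightarrow> 'a \<Rightarrow> 'a" where
  "im_part A b = cscale A (1 / (2 * \<i>)) (b \<ominus>\<^bsub>A\<^esub> cstar A b)"

definition cstar_closed :: "('a, 'm) cstar_algebra_scheme \<Rightarrow> 'a set \<Rightarrow> bool" where
  "cstar_closed A C \<longleftrightarrow>
     closedin (cstar_topology A) C \<and> \<zero>\<^bsub>A\<^esub> \<in> C \<and>
     (\<forall>x\<in>C. \<forall>y\<in>C. x \<oplus>\<^bsub>A\<^esub> y \<in> C \<and> x \<otimes>\<^bsub>A\<^esub> y \<in> C) \<and>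
     (\<forall>x\<in>C. cstar A x \<in> C \<and> (\<forall>s. cscale A s x \<in> C))"

text \<open>The C*-subalgebra generated by \<open>X\<close>.  The record keeps the unit of \<open>A\<close>, which lies in the
  new carrier as soon as \<open>X\<close> contains a unitary.\<close>

definition cstar_generated ::
  "('a, 'm) cstar_algebra_scheme \<Rightarrow> 'a set \<Rightarrow> ('a, 'm) cstar_algebra_scheme" where
  "cstar_generated A X = A\<lparr>carrier := \<Inter>{C. X \<subseteq> C \<and> cstar_closed A C}\<rparr>"

definition states :: "('a, 'm) cstar_algebra_scheme \<Rightarrow> ('a \<Rightarrow> complex) set" where
  "states A = {\<phi> \<in> extensional (carrier A).
     (\<forall>a\<in>carrier A. \<forall>b\<in>carrier A. \<phi> (a \<oplus>\<^bsub>A\<^esub> b) = \<phi> a + \<phi> b) \<and>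
     (\<forall>a\<in>carrier A. \<forall>s. \<phi> (cscale A s a) = s * \<phi> a) \<and>
     (\<forall>a\<in>carrier A. \<phi> (cstar A a \<otimes>\<^bsub>A\<^esub> a) \<in> \<real>\<^sub>\<ge>\<^sub>0) \<and>
     \<phi> \<one>\<^bsub>A\<^esub> = 1}"

definition weak_star :: "('a, 'm) cstar_algebra_scheme \<Rightarrow> ('a \<Rightarrow> complex) topology" where
  "weak_star A = subtopology (product_topology (\<lambda>_. euclidean) (carrier A)) (states A)"


section \<open>Quantum compact metric spaces\<close>

text \<open>A seminorm on a subspace of the self-adjoint part is encoded as an extended real valued
  function; its domain consists of the self-adjoint elements at which it is finite.\<close>

definition lip_dom :: "('a, 'm) cstar_algebra_scheme \<Rightarrow> ('a \<Rightarrow> ennreal) \<Rightarrow> 'a set" where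
  "lip_dom A L = {a \<in> sa A. L a < \<infinity>}"

text \<open>The supremum may a priori be infinite; finiteness is part of being a metric below.\<close>

definition mk ::
  "('a, 'm) cstar_algebra_scheme \<Rightarrow> ('a \<Rightarrow> ennreal) \<Rightarrow> ('a \<Rightarrow> complex) \<Rightarrow> ('a \<Rightarrow> complex) \<Rightarrow> ennreal" where
  "mk A L \<phi> \<psi> = (SUP a \<in> {a \<in> lip_dom A L. L a \<le> 1}. ennreal (cmod (\<phi> a - \<psi> a)))"

locale quantum_compact_metric_space = unital_cstar_algebra A
  for A :: "('a, 'm) cstar_algebra_scheme" (structure) +
  fixes L :: "'a \<Rightarrow> ennreal"
  assumes seminorm_add:
      "a \<in> lip_dom A L \<Longrightarrow> b \<in> lip_dom A L \<Longrightarrow> a \<oplus> b \<in> lip_dom A L \<and> L (a \<oplus> b) \<le> L a + L b"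
    and seminorm_scale:
      "a \<in> lip_dom A L \<Longrightarrow>
        cscale A (complex_of_real t) a \<in> lip_dom A L \<and>
        L (cscale A (complex_of_real t) a) = ennreal \<bar>t\<bar> * L a"
    and dense: "sa A \<subseteq> cstar_topology A closure_of lip_dom A L"
    and kernel:
      "a \<in> lip_dom A L \<Longrightarrow> L a = 0 \<longleftrightarrow> (\<exists>t::real. a = cscale A (complex_of_real t) \<one>)"
    and mk_finite: "\<phi> \<in> states A \<Longrightarrow> \<psi> \<in> states A \<Longrightarrow> mk A L \<phi> \<psi> < \<infinity>"
    and mk_metric: "Metric_space (states A) (\<lambda>\<phi> \<psi>. enn2real (mk A L \<phi> \<psi>))"
    and mk_topology:
      "Metric_space.mtopology (states A) (\<lambda>\<phi> \<psi>. enn2real (mk A L \<phi> \<psi>)) = weak_star A"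
    and leibniz_jordan:
      "a \<in> lip_dom A L \<Longrightarrow> b \<in> lip_dom A L \<Longrightarrow>
        cscale A (1 / 2) (a \<otimes> b \<oplus> b \<otimes> a) \<in> lip_dom A L \<and>
        L (cscale A (1 / 2) (a \<otimes> b \<oplus> b \<otimes> a))
          \<le> ennreal (cnorm A a) * L b + L a * ennreal (cnorm A b)"
    and leibniz_lie:
      "a \<in> lip_dom A L \<Longrightarrow> b \<in> lip_dom A L \<Longrightarrow>
        cscale A (1 / (2 * \<i>)) (a \<otimes> b \<ominus> b \<otimes> a) \<in> lip_dom A L \<and>
        L (cscale A (1 / (2 * \<i>)) (a \<otimes> b \<ominus> b \<otimes> a))
          \<le> ennreal (cnorm A a) * L b + L a * ennreal (cnorm A b)"
    and ball_closed: "closedin (cstar_topology A) {a \<in> lip_dom A L. L a \<le> 1}"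


section \<open>The Hilbert spaces \<open>l2\<close> and their bounded operators\<close>

text \<open>Vectors are functions on the whole index type vanishing outside the index set; the values
  are in \<^typ>\<open>complex\<close> or, for spinor-valued functions, in \<^typ>\<open>complex^'s\<close>.\<close>

definition l2 :: "'i set \<Rightarrow> ('i \<Rightarrow> 'b::real_normed_vector) set" where
  "l2 I = {\<xi>. (\<forall>i. i \<notin> I \<longrightarrow> \<xi> i = 0) \<and> (\<lambda>i. (norm (\<xi> i))\<^sup>2) summable_on I}"

definition l2_norm :: "'i set \<Rightarrow> ('i \<Rightarrow> 'b::real_normed_vector) \<Rightarrow> real" where
  "l2_norm I \<xi> = sqrt (\<Sum>\<^sub>\<infinity>i\<in>I. (norm (\<xi> i))\<^sup>2)"

definition l2_inner :: "'i set \<Rightarrow> ('i \<Rightarrow> complex) \<Rightarrow> ('i \<Rightarrow> complex) \<Rightarrow> complex" where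
  "l2_inner I \<xi> \<eta> = (\<Sum>\<^sub>\<infinity>i\<in>I. cnj (\<xi> i) * \<eta> i)"

text \<open>\<open>V\<close> is the domain of the operator \<open>T\<close>, which need not be all of \<open>l2 I\<close>.\<close>

definition op_bounded ::
  "'i set \<Rightarrow> ('i \<Rightarrow> 'b::real_normed_vector) set \<Rightarrow> (('i \<Rightarrow> 'b) \<Rightarrow> ('i \<Rightarrow> 'b)) \<Rightarrow> bool" where
  "op_bounded I V T \<longleftrightarrow>
     (\<forall>\<xi>\<in>V. T \<xi> \<in> l2 I) \<and> (\<exists>B. \<forall>\<xi>\<in>V. l2_norm I (T \<xi>) \<le> B * l2_norm I \<xi>)"

definition op_norm ::
  "'i set \<Rightarrow> ('i \<Rightarrow> 'b::real_normed_vector) set \<Rightarrow> (('i \<Rightarrow> 'b) \<Rightarrow> ('i \<Rightarrow> 'b)) \<Rightarrow> real" where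
  "op_norm I V T = (SUP \<xi> \<in> {\<xi> \<in> V. l2_norm I \<xi> \<le> 1}. l2_norm I (T \<xi>))"

definition bounded_ops :: "'i set \<Rightarrow> (('i \<Rightarrow> complex) \<Rightarrow> ('i \<Rightarrow> complex)) set" where
  "bounded_ops I = {T \<in> extensional (l2 I).
     (\<forall>\<xi>\<in>l2 I. \<forall>\<eta>\<in>l2 I. T (\<lambda>i. \<xi> i + \<eta> i) = (\<lambda>i. T \<xi> i + T \<eta> i)) \<and>
     (\<forall>\<xi>\<in>l2 I. \<forall>s. T (\<lambda>i. s * \<xi> i) = (\<lambda>i. s * T \<xi> i)) \<and>
     op_bounded I (l2 I) T}"

definition adjoint_op ::
  "'i set \<Rightarrow> (('i \<Rightarrow> complex) \<Rightarrow> ('i \<Rightarrow> complex)) \<Rightarrow> (('i \<Rightarrow> complex) \<Rightarrow> ('i \<Rightarrow> complex))" where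
  "adjoint_op I T =
     (THE S. S \<in> bounded_ops I \<and>
       (\<forall>\<xi>\<in>l2 I. \<forall>\<eta>\<in>l2 I. l2_inner I (T \<xi>) \<eta> = l2_inner I \<xi> (S \<eta>)))"

definition Bl2 :: "'i set \<Rightarrow> (('i \<Rightarrow> complex) \<Rightarrow> ('i \<Rightarrow> complex)) cstar_algebra" where
  "Bl2 I = \<lparr>carrier = bounded_ops I,
     monoid.mult = (\<lambda>S T. compose (l2 I) S T),
     one = (\<lambda>\<xi>\<in>l2 I. \<xi>),
     ring.zero = (\<lambda>\<xi>\<in>l2 I. \<lambda>i. 0),
     add = (\<lambda>S T. \<lambda>\<xi>\<in>l2 I. \<lambda>i. S \<xi> i + T \<xi> i),
     cscale = (\<lambda>s T. \<lambda>\<xi>\<in>l2 I. \<lambda>i. s * T \<xi> i),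
     cstar = adjoint_op I,
     cnorm = op_norm I (l2 I)\<rparr>"


section \<open>Quotients of \<open>Z^q\<close> and their normalized 2-cocycles\<close>

text \<open>Coordinates are indexed by \<open>{1..q}\<close>.  Both \<^term>\<open>integer_mod_group 0\<close> and \<open>mod 0\<close> encode the
  case of an infinite entry: the former is the group of integers, and \<^prop>\<open>(m::int) mod 0 = m\<close>.\<close>

definition modulus :: "enat \<Rightarrow> nat" where
  "modulus e = (case e of enat n \<Rightarrow> n | \<infinity> \<Rightarrow> 0)"

definition Zk :: "nat \<Rightarrow> (nat \<Rightarrow> enat) \<Rightarrow> (nat \<Rightarrow> int) monoid" where
  "Zk q k = product_group {1..q} (\<lambda>j. integer_mod_group (modulus (k j)))"

definition Zk_class :: "nat \<Rightarrow> (nat \<Rightarrow> enat) \<Rightarrow> (nat \<Rightarrow> int) \<Rightarrow> (nat \<Rightarrow> int)" where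
  "Zk_class q k m = (\<lambda>j\<in>{1..q}. m j mod int (modulus (k j)))"

definition Zk_unit :: "nat \<Rightarrow> (nat \<Rightarrow> enat) \<Rightarrow> nat \<Rightarrow> (nat \<Rightarrow> int)" where
  "Zk_unit q k j = Zk_class q k (\<lambda>i. if i = j then 1 else 0)"

definition normalized_cocycles :: "'g monoid \<Rightarrow> ('g \<times> 'g \<Rightarrow> complex) set" where
  "normalized_cocycles G = {\<sigma> \<in> carrier G \<times> carrier G \<rightarrow>\<^sub>E sphere 0 1.
     (\<forall>x\<in>carrier G. \<forall>y\<in>carrier G. \<forall>z\<in>carrier G.
        \<sigma> (x, y) * \<sigma> (x \<otimes>\<^bsub>G\<^esub> y, z) = \<sigma> (x, y \<otimes>\<^bsub>G\<^esub> z) * \<sigma> (y, z)) \<and>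
     (\<forall>x\<in>carrier G. \<sigma> (\<one>\<^bsub>G\<^esub>, x) = 1 \<and> \<sigma> (x, \<one>\<^bsub>G\<^esub>) = 1 \<and> \<sigma> (x, inv\<^bsub>G\<^esub> x) = 1)}"

definition Xi :: "nat \<Rightarrow> ((nat \<Rightarrow> enat) \<times> ((nat \<Rightarrow> int) \<times> (nat \<Rightarrow> int) \<Rightarrow> complex)) set" where
  "Xi q = {(k, \<sigma>). k \<in> {1..q} \<rightarrow>\<^sub>E {2..} \<and> \<sigma> \<in> normalized_cocycles (Zk q k)}"

text \<open>The order topology of \<^typ>\<open>enat\<close> is that of the one-point compactification.  A cocycle is
  pulled back to \<open>Z^q\<close> along the quotient map before being compared pointwise.\<close>

definition Xi_topology ::
  "nat \<Rightarrow> ((nat \<Rightarrow> enat) \<times> ((nat \<Rightarrow> int) \<times> (nat \<Rightarrow> int) \<Rightarrow> complex)) topology" where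
  "Xi_topology q =
     (let Z = carrier (Zk q (\<lambda>_. \<infinity>)) in
      pullback_topology (Xi q)
        (\<lambda>(k, \<sigma>). (k, \<lambda>(x, y)\<in>Z \<times> Z. \<sigma> (Zk_class q k x, Zk_class q k y)))
        (prod_topology
          (product_topology (\<lambda>_. top_of_set {2..}) {1..q})
          (product_topology (\<lambda>_. euclidean) (Z \<times> Z))))"

definition Zk_embed :: "nat \<Rightarrow> nat \<Rightarrow> (nat \<Rightarrow> int) \<Rightarrow> (nat \<Rightarrow> int)" where
  "Zk_embed d d' m = (\<lambda>j\<in>{1..d'}. if j \<le> d then m j else 0)"

definition twisted_shift ::
  "'g monoid \<Rightarrow> ('g \<times> 'g \<Rightarrow> complex) \<Rightarrow> 'g \<Rightarrow> ('g \<Rightarrow> complex) \<Rightarrow> ('g \<Rightarrow> complex)" where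
  "twisted_shift G \<sigma> m =
     (\<lambda>\<xi>\<in>l2 (carrier G). \<lambda>p. if p \<in> carrier G
        then \<sigma> (m, p \<otimes>\<^bsub>G\<^esub> inv\<^bsub>G\<^esub> m) * \<xi> (p \<otimes>\<^bsub>G\<^esub> inv\<^bsub>G\<^esub> m) else 0)"

definition twisted_group_algebra ::
  "'g monoid \<Rightarrow> ('g \<times> 'g \<Rightarrow> complex) \<Rightarrow> (('g \<Rightarrow> complex) \<Rightarrow> ('g \<Rightarrow> complex)) cstar_algebra" where
  "twisted_group_algebra G \<sigma> =
     cstar_generated (Bl2 (carrier G)) (twisted_shift G \<sigma> ` carrier G)"


section \<open>The Clifford algebra\<close>

text \<open>The algebra with generators \<open>\<gamma>\<^sub>1, \<dots>, \<gamma>\<^sub>N\<close> has the linear basis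
  \<open>\<gamma>\<^sub>I = \<gamma>\<^bsub>i1\<^esub> \<cdots> \<gamma>\<^bsub>ir\<^esub>\<close> for \<open>I = {i1 < \<dots> < ir} \<subseteq> {1..N}\<close>; an element is given by its coefficients.
  Reordering the product \<open>\<gamma>\<^sub>I \<gamma>\<^sub>J\<close> costs a sign for each pair \<open>j < i\<close>, and each
  pair \<open>j = i\<close> contributes \<open>\<gamma>\<^sub>i\<^sup>2 = -1\<close>.\<close>

definition clifford :: "nat \<Rightarrow> (nat set \<Rightarrow> complex) set" where
  "clifford N = {x. \<forall>I. \<not> I \<subseteq> {1..N} \<longrightarrow> x I = 0}"

definition clifford_basis :: "nat set \<Rightarrow> (nat set \<Rightarrow> complex)" where
  "clifford_basis I = (\<lambda>K. if K = I then 1 else 0)"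

definition clifford_gen :: "nat \<Rightarrow> (nat set \<Rightarrow> complex)" where
  "clifford_gen j = clifford_basis {j}"

definition clifford_sign :: "nat set \<Rightarrow> nat set \<Rightarrow> complex" where
  "clifford_sign I J = (-1) ^ card {(i, j). i \<in> I \<and> j \<in> J \<and> j \<le> i}"

definition clifford_mult ::
  "nat \<Rightarrow> (nat set \<Rightarrow> complex) \<Rightarrow> (nat set \<Rightarrow> complex) \<Rightarrow> (nat set \<Rightarrow> complex)" where
  "clifford_mult N x y = (\<lambda>K. \<Sum>I\<in>Pow {1..N}. \<Sum>J\<in>Pow {1..N}.
     if sym_diff I J = K then clifford_sign I J * x I * y J else 0)"

text \<open>For \<open>r = card I\<close>, one has \<open>\<gamma>\<^sub>I\<^sup>* = (-1)\<^sup>r \<gamma>\<^bsub>ir\<^esub> \<cdots> \<gamma>\<^bsub>i1\<^esub>\<close>, and reversing the product costs the sign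
  \<open>(-1)^(r (r - 1) / 2)\<close>.\<close>

definition clifford_star :: "(nat set \<Rightarrow> complex) \<Rightarrow> (nat set \<Rightarrow> complex)" where
  "clifford_star x = (\<lambda>I. (-1) ^ (card I * (card I + 1) div 2) * cnj (x I))"

definition faithful_clifford_rep ::
  "nat \<Rightarrow> ((nat set \<Rightarrow> complex) \<Rightarrow> complex^'s^'s) \<Rightarrow> bool" where
  "faithful_clifford_rep N c \<longleftrightarrow>
     (\<forall>x\<in>clifford N. \<forall>y\<in>clifford N. c (\<lambda>I. x I + y I) = c x + c y) \<and>
     (\<forall>x\<in>clifford N. \<forall>s. c (\<lambda>I. s * x I) = (\<chi> a b. s * c x $ a $ b)) \<and>
     (\<forall>x\<in>clifford N. \<forall>y\<in>clifford N. c (clifford_mult N x y) = c x ** c y) \<and>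
     c (clifford_basis {}) = mat 1 \<and>
     (\<forall>x\<in>clifford N. c (clifford_star x) = (\<chi> a b. cnj (c x $ b $ a))) \<and>
     inj_on c (clifford N)"

lemma clifford_mult_basis:
  assumes "I \<subseteq> {1..N}" "J \<subseteq> {1..N}"
  shows "clifford_mult N (clifford_basis I) (clifford_basis J) =
    (\<lambda>K. clifford_sign I J * clifford_basis (sym_diff I J) K)"
proof
  fix K
  have "clifford_mult N (clifford_basis I) (clifford_basis J) K =
     (\<Sum>I'\<in>Pow {1..N}. if I' = I then (\<Sum>J'\<in>Pow {1..N}. if J' = J then
        (if sym_diff I J = K then clifford_sign I J else 0) else 0) else 0)"
    unfolding clifford_mult_def clifford_basis_def
  proof (rule sum.cong[OF refl])
    fix I'
    show "(\<Sum>J'\<in>Pow {1..N}. if sym_diff I' J' = K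
              then clifford_sign I' J' * (if I' = I then 1 else 0) * (if J' = J then 1 else 0) else 0) =
          (if I' = I then (\<Sum>J'\<in>Pow {1..N}. if J' = J then
              (if sym_diff I J = K then clifford_sign I J else 0) else 0) else 0)"
    proof (cases "I' = I")
      case True
      show ?thesis unfolding True if_P[OF refl]
        by (rule sum.cong[OF refl]) simp
    qed (simp cong: if_cong)
  qed
  also have "\<dots> = (if sym_diff I J = K then clifford_sign I J else 0)"
    using assms by (simp add: sum.delta)
  finally show "clifford_mult N (clifford_basis I) (clifford_basis J) K =
     clifford_sign I J * clifford_basis (sym_diff I J) K"
    by (auto simp: clifford_basis_def)
qed

lemma clifford_sign_singleton: "clifford_sign {i} {j} = (if j \<le> i then -1 else 1)"
proof -
  have "{(a, b). a \<in> {i} \<and> b \<in> {j} \<and> b \<le> a} = (if j \<le> i then {(i, j)} else {})" by auto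
  then show ?thesis by (simp add: clifford_sign_def)
qed

lemma clifford_gen_square:
  assumes "j \<in> {1..N}"
  shows "clifford_mult N (clifford_gen j) (clifford_gen j) = (\<lambda>K. - clifford_basis {} K)"
  using assms clifford_mult_basis[of "{j}" N "{j}"]
  by (simp add: clifford_gen_def clifford_sign_singleton)

lemma clifford_gen_anticommute:
  assumes "i \<in> {1..N}" "j \<in> {1..N}" "i \<noteq> j"
  shows "clifford_mult N (clifford_gen i) (clifford_gen j) =
    (\<lambda>K. - clifford_mult N (clifford_gen j) (clifford_gen i) K)"
  using assms clifford_mult_basis[of "{i}" N "{j}"] clifford_mult_basis[of "{j}" N "{i}"]
  by (auto simp: clifford_gen_def clifford_sign_singleton Un_commute)

lemma clifford_gen_star: "clifford_star (clifford_gen j) = (\<lambda>K. - clifford_gen j K)"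
  by (auto simp: clifford_star_def clifford_gen_def clifford_basis_def)

lemma clifford_basis_insert:
  assumes "i \<in> {1..N}" "I \<subseteq> {1..N}" "\<And>j. j \<in> I \<Longrightarrow> i < j"
  shows "clifford_mult N (clifford_gen i) (clifford_basis I) = clifford_basis (insert i I)"
proof -
  have 1: "{(a, b). a \<in> {i} \<and> b \<in> I \<and> b \<le> a} = {}" using assms(3) by force
  have 2: "sym_diff {i} I = insert i I" using assms(3) by auto
  show ?thesis
    using clifford_mult_basis[of "{i}" N I] assms 2 unfolding clifford_gen_def clifford_sign_def 1
    by simp
qed


section \<open>The Dirac operators and the seminorms\<close>

text \<open>Throughout, \<open>k\<close>, \<open>k'\<close>, \<open>\<sigma>'\<close> stand for the data with a fixed index \<open>n\<close>.\<close>

type_synonym lat_fun = "(nat \<Rightarrow> int) \<Rightarrow> complex"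
type_synonym cocycle = "(nat \<Rightarrow> int) \<times> (nat \<Rightarrow> int) \<Rightarrow> complex"

definition tor_U :: "nat \<Rightarrow> (nat \<Rightarrow> enat) \<Rightarrow> cocycle \<Rightarrow> nat \<Rightarrow> lat_fun \<Rightarrow> lat_fun" where
  "tor_U d' k' \<sigma>' j = twisted_shift (Zk d' k') \<sigma>' (Zk_unit d' k' j)"

definition tor_B :: "nat \<Rightarrow> (nat \<Rightarrow> enat) \<Rightarrow> cocycle \<Rightarrow> (lat_fun \<Rightarrow> lat_fun) cstar_algebra" where
  "tor_B d' k' \<sigma>' = twisted_group_algebra (Zk d' k') \<sigma>'"

definition tor_A :: "nat \<Rightarrow> nat \<Rightarrow> (nat \<Rightarrow> enat) \<Rightarrow> cocycle \<Rightarrow> (lat_fun \<Rightarrow> lat_fun) cstar_algebra" where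
  "tor_A d d' k' \<sigma>' = cstar_generated (tor_B d' k' \<sigma>') (tor_U d' k' \<sigma>' ` {1..d})"

definition tor_v :: "nat \<Rightarrow> (nat \<Rightarrow> enat) \<Rightarrow> (nat \<Rightarrow> complex) \<Rightarrow> lat_fun \<Rightarrow> lat_fun" where
  "tor_v d' k' z = (\<lambda>\<xi>\<in>l2 (carrier (Zk d' k')). \<lambda>m. (\<Prod>j=1..d'. z j powi m j) * \<xi> m)"

definition tor_z :: "nat \<Rightarrow> (nat \<Rightarrow> enat) \<Rightarrow> nat \<Rightarrow> (nat \<Rightarrow> complex)" where
  "tor_z d' k' j = (\<lambda>i\<in>{1..d'}.
     if i = j \<and> k' j \<noteq> \<infinity> then exp (2 * \<i> * pi / of_nat (the_enat (k' j))) else 1)"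

definition tor_partial :: "nat \<Rightarrow> lat_fun \<Rightarrow> lat_fun" where
  "tor_partial j \<xi> = (\<lambda>m. \<i> * of_int (m j) * \<xi> m)"

definition tor_J :: "nat \<Rightarrow> (nat \<Rightarrow> enat) \<Rightarrow> lat_fun \<Rightarrow> lat_fun" where
  "tor_J d' k' \<xi> =
     (\<lambda>m. if m \<in> carrier (Zk d' k') then cnj (\<xi> (inv\<^bsub>Zk d' k'\<^esub> m)) else 0)"

definition tor_comm :: "nat \<Rightarrow> (nat \<Rightarrow> enat) \<Rightarrow> (lat_fun \<Rightarrow> lat_fun) \<Rightarrow> lat_fun \<Rightarrow> lat_fun" where
  "tor_comm d' k' a \<xi> =
     (\<lambda>m. a \<xi> m - tor_J d' k' (cstar (Bl2 (carrier (Zk d' k'))) a (tor_J d' k' \<xi>)) m)"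

definition tor_X ::
  "nat \<Rightarrow> (nat \<Rightarrow> nat) \<Rightarrow> (nat \<Rightarrow> enat) \<Rightarrow> cocycle \<Rightarrow> nat \<Rightarrow> lat_fun \<Rightarrow> lat_fun" where
  "tor_X d' f k' \<sigma>' j = re_part (Bl2 (carrier (Zk d' k'))) (tor_U d' k' \<sigma>' (f j))"

definition tor_Y ::
  "nat \<Rightarrow> (nat \<Rightarrow> nat) \<Rightarrow> (nat \<Rightarrow> enat) \<Rightarrow> cocycle \<Rightarrow> nat \<Rightarrow> lat_fun \<Rightarrow> lat_fun" where
  "tor_Y d' f k' \<sigma>' j =
     cscale (Bl2 (carrier (Zk d' k'))) (if f j > j then 1 else -1)
       (im_part (Bl2 (carrier (Zk d' k'))) (tor_U d' k' \<sigma>' (f j)))"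

text \<open>The operators \<open>\<Gamma>\<^sub>i\<close> for \<open>i \<in> {1..d+d'}\<close>.  They are given by formulas on functions of which only
  the restriction to the natural domain is meaningful.\<close>

definition tor_Gamma ::
  "nat \<Rightarrow> nat \<Rightarrow> (nat \<Rightarrow> nat) \<Rightarrow> (nat \<Rightarrow> enat) \<Rightarrow> (nat \<Rightarrow> enat) \<Rightarrow> cocycle \<Rightarrow> nat \<Rightarrow> lat_fun \<Rightarrow> lat_fun" where
  "tor_Gamma d d' f k k' \<sigma>' i \<xi> =
     (if i \<le> d then
        (if k i = \<infinity> then tor_X d' f k' \<sigma>' i (tor_partial i \<xi>)
         else (\<lambda>m. - of_nat (the_enat (k i)) / (2 * \<i> * pi)
                     * tor_comm d' k' (tor_Y d' f k' \<sigma>' i) \<xi> m))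
      else let j = i - d in
        if j \<le> d then
          (if k j = \<infinity> then tor_Y d' f k' \<sigma>' j (tor_partial j \<xi>)
           else (\<lambda>m. of_nat (the_enat (k j)) / (2 * \<i> * pi)
                       * tor_comm d' k' (tor_X d' f k' \<sigma>' j) \<xi> m))
        else
          (if k' j = \<infinity> then tor_partial j \<xi>
           else (\<lambda>m. of_nat (the_enat (k' j)) / (2 * \<i> * pi)
                       * im_part (Bl2 (carrier (Zk d' k')))
                           (\<one>\<^bsub>Bl2 (carrier (Zk d' k'))\<^esub> \<ominus>\<^bsub>Bl2 (carrier (Zk d' k'))\<^esub>
                              tor_v d' k' (tor_z d' k' j)) \<xi> m)))"

definition tor_sqlen :: "nat \<Rightarrow> (nat \<Rightarrow> enat) \<Rightarrow> (nat \<Rightarrow> int) \<Rightarrow> real" where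
  "tor_sqlen d' k' m = (\<Sum>j | j \<in> {1..d'} \<and> k' j = \<infinity>. (of_int (m j))\<^sup>2)"

definition tor_domD :: "nat \<Rightarrow> (nat \<Rightarrow> enat) \<Rightarrow> ((nat \<Rightarrow> int) \<Rightarrow> complex^'s) set" where
  "tor_domD d' k' = {\<xi> \<in> l2 (carrier (Zk d' k')).
     (\<lambda>m. (1 + tor_sqlen d' k' m) * (norm (\<xi> m))\<^sup>2) summable_on carrier (Zk d' k')}"

text \<open>The spinor space is \<^typ>\<open>complex^'s\<close>, so the tensor product with \<open>l2\<close> is the space of
  square-summable spinor-valued functions.\<close>

definition amplify :: "(lat_fun \<Rightarrow> lat_fun) \<Rightarrow> ((nat \<Rightarrow> int) \<Rightarrow> complex^'s) \<Rightarrow> ((nat \<Rightarrow> int) \<Rightarrow> complex^'s)" where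
  "amplify T \<xi> = (\<lambda>m. \<chi> t. T (\<lambda>p. \<xi> p $ t) m)"

definition tor_D ::
  "nat \<Rightarrow> nat \<Rightarrow> (nat \<Rightarrow> nat) \<Rightarrow> (nat \<Rightarrow> enat) \<Rightarrow> (nat \<Rightarrow> enat) \<Rightarrow> cocycle \<Rightarrow>
   ((nat set \<Rightarrow> complex) \<Rightarrow> complex^'s^'s) \<Rightarrow>
   ((nat \<Rightarrow> int) \<Rightarrow> complex^'s) \<Rightarrow> ((nat \<Rightarrow> int) \<Rightarrow> complex^'s)" where
  "tor_D d d' f k k' \<sigma>' c \<xi> =
     (\<lambda>m. \<Sum>i=1..d+d'. c (clifford_gen i) *v amplify (tor_Gamma d d' f k k' \<sigma>' i) \<xi> m)"

definition tor_D_comm ::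
  "nat \<Rightarrow> nat \<Rightarrow> (nat \<Rightarrow> nat) \<Rightarrow> (nat \<Rightarrow> enat) \<Rightarrow> (nat \<Rightarrow> enat) \<Rightarrow> cocycle \<Rightarrow>
   ((nat set \<Rightarrow> complex) \<Rightarrow> complex^'s^'s) \<Rightarrow> (lat_fun \<Rightarrow> lat_fun) \<Rightarrow>
   ((nat \<Rightarrow> int) \<Rightarrow> complex^'s) \<Rightarrow> ((nat \<Rightarrow> int) \<Rightarrow> complex^'s)" where
  "tor_D_comm d d' f k k' \<sigma>' c a \<xi> =
     (\<lambda>m. tor_D d d' f k k' \<sigma>' c (amplify a \<xi>) m - amplify a (tor_D d d' f k k' \<sigma>' c \<xi>) m)"

definition tor_domL ::
  "nat \<Rightarrow> nat \<Rightarrow> (nat \<Rightarrow> nat) \<Rightarrow> (nat \<Rightarrow> enat) \<Rightarrow> (nat \<Rightarrow> enat) \<Rightarrow> cocycle \<Rightarrow>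
   ((nat set \<Rightarrow> complex) \<Rightarrow> complex^'s^'s) \<Rightarrow> (lat_fun \<Rightarrow> lat_fun) set" where
  "tor_domL d d' f k k' \<sigma>' c = {a \<in> sa (tor_A d d' k' \<sigma>').
     amplify a ` tor_domD d' k' \<subseteq> (tor_domD d' k' :: ((nat \<Rightarrow> int) \<Rightarrow> complex^'s) set) \<and>
     op_bounded (carrier (Zk d' k')) (tor_domD d' k') (tor_D_comm d d' f k k' \<sigma>' c a)}"

definition tor_L ::
  "nat \<Rightarrow> nat \<Rightarrow> (nat \<Rightarrow> nat) \<Rightarrow> (nat \<Rightarrow> enat) \<Rightarrow> (nat \<Rightarrow> enat) \<Rightarrow> cocycle \<Rightarrow>
   ((nat set \<Rightarrow> complex) \<Rightarrow> complex^'s^'s) \<Rightarrow> (lat_fun \<Rightarrow> lat_fun) \<Rightarrow> ennreal" where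
  "tor_L d d' f k k' \<sigma>' c a =
     (if a \<in> tor_domL d d' f k k' \<sigma>' c
      then ennreal (op_norm (carrier (Zk d' k')) (tor_domD d' k') (tor_D_comm d d' f k k' \<sigma>' c a))
      else \<infinity>)"

end

theory Submission
  imports Defs
begin

text \<open>An element \<open>a\<close> of \<open>A\<^sub>n\<close> is determined by its coefficients \<open>a p = (a \<delta>\<^sub>0)(p)\<close>: its matrix has entries
  \<open>a (m - q) \<sigma> (m - q, q)\<close>. Every \<open>[\<Gamma>\<^sub>i, a]\<close> is bounded by a multiple of \<open>L\<^sub>n a\<close>, since the Clifford generators are
  linearly independent. For infinite \<open>k\<^sub>n(j)\<close>, the identity \<open>X\<^sub>j\<^sup>2 + Y\<^sub>j\<^sup>2 = 1\<close> and the fact that \<open>U\<^bsub>f(j)\<^esub>\<close>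
  commutes with \<open>A\<^sub>n\<close> and acts alike on both sides turn this into a bound on \<open>[\<partial>\<^sub>j, a]\<close>; for finite \<open>k\<^sub>n(j)\<close> it bounds
  \<open>[U\<^bsub>f(j)\<^esub>, a]\<close>, hence \<open>(\<lambda>\<^bsup>p(j)\<^esup> - 1) a p\<close> with \<open>\<lambda> = exp (\<plusminus>2 \<pi> \<i> / k\<^sub>n(j))\<close>. Thus all coefficients but the constant one are bounded on the Lipschitz
  ball. Moreover cutting off the coefficients with \<open>\<bar>p(j)\<bar> > N\<close> costs at most \<open>sqrt (2 / N) \<parallel>[\<partial>\<^sub>j, a]\<parallel>\<close>, by Cauchy-Schwarz
  along the \<open>j\<close>-th coordinate. So, up to \<open>\<epsilon>\<close>, two states differ on the Lipschitz ball only through finitely many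
  bounded coefficients, which makes \<open>mk\<close> continuous for the weak* topology.\<close>

section \<open>Square-summable functions\<close>

text \<open>The operators \<open>\<Gamma>\<close> contain multiplications by X_j and Y_j, which the
  dual torus action does not fix, so elements are not smoothed by averaging over that action; their
  matrices are truncated entrywise instead. A sharp cut to a band of width N is bounded only by a
  factor sqrt (2 N + 1), so with several infinite coordinates the widths are chosen one after
  another, each tolerance divided by the factors already spent. The surviving matrix is a finite
  combination of the unitaries, hence an element of the algebra, at which states can be evaluated.
  That matrices have this convolution form, supported on the first d coordinates, comes from
  commutation with the right translations and with a projection, two conditions that hold for
  generators and survive norm limits. Closedness of the Lipschitz ball cannot use norm convergence
  of derivatives: a norm limit of Lipschitz elements maps the domain to itself because the
  derivatives stay uniformly bounded on finite sets of lattice points. The constant coefficient has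
  no bound from L, but all states agree at the unit.\<close>

lemma l2_boundI:
  assumes "\<And>i. i \<notin> I \<Longrightarrow> \<xi> i = 0"
    and bnd: "\<And>F. finite F \<Longrightarrow> F \<subseteq> I \<Longrightarrow> L2_set (\<lambda>i. norm (\<xi> i)) F \<le> B"
  shows "\<xi> \<in> l2 I" "l2_norm I \<xi> \<le> B"
proof -
  have B: "0 \<le> B" using bnd[of "{}"] by simp
  have s: "(\<Sum>i\<in>F. (norm (\<xi> i))\<^sup>2) \<le> B\<^sup>2" if "finite F" "F \<subseteq> I" for F
    using bnd[OF that] B sqrt_le_D unfolding L2_set_def by blast
  have sm: "(\<lambda>i. (norm (\<xi> i))\<^sup>2) summable_on I"
    by (rule nonneg_bdd_above_summable_on) (auto intro!: bdd_aboveI[where M = "B\<^sup>2"] s)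
  then show "\<xi> \<in> l2 I" using assms(1) by (simp add: l2_def)
  have "(\<Sum>\<^sub>\<infinity>i\<in>I. (norm (\<xi> i))\<^sup>2) \<le> B\<^sup>2"
    by (rule infsum_le_finite_sums[OF sm]) (use s in auto)
  then show "l2_norm I \<xi> \<le> B"
    unfolding l2_norm_def using B by (simp add: real_le_lsqrt)
qed

lemma l2_outside: "\<xi> \<in> l2 I \<Longrightarrow> i \<notin> I \<Longrightarrow> \<xi> i = 0"
  by (simp add: l2_def)

lemma l2_norm_nonneg [simp]: "0 \<le> l2_norm I \<xi>"
  by (simp add: l2_norm_def infsum_nonneg)

lemma l2_norm_power2: "\<xi> \<in> l2 I \<Longrightarrow> (l2_norm I \<xi>)\<^sup>2 = (\<Sum>\<^sub>\<infinity>i\<in>I. (norm (\<xi> i))\<^sup>2)"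
  by (simp add: l2_norm_def infsum_nonneg)

lemma L2_set_le_l2_norm:
  assumes "\<xi> \<in> l2 I" "finite F" "F \<subseteq> I"
  shows "L2_set (\<lambda>i. norm (\<xi> i)) F \<le> l2_norm I \<xi>"
  unfolding L2_set_def l2_norm_def
  using assms by (intro real_sqrt_le_mono finite_sum_le_infsum) (auto simp: l2_def)

lemma norm_le_l2_norm:
  assumes "\<xi> \<in> l2 I"
  shows "norm (\<xi> i) \<le> l2_norm I \<xi>"
proof (cases "i \<in> I")
  case True
  then show ?thesis using L2_set_le_l2_norm[OF assms, of "{i}"] by (simp add: L2_set_def)
qed (simp add: l2_outside[OF assms])

lemma l2_norm_eq_0: "\<xi> \<in> l2 I \<Longrightarrow> l2_norm I \<xi> = 0 \<longleftrightarrow> \<xi> = (\<lambda>_. 0)"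
  using norm_le_l2_norm[of \<xi> I] by (auto simp: fun_eq_iff) (simp add: l2_norm_def)

text \<open>The two value types may differ, so the same comparison passes from a spinor-valued
  function to a component, or from the norms of the components back to the spinor.\<close>

lemma l2_dominated:
  fixes \<xi> :: "'i \<Rightarrow> 'b::real_normed_vector" and \<eta> :: "'i \<Rightarrow> 'c::real_normed_vector"
  assumes "\<xi> \<in> l2 I" "0 \<le> c" "\<And>i. i \<notin> I \<Longrightarrow> \<eta> i = 0"
    "\<And>i. i \<in> I \<Longrightarrow> norm (\<eta> i) \<le> c * norm (\<xi> i)"
  shows "\<eta> \<in> l2 I" "l2_norm I \<eta> \<le> c * l2_norm I \<xi>"
proof -
  have *: "L2_set (\<lambda>i. norm (\<eta> i)) F \<le> c * l2_norm I \<xi>" if F: "finite F" "F \<subseteq> I" for F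
  proof -
    have "L2_set (\<lambda>i. norm (\<eta> i)) F \<le> L2_set (\<lambda>i. c * norm (\<xi> i)) F"
      using F assms(4) by (intro L2_set_mono) auto
    also have "\<dots> = c * L2_set (\<lambda>i. norm (\<xi> i)) F"
      using assms(2) by (simp add: L2_set_right_distrib)
    also have "\<dots> \<le> c * l2_norm I \<xi>"
      using L2_set_le_l2_norm[OF assms(1) F] assms(2) by (rule mult_left_mono)
    finally show ?thesis .
  qed
  show "\<eta> \<in> l2 I" "l2_norm I \<eta> \<le> c * l2_norm I \<xi>"
    using l2_boundI[OF assms(3) *] by auto
qed

lemma l2_zero [simp]: "(\<lambda>_. 0) \<in> l2 I"
  by (simp add: l2_def)

lemma l2_norm_zero [simp]: "l2_norm I (\<lambda>_. 0) = 0"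
  by (simp add: l2_norm_def)

lemma l2_add:
  assumes "\<xi> \<in> l2 I" "\<eta> \<in> l2 I"
  shows "(\<lambda>i. \<xi> i + \<eta> i) \<in> l2 I" "l2_norm I (\<lambda>i. \<xi> i + \<eta> i) \<le> l2_norm I \<xi> + l2_norm I \<eta>"
proof -
  have *: "L2_set (\<lambda>i. norm (\<xi> i + \<eta> i)) F \<le> l2_norm I \<xi> + l2_norm I \<eta>" if F: "finite F" "F \<subseteq> I" for F
  proof -
    have "L2_set (\<lambda>i. norm (\<xi> i + \<eta> i)) F \<le> L2_set (\<lambda>i. norm (\<xi> i) + norm (\<eta> i)) F"
      by (intro L2_set_mono norm_triangle_ineq) auto
    also have "\<dots> \<le> L2_set (\<lambda>i. norm (\<xi> i)) F + L2_set (\<lambda>i. norm (\<eta> i)) F"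
      by (rule L2_set_triangle_ineq)
    also have "\<dots> \<le> l2_norm I \<xi> + l2_norm I \<eta>"
      using L2_set_le_l2_norm[OF _ F] assms by (intro add_mono) auto
    finally show ?thesis .
  qed
  have 0: "\<xi> i + \<eta> i = 0" if "i \<notin> I" for i using assms that by (simp add: l2_outside)
  show "(\<lambda>i. \<xi> i + \<eta> i) \<in> l2 I" "l2_norm I (\<lambda>i. \<xi> i + \<eta> i) \<le> l2_norm I \<xi> + l2_norm I \<eta>"
    using l2_boundI[of I "\<lambda>i. \<xi> i + \<eta> i", OF 0 *] by auto
qed

lemma l2_scaleR:
  assumes "\<xi> \<in> l2 I"
  shows "(\<lambda>i. r *\<^sub>R \<xi> i) \<in> l2 I" "l2_norm I (\<lambda>i. r *\<^sub>R \<xi> i) = \<bar>r\<bar> * l2_norm I \<xi>"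
proof -
  have *: "(\<lambda>i. s *\<^sub>R \<zeta> i) \<in> l2 I \<and> l2_norm I (\<lambda>i. s *\<^sub>R \<zeta> i) \<le> \<bar>s\<bar> * l2_norm I \<zeta>"
    if "\<zeta> \<in> l2 I" for s and \<zeta> :: "'a \<Rightarrow> 'b"
    using l2_dominated[OF that, of "\<bar>s\<bar>" "\<lambda>i. s *\<^sub>R \<zeta> i"] that by (auto simp: l2_outside)
  show 1: "(\<lambda>i. r *\<^sub>R \<xi> i) \<in> l2 I" using * assms by blast
  have "\<bar>r\<bar> * l2_norm I \<xi> \<le> l2_norm I (\<lambda>i. r *\<^sub>R \<xi> i)"
  proof (cases "r = 0")
    case False
    have "l2_norm I \<xi> = l2_norm I (\<lambda>i. inverse r *\<^sub>R (r *\<^sub>R \<xi> i))" using False by simp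
    also have "\<dots> \<le> \<bar>inverse r\<bar> * l2_norm I (\<lambda>i. r *\<^sub>R \<xi> i)" using *[OF 1, of "inverse r"] by blast
    finally show ?thesis using False by (simp add: field_simps)
  qed simp
  then show "l2_norm I (\<lambda>i. r *\<^sub>R \<xi> i) = \<bar>r\<bar> * l2_norm I \<xi>" using *[OF assms, of r] by simp
qed

lemma l2_scale:
  fixes \<xi> :: "'i \<Rightarrow> complex"
  assumes "\<xi> \<in> l2 I"
  shows "(\<lambda>i. s * \<xi> i) \<in> l2 I" "l2_norm I (\<lambda>i. s * \<xi> i) = cmod s * l2_norm I \<xi>"
proof -
  have *: "(\<lambda>i. s * \<zeta> i) \<in> l2 I \<and> l2_norm I (\<lambda>i. s * \<zeta> i) \<le> cmod s * l2_norm I \<zeta>"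
    if "\<zeta> \<in> l2 I" for s and \<zeta> :: "'i \<Rightarrow> complex"
    using l2_dominated[OF that, of "cmod s" "\<lambda>i. s * \<zeta> i"] that by (auto simp: l2_outside norm_mult)
  show 1: "(\<lambda>i. s * \<xi> i) \<in> l2 I" using * assms by blast
  have "cmod s * l2_norm I \<xi> \<le> l2_norm I (\<lambda>i. s * \<xi> i)"
  proof (cases "s = 0")
    case False
    have "l2_norm I \<xi> = l2_norm I (\<lambda>i. inverse s * (s * \<xi> i))" using False by (simp flip: mult.assoc)
    also have "\<dots> \<le> cmod (inverse s) * l2_norm I (\<lambda>i. s * \<xi> i)" using *[OF 1, of "inverse s"] by blast
    finally show ?thesis using False by (simp add: field_simps norm_divide)
  qed simp
  then show "l2_norm I (\<lambda>i. s * \<xi> i) = cmod s * l2_norm I \<xi>" using *[OF assms, of s] by simp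
qed

lemma l2_diff:
  assumes "\<xi> \<in> l2 I" "\<eta> \<in> l2 I"
  shows "(\<lambda>i. \<xi> i - \<eta> i) \<in> l2 I" "l2_norm I (\<lambda>i. \<xi> i - \<eta> i) \<le> l2_norm I \<xi> + l2_norm I \<eta>"
  using l2_add[OF assms(1) l2_scaleR(1)[OF assms(2), of "-1"]] l2_scaleR(2)[OF assms(2), of "-1"] by auto

lemma l2_norm_minus_commute: "l2_norm I (\<lambda>i. \<xi> i - \<eta> i) = l2_norm I (\<lambda>i. \<eta> i - \<xi> i)"
  by (simp add: l2_norm_def norm_minus_commute)

lemma l2_sum:
  assumes "\<And>k. k \<in> K \<Longrightarrow> \<xi> k \<in> l2 I"
  shows "(\<lambda>i. \<Sum>k\<in>K. \<xi> k i) \<in> l2 I" "l2_norm I (\<lambda>i. \<Sum>k\<in>K. \<xi> k i) \<le> (\<Sum>k\<in>K. l2_norm I (\<xi> k))"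
proof -
  have "(\<lambda>i. \<Sum>k\<in>K. \<xi> k i) \<in> l2 I \<and> l2_norm I (\<lambda>i. \<Sum>k\<in>K. \<xi> k i) \<le> (\<Sum>k\<in>K. l2_norm I (\<xi> k))"
    using assms
  proof (induction K rule: infinite_finite_induct)
    case (insert x F)
    then show ?case
      using l2_add[of "\<xi> x" I "\<lambda>i. \<Sum>k\<in>F. \<xi> k i"] by (auto intro: order_trans)
  qed auto
  then show "(\<lambda>i. \<Sum>k\<in>K. \<xi> k i) \<in> l2 I" "l2_norm I (\<lambda>i. \<Sum>k\<in>K. \<xi> k i) \<le> (\<Sum>k\<in>K. l2_norm I (\<xi> k))"
    by auto
qed

section \<open>Finitely supported vectors, cut-offs and the inner product\<close>

definition delta :: "'i \<Rightarrow> 'i \<Rightarrow> complex" where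
  "delta i = (\<lambda>j. if j = i then 1 else 0)"

text \<open>\<open>F\<close> is required neither to be finite nor to lie in the index set: with a
  finite set this truncates a vector, with a subgroup it is the projection behind
  \<open>restrict_op\<close>.\<close>

definition cutoff :: "'i set \<Rightarrow> ('i \<Rightarrow> 'b) \<Rightarrow> 'i \<Rightarrow> 'b::zero" where
  "cutoff F \<xi> = (\<lambda>i. if i \<in> F then \<xi> i else 0)"

lemma l2_cutoff:
  assumes "\<xi> \<in> l2 I"
  shows "cutoff S \<xi> \<in> l2 I" "l2_norm I (cutoff S \<xi>) \<le> l2_norm I \<xi>"
  using l2_dominated[OF assms, of 1 "cutoff S \<xi>"] assms by (auto simp: cutoff_def l2_outside)

lemma l2_norm_finite_support:
  assumes "finite F" "F \<subseteq> I" "\<And>i. i \<notin> F \<Longrightarrow> \<xi> i = 0"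
  shows "\<xi> \<in> l2 I" "l2_norm I \<xi> = L2_set (\<lambda>i. norm (\<xi> i)) F"
proof -
  have *: "L2_set (\<lambda>i. norm (\<xi> i)) E \<le> L2_set (\<lambda>i. norm (\<xi> i)) F" if "finite E" "E \<subseteq> I" for E
  proof -
    have "(\<Sum>i\<in>E. (norm (\<xi> i))\<^sup>2) = (\<Sum>i\<in>E \<inter> F. (norm (\<xi> i))\<^sup>2)"
      using that assms by (intro sum.mono_neutral_right) auto
    also have "\<dots> \<le> (\<Sum>i\<in>F. (norm (\<xi> i))\<^sup>2)" using assms by (intro sum_mono2) auto
    finally show ?thesis by (simp add: L2_set_def)
  qed
  have 0: "\<xi> i = 0" if "i \<notin> I" for i using assms that by auto
  note l2_boundI[of I \<xi>, OF 0 *]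
  then show "\<xi> \<in> l2 I" "l2_norm I \<xi> = L2_set (\<lambda>i. norm (\<xi> i)) F"
    using L2_set_le_l2_norm[of \<xi> I F] assms by auto
qed

lemma delta_l2 [simp]: "i \<in> I \<Longrightarrow> delta i \<in> l2 I"
  and l2_norm_delta: "i \<in> I \<Longrightarrow> l2_norm I (delta i) = 1"
  using l2_norm_finite_support[of "{i}" I "delta i"] by (auto simp: delta_def L2_set_def)

text \<open>The squared distance to the cut-off is the total sum minus the sum over F, so this is
  convergence of the series along the net of finite sets; finitely supported vectors are thereby
  dense.\<close>

lemma l2_cutoff_tendsto:
  assumes "\<xi> \<in> l2 I"
  shows "((\<lambda>F. l2_norm I (\<lambda>i. \<xi> i - cutoff F \<xi> i)) \<longlongrightarrow> 0) (finite_subsets_at_top I)"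
proof -
  let ?g = "\<lambda>i. (norm (\<xi> i))\<^sup>2"
  have sm: "?g summable_on I" using assms by (simp add: l2_def)
  have eq: "l2_norm I (\<lambda>i. \<xi> i - cutoff F \<xi> i) = sqrt (infsum ?g I - sum ?g F)" if F: "finite F" "F \<subseteq> I" for F
  proof -
    have "infsum (\<lambda>i. (norm (\<xi> i - cutoff F \<xi> i))\<^sup>2) I = infsum ?g (I - F)"
      by (rule infsum_cong_neutral) (auto simp: cutoff_def)
    also have "\<dots> = infsum ?g I - infsum ?g F"
      using F sm by (intro infsum_Diff) auto
    finally show ?thesis using F by (simp add: l2_norm_def)
  qed
  have "((\<lambda>F. sqrt (infsum ?g I - sum ?g F)) \<longlongrightarrow> sqrt (infsum ?g I - infsum ?g I)) (finite_subsets_at_top I)"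
    by (intro tendsto_intros infsum_tendsto sm)
  then have "((\<lambda>F. sqrt (infsum ?g I - sum ?g F)) \<longlongrightarrow> 0) (finite_subsets_at_top I)" by simp
  then show ?thesis
    by (rule Lim_transform_eventually) (intro eventually_finite_subsets_at_top_weakI, simp add: eq)
qed

lemma l2_mult_abs_summable:
  fixes \<xi> \<eta> :: "'i \<Rightarrow> complex"
  assumes "\<xi> \<in> l2 I" "\<eta> \<in> l2 I"
  shows "(\<lambda>i. norm (\<xi> i * \<eta> i)) summable_on I"
    "cmod (\<Sum>\<^sub>\<infinity>i\<in>I. \<xi> i * \<eta> i) \<le> l2_norm I \<xi> * l2_norm I \<eta>"
proof -
  have *: "(\<Sum>i\<in>F. norm (\<xi> i * \<eta> i)) \<le> l2_norm I \<xi> * l2_norm I \<eta>" if F: "finite F" "F \<subseteq> I" for F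
  proof -
    have "(\<Sum>i\<in>F. norm (\<xi> i * \<eta> i)) \<le> L2_set (\<lambda>i. norm (\<xi> i)) F * L2_set (\<lambda>i. norm (\<eta> i)) F"
      using L2_set_mult_ineq[of "\<lambda>i. norm (\<xi> i)" "\<lambda>i. norm (\<eta> i)" F] by (simp add: norm_mult)
    also have "\<dots> \<le> l2_norm I \<xi> * l2_norm I \<eta>"
      by (intro mult_mono L2_set_le_l2_norm F assms) auto
    finally show ?thesis .
  qed
  show 1: "(\<lambda>i. norm (\<xi> i * \<eta> i)) summable_on I"
    by (rule nonneg_bdd_above_summable_on) (auto intro!: bdd_aboveI[where M = "l2_norm I \<xi> * l2_norm I \<eta>"] *)
  have "cmod (\<Sum>\<^sub>\<infinity>i\<in>I. \<xi> i * \<eta> i) \<le> (\<Sum>\<^sub>\<infinity>i\<in>I. norm (\<xi> i * \<eta> i))"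
    by (rule norm_infsum_bound[OF 1])
  also have "\<dots> \<le> l2_norm I \<xi> * l2_norm I \<eta>"
    by (rule infsum_le_finite_sums[OF 1]) (rule *)
  finally show "cmod (\<Sum>\<^sub>\<infinity>i\<in>I. \<xi> i * \<eta> i) \<le> l2_norm I \<xi> * l2_norm I \<eta>" .
qed

lemma l2_cnj: "\<xi> \<in> l2 I \<Longrightarrow> (\<lambda>i. cnj (\<xi> i)) \<in> l2 I"
  and l2_norm_cnj: "l2_norm I (\<lambda>i. cnj (\<xi> i)) = l2_norm I \<xi>"
  by (simp_all add: l2_def l2_norm_def)

lemma l2_inner_bound:
  assumes "\<xi> \<in> l2 I" "\<eta> \<in> l2 I"
  shows "cmod (l2_inner I \<xi> \<eta>) \<le> l2_norm I \<xi> * l2_norm I \<eta>"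
  using l2_mult_abs_summable(2)[OF l2_cnj[OF assms(1)] assms(2)] by (simp add: l2_inner_def l2_norm_cnj)

lemma l2_inner_has_sum:
  assumes "\<xi> \<in> l2 I" "\<eta> \<in> l2 I"
  shows "((\<lambda>i. cnj (\<xi> i) * \<eta> i) has_sum l2_inner I \<xi> \<eta>) I"
  unfolding l2_inner_def
  by (intro has_sum_infsum abs_summable_summable[OF l2_mult_abs_summable(1)] l2_cnj assms)

lemma l2_inner_self:
  assumes "\<xi> \<in> l2 I"
  shows "l2_inner I \<xi> \<xi> = complex_of_real ((l2_norm I \<xi>)\<^sup>2)"
proof -
  have "((\<lambda>i. (norm (\<xi> i))\<^sup>2) has_sum (l2_norm I \<xi>)\<^sup>2) I"
    using assms by (simp add: l2_norm_power2) (simp add: l2_def)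
  then have "((\<lambda>i. complex_of_real ((norm (\<xi> i))\<^sup>2)) has_sum complex_of_real ((l2_norm I \<xi>)\<^sup>2)) I"
    by (simp only: has_sum_of_real_iff)
  moreover have "complex_of_real ((norm (\<xi> i))\<^sup>2) = cnj (\<xi> i) * \<xi> i" for i
    by (simp add: complex_norm_square mult.commute del: of_real_power)
  ultimately have "((\<lambda>i. cnj (\<xi> i) * \<xi> i) has_sum complex_of_real ((l2_norm I \<xi>)\<^sup>2)) I"
    by simp
  then show ?thesis
    by (rule has_sum_unique[OF l2_inner_has_sum[OF assms assms]])
qed


section \<open>Bounded operators and their matrices\<close>

lemma bounded_ops_closed: "T \<in> bounded_ops I \<Longrightarrow> \<xi> \<in> l2 I \<Longrightarrow> T \<xi> \<in> l2 I"
  by (simp add: bounded_ops_def op_bounded_def)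

lemma bounded_ops_outside: "T \<in> bounded_ops I \<Longrightarrow> \<xi> \<in> l2 I \<Longrightarrow> i \<notin> I \<Longrightarrow> T \<xi> i = 0"
  using bounded_ops_closed l2_outside by metis

lemma bounded_ops_add:
  "T \<in> bounded_ops I \<Longrightarrow> \<xi> \<in> l2 I \<Longrightarrow> \<eta> \<in> l2 I \<Longrightarrow> T (\<lambda>i. \<xi> i + \<eta> i) = (\<lambda>i. T \<xi> i + T \<eta> i)"
  by (simp add: bounded_ops_def)

lemma bounded_ops_scale:
  "T \<in> bounded_ops I \<Longrightarrow> \<xi> \<in> l2 I \<Longrightarrow> T (\<lambda>i. s * \<xi> i) = (\<lambda>i. s * T \<xi> i)"
  by (simp add: bounded_ops_def)

lemma bounded_ops_zero: "T \<in> bounded_ops I \<Longrightarrow> T (\<lambda>_. 0) = (\<lambda>_. 0)"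
  using bounded_ops_scale[of T I "\<lambda>_. 0" 0] by simp

lemma bounded_ops_diff:
  assumes "T \<in> bounded_ops I" "\<xi> \<in> l2 I" "\<eta> \<in> l2 I"
  shows "T (\<lambda>i. \<xi> i - \<eta> i) = (\<lambda>i. T \<xi> i - T \<eta> i)"
  using bounded_ops_add[OF assms(1,2) l2_scale(1)[OF assms(3), of "-1"]]
    bounded_ops_scale[OF assms(1,3), of "-1"] by simp

lemma bounded_ops_sum:
  assumes "T \<in> bounded_ops I" "finite K" "\<And>k. k \<in> K \<Longrightarrow> \<xi> k \<in> l2 I"
  shows "T (\<lambda>i. \<Sum>k\<in>K. \<xi> k i) = (\<lambda>i. \<Sum>k\<in>K. T (\<xi> k) i)"
  using assms(2,3)
proof (induction K rule: finite_induct)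
  case (insert x F)
  then show ?case
    using bounded_ops_add[OF assms(1), of "\<xi> x" "\<lambda>i. \<Sum>k\<in>F. \<xi> k i"] l2_sum(1)[of F \<xi> I] by simp
qed (simp add: bounded_ops_zero[OF assms(1)])

lemma op_norm_leI:
  assumes "\<And>\<xi>. \<xi> \<in> V \<Longrightarrow> l2_norm I (T \<xi>) \<le> B * l2_norm I \<xi>" "0 \<le> B" "(\<lambda>_. 0) \<in> V"
  shows "op_norm I V T \<le> B"
  unfolding op_norm_def
proof (rule cSUP_least)
  show "{\<xi> \<in> V. l2_norm I \<xi> \<le> 1} \<noteq> {}" using assms(3) by auto
  fix \<xi> assume \<xi>: "\<xi> \<in> {\<xi> \<in> V. l2_norm I \<xi> \<le> 1}"
  then have "l2_norm I (T \<xi>) \<le> B * l2_norm I \<xi>" using assms(1) by blast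
  also have "\<dots> \<le> B" using \<xi> assms(2) by (simp add: mult_left_le)
  finally show "l2_norm I (T \<xi>) \<le> B" .
qed

text \<open>Rescaling \<xi> to norm 1 needs only homogeneity over the reals. A vector of norm 0
  cannot be rescaled and is settled by the a priori bound. The domain V stays arbitrary because the
  lemma also serves commutators defined only on the domain of the Dirac operator.\<close>

lemma op_norm_bound:
  assumes "op_bounded I V T" "V \<subseteq> l2 I" "\<And>r \<xi>. \<xi> \<in> V \<Longrightarrow> (\<lambda>i. r *\<^sub>R \<xi> i) \<in> V"
    "\<And>r \<xi>. \<xi> \<in> V \<Longrightarrow> T (\<lambda>i. r *\<^sub>R \<xi> i) = (\<lambda>i. r *\<^sub>R T \<xi> i)" "\<xi> \<in> V"
  shows "l2_norm I (T \<xi>) \<le> op_norm I V T * l2_norm I \<xi>"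
proof -
  obtain B where B: "\<And>\<xi>. \<xi> \<in> V \<Longrightarrow> l2_norm I (T \<xi>) \<le> B * l2_norm I \<xi>"
    using assms(1) by (auto simp: op_bounded_def)
  have bdd: "bdd_above ((\<lambda>\<xi>. l2_norm I (T \<xi>)) ` {\<xi> \<in> V. l2_norm I \<xi> \<le> 1})"
  proof (rule bdd_aboveI2)
    fix \<xi> assume \<xi>: "\<xi> \<in> {\<xi> \<in> V. l2_norm I \<xi> \<le> 1}"
    then have "l2_norm I (T \<xi>) \<le> B * l2_norm I \<xi>" using B by blast
    also have "\<dots> \<le> \<bar>B\<bar> * 1" using \<xi> by (intro mult_mono) auto
    finally show "l2_norm I (T \<xi>) \<le> \<bar>B\<bar>" by simp
  qed
  show ?thesis
  proof (cases "l2_norm I \<xi> = 0")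
    case True
    then show ?thesis using B[OF assms(5)] by simp
  next
    case False
    let ?r = "inverse (l2_norm I \<xi>)"
    have "l2_norm I (\<lambda>i. ?r *\<^sub>R \<xi> i) = 1"
      using l2_scaleR(2)[of \<xi> I ?r] assms(2,5) False by (auto simp: abs_of_nonneg)
    then have "l2_norm I (T (\<lambda>i. ?r *\<^sub>R \<xi> i)) \<le> op_norm I V T"
      unfolding op_norm_def using assms(3,5) by (intro cSUP_upper bdd) auto
    moreover have "T \<xi> \<in> l2 I" using assms by (auto simp: op_bounded_def)
    ultimately have "?r * l2_norm I (T \<xi>) \<le> op_norm I V T"
      using l2_scaleR(2)[of "T \<xi>" I ?r] assms(4)[OF assms(5)] by (simp add: abs_of_nonneg)
    moreover have "0 < l2_norm I \<xi>" using False l2_norm_nonneg[of I \<xi>] by linarith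
    ultimately show ?thesis by (simp add: field_simps)
  qed
qed

lemma op_norm_nonneg:
  assumes "op_bounded I V T" "V \<subseteq> l2 I" "(\<lambda>_. 0) \<in> V"
  shows "0 \<le> op_norm I V T"
proof -
  obtain B where B: "\<And>\<xi>. \<xi> \<in> V \<Longrightarrow> l2_norm I (T \<xi>) \<le> B * l2_norm I \<xi>"
    using assms(1) by (auto simp: op_bounded_def)
  have bdd: "bdd_above ((\<lambda>\<xi>. l2_norm I (T \<xi>)) ` {\<xi> \<in> V. l2_norm I \<xi> \<le> 1})"
  proof (rule bdd_aboveI2)
    fix \<xi> assume \<xi>: "\<xi> \<in> {\<xi> \<in> V. l2_norm I \<xi> \<le> 1}"
    then have "l2_norm I (T \<xi>) \<le> B * l2_norm I \<xi>" using B by blast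
    also have "\<dots> \<le> \<bar>B\<bar> * 1" using \<xi> by (intro mult_mono) auto
    finally show "l2_norm I (T \<xi>) \<le> \<bar>B\<bar>" by simp
  qed
  have "0 \<le> l2_norm I (T (\<lambda>_. 0))" by simp
  also have "\<dots> \<le> op_norm I V T"
    unfolding op_norm_def using assms(3) by (intro cSUP_upper bdd) auto
  finally show ?thesis .
qed

abbreviation bop_norm :: "'i set \<Rightarrow> (('i \<Rightarrow> complex) \<Rightarrow> ('i \<Rightarrow> complex)) \<Rightarrow> real" where
  "bop_norm I \<equiv> op_norm I (l2 I)"

lemma bop_norm_bound:
  assumes "T \<in> bounded_ops I" "\<xi> \<in> l2 I"
  shows "l2_norm I (T \<xi>) \<le> bop_norm I T * l2_norm I \<xi>"
  using assms
  by (intro op_norm_bound l2_scaleR) (auto simp: bounded_ops_def scaleR_conv_of_real)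

lemma bop_norm_nonneg: "T \<in> bounded_ops I \<Longrightarrow> 0 \<le> bop_norm I T"
  by (rule op_norm_nonneg) (auto simp: bounded_ops_def)

lemma bop_norm_leI:
  assumes "\<And>\<xi>. \<xi> \<in> l2 I \<Longrightarrow> l2_norm I (T \<xi>) \<le> B * l2_norm I \<xi>" "0 \<le> B"
  shows "bop_norm I T \<le> B"
  using assms by (rule op_norm_leI) auto

section \<open>Matrices of operators and boundedness on finite sections\<close>

definition entry :: "(('i \<Rightarrow> complex) \<Rightarrow> ('i \<Rightarrow> complex)) \<Rightarrow> 'i \<Rightarrow> 'i \<Rightarrow> complex" where
  "entry T m q = T (delta q) m"

text \<open>Boundedness is tested on finite rectangles, with no question of summability, so a matrix
  can be cut, weighted or rescaled entrywise before it is known to define an operator.\<close>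

definition mat_bounded :: "'i set \<Rightarrow> real \<Rightarrow> ('i \<Rightarrow> 'i \<Rightarrow> complex) \<Rightarrow> bool" where
  "mat_bounded I K t \<longleftrightarrow> 0 \<le> K \<and>
     (\<forall>E F \<xi>. finite E \<and> finite F \<and> E \<subseteq> I \<and> F \<subseteq> I \<longrightarrow>
        L2_set (\<lambda>m. cmod (\<Sum>q\<in>F. t m q * \<xi> q)) E \<le> K * L2_set (\<lambda>q. cmod (\<xi> q)) F)"

definition mat_op :: "'i set \<Rightarrow> ('i \<Rightarrow> 'i \<Rightarrow> complex) \<Rightarrow> ('i \<Rightarrow> complex) \<Rightarrow> 'i \<Rightarrow> complex" where
  "mat_op I t = (\<lambda>\<xi>\<in>l2 I. \<lambda>m. if m \<in> I then \<Sum>\<^sub>\<infinity>q\<in>I. t m q * \<xi> q else 0)"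

lemma mat_boundedD:
  "mat_bounded I K t \<Longrightarrow> finite E \<Longrightarrow> finite F \<Longrightarrow> E \<subseteq> I \<Longrightarrow> F \<subseteq> I \<Longrightarrow>
     L2_set (\<lambda>m. cmod (\<Sum>q\<in>F. t m q * \<xi> q)) E \<le> K * L2_set (\<lambda>q. cmod (\<xi> q)) F"
  by (simp add: mat_bounded_def)

lemma cutoff_eq_sum_delta: "finite F \<Longrightarrow> cutoff F \<xi> = (\<lambda>i. \<Sum>q\<in>F. \<xi> q * delta q i)"
  by (auto simp: cutoff_def delta_def fun_eq_iff if_distrib[of "(*) _"] cong: if_cong)

lemma bounded_op_cutoff:
  assumes "T \<in> bounded_ops I" "finite F" "F \<subseteq> I"
  shows "T (cutoff F \<xi>) = (\<lambda>m. \<Sum>q\<in>F. entry T m q * \<xi> q)"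
proof -
  have d: "delta q \<in> l2 I" if "q \<in> F" for q using that assms by auto
  have "T (cutoff F \<xi>) = (\<lambda>m. \<Sum>q\<in>F. T (\<lambda>i. \<xi> q * delta q i) m)"
    unfolding cutoff_eq_sum_delta[OF assms(2)]
    using assms d by (intro bounded_ops_sum[OF assms(1)]) (auto intro: l2_scale)
  also have "\<dots> = (\<lambda>m. \<Sum>q\<in>F. entry T m q * \<xi> q)"
    using bounded_ops_scale[OF assms(1) d] by (simp add: entry_def mult.commute)
  finally show ?thesis .
qed

lemma bounded_op_mat_bounded:
  assumes "T \<in> bounded_ops I"
  shows "mat_bounded I (bop_norm I T) (entry T)"
  unfolding mat_bounded_def
proof (intro conjI allI impI)
  show "0 \<le> bop_norm I T" by (rule bop_norm_nonneg[OF assms])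
  fix E F and \<xi> :: "'a \<Rightarrow> complex" assume *: "finite E \<and> finite F \<and> E \<subseteq> I \<and> F \<subseteq> I"
  have c: "cutoff F \<xi> \<in> l2 I" "l2_norm I (cutoff F \<xi>) = L2_set (\<lambda>i. norm (\<xi> i)) F"
    using l2_norm_finite_support[of F I "cutoff F \<xi>"] * by (auto simp: cutoff_def cong: L2_set_cong)
  have "L2_set (\<lambda>m. cmod (T (cutoff F \<xi>) m)) E \<le> l2_norm I (T (cutoff F \<xi>))"
    using * by (intro L2_set_le_l2_norm bounded_ops_closed[OF assms c(1)]) auto
  also have "\<dots> \<le> bop_norm I T * l2_norm I (cutoff F \<xi>)" by (rule bop_norm_bound[OF assms c(1)])
  finally show "L2_set (\<lambda>m. cmod (\<Sum>q\<in>F. entry T m q * \<xi> q)) E \<le> bop_norm I T * L2_set (\<lambda>q. cmod (\<xi> q)) F"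
    using bounded_op_cutoff[OF assms, of F \<xi>] * c(2) by simp
qed

text \<open>Riesz representation as a series: \<phi> of a finite cut-off is a finite sum, and the
  bound on \<phi> turns l2 convergence of the cut-offs into convergence of these sums.\<close>

lemma l2_functional_has_sum:
  fixes \<phi> :: "('i \<Rightarrow> complex) \<Rightarrow> complex"
  assumes add: "\<And>\<xi> \<eta>. \<xi> \<in> l2 I \<Longrightarrow> \<eta> \<in> l2 I \<Longrightarrow> \<phi> (\<lambda>i. \<xi> i + \<eta> i) = \<phi> \<xi> + \<phi> \<eta>"
    and scale: "\<And>\<xi> s. \<xi> \<in> l2 I \<Longrightarrow> \<phi> (\<lambda>i. s * \<xi> i) = s * \<phi> \<xi>"
    and bound: "\<And>\<xi>. \<xi> \<in> l2 I \<Longrightarrow> cmod (\<phi> \<xi>) \<le> K * l2_norm I \<xi>"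
    and \<xi>: "\<xi> \<in> l2 I"
  shows "((\<lambda>q. \<phi> (delta q) * \<xi> q) has_sum \<phi> \<xi>) I"
  unfolding has_sum_def
proof (rule Lim_null[THEN iffD2], rule Lim_null_comparison)
  have diff: "\<phi> (\<lambda>i. \<xi> i - \<eta> i) = \<phi> \<xi> - \<phi> \<eta>" if "\<xi> \<in> l2 I" "\<eta> \<in> l2 I" for \<xi> \<eta>
    using add[OF that(1) l2_scale(1)[OF that(2), of "-1"]] scale[OF that(2), of "-1"] by simp
  have cut: "\<phi> (cutoff F \<xi>) = (\<Sum>q\<in>F. \<phi> (delta q) * \<xi> q)" if "finite F" "F \<subseteq> I" for F
    using that
  proof (induction F rule: finite_induct)
    case empty
    then show ?case using scale[OF l2_zero, of 0] by (simp add: cutoff_def)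
  next
    case (insert x F)
    then have d: "(\<lambda>i. \<xi> x * delta x i) \<in> l2 I" "delta x \<in> l2 I" by (auto intro: l2_scale)
    have "cutoff (insert x F) \<xi> = (\<lambda>i. \<xi> x * delta x i + cutoff F \<xi> i)"
      using insert(2) by (auto simp: cutoff_def delta_def fun_eq_iff)
    then show ?case
      using insert add[OF d(1) l2_cutoff(1)[OF \<xi>, of F]] scale[OF d(2)] by simp
  qed
  show "\<forall>\<^sub>F F in finite_subsets_at_top I.
      norm ((\<Sum>q\<in>F. \<phi> (delta q) * \<xi> q) - \<phi> \<xi>) \<le> K * l2_norm I (\<lambda>i. \<xi> i - cutoff F \<xi> i)"
  proof (intro eventually_finite_subsets_at_top_weakI)
    fix F assume F: "finite F" "F \<subseteq> I"
    show "norm ((\<Sum>q\<in>F. \<phi> (delta q) * \<xi> q) - \<phi> \<xi>) \<le> K * l2_norm I (\<lambda>i. \<xi> i - cutoff F \<xi> i)"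
      using bound[OF l2_diff(1)[OF \<xi> l2_cutoff(1)[OF \<xi>]], of F] diff[OF \<xi> l2_cutoff(1)[OF \<xi>], of F] cut[OF F]
      by (simp add: norm_minus_commute)
  qed
  show "((\<lambda>F. K * l2_norm I (\<lambda>i. \<xi> i - cutoff F \<xi> i)) \<longlongrightarrow> 0) (finite_subsets_at_top I)"
    using tendsto_mult_right_zero[OF l2_cutoff_tendsto[OF \<xi>]] .
qed

lemma bounded_op_has_sum:
  assumes "T \<in> bounded_ops I" "\<xi> \<in> l2 I"
  shows "((\<lambda>q. entry T m q * \<xi> q) has_sum T \<xi> m) I"
  unfolding entry_def
  by (rule l2_functional_has_sum[where K = "bop_norm I T"])
     (use assms norm_le_l2_norm[OF bounded_ops_closed[OF assms(1)]] bop_norm_bound[OF assms(1)] in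
       \<open>auto simp: bounded_ops_add bounded_ops_scale intro: order_trans\<close>)

lemma bounded_ops_eqI:
  assumes "T \<in> bounded_ops I" "S \<in> bounded_ops I" "\<And>\<xi>. \<xi> \<in> l2 I \<Longrightarrow> T \<xi> = S \<xi>"
  shows "T = S"
  using assms by (intro extensionalityI[of T "l2 I"]) (auto simp: bounded_ops_def)

lemma bounded_ops_eq_entryI:
  assumes "T \<in> bounded_ops I" "S \<in> bounded_ops I" "\<And>m q. m \<in> I \<Longrightarrow> q \<in> I \<Longrightarrow> entry T m q = entry S m q"
  shows "T = S"
proof (rule bounded_ops_eqI[OF assms(1,2)])
  fix \<xi> :: "'a \<Rightarrow> complex" assume \<xi>: "\<xi> \<in> l2 I"
  have "T \<xi> m = S \<xi> m" if "m \<in> I" for m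
  proof -
    have "((\<lambda>q. entry T m q * \<xi> q) has_sum T \<xi> m) I" by (rule bounded_op_has_sum[OF assms(1) \<xi>])
    then have "((\<lambda>q. entry S m q * \<xi> q) has_sum T \<xi> m) I"
      by (rule has_sum_cong[THEN iffD1, rotated]) (use assms that in auto)
    then show ?thesis using bounded_op_has_sum[OF assms(2) \<xi>] has_sum_unique by blast
  qed
  then show "T \<xi> = S \<xi>"
    using bounded_ops_outside[OF assms(1) \<xi>] bounded_ops_outside[OF assms(2) \<xi>] by (metis ext)
qed

text \<open>Cancels x on both sides; in its uses x is the norm of the very vector on which a matrix
  is tested.\<close>

lemma real_le_of_square_le: "(x::real) * x \<le> K * x \<Longrightarrow> 0 \<le> K \<Longrightarrow> 0 \<le> x \<Longrightarrow> x \<le> K"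
  by (cases "x = 0") (auto simp: mult_le_cancel_right)

text \<open>Testing the finite row at m on its own conjugate gives S \<le> K sqrt S for the sum S of
  squared entries. Square summable rows are what makes the series in \<open>mat_op\<close>
  converge.\<close>

lemma mat_bounded_row:
  assumes "mat_bounded I K t" "m \<in> I"
  shows "(\<lambda>q. if q \<in> I then t m q else 0) \<in> l2 I"
proof (rule l2_boundI[where B = K])
  fix F assume F: "finite F" "F \<subseteq> I"
  let ?S = "\<Sum>q\<in>F. (cmod (t m q))\<^sup>2"
  have "cmod (\<Sum>q\<in>F. t m q * cnj (t m q)) \<le> K * L2_set (\<lambda>q. cmod (cnj (t m q))) F"
    using mat_boundedD[OF assms(1), of "{m}" F "\<lambda>q. cnj (t m q)"] F assms(2) by (simp add: L2_set_def)
  moreover have "(\<Sum>q\<in>F. t m q * cnj (t m q)) = complex_of_real ?S"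
    by (simp add: complex_norm_square del: of_real_power)
  ultimately have "?S \<le> K * sqrt ?S"
    by (simp add: L2_set_def sum_nonneg del: of_real_sum)
  then have "sqrt ?S * sqrt ?S \<le> K * sqrt ?S" by (simp add: sum_nonneg)
  then have "sqrt ?S \<le> K"
    by (rule real_le_of_square_le) (use assms(1) in \<open>auto simp: mat_bounded_def sum_nonneg\<close>)
  then show "L2_set (\<lambda>i. cmod (if i \<in> I then t m i else 0)) F \<le> K"
    using F by (simp add: L2_set_def subset_iff cong: sum.cong)
qed auto

lemma mat_op_has_sum:
  assumes "mat_bounded I K t" "m \<in> I" "\<xi> \<in> l2 I"
  shows "((\<lambda>q. t m q * \<xi> q) has_sum mat_op I t \<xi> m) I"
proof -
  have "(\<lambda>q. (if q \<in> I then t m q else 0) * \<xi> q) summable_on I"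
    using l2_mult_abs_summable(1)[OF mat_bounded_row[OF assms(1,2)] assms(3)] by (rule abs_summable_summable)
  then have "(\<lambda>q. t m q * \<xi> q) summable_on I"
    by (rule summable_on_cong[THEN iffD1, rotated]) auto
  then show ?thesis using assms by (simp add: mat_op_def)
qed

text \<open>The finite estimate passes to the limit in two stages: for a fixed finite set of rows
  the columns exhaust the index set, after which the bound is uniform in the rows and
  \<open>l2_boundI\<close> applies.\<close>

lemma mat_op_bounded:
  assumes "mat_bounded I K t"
  shows "mat_op I t \<in> bounded_ops I" "bop_norm I (mat_op I t) \<le> K"
    "m \<in> I \<Longrightarrow> q \<in> I \<Longrightarrow> entry (mat_op I t) m q = t m q"
proof -
  have K: "0 \<le> K" using assms by (simp add: mat_bounded_def)
  have *: "L2_set (\<lambda>m. cmod (mat_op I t \<xi> m)) E \<le> K * l2_norm I \<xi>"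
    if \<xi>: "\<xi> \<in> l2 I" and E: "finite E" "E \<subseteq> I" for \<xi> E
  proof (rule tendsto_upperbound)
    have "((\<lambda>F. \<Sum>q\<in>F. t m q * \<xi> q) \<longlongrightarrow> mat_op I t \<xi> m) (finite_subsets_at_top I)" if "m \<in> E" for m
      using mat_op_has_sum[OF assms _ \<xi>, of m] E that by (auto simp: has_sum_def)
    then show "((\<lambda>F. L2_set (\<lambda>m. cmod (\<Sum>q\<in>F. t m q * \<xi> q)) E) \<longlongrightarrow> L2_set (\<lambda>m. cmod (mat_op I t \<xi> m)) E)
        (finite_subsets_at_top I)"
      unfolding L2_set_def by (intro tendsto_intros) auto
    show "\<forall>\<^sub>F F in finite_subsets_at_top I. L2_set (\<lambda>m. cmod (\<Sum>q\<in>F. t m q * \<xi> q)) E \<le> K * l2_norm I \<xi>"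
    proof (intro eventually_finite_subsets_at_top_weakI)
      fix F assume F: "finite F" "F \<subseteq> I"
      show "L2_set (\<lambda>m. cmod (\<Sum>q\<in>F. t m q * \<xi> q)) E \<le> K * l2_norm I \<xi>"
        using mat_boundedD[OF assms E(1) F(1) E(2) F(2), of \<xi>]
          mult_left_mono[OF L2_set_le_l2_norm[OF \<xi> F] K] by linarith
    qed
  qed auto
  have cl: "mat_op I t \<xi> \<in> l2 I" "l2_norm I (mat_op I t \<xi>) \<le> K * l2_norm I \<xi>" if \<xi>: "\<xi> \<in> l2 I" for \<xi>
  proof -
    have 0: "mat_op I t \<xi> m = 0" if "m \<notin> I" for m using \<xi> that by (simp add: mat_op_def)
    show "mat_op I t \<xi> \<in> l2 I" "l2_norm I (mat_op I t \<xi>) \<le> K * l2_norm I \<xi>"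
      using l2_boundI[of I "mat_op I t \<xi>", OF 0 *[OF \<xi>]] by auto
  qed
  show "mat_op I t \<in> bounded_ops I"
    unfolding bounded_ops_def
  proof (intro CollectI conjI ballI allI)
    show "mat_op I t \<in> extensional (l2 I)" by (simp add: mat_op_def)
    show "mat_op I t (\<lambda>i. \<xi> i + \<eta> i) = (\<lambda>i. mat_op I t \<xi> i + mat_op I t \<eta> i)"
      if "\<xi> \<in> l2 I" "\<eta> \<in> l2 I" for \<xi> \<eta>
    proof
      fix m show "mat_op I t (\<lambda>i. \<xi> i + \<eta> i) m = mat_op I t \<xi> m + mat_op I t \<eta> m"
      proof (cases "m \<in> I")
        case True
        have "((\<lambda>q. t m q * (\<xi> q + \<eta> q)) has_sum (mat_op I t \<xi> m + mat_op I t \<eta> m)) I"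
          using has_sum_add[OF mat_op_has_sum[OF assms True that(1)] mat_op_has_sum[OF assms True that(2)]]
          by (simp add: algebra_simps)
        then show ?thesis
          using mat_op_has_sum[OF assms True l2_add(1)[OF that]] has_sum_unique by blast
      qed (use that in \<open>simp add: mat_op_def l2_add\<close>)
    qed
    show "mat_op I t (\<lambda>i. s * \<xi> i) = (\<lambda>i. s * mat_op I t \<xi> i)" if "\<xi> \<in> l2 I" for \<xi> s
    proof
      fix m show "mat_op I t (\<lambda>i. s * \<xi> i) m = s * mat_op I t \<xi> m"
      proof (cases "m \<in> I")
        case True
        have "((\<lambda>q. t m q * (s * \<xi> q)) has_sum (s * mat_op I t \<xi> m)) I"
          using has_sum_cmult_right[OF mat_op_has_sum[OF assms True that], of s]
          by (simp add: algebra_simps)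
        then show ?thesis
          using mat_op_has_sum[OF assms True l2_scale(1)[OF that]] has_sum_unique by blast
      qed (use that in \<open>simp add: mat_op_def l2_scale\<close>)
    qed
    show "op_bounded I (l2 I) (mat_op I t)" using cl by (auto simp: op_bounded_def)
  qed
  show "bop_norm I (mat_op I t) \<le> K" using cl K by (intro bop_norm_leI) auto
  show "entry (mat_op I t) m q = t m q" if "m \<in> I" "q \<in> I"
  proof -
    have "((\<lambda>p. t m p * delta q p) has_sum t m q) I"
    proof (rule has_sum_cong_neutral[THEN iffD1])
      show "((\<lambda>p. t m q) has_sum t m q) {q}" using has_sum_finite[of "{q}" "\<lambda>p. t m q"] by simp
    qed (use that in \<open>auto simp: delta_def\<close>)
    then show ?thesis
      using mat_op_has_sum[OF assms that(1) delta_l2[OF that(2)]] has_sum_unique unfolding entry_def by blast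
  qed
qed

text \<open>Let \<eta> be the adjoint matrix applied to \<xi> over F, restricted to E. The squared
  norm of \<eta> is the pairing of t \<eta> with \<xi>, hence at most K times the product of both
  norms, and one factor cancels. Only finite sums occur.\<close>

lemma mat_bounded_adjoint:
  assumes "mat_bounded I K t"
  shows "mat_bounded I K (\<lambda>m q. cnj (t q m))"
  unfolding mat_bounded_def
proof (intro conjI allI impI)
  show K: "0 \<le> K" using assms by (simp add: mat_bounded_def)
  fix E F and \<xi> :: "'a \<Rightarrow> complex" assume *: "finite E \<and> finite F \<and> E \<subseteq> I \<and> F \<subseteq> I"
  define \<eta> where "\<eta> m = (\<Sum>q\<in>F. cnj (t q m) * \<xi> q)" for m
  let ?E = "L2_set (\<lambda>m. cmod (\<eta> m)) E" and ?F = "L2_set (\<lambda>q. cmod (\<xi> q)) F"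
  have "complex_of_real (?E\<^sup>2) = (\<Sum>m\<in>E. cnj (\<eta> m) * \<eta> m)"
    by (simp add: L2_set_def sum_nonneg complex_norm_square mult.commute del: of_real_power)
  also have "\<dots> = (\<Sum>m\<in>E. \<Sum>q\<in>F. cnj (\<eta> m) * (cnj (t q m) * \<xi> q))"
    by (subst (2) \<eta>_def) (simp add: sum_distrib_left)
  also have "\<dots> = (\<Sum>q\<in>F. \<Sum>m\<in>E. cnj (\<eta> m) * (cnj (t q m) * \<xi> q))" by (rule sum.swap)
  also have "\<dots> = (\<Sum>q\<in>F. cnj (\<Sum>m\<in>E. t q m * \<eta> m) * \<xi> q)"
    by (simp add: sum_distrib_left sum_distrib_right mult_ac)
  finally have "?E\<^sup>2 = cmod (\<Sum>q\<in>F. cnj (\<Sum>m\<in>E. t q m * \<eta> m) * \<xi> q)"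
    by (metis norm_of_real abs_of_nonneg zero_le_power2)
  also have "\<dots> \<le> (\<Sum>q\<in>F. \<bar>cmod (\<Sum>m\<in>E. t q m * \<eta> m)\<bar> * \<bar>cmod (\<xi> q)\<bar>)"
    by (rule order_trans[OF norm_sum]) (simp add: norm_mult del: cnj_sum)
  also have "\<dots> \<le> L2_set (\<lambda>q. cmod (\<Sum>m\<in>E. t q m * \<eta> m)) F * ?F" by (rule L2_set_mult_ineq)
  also have "\<dots> \<le> (K * ?E) * ?F"
    using mat_boundedD[OF assms, of F E \<eta>] * by (intro mult_right_mono) auto
  finally have "?E * ?E \<le> (K * ?F) * ?E" by (simp add: power2_eq_square algebra_simps)
  then have "?E \<le> K * ?F" by (rule real_le_of_square_le) (simp_all add: K)
  then show "L2_set (\<lambda>m. cmod (\<Sum>q\<in>F. cnj (t q m) * \<xi> q)) E \<le> K * L2_set (\<lambda>q. cmod (\<xi> q)) F"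
    by (simp only: \<eta>_def)
qed

section \<open>The C*-algebra of bounded operators\<close>

lemma l2_inner_delta: "m \<in> I \<Longrightarrow> \<eta> \<in> l2 I \<Longrightarrow> l2_inner I (delta m) \<eta> = \<eta> m"
proof -
  assume m: "m \<in> I" and "\<eta> \<in> l2 I"
  have "((\<lambda>i. cnj (delta m i) * \<eta> i) has_sum \<eta> m) I"
  proof (rule has_sum_cong_neutral[THEN iffD1])
    show "((\<lambda>p. \<eta> m) has_sum \<eta> m) {m}" using has_sum_finite[of "{m}" "\<lambda>p. \<eta> m"] by simp
  qed (use m in \<open>auto simp: delta_def\<close>)
  then show ?thesis unfolding l2_inner_def by (rule infsumI)
qed

lemma l2_inner_commute: "l2_inner I \<xi> \<eta> = cnj (l2_inner I \<eta> \<xi>)"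
  by (simp add: l2_inner_def mult.commute flip: infsum_cnj)

lemma l2_inner_add_right:
  assumes "\<xi> \<in> l2 I" "\<eta> \<in> l2 I" "\<zeta> \<in> l2 I"
  shows "l2_inner I \<xi> (\<lambda>i. \<eta> i + \<zeta> i) = l2_inner I \<xi> \<eta> + l2_inner I \<xi> \<zeta>"
proof -
  have "((\<lambda>i. cnj (\<xi> i) * (\<eta> i + \<zeta> i)) has_sum (l2_inner I \<xi> \<eta> + l2_inner I \<xi> \<zeta>)) I"
    using has_sum_add[OF l2_inner_has_sum[OF assms(1,2)] l2_inner_has_sum[OF assms(1,3)]]
    by (simp add: algebra_simps)
  then show ?thesis unfolding l2_inner_def[of I \<xi> "\<lambda>i. \<eta> i + \<zeta> i"] by (rule infsumI)
qed

lemma l2_inner_scale_right: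
  assumes "\<xi> \<in> l2 I" "\<eta> \<in> l2 I"
  shows "l2_inner I \<xi> (\<lambda>i. s * \<eta> i) = s * l2_inner I \<xi> \<eta>"
proof -
  have "((\<lambda>i. cnj (\<xi> i) * (s * \<eta> i)) has_sum (s * l2_inner I \<xi> \<eta>)) I"
    using has_sum_cmult_right[OF l2_inner_has_sum[OF assms(1,2)], of s] by (simp add: algebra_simps)
  then show ?thesis unfolding l2_inner_def[of I \<xi> "\<lambda>i. s * \<eta> i"] by (rule infsumI)
qed

text \<open>\<open>adjoint_op\<close> is a definite description, so existence and uniqueness are
  both due before it can be used: the conjugate transpose satisfies the pairing identity, and any
  solution has the same entries because the identity can be read at basis vectors.\<close>

lemma adjoint_op_characterization:
  fixes T :: "('i \<Rightarrow> complex) \<Rightarrow> 'i \<Rightarrow> complex"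
  assumes T: "T \<in> bounded_ops I"
  shows "adjoint_op I T = mat_op I (\<lambda>m q. cnj (entry T q m))"
    "\<And>\<xi> \<eta>. \<xi> \<in> l2 I \<Longrightarrow> \<eta> \<in> l2 I \<Longrightarrow> l2_inner I (T \<xi>) \<eta> = l2_inner I \<xi> (adjoint_op I T \<eta>)"
proof -
  let ?S = "mat_op I (\<lambda>m q. cnj (entry T q m))"
  have mb: "mat_bounded I (bop_norm I T) (\<lambda>m q. cnj (entry T q m))"
    by (rule mat_bounded_adjoint[OF bounded_op_mat_bounded[OF T]])
  note S = mat_op_bounded[OF mb]
  have adj: "l2_inner I (T \<xi>) \<eta> = l2_inner I \<xi> (?S \<eta>)" if \<xi>: "\<xi> \<in> l2 I" and \<eta>: "\<eta> \<in> l2 I" for \<xi> \<eta>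
  proof -
    \<comment> \<open>The functional is taken in the second slot of \<open>l2_inner\<close>, where
      the pairing is linear; conjugating the resulting series afterwards moves it to the first
      slot.\<close>
    have "((\<lambda>q. l2_inner I \<eta> (T (delta q)) * \<xi> q) has_sum l2_inner I \<eta> (T \<xi>)) I"
    proof (rule l2_functional_has_sum[where K = "l2_norm I \<eta> * bop_norm I T"])
      fix \<zeta> :: "'i \<Rightarrow> complex" assume \<zeta>: "\<zeta> \<in> l2 I"
      have "cmod (l2_inner I \<eta> (T \<zeta>)) \<le> l2_norm I \<eta> * l2_norm I (T \<zeta>)"
        by (rule l2_inner_bound[OF \<eta> bounded_ops_closed[OF T \<zeta>]])
      also have "\<dots> \<le> l2_norm I \<eta> * (bop_norm I T * l2_norm I \<zeta>)"
        by (intro mult_left_mono bop_norm_bound[OF T \<zeta>]) auto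
      finally show "cmod (l2_inner I \<eta> (T \<zeta>)) \<le> l2_norm I \<eta> * bop_norm I T * l2_norm I \<zeta>"
        by (simp add: mult.assoc)
    qed (use T \<xi> \<eta> in \<open>simp_all add: bounded_ops_add bounded_ops_scale l2_inner_add_right
            l2_inner_scale_right bounded_ops_closed\<close>)
    then have "((\<lambda>q. cnj (l2_inner I \<eta> (T (delta q)) * \<xi> q)) has_sum cnj (l2_inner I \<eta> (T \<xi>))) I"
      by (simp only: has_sum_cnj_iff)
    then have 1: "((\<lambda>q. l2_inner I (T (delta q)) \<eta> * cnj (\<xi> q)) has_sum l2_inner I (T \<xi>) \<eta>) I"
      by (simp flip: l2_inner_commute)
    have 2: "l2_inner I (T (delta q)) \<eta> = ?S \<eta> q" if "q \<in> I" for q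
      using \<eta> that by (simp add: l2_inner_def mat_op_def entry_def)
    have "((\<lambda>q. cnj (\<xi> q) * ?S \<eta> q) has_sum l2_inner I (T \<xi>) \<eta>) I"
      by (rule has_sum_cong[THEN iffD1, OF _ 1]) (simp add: 2 mult.commute)
    then show ?thesis
      using l2_inner_has_sum[OF \<xi> bounded_ops_closed[OF S(1) \<eta>]] has_sum_unique by blast
  qed
  show eq: "adjoint_op I T = ?S"
    unfolding adjoint_op_def
  proof (rule the_equality)
    show "?S \<in> bounded_ops I \<and> (\<forall>\<xi>\<in>l2 I. \<forall>\<eta>\<in>l2 I. l2_inner I (T \<xi>) \<eta> = l2_inner I \<xi> (?S \<eta>))"
      using S(1) adj by blast
    fix R assume R: "R \<in> bounded_ops I \<and> (\<forall>\<xi>\<in>l2 I. \<forall>\<eta>\<in>l2 I. l2_inner I (T \<xi>) \<eta> = l2_inner I \<xi> (R \<eta>))"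
    show "R = ?S"
    proof (rule bounded_ops_eq_entryI[OF _ S(1)])
      fix m q assume mq: "m \<in> I" "q \<in> I"
      have "l2_inner I (T (delta m)) (delta q) = l2_inner I (delta m) (R (delta q))" using R mq by simp
      also have "\<dots> = entry R m q" unfolding entry_def
        using R mq by (intro l2_inner_delta bounded_ops_closed[of R]) auto
      also have "l2_inner I (T (delta m)) (delta q) = cnj (T (delta m) q)"
        using mq T by (subst l2_inner_commute) (simp add: l2_inner_delta bounded_ops_closed)
      finally show "entry R m q = entry ?S m q" using mq S(3) by (simp add: entry_def)
    qed (use R in auto)
  qed
  show "l2_inner I (T \<xi>) \<eta> = l2_inner I \<xi> (adjoint_op I T \<eta>)" if "\<xi> \<in> l2 I" "\<eta> \<in> l2 I" for \<xi> \<eta>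
    unfolding eq using that by (rule adj)
qed

lemma adjoint_op_bounded:
  assumes T: "T \<in> bounded_ops I"
  shows "adjoint_op I T \<in> bounded_ops I" "bop_norm I (adjoint_op I T) \<le> bop_norm I T"
    "\<And>m q. m \<in> I \<Longrightarrow> q \<in> I \<Longrightarrow> entry (adjoint_op I T) m q = cnj (entry T q m)"
  unfolding adjoint_op_characterization(1)[OF T]
  using mat_op_bounded[OF mat_bounded_adjoint[OF bounded_op_mat_bounded[OF T]]] by auto

lemma adjoint_op_eqI:
  assumes "T \<in> bounded_ops I" "S \<in> bounded_ops I"
    "\<And>m q. m \<in> I \<Longrightarrow> q \<in> I \<Longrightarrow> entry S m q = cnj (entry T q m)"
  shows "adjoint_op I T = S"
  by (rule bounded_ops_eq_entryI[OF adjoint_op_bounded(1)[OF assms(1)] assms(2)])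
     (simp add: assms(3) adjoint_op_bounded(3)[OF assms(1)])

section \<open>Operations on bounded operators\<close>

lemma bounded_opsI:
  assumes "T \<in> extensional (l2 I)" "\<And>\<xi>. \<xi> \<in> l2 I \<Longrightarrow> T \<xi> \<in> l2 I"
    "\<And>\<xi> \<eta>. \<xi> \<in> l2 I \<Longrightarrow> \<eta> \<in> l2 I \<Longrightarrow> T (\<lambda>i. \<xi> i + \<eta> i) = (\<lambda>i. T \<xi> i + T \<eta> i)"
    "\<And>\<xi> s. \<xi> \<in> l2 I \<Longrightarrow> T (\<lambda>i. s * \<xi> i) = (\<lambda>i. s * T \<xi> i)"
    "\<And>\<xi>. \<xi> \<in> l2 I \<Longrightarrow> l2_norm I (T \<xi>) \<le> B * l2_norm I \<xi>"
  shows "T \<in> bounded_ops I"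
  using assms unfolding bounded_ops_def op_bounded_def by blast

lemma Bl2_simps [simp]:
  "carrier (Bl2 I) = bounded_ops I"
  "(\<otimes>\<^bsub>Bl2 I\<^esub>) = (\<lambda>S T. compose (l2 I) S T)"
  "\<one>\<^bsub>Bl2 I\<^esub> = (\<lambda>\<xi>\<in>l2 I. \<xi>)"
  "\<zero>\<^bsub>Bl2 I\<^esub> = (\<lambda>\<xi>\<in>l2 I. \<lambda>i. 0)"
  "(\<oplus>\<^bsub>Bl2 I\<^esub>) = (\<lambda>S T. \<lambda>\<xi>\<in>l2 I. \<lambda>i. S \<xi> i + T \<xi> i)"
  "cscale (Bl2 I) = (\<lambda>s T. \<lambda>\<xi>\<in>l2 I. \<lambda>i. s * T \<xi> i)"
  "cstar (Bl2 I) = adjoint_op I"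
  "cnorm (Bl2 I) = bop_norm I"
  by (simp_all add: Bl2_def)

lemma bounded_op_plus:
  assumes S: "S \<in> bounded_ops I" and T: "T \<in> bounded_ops I"
  shows "(\<lambda>\<xi>\<in>l2 I. \<lambda>i. S \<xi> i + T \<xi> i) \<in> bounded_ops I"
    "bop_norm I (\<lambda>\<xi>\<in>l2 I. \<lambda>i. S \<xi> i + T \<xi> i) \<le> bop_norm I S + bop_norm I T"
proof -
  have *: "l2_norm I (\<lambda>i. S \<xi> i + T \<xi> i) \<le> (bop_norm I S + bop_norm I T) * l2_norm I \<xi>" if "\<xi> \<in> l2 I" for \<xi>
    using l2_add(2)[OF bounded_ops_closed[OF S that] bounded_ops_closed[OF T that]]
      bop_norm_bound[OF S that] bop_norm_bound[OF T that] by (simp add: algebra_simps)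
  show "(\<lambda>\<xi>\<in>l2 I. \<lambda>i. S \<xi> i + T \<xi> i) \<in> bounded_ops I"
    by (rule bounded_opsI[where B = "bop_norm I S + bop_norm I T"])
      (use * S T in \<open>auto simp: l2_add l2_scale bounded_ops_add bounded_ops_scale bounded_ops_closed algebra_simps\<close>)
  show "bop_norm I (\<lambda>\<xi>\<in>l2 I. \<lambda>i. S \<xi> i + T \<xi> i) \<le> bop_norm I S + bop_norm I T"
    by (rule bop_norm_leI) (use * bop_norm_nonneg[OF S] bop_norm_nonneg[OF T] in auto)
qed

lemma bounded_op_cscale:
  assumes T: "T \<in> bounded_ops I"
  shows "(\<lambda>\<xi>\<in>l2 I. \<lambda>i. s * T \<xi> i) \<in> bounded_ops I"
    "bop_norm I (\<lambda>\<xi>\<in>l2 I. \<lambda>i. s * T \<xi> i) = cmod s * bop_norm I T"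
proof -
  have *: "l2_norm I (\<lambda>i. s * T \<xi> i) \<le> (cmod s * bop_norm I T) * l2_norm I \<xi>"
    if "T \<in> bounded_ops I" "\<xi> \<in> l2 I" for \<xi> s T
    using l2_scale(2)[OF bounded_ops_closed[OF that]] mult_left_mono[OF bop_norm_bound[OF that], of "cmod s"]
    by (simp add: mult.assoc)
  have 1: "(\<lambda>\<xi>\<in>l2 I. \<lambda>i. s * T \<xi> i) \<in> bounded_ops I" if "T \<in> bounded_ops I" for s T
    by (rule bounded_opsI[where B = "cmod s * bop_norm I T"])
      (use * that in \<open>auto simp: l2_add l2_scale bounded_ops_add bounded_ops_scale bounded_ops_closed algebra_simps\<close>)
  then show "(\<lambda>\<xi>\<in>l2 I. \<lambda>i. s * T \<xi> i) \<in> bounded_ops I" using T by blast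
  have 2: "bop_norm I (\<lambda>\<xi>\<in>l2 I. \<lambda>i. s * T \<xi> i) \<le> cmod s * bop_norm I T" if "T \<in> bounded_ops I" for s T
    by (rule bop_norm_leI) (use * that bop_norm_nonneg[OF that] in auto)
  have "cmod s * bop_norm I T \<le> bop_norm I (\<lambda>\<xi>\<in>l2 I. \<lambda>i. s * T \<xi> i)"
  proof (cases "s = 0")
    case True
    then show ?thesis using bop_norm_nonneg[OF 1[OF T, of s]] by simp
  next
    case False
    have "(\<lambda>\<xi>\<in>l2 I. \<lambda>i. inverse s * (\<lambda>\<xi>\<in>l2 I. \<lambda>i. s * T \<xi> i) \<xi> i) = T"
      using False T by (intro extensionalityI[of _ "l2 I"]) (auto simp: bounded_ops_def simp flip: mult.assoc)
    then have "bop_norm I T \<le> cmod (inverse s) * bop_norm I (\<lambda>\<xi>\<in>l2 I. \<lambda>i. s * T \<xi> i)"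
      using 2[OF 1[OF T, of s], of "inverse s"] by simp
    then show ?thesis using False by (simp add: field_simps norm_divide)
  qed
  then show "bop_norm I (\<lambda>\<xi>\<in>l2 I. \<lambda>i. s * T \<xi> i) = cmod s * bop_norm I T"
    using 2[OF T, of s] by simp
qed

lemma bounded_op_compose:
  assumes S: "S \<in> bounded_ops I" and T: "T \<in> bounded_ops I"
  shows "compose (l2 I) S T \<in> bounded_ops I"
    "bop_norm I (compose (l2 I) S T) \<le> bop_norm I S * bop_norm I T"
proof -
  have *: "l2_norm I (S (T \<xi>)) \<le> (bop_norm I S * bop_norm I T) * l2_norm I \<xi>" if "\<xi> \<in> l2 I" for \<xi>
    using bop_norm_bound[OF S bounded_ops_closed[OF T that]]
      mult_left_mono[OF bop_norm_bound[OF T that] bop_norm_nonneg[OF S]] by (simp add: mult.assoc)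
  show "compose (l2 I) S T \<in> bounded_ops I"
    by (rule bounded_opsI[where B = "bop_norm I S * bop_norm I T"])
      (use * S T in \<open>auto simp: compose_def l2_add l2_scale bounded_ops_add bounded_ops_scale bounded_ops_closed\<close>)
  show "bop_norm I (compose (l2 I) S T) \<le> bop_norm I S * bop_norm I T"
    by (rule bop_norm_leI) (use * bop_norm_nonneg[OF S] bop_norm_nonneg[OF T] in \<open>auto simp: compose_def\<close>)
qed

lemma bounded_op_one: "(\<lambda>\<xi>\<in>l2 I. \<xi>) \<in> bounded_ops I"
  and bounded_op_zero: "(\<lambda>\<xi>\<in>l2 I. \<lambda>i. 0) \<in> bounded_ops I"
  by (auto intro!: bounded_opsI[where B = 1] simp: l2_add l2_scale)

lemma entry_compose_has_sum:
  assumes "S \<in> bounded_ops I" "T \<in> bounded_ops I" "q \<in> I"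
  shows "((\<lambda>p. entry S m p * entry T p q) has_sum entry (compose (l2 I) S T) m q) I"
  using bounded_op_has_sum[OF assms(1) bounded_ops_closed[OF assms(2) delta_l2[OF assms(3)]], of m] assms
  by (simp add: entry_def compose_def)

lemma bounded_op_restrict: "T \<in> bounded_ops I \<Longrightarrow> restrict T (l2 I) = T"
  by (rule extensionalityI[of _ "l2 I"]) (auto simp: bounded_ops_def)

lemma Bl2_scale_add:
  "cscale (Bl2 I) (s + t) T = cscale (Bl2 I) s T \<oplus>\<^bsub>Bl2 I\<^esub> cscale (Bl2 I) t T"
  by (auto simp: algebra_simps intro!: restrict_ext)

lemma ring_Bl2: "ring (Bl2 I)"
proof (rule ringI)
  show "abelian_group (Bl2 I)"
  proof (rule abelian_groupI)
    fix x assume x: "x \<in> carrier (Bl2 I)"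
    show "\<exists>y\<in>carrier (Bl2 I). y \<oplus>\<^bsub>Bl2 I\<^esub> x = \<zero>\<^bsub>Bl2 I\<^esub>"
      by (rule bexI[where x = "\<lambda>\<xi>\<in>l2 I. \<lambda>i. (-1) * x \<xi> i"]) (use x bounded_op_cscale(1)[of x I "-1"] in auto)
    show "\<zero>\<^bsub>Bl2 I\<^esub> \<oplus>\<^bsub>Bl2 I\<^esub> x = x"
      using x by (intro extensionalityI[of _ "l2 I"]) (auto simp: bounded_ops_def)
  qed (auto simp: bounded_op_plus bounded_op_zero algebra_simps intro!: restrict_ext)
  show "monoid (Bl2 I)"
  proof (rule monoidI)
    fix x y z assume "x \<in> carrier (Bl2 I)" "y \<in> carrier (Bl2 I)" "z \<in> carrier (Bl2 I)"
    then show "x \<otimes>\<^bsub>Bl2 I\<^esub> y \<otimes>\<^bsub>Bl2 I\<^esub> z = x \<otimes>\<^bsub>Bl2 I\<^esub> (y \<otimes>\<^bsub>Bl2 I\<^esub> z)"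
      by (auto simp: compose_def bounded_ops_closed intro!: restrict_ext)
  next
    fix x assume x: "x \<in> carrier (Bl2 I)"
    then show "\<one>\<^bsub>Bl2 I\<^esub> \<otimes>\<^bsub>Bl2 I\<^esub> x = x" "x \<otimes>\<^bsub>Bl2 I\<^esub> \<one>\<^bsub>Bl2 I\<^esub> = x"
      by (auto intro!: extensionalityI[of _ "l2 I"] simp: compose_def bounded_ops_closed)
         (auto simp: bounded_ops_def)
  qed (auto simp: bounded_op_compose bounded_op_one)
qed (auto simp: compose_def bounded_ops_add bounded_ops_closed intro!: restrict_ext)

text \<open>Besides closedness only distributivity over sums of scalars and the action of 1 enter,
  so negatives are available as scalar multiples before the structure is known to be a
  C*-algebra.\<close>

lemma a_inv_eq_cscale:
  fixes A :: "('a, 'm) cstar_algebra_scheme" (structure)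
  assumes "ring A"
    and cl: "\<And>s x. x \<in> carrier A \<Longrightarrow> cscale A s x \<in> carrier A"
    and add: "\<And>s t x. x \<in> carrier A \<Longrightarrow> cscale A (s + t) x = cscale A s x \<oplus> cscale A t x"
    and one: "\<And>x. x \<in> carrier A \<Longrightarrow> cscale A 1 x = x"
    and x: "x \<in> carrier A"
  shows "\<ominus> x = cscale A (-1) x" "cscale A 0 x = \<zero>"
proof -
  interpret ring A by fact
  have "cscale A 0 x \<oplus> cscale A 0 x = cscale A 0 x" using add[OF x, of 0 0] by simp
  then show 0: "cscale A 0 x = \<zero>" using cl[OF x] by (metis add.l_cancel_one')
  have "cscale A (-1) x \<oplus> x = \<zero>" using add[OF x, of "-1" 1] one[OF x] 0 by simp
  then show "\<ominus> x = cscale A (-1) x" using minus_equality cl[OF x] x by blast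
qed

lemma Bl2_minus:
  assumes "S \<in> bounded_ops I" "T \<in> bounded_ops I"
  shows "S \<ominus>\<^bsub>Bl2 I\<^esub> T = (\<lambda>\<xi>\<in>l2 I. \<lambda>i. S \<xi> i - T \<xi> i)"
proof -
  have "\<ominus>\<^bsub>Bl2 I\<^esub> T = cscale (Bl2 I) (-1) T"
    by (rule a_inv_eq_cscale(1)[OF ring_Bl2 _ Bl2_scale_add])
       (use assms in \<open>simp_all add: bounded_op_cscale bounded_op_restrict\<close>)
  then show ?thesis using assms by (auto simp: a_minus_def intro!: restrict_ext)
qed

text \<open>Stated outside the locale of C*-algebras: completeness, an axiom of that locale, is a
  statement about this metric, so the metric axioms have to come first.\<close>

lemma cdist_metric:
  fixes A :: "('a, 'm) cstar_algebra_scheme" (structure)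
  assumes "ring A"
    and cl: "\<And>s x. x \<in> carrier A \<Longrightarrow> cscale A s x \<in> carrier A"
    and add: "\<And>s t x. x \<in> carrier A \<Longrightarrow> cscale A (s + t) x = cscale A s x \<oplus> cscale A t x"
    and one: "\<And>x. x \<in> carrier A \<Longrightarrow> cscale A 1 x = x"
    and nonneg: "\<And>x. x \<in> carrier A \<Longrightarrow> 0 \<le> cnorm A x"
    and zero: "\<And>x. x \<in> carrier A \<Longrightarrow> cnorm A x = 0 \<longleftrightarrow> x = \<zero>"
    and tri: "\<And>x y. x \<in> carrier A \<Longrightarrow> y \<in> carrier A \<Longrightarrow> cnorm A (x \<oplus> y) \<le> cnorm A x + cnorm A y"
    and scale: "\<And>s x. x \<in> carrier A \<Longrightarrow> cnorm A (cscale A s x) = cmod s * cnorm A x"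
  shows "Metric_space (carrier A) (cdist A)"
proof -
  interpret ring A by fact
  note inv = a_inv_eq_cscale(1)[OF assms(1) cl add one]
  show ?thesis
  proof
    show "0 \<le> cdist A x y" for x y by (simp add: cdist_def nonneg)
    show "cdist A x y = cdist A y x" for x y
    proof (cases "x \<in> carrier A \<and> y \<in> carrier A")
      case True
      have "x \<ominus> y = \<ominus> (y \<ominus> x)" using True by (simp add: a_minus_def minus_add a_comm)
      also have "cnorm A \<dots> = cnorm A (y \<ominus> x)" using True by (simp add: inv scale)
      finally show ?thesis using True by (simp add: cdist_def)
    qed (auto simp: cdist_def)
    show "cdist A x y = 0 \<longleftrightarrow> x = y" if "x \<in> carrier A" "y \<in> carrier A" for x y
      using that zero[of "x \<ominus> y"] by (simp add: cdist_def) (metis minus_equality minus_minus a_inv_closed a_minus_def r_neg)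
    show "cdist A x z \<le> cdist A x y + cdist A y z"
      if "x \<in> carrier A" "y \<in> carrier A" "z \<in> carrier A" for x y z
    proof -
      have "x \<ominus> z = (x \<ominus> y) \<oplus> (y \<ominus> z)" using that by algebra
      then show ?thesis using that tri[of "x \<ominus> y" "y \<ominus> z"] by (simp add: cdist_def)
    qed
  qed
qed

text \<open>The limit is asked for with a weak inequality, which is what passing to the limit in a
  Cauchy estimate gives; using half of \<epsilon> restores the strict one.\<close>

lemma mcompleteI:
  assumes "Metric_space M d"
    and "\<And>\<sigma>. (\<And>n::nat. \<sigma> n \<in> M) \<Longrightarrow> (\<And>\<epsilon>. \<epsilon> > 0 \<Longrightarrow> \<exists>N. \<forall>m\<ge>N. \<forall>n\<ge>N. d (\<sigma> m) (\<sigma> n) < \<epsilon>) \<Longrightarrow>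
      \<exists>x\<in>M. \<forall>\<epsilon>>0. \<exists>N. \<forall>n\<ge>N. d (\<sigma> n) x \<le> \<epsilon>"
  shows "Metric_space.mcomplete M d"
proof -
  interpret Metric_space M d by fact
  show ?thesis unfolding mcomplete_def
  proof (intro allI impI)
    fix \<sigma> assume "MCauchy \<sigma>"
    then have *: "range \<sigma> \<subseteq> M" "\<And>\<epsilon>. \<epsilon> > 0 \<Longrightarrow> \<exists>N. \<forall>n n'. N \<le> n \<longrightarrow> N \<le> n' \<longrightarrow> d (\<sigma> n) (\<sigma> n') < \<epsilon>"
      by (auto simp: MCauchy_def)
    have "\<exists>x\<in>M. \<forall>\<epsilon>>0. \<exists>N. \<forall>n\<ge>N. d (\<sigma> n) x \<le> \<epsilon>"
    proof (rule assms(2))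
      show "\<sigma> n \<in> M" for n using *(1) by auto
      show "\<exists>N. \<forall>m\<ge>N. \<forall>n\<ge>N. d (\<sigma> m) (\<sigma> n) < \<epsilon>" if "\<epsilon> > 0" for \<epsilon> using *(2)[OF that] by meson
    qed
    then obtain x where x: "x \<in> M" "\<And>\<epsilon>. \<epsilon> > 0 \<Longrightarrow> \<exists>N. \<forall>n\<ge>N. d (\<sigma> n) x \<le> \<epsilon>" by blast
    have "limitin mtopology \<sigma> x sequentially"
      unfolding limitin_metric
    proof (intro conjI allI impI x(1))
      fix \<epsilon> :: real assume "\<epsilon> > 0"
      then obtain N where "\<forall>n\<ge>N. d (\<sigma> n) x \<le> \<epsilon>/2" using x(2)[of "\<epsilon>/2"] by auto
      then show "\<forall>\<^sub>F n in sequentially. \<sigma> n \<in> M \<and> d (\<sigma> n) x < \<epsilon>"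
        using \<open>\<epsilon> > 0\<close> *(1) by (intro eventually_sequentiallyI[of N]) (force simp: subset_iff)
    qed
    then show "\<exists>x. limitin mtopology \<sigma> x sequentially" by blast
  qed
qed

theorem unital_cstar_algebra_Bl2: "unital_cstar_algebra (Bl2 I)"
proof -
  interpret ring "Bl2 I" by (rule ring_Bl2)
  have norm_zero: "bop_norm I x = 0 \<longleftrightarrow> x = \<zero>\<^bsub>Bl2 I\<^esub>" if x: "x \<in> bounded_ops I" for x
  proof
    assume 0: "bop_norm I x = 0"
    have "x \<xi> = (\<lambda>i. 0)" if "\<xi> \<in> l2 I" for \<xi>
      using bop_norm_bound[OF x that] 0 l2_norm_eq_0[OF bounded_ops_closed[OF x that]]
        l2_norm_nonneg[of I "x \<xi>"] by simp
    then show "x = \<zero>\<^bsub>Bl2 I\<^esub>" using x by (intro bounded_ops_eqI) (auto simp: bounded_op_zero)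
  next
    assume "x = \<zero>\<^bsub>Bl2 I\<^esub>"
    then have "bop_norm I x \<le> 0" by (intro bop_norm_leI) auto
    then show "bop_norm I x = 0" using bop_norm_nonneg[OF x] by simp
  qed
  have metric: "Metric_space (carrier (Bl2 I)) (cdist (Bl2 I))"
    by (rule cdist_metric[OF ring_Bl2 _ Bl2_scale_add])
       (simp_all add: bounded_op_cscale bounded_op_plus(2) norm_zero[simplified] bop_norm_nonneg bounded_op_restrict)
  show ?thesis
  proof (intro unital_cstar_algebra.intro ring_Bl2 unital_cstar_algebra_axioms.intro)
    fix x y assume x: "x \<in> carrier (Bl2 I)" and y: "y \<in> carrier (Bl2 I)"
    then have x': "x \<in> bounded_ops I" and y': "y \<in> bounded_ops I" by auto
    show "cstar (Bl2 I) (x \<oplus>\<^bsub>Bl2 I\<^esub> y) = cstar (Bl2 I) x \<oplus>\<^bsub>Bl2 I\<^esub> cstar (Bl2 I) y"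
      unfolding Bl2_simps
      by (rule adjoint_op_eqI[OF bounded_op_plus(1)[OF x' y']
            bounded_op_plus(1)[OF adjoint_op_bounded(1)[OF x'] adjoint_op_bounded(1)[OF y']]])
         (simp add: entry_def adjoint_op_bounded(3)[OF x', unfolded entry_def]
            adjoint_op_bounded(3)[OF y', unfolded entry_def])
    show "cstar (Bl2 I) (x \<otimes>\<^bsub>Bl2 I\<^esub> y) = cstar (Bl2 I) y \<otimes>\<^bsub>Bl2 I\<^esub> cstar (Bl2 I) x"
      unfolding Bl2_simps
    proof (rule adjoint_op_eqI)
      fix m q assume mq: "m \<in> I" "q \<in> I"
      have "((\<lambda>p. cnj (entry x q p * entry y p m)) has_sum cnj (entry (compose (l2 I) x y) q m)) I"
        unfolding has_sum_cnj_iff by (rule entry_compose_has_sum[OF x' y' mq(1)])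
      then have "((\<lambda>p. entry (adjoint_op I y) m p * entry (adjoint_op I x) p q) has_sum
          cnj (entry (compose (l2 I) x y) q m)) I"
        by (rule has_sum_cong[THEN iffD1, rotated])
           (simp add: mq adjoint_op_bounded(3)[OF x'] adjoint_op_bounded(3)[OF y'])
      then show "entry (compose (l2 I) (adjoint_op I y) (adjoint_op I x)) m q = cnj (entry (compose (l2 I) x y) q m)"
        using entry_compose_has_sum[OF adjoint_op_bounded(1)[OF y'] adjoint_op_bounded(1)[OF x'] mq(2)] has_sum_unique
        by blast
    qed (use x' y' in \<open>auto simp: bounded_op_compose adjoint_op_bounded\<close>)
    show "cnorm (Bl2 I) (x \<oplus>\<^bsub>Bl2 I\<^esub> y) \<le> cnorm (Bl2 I) x + cnorm (Bl2 I) y"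
      "cnorm (Bl2 I) (x \<otimes>\<^bsub>Bl2 I\<^esub> y) \<le> cnorm (Bl2 I) x * cnorm (Bl2 I) y"
      using x' y' by (auto simp: bounded_op_plus bounded_op_compose)
  next
    fix x assume x: "x \<in> carrier (Bl2 I)"
    then have x': "x \<in> bounded_ops I" by auto
    show "cstar (Bl2 I) (cstar (Bl2 I) x) = x"
      unfolding Bl2_simps
      by (rule adjoint_op_eqI[OF adjoint_op_bounded(1)[OF x'] x']) (simp add: adjoint_op_bounded(3)[OF x'])
    show "cstar (Bl2 I) (cscale (Bl2 I) s x) = cscale (Bl2 I) (cnj s) (cstar (Bl2 I) x)" for s
      unfolding Bl2_simps
      by (rule adjoint_op_eqI[OF bounded_op_cscale(1)[OF x'] bounded_op_cscale(1)[OF adjoint_op_bounded(1)[OF x']]])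
         (simp add: entry_def adjoint_op_bounded(3)[OF x', unfolded entry_def])
    have ad: "adjoint_op I x \<in> bounded_ops I" by (rule adjoint_op_bounded[OF x'])
    show "cnorm (Bl2 I) (cstar (Bl2 I) x \<otimes>\<^bsub>Bl2 I\<^esub> x) = (cnorm (Bl2 I) x)\<^sup>2"
    proof (rule antisym)
      have "bop_norm I (compose (l2 I) (adjoint_op I x) x) \<le> bop_norm I (adjoint_op I x) * bop_norm I x"
        by (rule bounded_op_compose(2)[OF ad x'])
      also have "\<dots> \<le> bop_norm I x * bop_norm I x"
        by (intro mult_right_mono adjoint_op_bounded(2)[OF x'] bop_norm_nonneg[OF x'])
      finally show "cnorm (Bl2 I) (cstar (Bl2 I) x \<otimes>\<^bsub>Bl2 I\<^esub> x) \<le> (cnorm (Bl2 I) x)\<^sup>2"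
        by (simp add: power2_eq_square)
      let ?B = "bop_norm I (compose (l2 I) (adjoint_op I x) x)"
      have B0: "0 \<le> ?B" by (intro bop_norm_nonneg bounded_op_compose ad x')
      \<comment> \<open>The nontrivial half of the C*-identity: the squared norm of x \<xi> is the
        pairing of \<xi> with x* x \<xi>.\<close>
      have "bop_norm I x \<le> sqrt ?B"
      proof (rule bop_norm_leI)
        fix \<xi> :: "'a \<Rightarrow> complex" assume \<xi>: "\<xi> \<in> l2 I"
        have x\<xi>: "x \<xi> \<in> l2 I" by (rule bounded_ops_closed[OF x' \<xi>])
        have "(l2_norm I (x \<xi>))\<^sup>2 = cmod (l2_inner I (x \<xi>) (x \<xi>))"
          by (simp add: l2_inner_self[OF x\<xi>] norm_power)
        also have "\<dots> = cmod (l2_inner I \<xi> (compose (l2 I) (adjoint_op I x) x \<xi>))"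
          using \<xi> by (simp add: adjoint_op_characterization(2)[OF x' \<xi> x\<xi>] compose_def)
        also have "\<dots> \<le> l2_norm I \<xi> * l2_norm I (compose (l2 I) (adjoint_op I x) x \<xi>)"
          by (intro l2_inner_bound \<xi> bounded_ops_closed[OF bounded_op_compose(1)[OF ad x']])
        also have "\<dots> \<le> l2_norm I \<xi> * (?B * l2_norm I \<xi>)"
          by (intro mult_left_mono bop_norm_bound bounded_op_compose ad x' \<xi>) auto
        finally have "(l2_norm I (x \<xi>))\<^sup>2 \<le> (sqrt ?B * l2_norm I \<xi>)\<^sup>2"
          using B0 by (simp add: power_mult_distrib power2_eq_square mult_ac)
        then show "l2_norm I (x \<xi>) \<le> sqrt ?B * l2_norm I \<xi>"
          by (rule power2_le_imp_le) (simp add: B0)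
      qed (simp add: B0)
      then have "(bop_norm I x)\<^sup>2 \<le> (sqrt ?B)\<^sup>2" by (intro power_mono bop_norm_nonneg[OF x'])
      then show "(cnorm (Bl2 I) x)\<^sup>2 \<le> cnorm (Bl2 I) (cstar (Bl2 I) x \<otimes>\<^bsub>Bl2 I\<^esub> x)" using B0 by simp
    qed
  next
    show "Metric_space.mcomplete (carrier (Bl2 I)) (cdist (Bl2 I))"
    proof (rule mcompleteI[OF metric])
      fix \<sigma> :: "nat \<Rightarrow> ('a \<Rightarrow> complex) \<Rightarrow> 'a \<Rightarrow> complex"
      assume "\<And>n. \<sigma> n \<in> carrier (Bl2 I)"
      then have \<sigma>: "\<sigma> n \<in> bounded_ops I" for n by simp
      assume cau: "\<And>\<epsilon>. \<epsilon> > 0 \<Longrightarrow> \<exists>N. \<forall>m\<ge>N. \<forall>n\<ge>N. cdist (Bl2 I) (\<sigma> m) (\<sigma> n) < \<epsilon>"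
      have diff: "l2_norm I (\<lambda>i. \<sigma> m \<xi> i - \<sigma> n \<xi> i) \<le> cdist (Bl2 I) (\<sigma> m) (\<sigma> n) * l2_norm I \<xi>"
        if "\<xi> \<in> l2 I" for \<xi> m n
      proof -
        have "\<sigma> m \<ominus>\<^bsub>Bl2 I\<^esub> \<sigma> n \<in> bounded_ops I" using minus_closed[of "\<sigma> m" "\<sigma> n"] \<sigma> by simp
        from bop_norm_bound[OF this that] show ?thesis using \<sigma> that by (simp add: cdist_def Bl2_minus)
      qed
      have lim: "\<exists>l. (\<lambda>n. \<sigma> n \<xi> i) \<longlonglongrightarrow> l" if \<xi>: "\<xi> \<in> l2 I" for \<xi> i
      proof -
        have "Cauchy (\<lambda>n. \<sigma> n \<xi> i)"
        proof (rule CauchyI)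
          fix e :: real assume "0 < e"
          let ?d = "e / (l2_norm I \<xi> + 1)"
          have pos: "0 < l2_norm I \<xi> + 1" using l2_norm_nonneg[of I \<xi>] by linarith
          then obtain N where N: "\<forall>m\<ge>N. \<forall>n\<ge>N. cdist (Bl2 I) (\<sigma> m) (\<sigma> n) < ?d"
            using cau[of ?d] \<open>0 < e\<close> by auto
          have "norm (\<sigma> m \<xi> i - \<sigma> n \<xi> i) < e" if "m \<ge> N" "n \<ge> N" for m n
          proof -
            have "norm (\<sigma> m \<xi> i - \<sigma> n \<xi> i) \<le> l2_norm I (\<lambda>i. \<sigma> m \<xi> i - \<sigma> n \<xi> i)"
              by (rule norm_le_l2_norm[OF l2_diff(1)]) (auto intro: bounded_ops_closed \<sigma> \<xi>)
            also have "\<dots> \<le> cdist (Bl2 I) (\<sigma> m) (\<sigma> n) * l2_norm I \<xi>" by (rule diff[OF \<xi>])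
            also have "\<dots> \<le> ?d * l2_norm I \<xi>" using N that by (intro mult_right_mono) (auto intro: less_imp_le)
            also have "\<dots> < ?d * (l2_norm I \<xi> + 1)" using pos \<open>0 < e\<close> by (intro mult_strict_left_mono) auto
            also have "\<dots> = e" using pos by simp
            finally show ?thesis .
          qed
          then show "\<exists>M. \<forall>m\<ge>M. \<forall>n\<ge>M. norm (\<sigma> m \<xi> i - \<sigma> n \<xi> i) < e" by blast
        qed
        then show ?thesis by (simp add: Cauchy_convergent_iff convergent_def)
      qed
      \<comment> \<open>A Cauchy sequence in operator norm converges at every vector and every
        index, which yields a candidate for the limit; norm convergence to it is recovered
        afterwards.\<close>
      define T where "T = (\<lambda>\<xi>\<in>l2 I. \<lambda>i. lim (\<lambda>n. \<sigma> n \<xi> i))"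
      have T: "(\<lambda>n. \<sigma> n \<xi> i) \<longlonglongrightarrow> T \<xi> i" if "\<xi> \<in> l2 I" for \<xi> i
        using lim[OF that] that by (auto simp: T_def convergent_def convergent_LIMSEQ_iff[symmetric])
      \<comment> \<open>The Cauchy estimate survives m \<rightarrow> \<infinity> on each finite
        index set, where only finitely many limits are involved, and the bound is uniform over these
        sets.\<close>
      have close: "(\<lambda>i. \<sigma> n \<xi> i - T \<xi> i) \<in> l2 I" "l2_norm I (\<lambda>i. \<sigma> n \<xi> i - T \<xi> i) \<le> \<epsilon> * l2_norm I \<xi>"
        if \<xi>: "\<xi> \<in> l2 I" and N: "\<And>m. m \<ge> N \<Longrightarrow> cdist (Bl2 I) (\<sigma> n) (\<sigma> m) \<le> \<epsilon>" for \<xi> n N \<epsilon>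
      proof -
        have o: "\<sigma> n \<xi> i - T \<xi> i = 0" if "i \<notin> I" for i
        proof -
          have 0: "\<sigma> m \<xi> i = 0" for m using bounded_ops_outside[OF \<sigma> \<xi> that] .
          then have "T \<xi> i = 0" using T[OF \<xi>, of i] by (simp add: LIMSEQ_const_iff)
          then show ?thesis using 0 by simp
        qed
        have b: "L2_set (\<lambda>i. norm (\<sigma> n \<xi> i - T \<xi> i)) F \<le> \<epsilon> * l2_norm I \<xi>" if F: "finite F" "F \<subseteq> I" for F
        proof (rule LIMSEQ_le_const2)
          show "(\<lambda>m. L2_set (\<lambda>i. norm (\<sigma> n \<xi> i - \<sigma> m \<xi> i)) F) \<longlonglongrightarrow> L2_set (\<lambda>i. norm (\<sigma> n \<xi> i - T \<xi> i)) F"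
            unfolding L2_set_def by (intro tendsto_intros T[OF \<xi>])
          have "L2_set (\<lambda>i. norm (\<sigma> n \<xi> i - \<sigma> m \<xi> i)) F \<le> \<epsilon> * l2_norm I \<xi>" if "m \<ge> N" for m
          proof -
            have "L2_set (\<lambda>i. norm (\<sigma> n \<xi> i - \<sigma> m \<xi> i)) F \<le> l2_norm I (\<lambda>i. \<sigma> n \<xi> i - \<sigma> m \<xi> i)"
              by (rule L2_set_le_l2_norm[OF l2_diff(1) F]) (auto intro: bounded_ops_closed \<sigma> \<xi>)
            also have "\<dots> \<le> cdist (Bl2 I) (\<sigma> n) (\<sigma> m) * l2_norm I \<xi>" by (rule diff[OF \<xi>])
            also have "\<dots> \<le> \<epsilon> * l2_norm I \<xi>" using N[OF that] by (intro mult_right_mono) auto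
            finally show ?thesis .
          qed
          then show "\<exists>M. \<forall>m\<ge>M. L2_set (\<lambda>i. norm (\<sigma> n \<xi> i - \<sigma> m \<xi> i)) F \<le> \<epsilon> * l2_norm I \<xi>" by blast
        qed
        show "(\<lambda>i. \<sigma> n \<xi> i - T \<xi> i) \<in> l2 I" "l2_norm I (\<lambda>i. \<sigma> n \<xi> i - T \<xi> i) \<le> \<epsilon> * l2_norm I \<xi>"
          using l2_boundI[OF o b] by auto
      qed
      obtain N where N: "\<And>m. m \<ge> N \<Longrightarrow> cdist (Bl2 I) (\<sigma> N) (\<sigma> m) \<le> 1"
        using cau[of 1] by (auto intro: less_imp_le)
      have Tb: "T \<in> bounded_ops I"
      proof (rule bounded_opsI[where B = "bop_norm I (\<sigma> N) + 1"])
        show "T \<in> extensional (l2 I)" by (simp add: T_def)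
        show "T (\<lambda>i. \<xi> i + \<eta> i) = (\<lambda>i. T \<xi> i + T \<eta> i)" if "\<xi> \<in> l2 I" "\<eta> \<in> l2 I" for \<xi> \<eta>
        proof
          fix i show "T (\<lambda>i. \<xi> i + \<eta> i) i = T \<xi> i + T \<eta> i"
            using T[OF l2_add(1)[OF that], of i] tendsto_add[OF T[OF that(1), of i] T[OF that(2), of i]]
            by (intro LIMSEQ_unique) (auto simp: bounded_ops_add[OF \<sigma> that])
        qed
        show "T (\<lambda>i. s * \<xi> i) = (\<lambda>i. s * T \<xi> i)" if "\<xi> \<in> l2 I" for \<xi> s
        proof
          fix i show "T (\<lambda>i. s * \<xi> i) i = s * T \<xi> i"
            using T[OF l2_scale(1)[OF that], of s i] tendsto_mult_left[OF T[OF that, of i], of s]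
            by (intro LIMSEQ_unique) (auto simp: bounded_ops_scale[OF \<sigma> that])
        qed
        fix \<xi> :: "'a \<Rightarrow> complex" assume \<xi>: "\<xi> \<in> l2 I"
        have eq: "T \<xi> = (\<lambda>i. \<sigma> N \<xi> i - (\<sigma> N \<xi> i - T \<xi> i))" by simp
        note c = close[OF \<xi>, where n = N and N = N and \<epsilon> = 1, OF N]
        show "T \<xi> \<in> l2 I" by (subst eq) (intro l2_diff(1) bounded_ops_closed[OF \<sigma> \<xi>] c)
        have "l2_norm I (T \<xi>) \<le> l2_norm I (\<sigma> N \<xi>) + l2_norm I (\<lambda>i. \<sigma> N \<xi> i - T \<xi> i)"
          by (subst eq) (intro l2_diff(2) bounded_ops_closed[OF \<sigma> \<xi>] c)
        then show "l2_norm I (T \<xi>) \<le> (bop_norm I (\<sigma> N) + 1) * l2_norm I \<xi>"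
          using c(2) bop_norm_bound[OF \<sigma> \<xi>, of N] by (simp add: algebra_simps)
      qed
      show "\<exists>x\<in>carrier (Bl2 I). \<forall>\<epsilon>>0. \<exists>N. \<forall>n\<ge>N. cdist (Bl2 I) (\<sigma> n) x \<le> \<epsilon>"
      proof (intro bexI[where x = T] allI impI)
        fix \<epsilon> :: real assume "\<epsilon> > 0"
        then obtain N where N: "\<forall>m\<ge>N. \<forall>n\<ge>N. cdist (Bl2 I) (\<sigma> m) (\<sigma> n) < \<epsilon>" using cau by blast
        have "cdist (Bl2 I) (\<sigma> n) T \<le> \<epsilon>" if "n \<ge> N" for n
        proof -
          have "bop_norm I (\<lambda>\<xi>\<in>l2 I. \<lambda>i. \<sigma> n \<xi> i - T \<xi> i) \<le> \<epsilon>"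
            by (rule bop_norm_leI) (use close(2)[of _ N n \<epsilon>] N that \<open>\<epsilon> > 0\<close> in \<open>auto intro: less_imp_le\<close>)
          then show ?thesis using \<sigma> Tb by (simp add: cdist_def Bl2_minus)
        qed
        then show "\<exists>N. \<forall>n\<ge>N. cdist (Bl2 I) (\<sigma> n) T \<le> \<epsilon>" by blast
      qed (simp add: Tb)
    qed
  next
    fix x y s assume "x \<in> carrier (Bl2 I)" "y \<in> carrier (Bl2 I)"
    then show "x \<otimes>\<^bsub>Bl2 I\<^esub> cscale (Bl2 I) s y = cscale (Bl2 I) s (x \<otimes>\<^bsub>Bl2 I\<^esub> y)"
      "cscale (Bl2 I) s x \<otimes>\<^bsub>Bl2 I\<^esub> y = cscale (Bl2 I) s (x \<otimes>\<^bsub>Bl2 I\<^esub> y)"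
      by (auto simp: compose_def bounded_ops_scale bounded_ops_closed intro!: restrict_ext)
  next
    fix x s t show "cscale (Bl2 I) (s + t) x = cscale (Bl2 I) s x \<oplus>\<^bsub>Bl2 I\<^esub> cscale (Bl2 I) t x"
      by (rule Bl2_scale_add)
  qed (simp_all add: bounded_op_cscale bop_norm_nonneg norm_zero[simplified] adjoint_op_bounded
         bounded_op_restrict algebra_simps cong: restrict_cong)
qed

section \<open>Abstract C*-algebras\<close>

context unital_cstar_algebra begin

lemma metric: "Metric_space (carrier A) (cdist A)"
  by (rule cdist_metric[OF ring_axioms scale_closed scale_add_left scale_one norm_nonneg norm_eq_zero norm_triangle norm_scale])

lemma a_inv_scale: "x \<in> carrier A \<Longrightarrow> \<ominus> x = cscale A (-1) x"
  by (rule a_inv_eq_cscale[OF ring_axioms scale_closed scale_add_left scale_one])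

lemma scale_zero_left: "x \<in> carrier A \<Longrightarrow> cscale A 0 x = \<zero>"
  by (rule a_inv_eq_cscale[OF ring_axioms scale_closed scale_add_left scale_one])

lemma norm_minus: "x \<in> carrier A \<Longrightarrow> cnorm A (\<ominus> x) = cnorm A x"
  by (simp add: a_inv_scale norm_scale)

lemma norm_minus_commute: "x \<in> carrier A \<Longrightarrow> y \<in> carrier A \<Longrightarrow> cnorm A (x \<ominus> y) = cnorm A (y \<ominus> x)"
  using Metric_space.commute[OF metric, of x y] by (simp add: cdist_def)

lemma norm_triangle_diff: "x \<in> carrier A \<Longrightarrow> y \<in> carrier A \<Longrightarrow> cnorm A (x \<ominus> y) \<le> cnorm A x + cnorm A y"
  using norm_triangle[of x "\<ominus> y"] by (simp add: a_minus_def norm_minus)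

lemma star_minus: "x \<in> carrier A \<Longrightarrow> y \<in> carrier A \<Longrightarrow> cstar A (x \<ominus> y) = cstar A x \<ominus> cstar A y"
  by (simp add: a_minus_def star_add star_closed a_inv_scale scale_closed star_scale)

lemma star_one: "cstar A \<one> = \<one>"
  using star_mult[of "cstar A \<one>" \<one>] star_closed[of \<one>] star_star[of \<one>] by simp

lemma star_zero: "cstar A \<zero> = \<zero>"
  using star_scale[of \<zero> 0] star_closed[of \<zero>] by (simp add: scale_zero_left)

lemma scale_minus_right:
  "x \<in> carrier A \<Longrightarrow> y \<in> carrier A \<Longrightarrow> cscale A s (x \<ominus> y) = cscale A s x \<ominus> cscale A s y"
  by (simp add: a_minus_def a_inv_scale scale_add_right scale_closed scale_scale mult.commute)

text \<open>The C*-identity bounds the square of the norm by the product of the norms of x and its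
  adjoint; cancelling one factor is possible unless the norm of x vanishes.\<close>

lemma norm_star_le: "x \<in> carrier A \<Longrightarrow> cnorm A x \<le> cnorm A (cstar A x)"
  using cstar_identity[of x] norm_mult[of "cstar A x" x] star_closed[of x] norm_nonneg[of x] norm_nonneg[of "cstar A x"]
  by (cases "cnorm A x = 0") (auto simp: power2_eq_square)

lemma norm_star: "x \<in> carrier A \<Longrightarrow> cnorm A (cstar A x) = cnorm A x"
  using norm_star_le[of x] norm_star_le[of "cstar A x"] star_closed[of x] star_star[of x] by simp

lemma topspace_cstar: "topspace (cstar_topology A) = carrier A"
  using Metric_space.topspace_mtopology[OF metric] by (simp add: cstar_topology_def)

lemma closure_of_iff:
  assumes "S \<subseteq> carrier A"
  shows "x \<in> cstar_topology A closure_of S \<longleftrightarrow>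
    x \<in> carrier A \<and> (\<forall>\<epsilon>>0. \<exists>y\<in>S. cnorm A (x \<ominus> y) < \<epsilon>)"
  using assms unfolding cstar_topology_def Metric_space.metric_closure_of[OF metric]
  by (auto simp: Metric_space.in_mball[OF metric] cdist_def subset_iff) 

lemma closedin_iff:
  "closedin (cstar_topology A) C \<longleftrightarrow>
    C \<subseteq> carrier A \<and> (\<forall>x\<in>carrier A. (\<forall>\<epsilon>>0. \<exists>y\<in>C. cnorm A (x \<ominus> y) < \<epsilon>) \<longrightarrow> x \<in> C)"
proof (cases "C \<subseteq> carrier A")
  case True
  show ?thesis
    using True closure_of_iff[OF True] closure_of_subset[of C "cstar_topology A"]
    unfolding closure_of_subset_eq[symmetric] topspace_cstar by blast
next
  case False
  then show ?thesis using closedin_subset[of "cstar_topology A" C] topspace_cstar by auto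
qed

lemma complete_seq:
  fixes x :: "nat \<Rightarrow> 'a"
  assumes "\<And>n. x n \<in> carrier A" "\<And>\<epsilon>. \<epsilon> > 0 \<Longrightarrow> \<exists>N. \<forall>m\<ge>N. \<forall>n\<ge>N. cnorm A (x m \<ominus> x n) < \<epsilon>"
  obtains l where "l \<in> carrier A" "\<And>\<epsilon>. \<epsilon> > 0 \<Longrightarrow> \<exists>N. \<forall>n\<ge>N. cnorm A (x n \<ominus> l) < \<epsilon>"
proof -
  interpret M: Metric_space "carrier A" "cdist A" by (rule metric)
  have "M.MCauchy x"
    unfolding M.MCauchy_def using assms by (auto simp: cdist_def)
  then obtain l where "limitin M.mtopology x l sequentially"
    using complete by (auto simp: M.mcomplete_def)
  then have l: "l \<in> carrier A" "\<And>\<epsilon>. \<epsilon> > 0 \<Longrightarrow> \<exists>N. \<forall>n\<ge>N. x n \<in> carrier A \<and> cdist A (x n) l < \<epsilon>"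
    by (auto simp: M.limitin_metric eventually_sequentially)
  show ?thesis
    by (rule that[OF l(1)]) (use l assms(1) in \<open>auto simp: cdist_def\<close>)
qed

text \<open>Closedness gives completeness. Negatives are not listed in \<open>cstar_closed\<close>;
  they come from scaling by -1.\<close>

lemma subalgebra:
  assumes C: "cstar_closed A C" and one: "\<one> \<in> C"
  shows "unital_cstar_algebra (A\<lparr>carrier := C\<rparr>)"
proof -
  let ?B = "A\<lparr>carrier := C\<rparr>"
  have sub: "C \<subseteq> carrier A"
    and lim: "\<And>x. x \<in> carrier A \<Longrightarrow> (\<And>\<epsilon>. \<epsilon> > 0 \<Longrightarrow> \<exists>y\<in>C. cnorm A (x \<ominus> y) < \<epsilon>) \<Longrightarrow> x \<in> C"
    using C by (auto simp: cstar_closed_def closedin_iff)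
  have c: "\<zero> \<in> C" "\<And>x y. x \<in> C \<Longrightarrow> y \<in> C \<Longrightarrow> x \<oplus> y \<in> C" "\<And>x y. x \<in> C \<Longrightarrow> y \<in> C \<Longrightarrow> x \<otimes> y \<in> C"
    "\<And>x. x \<in> C \<Longrightarrow> cstar A x \<in> C" "\<And>x s. x \<in> C \<Longrightarrow> cscale A s x \<in> C"
    using C by (auto simp: cstar_closed_def)
  have i: "\<And>x. x \<in> C \<Longrightarrow> x \<in> carrier A" using sub by auto
  have ring: "ring ?B"
  proof (rule ringI)
    show "abelian_group ?B"
    proof (rule abelian_groupI)
      fix x assume x: "x \<in> carrier ?B"
      show "\<exists>y\<in>carrier ?B. y \<oplus>\<^bsub>?B\<^esub> x = \<zero>\<^bsub>?B\<^esub>"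
        by (rule bexI[of _ "cscale A (-1) x"]) (use x l_neg[of x] i c a_inv_scale[of x] in auto)
    qed (use i c in \<open>auto simp: a_ac\<close>)
    show "monoid ?B" by (rule monoidI) (use i c one in \<open>auto simp: m_assoc\<close>)
  qed (use i c in \<open>auto simp: l_distr r_distr\<close>)
  have minus: "x \<ominus>\<^bsub>?B\<^esub> y = x \<ominus> y" if "x \<in> C" "y \<in> C" for x y
  proof -
    have "\<ominus>\<^bsub>?B\<^esub> y = cscale ?B (-1) y"
      by (rule a_inv_eq_cscale[OF ring]) (use that i c in \<open>auto simp: scale_add_left scale_one\<close>)
    then show ?thesis using that i by (simp add: a_minus_def a_inv_scale)
  qed
  have metric': "Metric_space (carrier ?B) (cdist ?B)"
    by (rule cdist_metric[OF ring])
      (use i c in \<open>auto simp: scale_add_left scale_one norm_nonneg norm_eq_zero norm_triangle norm_scale\<close>)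
  show ?thesis
  proof (intro unital_cstar_algebra.intro ring unital_cstar_algebra_axioms.intro)
    show "Metric_space.mcomplete (carrier ?B) (cdist ?B)"
    proof (rule mcompleteI[OF metric'])
      fix \<sigma> :: "nat \<Rightarrow> 'a"
      assume "\<And>n. \<sigma> n \<in> carrier ?B"
        and cau: "\<And>\<epsilon>. \<epsilon> > 0 \<Longrightarrow> \<exists>N. \<forall>m\<ge>N. \<forall>n\<ge>N. cdist ?B (\<sigma> m) (\<sigma> n) < \<epsilon>"
      then have \<sigma>: "\<sigma> n \<in> C" for n by simp
      obtain l where l: "l \<in> carrier A" "\<And>\<epsilon>. \<epsilon> > 0 \<Longrightarrow> \<exists>N. \<forall>n\<ge>N. cnorm A (\<sigma> n \<ominus> l) < \<epsilon>"
      proof (rule complete_seq[of \<sigma>])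
        show "\<exists>N. \<forall>m\<ge>N. \<forall>n\<ge>N. cnorm A (\<sigma> m \<ominus> \<sigma> n) < \<epsilon>" if "\<epsilon> > 0" for \<epsilon>
          using cau[OF that] \<sigma> by (simp add: cdist_def minus)
      qed (use \<sigma> i in auto)
      have "l \<in> C"
      proof (rule lim[OF l(1)])
        fix \<epsilon> :: real assume "\<epsilon> > 0"
        then obtain N where "cnorm A (\<sigma> N \<ominus> l) < \<epsilon>" using l(2) by blast
        then show "\<exists>y\<in>C. cnorm A (l \<ominus> y) < \<epsilon>" using \<sigma>[of N] i l(1) by (metis norm_minus_commute)
      qed
      moreover have "\<exists>N. \<forall>n\<ge>N. cdist ?B (\<sigma> n) l \<le> \<epsilon>" if "\<epsilon> > 0" for \<epsilon>
        using l(2)[OF that] \<sigma> \<open>l \<in> C\<close> by (auto simp: cdist_def minus intro: less_imp_le)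
      ultimately show "\<exists>x\<in>carrier ?B. \<forall>\<epsilon>>0. \<exists>N. \<forall>n\<ge>N. cdist ?B (\<sigma> n) x \<le> \<epsilon>"
        by auto
    qed
  qed (use i c in \<open>auto simp: scale_add_left scale_add_right scale_scale scale_one scale_mult_left scale_mult_right
       star_star star_add star_scale star_mult norm_nonneg norm_eq_zero norm_triangle norm_scale norm_mult cstar_identity\<close>)
qed

text \<open>The additive inverse is determined inside the carrier, so it might change when the
  carrier shrinks; being the scalar multiple by -1, it does not.\<close>

lemma subalgebra_minus:
  assumes "cstar_closed A C" "\<one> \<in> C" "x \<in> C" "y \<in> C"
  shows "x \<ominus>\<^bsub>A\<lparr>carrier := C\<rparr>\<^esub> y = x \<ominus> y"
proof -
  interpret B: unital_cstar_algebra "A\<lparr>carrier := C\<rparr>" by (rule subalgebra[OF assms(1,2)])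
  have "y \<in> carrier A" using assms by (auto simp: cstar_closed_def closedin_iff)
  then show ?thesis using B.a_inv_scale[of y] assms by (simp add: a_minus_def a_inv_scale)
qed

text \<open>Serves an algebra that is generated inside another subalgebra, while commutants are
  formed among all bounded operators.\<close>

lemma cstar_closed_Int_subalgebra:
  assumes C: "cstar_closed A C" "\<one> \<in> C" and D: "cstar_closed A D"
  shows "cstar_closed (A\<lparr>carrier := C\<rparr>) (D \<inter> C)"
proof -
  interpret B: unital_cstar_algebra "A\<lparr>carrier := C\<rparr>" by (rule subalgebra[OF C])
  have "closedin (cstar_topology (A\<lparr>carrier := C\<rparr>)) (D \<inter> C)"
    unfolding B.closedin_iff
  proof (intro conjI ballI impI)
    fix x assume x: "x \<in> carrier (A\<lparr>carrier := C\<rparr>)"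
      "\<forall>\<epsilon>>0. \<exists>y\<in>D \<inter> C. cnorm (A\<lparr>carrier := C\<rparr>) (x \<ominus>\<^bsub>A\<lparr>carrier := C\<rparr>\<^esub> y) < \<epsilon>"
    have "\<exists>y\<in>D. cnorm A (x \<ominus> y) < \<epsilon>" if "\<epsilon> > 0" for \<epsilon>
      using x that subalgebra_minus[OF C, of x] by fastforce
    moreover have "x \<in> carrier A" using x C by (auto simp: cstar_closed_def closedin_iff)
    ultimately have "x \<in> D" using D unfolding cstar_closed_def closedin_iff by blast
    then show "x \<in> D \<inter> C" using x by simp
  qed auto
  then show ?thesis using C D by (auto simp: cstar_closed_def)
qed

section \<open>Generated C*-subalgebras, commutants and square roots\<close>

lemma cstar_closed_carrier: "cstar_closed A (carrier A)"
  by (auto simp: cstar_closed_def closedin_iff star_closed scale_closed)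

lemma cstar_generated:
  assumes X: "X \<subseteq> carrier A"
  shows "cstar_closed A (carrier (cstar_generated A X))" "X \<subseteq> carrier (cstar_generated A X)"
    "\<And>C. X \<subseteq> C \<Longrightarrow> cstar_closed A C \<Longrightarrow> carrier (cstar_generated A X) \<subseteq> C"
proof -
  let ?F = "{C. X \<subseteq> C \<and> cstar_closed A C}"
  have ne: "carrier A \<in> ?F" using X cstar_closed_carrier by simp
  have "closedin (cstar_topology A) (\<Inter>?F)"
    by (rule closedin_Inter) (use ne in \<open>auto simp: cstar_closed_def\<close>)
  then show "cstar_closed A (carrier (cstar_generated A X))"
    by (auto simp: cstar_generated_def cstar_closed_def)
qed (auto simp: cstar_generated_def)

lemma cstar_generated_eq: "cstar_generated A X = A\<lparr>carrier := carrier (cstar_generated A X)\<rparr>"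
  by (simp add: cstar_generated_def)

text \<open>The generator u contributes the unit as the product of its adjoint with u itself; a
  generated subalgebra in general need not contain the unit.\<close>

lemma unital_cstar_algebra_generated:
  assumes X: "X \<subseteq> carrier A" and u: "u \<in> X" "cstar A u \<otimes> u = \<one>"
  shows "\<one> \<in> carrier (cstar_generated A X)" "unital_cstar_algebra (cstar_generated A X)"
proof -
  show 1: "\<one> \<in> carrier (cstar_generated A X)"
  proof -
    have "u \<in> carrier (cstar_generated A X)" using cstar_generated(2)[OF X] u(1) by blast
    then show ?thesis using cstar_generated(1)[OF X] u(2) unfolding cstar_closed_def by metis
  qed
  show "unital_cstar_algebra (cstar_generated A X)"
    by (subst cstar_generated_eq) (rule subalgebra[OF cstar_generated(1)[OF X] 1])
qed

text \<open>A commutant is a norm closed algebra by continuity of multiplication; stability of S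
  under the adjoint makes it stable as well, by taking adjoints of the commutation relation.\<close>

lemma cstar_closed_commutant:
  assumes S: "S \<subseteq> carrier A" and star: "\<And>s. s \<in> S \<Longrightarrow> cstar A s \<in> S"
  shows "cstar_closed A {x \<in> carrier A. \<forall>s\<in>S. x \<otimes> s = s \<otimes> x}"
  unfolding cstar_closed_def
proof (intro conjI ballI allI)
  let ?C = "{x \<in> carrier A. \<forall>s\<in>S. x \<otimes> s = s \<otimes> x}"
  show "closedin (cstar_topology A) ?C"
    unfolding closedin_iff
  proof (intro conjI ballI impI)
    fix x assume x: "x \<in> carrier A" and lim: "\<forall>\<epsilon>>0. \<exists>y\<in>?C. cnorm A (x \<ominus> y) < \<epsilon>"
    have "x \<otimes> s = s \<otimes> x" if s: "s \<in> S" for s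
    proof -
      have sA: "s \<in> carrier A" using S s by auto
      have "cnorm A (x \<otimes> s \<ominus> s \<otimes> x) \<le> 0 + e" if "e > 0" for e
      proof -
        \<comment> \<open>Replacing x by y changes x s - s x by at most 2 ||x - y|| ||s||; the added
          1 keeps the denominator positive when s = 0.\<close>
        let ?e = "e / (2 * (cnorm A s + 1))"
        have pos: "0 < cnorm A s + 1" using norm_nonneg[OF sA] by linarith
        then obtain y where y: "y \<in> carrier A" "y \<otimes> s = s \<otimes> y" "cnorm A (x \<ominus> y) < ?e"
          using lim[rule_format, of ?e] \<open>e > 0\<close> s by auto
        have "x \<otimes> s \<ominus> s \<otimes> x = (x \<ominus> y) \<otimes> s \<ominus> s \<otimes> (x \<ominus> y)"
        proof -
          have "(x \<ominus> y) \<otimes> s \<ominus> s \<otimes> (x \<ominus> y) = (x \<otimes> s \<ominus> y \<otimes> s) \<ominus> (s \<otimes> x \<ominus> s \<otimes> y)"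
            using x y(1) sA by algebra
          also have "\<dots> = x \<otimes> s \<ominus> s \<otimes> x" unfolding y(2) using x y(1) sA by algebra
          finally show ?thesis by simp
        qed
        also have "cnorm A \<dots> \<le> cnorm A ((x \<ominus> y) \<otimes> s) + cnorm A (s \<otimes> (x \<ominus> y))"
          using x y(1) sA by (intro norm_triangle_diff) auto
        also have "\<dots> \<le> cnorm A (x \<ominus> y) * cnorm A s + cnorm A s * cnorm A (x \<ominus> y)"
          using x y(1) sA by (intro add_mono norm_mult) auto
        also have "\<dots> = cnorm A (x \<ominus> y) * (2 * cnorm A s)" by simp
        also have "\<dots> \<le> ?e * (2 * cnorm A s)"
          using y(3) norm_nonneg[OF sA] by (intro mult_right_mono) auto
        also have "\<dots> \<le> ?e * (2 * (cnorm A s + 1))" using pos \<open>e > 0\<close> by (intro mult_left_mono) auto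
        also have "\<dots> = e" using pos by simp
        finally show ?thesis by simp
      qed
      then have "cnorm A (x \<otimes> s \<ominus> s \<otimes> x) \<le> 0" by (rule field_le_epsilon)
      then have "cdist A (x \<otimes> s) (s \<otimes> x) = 0"
        using x sA norm_nonneg[of "x \<otimes> s \<ominus> s \<otimes> x"] by (simp add: cdist_def)
      then show ?thesis using x sA Metric_space.zero[OF metric, of "x \<otimes> s" "s \<otimes> x"] by simp
    qed
    then show "x \<in> ?C" using x by blast
  qed auto
  fix x assume "x \<in> ?C"
  then have x: "x \<in> carrier A" "\<And>s. s \<in> S \<Longrightarrow> x \<otimes> s = s \<otimes> x" by auto
  show "cstar A x \<in> ?C"
  proof (intro CollectI conjI ballI)
    fix s assume s: "s \<in> S"
    then have sA: "s \<in> carrier A" using S by auto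
    have "cstar A (x \<otimes> cstar A s) = cstar A (cstar A s \<otimes> x)" using x(2) star[OF s] by simp
    then show "cstar A x \<otimes> s = s \<otimes> cstar A x"
      using x(1) sA star_closed[OF sA] by (simp add: star_mult star_star)
  qed (simp add: x star_closed)
  show "cscale A s x \<in> ?C" for s
    using x S by (auto simp: scale_closed scale_mult_left scale_mult_right subset_iff)
  fix y assume "y \<in> ?C"
  then have y: "y \<in> carrier A" "\<And>s. s \<in> S \<Longrightarrow> y \<otimes> s = s \<otimes> y" by auto
  show "x \<oplus> y \<in> ?C" using x y S by (auto simp: l_distr r_distr subset_iff)
  show "x \<otimes> y \<in> ?C"
  proof (intro CollectI conjI ballI)
    fix s assume s: "s \<in> S"
    then have sA: "s \<in> carrier A" using S by auto
    have "x \<otimes> y \<otimes> s = x \<otimes> (s \<otimes> y)" using x(1) y sA s by (simp add: m_assoc)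
    also have "\<dots> = s \<otimes> (x \<otimes> y)" using x y(1) sA s by (simp flip: m_assoc)
    finally show "x \<otimes> y \<otimes> s = s \<otimes> (x \<otimes> y)" .
  qed (simp add: x y)
qed (use S in \<open>simp add: subset_iff\<close>)

text \<open>The square root of \<open>1 - a\<close> is \<open>1 - y\<close> where \<open>y\<close> is the fixed point of the contraction
  \<open>y \<mapsto> (a + y\<^sup>2) / 2\<close>.\<close>

lemma square_root_one_minus:
  assumes a: "a \<in> carrier A" "cstar A a = a" and r: "cnorm A a \<le> r" "r < 1"
  obtains b where "b \<in> carrier A" "cstar A b = b" "b \<otimes> b = \<one> \<ominus> a"
proof -
  define f where "f y = cscale A (1/2) (a \<oplus> y \<otimes> y)" for y
  define y where "y n = (f ^^ n) \<zero>" for n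
  have r0: "0 \<le> r" using norm_nonneg[OF a(1)] r by linarith
  have fc: "f x \<in> carrier A" if "x \<in> carrier A" for x using that a by (simp add: f_def scale_closed)
  \<comment> \<open>The iterates stay in the ball of radius r because (r + r^2) / 2 \<le> r for r
    \<le> 1.\<close>
  have y: "y n \<in> carrier A \<and> cstar A (y n) = y n \<and> cnorm A (y n) \<le> r" for n
  proof (induction n)
    case 0
    then show ?case using norm_eq_zero[of \<zero>] r0 by (simp add: y_def star_zero)
  next
    case (Suc n)
    then have n: "y n \<in> carrier A" "cstar A (y n) = y n" "cnorm A (y n) \<le> r" by auto
    have S: "y (Suc n) = f (y n)" by (simp add: y_def)
    have "cnorm A (f (y n)) = (1/2) * cnorm A (a \<oplus> y n \<otimes> y n)"
      using n a by (simp add: f_def norm_scale norm_divide)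
    also have "\<dots> \<le> (1/2) * (cnorm A a + cnorm A (y n) * cnorm A (y n))"
      using n a norm_triangle[of a "y n \<otimes> y n"] norm_mult[of "y n" "y n"] by simp
    also have "\<dots> \<le> (1/2) * (r + r * r)"
      using n r r0 norm_nonneg[OF n(1)] by (intro mult_left_mono add_mono mult_mono) auto
    also have "\<dots> \<le> r" using r r0 mult_left_mono[of r 1 r] by simp
    finally have "cnorm A (f (y n)) \<le> r" .
    moreover have "cstar A (f (y n)) = f (y n)"
      using n a by (simp add: f_def star_scale star_add star_mult)
    ultimately show ?case using S fc n by simp
  qed
  \<comment> \<open>Writing u u - v v as u (u - v) + (u - v) v does not need commutativity; on the
    ball of radius r it makes the iteration contract by the factor r.\<close>
  have diff: "cnorm A (f u \<ominus> f v) \<le> 1/2 * (cnorm A u * cnorm A (u \<ominus> v) + cnorm A (u \<ominus> v) * cnorm A v)"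
    if "u \<in> carrier A" "v \<in> carrier A" for u v
  proof -
    have "f u \<ominus> f v = cscale A (1/2) ((a \<oplus> u \<otimes> u) \<ominus> (a \<oplus> v \<otimes> v))"
      using that a by (simp add: f_def scale_minus_right)
    also have "(a \<oplus> u \<otimes> u) \<ominus> (a \<oplus> v \<otimes> v) = u \<otimes> (u \<ominus> v) \<oplus> (u \<ominus> v) \<otimes> v"
      using that a(1) by algebra
    finally have "cnorm A (f u \<ominus> f v) = 1/2 * cnorm A (u \<otimes> (u \<ominus> v) \<oplus> (u \<ominus> v) \<otimes> v)"
      using that by (simp add: norm_scale norm_divide)
    also have "\<dots> \<le> 1/2 * (cnorm A (u \<otimes> (u \<ominus> v)) + cnorm A ((u \<ominus> v) \<otimes> v))"
      using that by (intro mult_left_mono norm_triangle) auto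
    also have "\<dots> \<le> 1/2 * (cnorm A u * cnorm A (u \<ominus> v) + cnorm A (u \<ominus> v) * cnorm A v)"
      using that by (intro mult_left_mono add_mono norm_mult) auto
    finally show ?thesis .
  qed
  have step: "cnorm A (y (Suc n) \<ominus> y n) \<le> r ^ n" for n
  proof (induction n)
    case 0
    have "cnorm A (y 1 \<ominus> y 0) \<le> cnorm A (y 1) + 0"
      using norm_triangle_diff[of "y 1" "y 0"] y[of 1] y[of 0] norm_eq_zero[of \<zero>] by (simp add: y_def)
    then show ?case using y[of 1] r by simp
  next
    case (Suc n)
    have "cnorm A (y (Suc (Suc n)) \<ominus> y (Suc n)) = cnorm A (f (y (Suc n)) \<ominus> f (y n))" by (simp add: y_def)
    also have "\<dots> \<le> 1/2 * (cnorm A (y (Suc n)) * cnorm A (y (Suc n) \<ominus> y n) + cnorm A (y (Suc n) \<ominus> y n) * cnorm A (y n))"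
      using y by (intro diff) auto
    also have "\<dots> \<le> 1/2 * (r * r ^ n + r ^ n * r)"
      using y Suc norm_nonneg r0 by (intro mult_left_mono add_mono mult_mono) auto
    finally show ?case by simp
  qed
  have far: "cnorm A (y (n + k) \<ominus> y n) \<le> r ^ n / (1 - r)" for n k
  proof -
    have "cnorm A (y (n + k) \<ominus> y n) \<le> (\<Sum>i<k. r ^ (n + i))"
    proof (induction k)
      case 0
      then show ?case using y[of n] norm_eq_zero[of \<zero>] by (simp add: a_minus_def r_neg)
    next
      case (Suc k)
      have "y (n + Suc k) \<ominus> y n = (y (Suc (n + k)) \<ominus> y (n + k)) \<oplus> (y (n + k) \<ominus> y n)"
        using y[THEN conjunct1, of n] y[THEN conjunct1, of "n + k"] y[THEN conjunct1, of "Suc (n + k)"]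
        unfolding add_Suc_right by algebra
      then have "cnorm A (y (n + Suc k) \<ominus> y n) \<le> cnorm A (y (Suc (n + k)) \<ominus> y (n + k)) + cnorm A (y (n + k) \<ominus> y n)"
        using y by (simp add: norm_triangle)
      then show ?case using Suc step[of "n + k"] by simp
    qed
    also have "\<dots> = r ^ n * (\<Sum>i<k. r ^ i)" by (simp add: power_add sum_distrib_left)
    also have "\<dots> \<le> r ^ n * (1 / (1 - r))"
      using r r0 by (intro mult_left_mono) (auto simp: sum_gp_strict divide_right_mono)
    finally show ?thesis by simp
  qed
  have lim0: "(\<lambda>n. r ^ n / (1 - r)) \<longlonglongrightarrow> 0"
    using r r0 by (intro tendsto_divide_zero LIMSEQ_power_zero) auto
  obtain l where l: "l \<in> carrier A" "\<And>\<epsilon>. \<epsilon> > 0 \<Longrightarrow> \<exists>N. \<forall>n\<ge>N. cnorm A (y n \<ominus> l) < \<epsilon>"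
  proof (rule complete_seq[of y])
    fix \<epsilon> :: real assume "\<epsilon> > 0"
    then obtain N where N: "r ^ N / (1 - r) < \<epsilon> / 2"
      using LIMSEQ_D[OF lim0, of "\<epsilon>/2"] r r0 by auto
    have near: "cnorm A (y m \<ominus> y N) < \<epsilon> / 2" if "m \<ge> N" for m
      using le_less_trans[OF far[of N "m - N"] N] that by simp
    have "cnorm A (y m \<ominus> y n) < \<epsilon>" if "m \<ge> N" "n \<ge> N" for m n
    proof -
      have "y m \<ominus> y n = (y m \<ominus> y N) \<ominus> (y n \<ominus> y N)" using y[THEN conjunct1, of m] y[THEN conjunct1, of n] y[THEN conjunct1, of N] by algebra
      then have "cnorm A (y m \<ominus> y n) \<le> cnorm A (y m \<ominus> y N) + cnorm A (y n \<ominus> y N)"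
        using y by (simp add: norm_triangle_diff)
      then show ?thesis using near[OF that(1)] near[OF that(2)] by simp
    qed
    then show "\<exists>N. \<forall>m\<ge>N. \<forall>n\<ge>N. cnorm A (y m \<ominus> y n) < \<epsilon>" by blast
  qed (use y in auto)
  have eqI: "u = v" if uv: "u \<in> carrier A" "v \<in> carrier A" and e: "\<And>\<epsilon>. \<epsilon> > 0 \<Longrightarrow> cnorm A (u \<ominus> v) \<le> \<epsilon>" for u v
  proof -
    have "cnorm A (u \<ominus> v) \<le> 0" by (rule field_le_epsilon) (use e in auto)
    then have "cdist A u v = 0" using uv norm_nonneg[of "u \<ominus> v"] by (simp add: cdist_def)
    then show ?thesis using Metric_space.zero[OF metric uv] by simp
  qed
  have starl: "cstar A l = l"
  proof (rule eqI)
    fix \<epsilon> :: real assume "\<epsilon> > 0"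
    then obtain n where n: "cnorm A (y n \<ominus> l) < \<epsilon>/2" using l(2)[of "\<epsilon>/2"] by auto
    have "cnorm A (cstar A (y n \<ominus> l)) < \<epsilon>/2" using n y[of n] l(1) by (simp add: norm_star)
    then have 2: "cnorm A (y n \<ominus> cstar A l) < \<epsilon>/2" using y[of n] l(1) by (simp add: star_minus)
    have "cstar A l \<ominus> l = (y n \<ominus> l) \<ominus> (y n \<ominus> cstar A l)"
      using y[of n] l(1) star_closed[OF l(1)] by algebra
    also have "cnorm A \<dots> \<le> cnorm A (y n \<ominus> l) + cnorm A (y n \<ominus> cstar A l)"
      using y[of n] l(1) star_closed[OF l(1)] by (intro norm_triangle_diff) auto
    finally show "cnorm A (cstar A l \<ominus> l) \<le> \<epsilon>" using n 2 by simp
  qed (use l star_closed in auto)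
  have fl: "f l = l"
  proof (rule eqI)
    fix \<epsilon> :: real assume e: "\<epsilon> > 0"
    let ?K = "cnorm A l + 1"
    have K: "?K > 0" using norm_nonneg[OF l(1)] by linarith
    obtain N1 where N1: "\<forall>n\<ge>N1. cnorm A (y n \<ominus> l) < \<epsilon>/2 / ?K" using l(2)[of "\<epsilon>/2 / ?K"] e K by auto
    obtain N2 where N2: "\<forall>n\<ge>N2. cnorm A (y n \<ominus> l) < \<epsilon>/2" using l(2)[of "\<epsilon>/2"] e by auto
    define n where "n = max N1 N2"
    have n: "cnorm A (y n \<ominus> l) < \<epsilon>/2 / ?K" "cnorm A (y (Suc n) \<ominus> l) < \<epsilon>/2"
      using N1 N2 by (auto simp: n_def)
    have yn: "y n \<in> carrier A" "y (Suc n) \<in> carrier A" "y (Suc n) = f (y n)" "cnorm A (y n) \<le> 1"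
      using y[of n] y[of "Suc n"] r by (auto simp: y_def)
    have "cnorm A (f (y n) \<ominus> f l) \<le> 1/2 * (cnorm A (y n) * cnorm A (y n \<ominus> l) + cnorm A (y n \<ominus> l) * cnorm A l)"
      using yn l by (intro diff) auto
    also have "\<dots> = 1/2 * (cnorm A (y n) + cnorm A l) * cnorm A (y n \<ominus> l)" by (simp add: algebra_simps)
    also have "\<dots> \<le> ?K * (\<epsilon>/2 / ?K)"
      using yn n(1) norm_nonneg[OF l(1)] norm_nonneg[OF yn(1)] norm_nonneg[of "y n \<ominus> l"] l(1)
      by (intro mult_mono) auto
    also have "\<dots> = \<epsilon>/2" using K by (metis nonzero_mult_div_cancel_left times_divide_eq_right less_irrefl)
    finally have 1: "cnorm A (f (y n) \<ominus> f l) \<le> \<epsilon>/2" .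
    have "f l \<ominus> l = (y (Suc n) \<ominus> l) \<ominus> (f (y n) \<ominus> f l)"
      using yn fc[OF l(1)] l(1) by (simp, algebra)
    also have "cnorm A \<dots> \<le> cnorm A (y (Suc n) \<ominus> l) + cnorm A (f (y n) \<ominus> f l)"
      using yn fc l(1) by (intro norm_triangle_diff) auto
    finally show "cnorm A (f l \<ominus> l) \<le> \<epsilon>" using n 1 by simp
  qed (use l fc in auto)
  \<comment> \<open>The fixed point equation reads 2 l = a + l l, that is, 1 - l squares to 1 -
    a.\<close>
  have "l \<oplus> l = f l \<oplus> f l" by (simp add: fl)
  also have "\<dots> = cscale A (1/2 + 1/2) (a \<oplus> l \<otimes> l)"
    unfolding f_def using a(1) l(1) by (subst scale_add_left) auto
  also have "\<dots> = a \<oplus> l \<otimes> l" using a(1) l(1) scale_one[of "a \<oplus> l \<otimes> l"] by simp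
  finally have ll: "l \<oplus> l = a \<oplus> l \<otimes> l" .
  show ?thesis
  proof (rule that)
    show "\<one> \<ominus> l \<in> carrier A" using l by simp
    show "cstar A (\<one> \<ominus> l) = \<one> \<ominus> l" using l by (simp add: star_minus star_one starl)
    have "(\<one> \<ominus> l) \<otimes> (\<one> \<ominus> l) = \<one> \<ominus> (l \<oplus> l \<otimes> \<one>) \<oplus> l \<otimes> l" using l(1) by algebra
    also have "\<dots> = \<one> \<ominus> (l \<oplus> l) \<oplus> l \<otimes> l" using l(1) by simp
    also have "\<dots> = \<one> \<ominus> a" unfolding ll using l(1) a(1) by algebra
    finally show "(\<one> \<ominus> l) \<otimes> (\<one> \<ominus> l) = \<one> \<ominus> a" .
  qed
qed

section \<open>Real and imaginary parts\<close>

lemma re_part_sa: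
  assumes "x \<in> carrier A"
  shows "re_part A x \<in> sa A" "cnorm A (re_part A x) \<le> cnorm A x"
proof -
  note c = assms star_closed[OF assms]
  have "cstar A (re_part A x) = re_part A x"
    using c by (simp add: re_part_def star_scale star_add star_star a_comm)
  then show "re_part A x \<in> sa A" using c by (simp add: sa_def re_part_def scale_closed)
  show "cnorm A (re_part A x) \<le> cnorm A x"
    using norm_triangle[of x "cstar A x"] c by (simp add: re_part_def norm_scale norm_divide norm_star)
qed

lemma im_part_sa:
  assumes "x \<in> carrier A"
  shows "im_part A x \<in> sa A" "cnorm A (im_part A x) \<le> cnorm A x"
proof -
  note c = assms star_closed[OF assms]
  have "cstar A (im_part A x) = cscale A (- 1 / (2 * \<i>)) (cstar A x \<ominus> x)"
    using c by (simp add: im_part_def star_scale star_minus star_star divide_minus1)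
  also have "cstar A x \<ominus> x = cscale A (-1) (x \<ominus> cstar A x)"
    using c by (simp flip: a_inv_scale) algebra
  finally have "cstar A (im_part A x) = im_part A x"
    using c by (simp add: im_part_def scale_scale)
  then show "im_part A x \<in> sa A" using c by (simp add: sa_def im_part_def scale_closed)
  show "cnorm A (im_part A x) \<le> cnorm A x"
    using norm_triangle_diff[of x "cstar A x"] c by (simp add: im_part_def norm_scale norm_divide Real_Vector_Spaces.norm_mult norm_star)
qed

lemma re_im_decomposition:
  assumes "x \<in> carrier A"
  shows "x = re_part A x \<oplus> cscale A \<i> (im_part A x)"
proof -
  note c = assms star_closed[OF assms]
  have "re_part A x \<oplus> cscale A \<i> (im_part A x) = cscale A (1/2) (x \<oplus> cstar A x) \<oplus> cscale A (1/2) (x \<ominus> cstar A x)"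
    using c by (simp add: re_part_def im_part_def scale_scale)
  also have "\<dots> = cscale A (1/2) (x \<oplus> x)"
    using c by (subst scale_add_right[symmetric]) (simp_all, rule arg_cong[of _ _ "cscale A (1/2)"], algebra)
  also have "\<dots> = cscale A (1/2 + 1/2) x" using c by (subst scale_add_left) (simp_all add: scale_add_right)
  finally show ?thesis using c by (simp add: scale_one)
qed

subsection \<open>States\<close>

context
  fixes \<phi> assumes \<phi>: "\<phi> \<in> states A"
begin

lemma state_add: "x \<in> carrier A \<Longrightarrow> y \<in> carrier A \<Longrightarrow> \<phi> (x \<oplus> y) = \<phi> x + \<phi> y"
  and state_scale: "x \<in> carrier A \<Longrightarrow> \<phi> (cscale A s x) = s * \<phi> x"
  and state_one: "\<phi> \<one> = 1"
  and state_positive: "x \<in> carrier A \<Longrightarrow> \<phi> (cstar A x \<otimes> x) \<in> \<real>\<^sub>\<ge>\<^sub>0"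
  using \<phi> by (auto simp: states_def)

lemma state_minus: "x \<in> carrier A \<Longrightarrow> y \<in> carrier A \<Longrightarrow> \<phi> (x \<ominus> y) = \<phi> x - \<phi> y"
  by (simp add: a_minus_def state_add a_inv_scale scale_closed state_scale)

text \<open>Both 1 - a and 1 + a are squares of self-adjoint elements, so a state is nonnegative on
  them; this forces \<phi> a to be real and to lie between -1 and 1.\<close>

lemma state_sa_strict:
  assumes "a \<in> sa A" "cnorm A a < 1"
  shows "cmod (\<phi> a) \<le> 1"
proof -
  have *: "1 - \<phi> b \<in> \<real>\<^sub>\<ge>\<^sub>0" if b: "b \<in> carrier A" "cstar A b = b" "cnorm A b < 1" for b
  proof -
    obtain c where c: "c \<in> carrier A" "cstar A c = c" "c \<otimes> c = \<one> \<ominus> b"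
      using square_root_one_minus[of b "cnorm A b"] b by auto
    then show ?thesis using state_positive[of c] b by (simp add: state_minus state_one)
  qed
  have a: "a \<in> carrier A" "cstar A a = a" using assms by (auto simp: sa_def)
  have "1 - \<phi> a \<in> \<real>\<^sub>\<ge>\<^sub>0" using * a assms by blast
  moreover have "1 - \<phi> (cscale A (-1) a) \<in> \<real>\<^sub>\<ge>\<^sub>0"
    by (rule *) (use a assms in \<open>auto simp: scale_closed star_scale norm_scale\<close>)
  ultimately have "Im (\<phi> a) = 0" "Re (\<phi> a) \<le> 1" "- 1 \<le> Re (\<phi> a)"
    using a by (auto simp: complex_nonneg_Reals_iff state_scale)
  then show ?thesis by (simp add: cmod_def)
qed

lemma state_sa_bound:
  assumes a: "a \<in> sa A"
  shows "cmod (\<phi> a) \<le> cnorm A a"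
proof (rule field_le_epsilon)
  fix e :: real assume "e > 0"
  have aA: "a \<in> carrier A" "cstar A a = a" using a by (auto simp: sa_def)
  \<comment> \<open>The margin e makes the rescaled element a strict contraction, as the square root
    requires.\<close>
  let ?t = "cnorm A a + e"
  have t: "?t > 0" using norm_nonneg[OF aA(1)] \<open>e > 0\<close> by linarith
  have "cmod (\<phi> (cscale A (complex_of_real (1/?t)) a)) \<le> 1"
    by (rule state_sa_strict)
       (use aA t \<open>e > 0\<close> in \<open>auto simp: sa_def scale_closed star_scale norm_scale norm_divide simp flip: of_real_add\<close>)
  moreover have "cmod (complex_of_real (1/?t)) = 1/?t" using t by (simp only: norm_of_real) (simp only: abs_of_pos divide_pos_pos zero_less_one)
  ultimately show "cmod (\<phi> a) \<le> ?t"
    using t by (simp only: state_scale[OF aA(1)] Real_Vector_Spaces.norm_mult) (simp add: field_simps)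
qed

text \<open>The factor 2 comes from splitting x into real and imaginary part; this takes the place
  of the Cauchy-Schwarz inequality for states.\<close>

lemma state_bound:
  assumes x: "x \<in> carrier A"
  shows "cmod (\<phi> x) \<le> 2 * cnorm A x"
proof -
  note re = re_part_sa[OF x] and im = im_part_sa[OF x]
  have c: "re_part A x \<in> carrier A" "im_part A x \<in> carrier A" using re im by (auto simp: sa_def)
  have "\<phi> x = \<phi> (re_part A x) + \<i> * \<phi> (im_part A x)"
    using c by (subst re_im_decomposition[OF x]) (simp add: state_add scale_closed state_scale)
  also have "cmod \<dots> \<le> cmod (\<phi> (re_part A x)) + cmod (\<i> * \<phi> (im_part A x))" by (rule norm_triangle_ineq)
  also have "\<dots> \<le> cnorm A x + cnorm A x"
    using state_sa_bound[OF re(1)] state_sa_bound[OF im(1)] re(2) im(2) by (simp add: Real_Vector_Spaces.norm_mult)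
  finally show ?thesis by simp
qed

lemma state_diff_bound:
  assumes "x \<in> carrier A" "y \<in> carrier A"
  shows "cmod (\<phi> x - \<phi> y) \<le> 2 * cnorm A (x \<ominus> y)"
  using state_bound[of "x \<ominus> y"] assms by (simp add: state_minus)

end

end

section \<open>A criterion for quantum compact metric spaces\<close>

text \<open>The approximation hypothesis replaces total boundedness of the Lipschitz ball modulo scalars:
  it makes the metric \<open>mk\<close> continuous for the weak* topology.\<close>

theorem (in unital_cstar_algebra) quantum_compact_metric_spaceI:
  fixes L :: "'a \<Rightarrow> ennreal"
  assumes add: "\<And>a b. a \<in> lip_dom A L \<Longrightarrow> b \<in> lip_dom A L \<Longrightarrow> a \<oplus> b \<in> lip_dom A L \<and> L (a \<oplus> b) \<le> L a + L b"
    and scale: "\<And>a t. a \<in> lip_dom A L \<Longrightarrow>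
        cscale A (complex_of_real t) a \<in> lip_dom A L \<and> L (cscale A (complex_of_real t) a) = ennreal \<bar>t\<bar> * L a"
    and dense: "\<And>a \<epsilon>. a \<in> sa A \<Longrightarrow> \<epsilon> > 0 \<Longrightarrow> \<exists>b\<in>lip_dom A L. cnorm A (a \<ominus> b) < \<epsilon>"
    and kernel: "\<And>a. a \<in> lip_dom A L \<Longrightarrow> L a = 0 \<longleftrightarrow> (\<exists>t::real. a = cscale A (complex_of_real t) \<one>)"
    and jordan: "\<And>a b. a \<in> lip_dom A L \<Longrightarrow> b \<in> lip_dom A L \<Longrightarrow>
        cscale A (1 / 2) (a \<otimes> b \<oplus> b \<otimes> a) \<in> lip_dom A L \<and>
        L (cscale A (1 / 2) (a \<otimes> b \<oplus> b \<otimes> a)) \<le> ennreal (cnorm A a) * L b + L a * ennreal (cnorm A b)"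
    and lie: "\<And>a b. a \<in> lip_dom A L \<Longrightarrow> b \<in> lip_dom A L \<Longrightarrow>
        cscale A (1 / (2 * \<i>)) (a \<otimes> b \<ominus> b \<otimes> a) \<in> lip_dom A L \<and>
        L (cscale A (1 / (2 * \<i>)) (a \<otimes> b \<ominus> b \<otimes> a)) \<le> ennreal (cnorm A a) * L b + L a * ennreal (cnorm A b)"
    and closed: "\<And>a. a \<in> carrier A \<Longrightarrow> (\<And>\<epsilon>. \<epsilon> > 0 \<Longrightarrow> \<exists>b\<in>lip_dom A L. L b \<le> 1 \<and> cnorm A (a \<ominus> b) < \<epsilon>) \<Longrightarrow>
        a \<in> lip_dom A L \<and> L a \<le> 1"
    and approx: "\<And>\<epsilon>. \<epsilon> > 0 \<Longrightarrow> \<exists>F C. finite F \<and> F \<subseteq> carrier A \<and> 0 \<le> C \<and>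
        (\<forall>a\<in>lip_dom A L. L a \<le> 1 \<longrightarrow> (\<forall>\<phi>\<in>states A. \<forall>\<psi>\<in>states A.
           cmod (\<phi> a - \<psi> a) \<le> \<epsilon> + C * (\<Sum>x\<in>F. cmod (\<phi> x - \<psi> x))))"
  shows "quantum_compact_metric_space A L"
proof -
  let ?d = "\<lambda>\<phi> \<psi>. enn2real (mk A L \<phi> \<psi>)"
  have domA: "a \<in> carrier A" if "a \<in> lip_dom A L" for a using that by (auto simp: lip_dom_def sa_def)
  have mk_leI: "mk A L \<phi> \<psi> \<le> ennreal B"
    if "\<And>a. a \<in> lip_dom A L \<Longrightarrow> L a \<le> 1 \<Longrightarrow> cmod (\<phi> a - \<psi> a) \<le> B" for \<phi> \<psi> B
    unfolding mk_def by (rule SUP_least) (use that in \<open>auto intro: ennreal_leI\<close>)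
  \<comment> \<open>With \<epsilon> = 1 the approximation hypothesis bounds the difference of two
    given states on the whole Lipschitz ball by one finite number.\<close>
  have finite: "mk A L \<phi> \<psi> < \<infinity>" if st: "\<phi> \<in> states A" "\<psi> \<in> states A" for \<phi> \<psi>
  proof -
    obtain F C where "\<forall>a\<in>lip_dom A L. L a \<le> 1 \<longrightarrow> (\<forall>\<phi>\<in>states A. \<forall>\<psi>\<in>states A.
           cmod (\<phi> a - \<psi> a) \<le> 1 + C * (\<Sum>x\<in>F. cmod (\<phi> x - \<psi> x)))"
      using approx[of 1] by auto
    then have "mk A L \<phi> \<psi> \<le> ennreal (1 + C * (\<Sum>x\<in>F. cmod (\<phi> x - \<psi> x)))"
      using st by (intro mk_leI) auto
    then show ?thesis by (simp add: le_less_trans)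
  qed
  have d_ball: "cmod (\<phi> a - \<psi> a) \<le> ?d \<phi> \<psi>"
    if "\<phi> \<in> states A" "\<psi> \<in> states A" "a \<in> lip_dom A L" "L a \<le> 1" for \<phi> \<psi> a
  proof -
    have "ennreal (cmod (\<phi> a - \<psi> a)) \<le> mk A L \<phi> \<psi>"
      unfolding mk_def by (rule SUP_upper) (use that in auto)
    then have "enn2real (ennreal (cmod (\<phi> a - \<psi> a))) \<le> ?d \<phi> \<psi>"
      by (rule enn2real_mono) (use finite[OF that(1,2)] in simp)
    then show ?thesis by simp
  qed
  have d_leI: "?d \<phi> \<psi> \<le> B"
    if "\<And>a. a \<in> lip_dom A L \<Longrightarrow> L a \<le> 1 \<Longrightarrow> cmod (\<phi> a - \<psi> a) \<le> B" "0 \<le> B" for \<phi> \<psi> B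
    using enn2real_mono[OF mk_leI[OF that(1)]] that(2) by auto
  \<comment> \<open>Scaling a into the Lipschitz ball by 1 / (l + 1), where l is the value of L at
    a, also works when L a = 0.\<close>
  have d_dom: "\<exists>K>0. \<forall>\<phi>\<in>states A. \<forall>\<psi>\<in>states A. cmod (\<phi> a - \<psi> a) \<le> K * ?d \<phi> \<psi>" if a: "a \<in> lip_dom A L" for a
  proof -
    define l where "l = enn2real (L a)"
    have "L a < \<infinity>" using a by (simp add: lip_dom_def)
    then have La: "L a = ennreal l" by (simp add: l_def)
    have l0: "0 \<le> l" by (simp add: l_def)
    let ?t = "1 / (l + 1)"
    let ?b = "cscale A (complex_of_real ?t) a"
    have "L ?b = ennreal (\<bar>?t\<bar> * l)"
      using scale[OF a, of ?t] l0 unfolding La by (simp only: ennreal_mult abs_ge_zero)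
    also have "\<dots> \<le> ennreal 1" using l0 by (intro ennreal_leI) (simp add: field_simps)
    finally have "L ?b \<le> 1" by simp
    then have *: "cmod (\<phi> ?b - \<psi> ?b) \<le> ?d \<phi> \<psi>" if "\<phi> \<in> states A" "\<psi> \<in> states A" for \<phi> \<psi>
      using that scale[OF a, of ?t] by (intro d_ball) auto
    have "cmod (\<phi> a - \<psi> a) \<le> (l + 1) * ?d \<phi> \<psi>" if st: "\<phi> \<in> states A" "\<psi> \<in> states A" for \<phi> \<psi>
    proof -
      have "cmod (\<phi> ?b - \<psi> ?b) = ?t * cmod (\<phi> a - \<psi> a)"
        using l0 unfolding state_scale[OF st(1) domA[OF a]] state_scale[OF st(2) domA[OF a]]
        by (simp only: Real_Vector_Spaces.norm_mult norm_of_real abs_of_nonneg divide_nonneg_nonneg add_nonneg_nonneg zero_le_one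
             flip: right_diff_distrib)
      then have "?t * cmod (\<phi> a - \<psi> a) \<le> ?d \<phi> \<psi>" using *[OF st] by simp
      then have "(l + 1) * (?t * cmod (\<phi> a - \<psi> a)) \<le> (l + 1) * ?d \<phi> \<psi>" using l0 by (intro mult_left_mono) auto
      then show ?thesis using l0 by simp
    qed
    then show ?thesis using l0 by (intro exI[of _ "l + 1"]) auto
  qed
  \<comment> \<open>Elements outside the Lipschitz domain are reached by density: with b within
    \<delta> / 8 of a, each of the two states errs by at most \<delta> / 4, which leaves room for
    the metric term at b.\<close>
  have cont_sa: "\<exists>r>0. \<forall>\<phi>\<in>states A. \<forall>\<psi>\<in>states A. ?d \<phi> \<psi> < r \<longrightarrow> cmod (\<phi> a - \<psi> a) < \<delta>"
    if a: "a \<in> sa A" and \<delta>: "\<delta> > 0" for a and \<delta> :: real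
  proof -
    have aA: "a \<in> carrier A" using a by (simp add: sa_def)
    obtain b where b: "b \<in> lip_dom A L" "cnorm A (a \<ominus> b) < \<delta> / 8" using dense[OF a, of "\<delta>/8"] \<delta> by auto
    obtain K where K: "K > 0" "\<forall>\<phi>\<in>states A. \<forall>\<psi>\<in>states A. cmod (\<phi> b - \<psi> b) \<le> K * ?d \<phi> \<psi>"
      using d_dom[OF b(1)] by blast
    have "cmod (\<phi> a - \<psi> a) < \<delta>"
      if st: "\<phi> \<in> states A" "\<psi> \<in> states A" and d: "?d \<phi> \<psi> < \<delta> / (4 * K)" for \<phi> \<psi>
    proof -
      have "cmod (\<phi> a - \<psi> a) \<le> cmod (\<phi> a - \<phi> b) + cmod (\<phi> b - \<psi> b) + cmod (\<psi> a - \<psi> b)"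
        using norm_triangle_ineq[of "(\<phi> a - \<phi> b) + (\<phi> b - \<psi> b)" "\<psi> b - \<psi> a"]
          norm_triangle_ineq[of "\<phi> a - \<phi> b" "\<phi> b - \<psi> b"]
          Real_Vector_Spaces.norm_minus_commute[of "\<psi> b" "\<psi> a"] by simp
      moreover have "cmod (\<phi> a - \<phi> b) \<le> \<delta>/4" "cmod (\<psi> a - \<psi> b) \<le> \<delta>/4"
        using state_diff_bound[OF st(1) aA domA[OF b(1)]] state_diff_bound[OF st(2) aA domA[OF b(1)]] b(2) by auto
      moreover have "cmod (\<phi> b - \<psi> b) \<le> K * ?d \<phi> \<psi>" using K st by blast
      moreover have "K * ?d \<phi> \<psi> < \<delta>/4" using d K(1) by (simp add: field_simps)
      ultimately show ?thesis using \<delta> by linarith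
    qed
    then show ?thesis using K(1) \<delta> by (intro exI[of _ "\<delta> / (4 * K)"]) auto
  qed
  have cont: "\<exists>r>0. \<forall>\<phi>\<in>states A. \<forall>\<psi>\<in>states A. ?d \<phi> \<psi> < r \<longrightarrow> cmod (\<phi> x - \<psi> x) < \<delta>"
    if x: "x \<in> carrier A" and \<delta>: "\<delta> > 0" for x and \<delta> :: real
  proof -
    note re = re_part_sa(1)[OF x] and im = im_part_sa(1)[OF x]
    have c: "re_part A x \<in> carrier A" "im_part A x \<in> carrier A" using re im by (auto simp: sa_def)
    obtain r1 where r1: "r1 > 0" "\<forall>\<phi>\<in>states A. \<forall>\<psi>\<in>states A. ?d \<phi> \<psi> < r1 \<longrightarrow> cmod (\<phi> (re_part A x) - \<psi> (re_part A x)) < \<delta>/2"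
      using cont_sa[OF re, of "\<delta>/2"] \<delta> by auto
    obtain r2 where r2: "r2 > 0" "\<forall>\<phi>\<in>states A. \<forall>\<psi>\<in>states A. ?d \<phi> \<psi> < r2 \<longrightarrow> cmod (\<phi> (im_part A x) - \<psi> (im_part A x)) < \<delta>/2"
      using cont_sa[OF im, of "\<delta>/2"] \<delta> by auto
    have split: "\<phi> x = \<phi> (re_part A x) + \<i> * \<phi> (im_part A x)" if "\<phi> \<in> states A" for \<phi>
      using c by (subst re_im_decomposition[OF x]) (simp add: state_add[OF that] scale_closed state_scale[OF that])
    have "cmod (\<phi> x - \<psi> x) < \<delta>" if st: "\<phi> \<in> states A" "\<psi> \<in> states A" and d: "?d \<phi> \<psi> < min r1 r2" for \<phi> \<psi>
    proof -
      have "\<phi> x - \<psi> x = (\<phi> (re_part A x) - \<psi> (re_part A x)) + \<i> * (\<phi> (im_part A x) - \<psi> (im_part A x))"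
        using split[OF st(1)] split[OF st(2)] by (simp add: algebra_simps)
      then have "cmod (\<phi> x - \<psi> x) \<le> cmod (\<phi> (re_part A x) - \<psi> (re_part A x)) + cmod (\<phi> (im_part A x) - \<psi> (im_part A x))"
        by (metis norm_triangle_ineq Real_Vector_Spaces.norm_mult norm_ii mult_1)
      moreover have "cmod (\<phi> (re_part A x) - \<psi> (re_part A x)) < \<delta>/2" "cmod (\<phi> (im_part A x) - \<psi> (im_part A x)) < \<delta>/2"
        using r1(2) r2(2) st d by auto
      ultimately show ?thesis by linarith
    qed
    then show ?thesis using r1(1) r2(1) by (intro exI[of _ "min r1 r2"]) auto
  qed
  have commute: "mk A L \<phi> \<psi> = mk A L \<psi> \<phi>" for \<phi> \<psi> by (simp add: mk_def Real_Vector_Spaces.norm_minus_commute)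
  interpret M: Metric_space "states A" ?d
  proof
    show "0 \<le> ?d \<phi> \<psi>" "?d \<phi> \<psi> = ?d \<psi> \<phi>" for \<phi> \<psi> by (simp_all add: commute)
    show "?d \<phi> \<psi> = 0 \<longleftrightarrow> \<phi> = \<psi>" if st: "\<phi> \<in> states A" "\<psi> \<in> states A" for \<phi> \<psi>
    proof
      assume 0: "?d \<phi> \<psi> = 0"
      have "\<phi> x = \<psi> x" if x: "x \<in> carrier A" for x
      proof (rule ccontr)
        assume "\<phi> x \<noteq> \<psi> x"
        then obtain r where "r > 0" "\<forall>\<phi>'\<in>states A. \<forall>\<psi>'\<in>states A. ?d \<phi>' \<psi>' < r \<longrightarrow>
            cmod (\<phi>' x - \<psi>' x) < cmod (\<phi> x - \<psi> x)"
          using cont[OF x, of "cmod (\<phi> x - \<psi> x)"] by auto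
        then have "cmod (\<phi> x - \<psi> x) < cmod (\<phi> x - \<psi> x)" using st 0 by metis
        then show False by simp
      qed
      then show "\<phi> = \<psi>" using st by (intro extensionalityI[of _ "carrier A"]) (auto simp: states_def)
    next
      assume "\<phi> = \<psi>"
      then have "?d \<phi> \<psi> \<le> 0" by (intro d_leI) auto
      then show "?d \<phi> \<psi> = 0" using enn2real_nonneg[of "mk A L \<phi> \<psi>"] by linarith
    qed
    show "?d \<phi> \<theta> \<le> ?d \<phi> \<psi> + ?d \<psi> \<theta>" if st: "\<phi> \<in> states A" "\<psi> \<in> states A" "\<theta> \<in> states A" for \<phi> \<psi> \<theta>
    proof (rule d_leI)
      fix a assume a: "a \<in> lip_dom A L" "L a \<le> 1"
      have "cmod (\<phi> a - \<theta> a) \<le> cmod (\<phi> a - \<psi> a) + cmod (\<psi> a - \<theta> a)"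
        using norm_triangle_ineq[of "\<phi> a - \<psi> a" "\<psi> a - \<theta> a"] by simp
      then show "cmod (\<phi> a - \<theta> a) \<le> ?d \<phi> \<psi> + ?d \<psi> \<theta>"
        using d_ball[OF st(1,2) a] d_ball[OF st(2,3) a] by linarith
    qed simp
  qed
  have tsW: "topspace (weak_star A) = states A"
    by (auto simp: weak_star_def states_def PiE_iff extensional_def)
  \<comment> \<open>Two continuous identity maps in opposite directions identify the topologies.
    This one, from the metric to the weak* topology, rests on density of the Lipschitz
    domain.\<close>
  have toW: "continuous_map M.mtopology (weak_star A) id"
    unfolding weak_star_def continuous_map_in_subtopology continuous_map_componentwise
  proof (intro conjI ballI)
    show "id ` topspace M.mtopology \<subseteq> extensional (carrier A)"
      unfolding M.topspace_mtopology by (auto simp: states_def)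
    fix x assume x: "x \<in> carrier A"
    show "continuous_map M.mtopology euclidean (\<lambda>\<phi>. id \<phi> x)"
      unfolding continuous_map_def
    proof (intro conjI allI impI)
      fix U :: "complex set" assume "openin euclidean U"
      then have U: "open U" by simp
      show "openin M.mtopology {\<phi> \<in> topspace M.mtopology. id \<phi> x \<in> U}"
        unfolding M.openin_mtopology
      proof (intro conjI allI impI)
        fix \<phi> assume "\<phi> \<in> {\<phi> \<in> topspace M.mtopology. id \<phi> x \<in> U}"
        then have \<phi>: "\<phi> \<in> states A" "\<phi> x \<in> U" by auto
        then obtain \<delta> where \<delta>: "\<delta> > 0" "ball (\<phi> x) \<delta> \<subseteq> U" using U open_contains_ball by blast
        obtain r where r: "r > 0" "\<forall>\<phi>\<in>states A. \<forall>\<psi>\<in>states A. ?d \<phi> \<psi> < r \<longrightarrow> cmod (\<phi> x - \<psi> x) < \<delta>"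
          using cont[OF x \<delta>(1)] by blast
        have "M.mball \<phi> r \<subseteq> {\<phi> \<in> topspace M.mtopology. id \<phi> x \<in> U}"
        proof
          fix \<psi> assume "\<psi> \<in> M.mball \<phi> r"
          then have "\<psi> \<in> states A" "cmod (\<phi> x - \<psi> x) < \<delta>" using r(2) \<phi>(1) by (auto simp: M.in_mball)
          then show "\<psi> \<in> {\<phi> \<in> topspace M.mtopology. id \<phi> x \<in> U}" using \<delta>(2) by (auto simp: dist_norm)
        qed
        then show "\<exists>r>0. M.mball \<phi> r \<subseteq> {\<phi> \<in> topspace M.mtopology. id \<phi> x \<in> U}" using r(1) by blast
      qed auto
    qed auto
  qed auto
  \<comment> \<open>Controlling the finitely many values at F to within \<epsilon> / (2 (C + 1))
    controls the whole Lipschitz ball at once; C + 1 in place of C keeps the quotient defined for C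
    = 0.\<close>
  have toM: "continuous_map (weak_star A) M.mtopology id"
    unfolding M.continuous_map_to_metric
  proof (intro ballI allI impI)
    fix \<phi> and \<epsilon> :: real assume "\<phi> \<in> topspace (weak_star A)" and \<epsilon>: "\<epsilon> > 0"
    then have \<phi>: "\<phi> \<in> states A" by (simp add: tsW)
    obtain F C where F: "finite F" "F \<subseteq> carrier A" "0 \<le> C"
      and FC: "\<forall>a\<in>lip_dom A L. L a \<le> 1 \<longrightarrow> (\<forall>\<phi>\<in>states A. \<forall>\<psi>\<in>states A.
           cmod (\<phi> a - \<psi> a) \<le> \<epsilon>/2 + C * (\<Sum>x\<in>F. cmod (\<phi> x - \<psi> x)))"
      using approx[of "\<epsilon>/2"] \<epsilon> by auto
    let ?g = "\<lambda>\<psi>. \<Sum>x\<in>F. cmod (\<phi> x - \<psi> x)"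
    let ?U = "{\<psi> \<in> topspace (weak_star A). ?g \<psi> \<in> {..<\<epsilon> / (2 * (C + 1))}}"
    have proj: "continuous_map (weak_star A) euclidean (\<lambda>\<psi>. \<psi> x)" if "x \<in> F" for x
      unfolding weak_star_def
      using F(2) that by (intro continuous_map_from_subtopology continuous_map_product_projection) auto
    have "continuous_map (weak_star A) euclidean ?g"
      using F(1) by (intro continuous_intros proj) auto
    then have "openin (weak_star A) ?U"
      by (rule openin_continuous_map_preimage) simp
    moreover have "\<phi> \<in> ?U" using \<phi> \<epsilon> F(3) by (simp add: tsW)
    moreover have "id \<psi> \<in> M.mball (id \<phi>) \<epsilon>" if "\<psi> \<in> ?U" for \<psi>
    proof -
      have \<psi>: "\<psi> \<in> states A" "?g \<psi> < \<epsilon> / (2 * (C + 1))" using that by (auto simp: tsW)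
      have g0: "0 \<le> ?g \<psi>" by (intro sum_nonneg) auto
      have "?d \<phi> \<psi> \<le> \<epsilon>/2 + C * ?g \<psi>"
        using FC \<phi> \<psi>(1) \<epsilon> F(3) g0 by (intro d_leI) auto
      also have "C * ?g \<psi> \<le> (C + 1) * ?g \<psi>" using g0 by (intro mult_right_mono) auto
      also have "(C + 1) * ?g \<psi> < \<epsilon>/2" using \<psi>(2) F(3) by (simp add: field_simps)
      finally show ?thesis using \<phi> \<psi>(1) by (simp add: M.in_mball)
    qed
    ultimately show "\<exists>U. openin (weak_star A) U \<and> \<phi> \<in> U \<and> (\<forall>\<psi>\<in>U. id \<psi> \<in> M.mball (id \<phi>) \<epsilon>)"
      by blast
  qed
  have finer: "openin X S" if "continuous_map X Y id" "topspace X = topspace Y" "openin Y S" for X Y :: "('a \<Rightarrow> complex) topology" and S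
  proof -
    have "openin X {x \<in> topspace X. id x \<in> S}" using openin_continuous_map_preimage that by blast
    moreover have "{x \<in> topspace X. id x \<in> S} = S" using openin_subset[OF that(3)] that(2) by auto
    ultimately show ?thesis by simp
  qed
  show ?thesis
  proof (intro quantum_compact_metric_space.intro unital_cstar_algebra_axioms quantum_compact_metric_space_axioms.intro)
    show "M.mtopology = weak_star A"
      unfolding topology_eq using finer[OF toW] finer[OF toM] tsW by auto
    show "Metric_space (states A) ?d" by (rule M.Metric_space_axioms)
    have lipA: "lip_dom A L \<subseteq> carrier A" using domA by blast
    show "sa A \<subseteq> cstar_topology A closure_of lip_dom A L"
      unfolding subset_iff closure_of_iff[OF lipA] using dense by (auto simp: sa_def)
    show "closedin (cstar_topology A) {a \<in> lip_dom A L. L a \<le> 1}"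
      unfolding closedin_iff
    proof (intro conjI ballI impI)
      fix a assume a: "a \<in> carrier A" and lim: "\<forall>\<epsilon>>0. \<exists>b\<in>{a \<in> lip_dom A L. L a \<le> 1}. cnorm A (a \<ominus> b) < \<epsilon>"
      have "a \<in> lip_dom A L \<and> L a \<le> 1" by (rule closed[OF a]) (use lim in blast)
      then show "a \<in> {a \<in> lip_dom A L. L a \<le> 1}" by blast
    qed (use domA in auto)
  qed (use add scale kernel jordan lie finite in auto)
qed

text \<open>Continuity of the operations. For products the second factor is approximated first, as
  the accuracy demanded of the first factor depends on the norm of that approximant.\<close>

lemma (in unital_cstar_algebra) cstar_closed_closure:
  assumes S: "S \<subseteq> carrier A" "\<zero> \<in> S" "\<And>x y. x \<in> S \<Longrightarrow> y \<in> S \<Longrightarrow> x \<oplus> y \<in> S"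
    "\<And>x y. x \<in> S \<Longrightarrow> y \<in> S \<Longrightarrow> x \<otimes> y \<in> S" "\<And>x. x \<in> S \<Longrightarrow> cstar A x \<in> S"
    "\<And>x s. x \<in> S \<Longrightarrow> cscale A s x \<in> S"
  shows "cstar_closed A (cstar_topology A closure_of S)"
  unfolding cstar_closed_def
proof (intro conjI ballI allI)
  have SA: "x \<in> carrier A" if "x \<in> S" for x using that S(1) by auto
  note iff = closure_of_iff[OF S(1)]
  show "closedin (cstar_topology A) (cstar_topology A closure_of S)" by simp
  show "\<zero> \<in> cstar_topology A closure_of S"
    using S(2) closure_of_subset[of S "cstar_topology A"] S(1) by (auto simp: topspace_cstar)
  fix x assume x: "x \<in> cstar_topology A closure_of S"
  then have xA: "x \<in> carrier A" by (simp add: iff)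
  show "cstar A x \<in> cstar_topology A closure_of S"
    unfolding iff
  proof (intro conjI allI impI)
    fix \<epsilon> :: real assume "\<epsilon> > 0"
    then obtain y where y: "y \<in> S" "cnorm A (x \<ominus> y) < \<epsilon>" using x iff by blast
    then show "\<exists>y\<in>S. cnorm A (cstar A x \<ominus> y) < \<epsilon>"
      using SA[OF y(1)] xA S(5)[OF y(1)] by (intro bexI[of _ "cstar A y"]) (simp_all add: norm_star flip: star_minus)
  qed (simp add: xA star_closed)
  show "cscale A s x \<in> cstar_topology A closure_of S" for s
    unfolding iff
  proof (intro conjI allI impI)
    fix \<epsilon> :: real assume e: "\<epsilon> > 0"
    have pos: "0 < cmod s + 1" using norm_ge_zero[of s] by linarith
    then obtain y where y: "y \<in> S" "cnorm A (x \<ominus> y) < \<epsilon> / (cmod s + 1)" using x iff e by (metis divide_pos_pos)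
    have "cnorm A (cscale A s x \<ominus> cscale A s y) = cmod s * cnorm A (x \<ominus> y)"
      using SA[OF y(1)] xA by (simp add: norm_scale flip: scale_minus_right)
    also have "\<dots> \<le> (cmod s + 1) * cnorm A (x \<ominus> y)"
      using SA[OF y(1)] xA by (intro mult_right_mono norm_nonneg) auto
    also have "\<dots> < \<epsilon>" using y(2) pos by (simp add: field_simps)
    finally show "\<exists>y\<in>S. cnorm A (cscale A s x \<ominus> y) < \<epsilon>" using S(6)[OF y(1)] by blast
  qed (simp add: xA scale_closed)
  fix z assume z: "z \<in> cstar_topology A closure_of S"
  then have zA: "z \<in> carrier A" by (simp add: iff)
  show "x \<oplus> z \<in> cstar_topology A closure_of S"
    unfolding iff
  proof (intro conjI allI impI)
    fix \<epsilon> :: real assume e: "\<epsilon> > 0"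
    obtain y where y: "y \<in> S" "cnorm A (x \<ominus> y) < \<epsilon>/2" using x iff e half_gt_zero by blast
    obtain w where w: "w \<in> S" "cnorm A (z \<ominus> w) < \<epsilon>/2" using z iff e half_gt_zero by blast
    have "(x \<oplus> z) \<ominus> (y \<oplus> w) = (x \<ominus> y) \<oplus> (z \<ominus> w)" using xA zA SA[OF y(1)] SA[OF w(1)] by algebra
    then have "cnorm A ((x \<oplus> z) \<ominus> (y \<oplus> w)) \<le> cnorm A (x \<ominus> y) + cnorm A (z \<ominus> w)"
      using xA zA SA[OF y(1)] SA[OF w(1)] by (simp add: norm_triangle)
    then show "\<exists>y\<in>S. cnorm A (x \<oplus> z \<ominus> y) < \<epsilon>" using S(3)[OF y(1) w(1)] y(2) w(2)
      by (intro bexI[of _ "y \<oplus> w"]) auto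
  qed (simp add: xA zA)
  show "x \<otimes> z \<in> cstar_topology A closure_of S"
    unfolding iff
  proof (intro conjI allI impI)
    fix \<epsilon> :: real assume e: "\<epsilon> > 0"
    define K where "K = cnorm A x + 1"
    have K: "K > 0" using norm_nonneg[OF xA] by (simp add: K_def)
    obtain w where w: "w \<in> S" "cnorm A (z \<ominus> w) < \<epsilon>/2/K" using z iff e K by (metis divide_pos_pos half_gt_zero)
    note wA = SA[OF w(1)]
    define N where "N = cnorm A w + 1"
    have N: "N > 0" using norm_nonneg[OF wA] by (simp add: N_def)
    obtain y where y: "y \<in> S" "cnorm A (x \<ominus> y) < \<epsilon>/2/N" using x iff e N by (metis divide_pos_pos half_gt_zero)
    note yA = SA[OF y(1)]
    have "x \<otimes> z \<ominus> y \<otimes> w = x \<otimes> (z \<ominus> w) \<oplus> (x \<ominus> y) \<otimes> w" using xA zA yA wA by algebra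
    then have "cnorm A (x \<otimes> z \<ominus> y \<otimes> w) \<le> cnorm A (x \<otimes> (z \<ominus> w)) + cnorm A ((x \<ominus> y) \<otimes> w)"
      using xA zA yA wA by (simp add: norm_triangle)
    also have "\<dots> \<le> cnorm A x * cnorm A (z \<ominus> w) + cnorm A (x \<ominus> y) * cnorm A w"
      using xA zA yA wA by (intro add_mono norm_mult) auto
    also have "\<dots> \<le> K * cnorm A (z \<ominus> w) + cnorm A (x \<ominus> y) * N"
      using xA zA yA wA by (intro add_mono mult_right_mono mult_left_mono norm_nonneg) (auto simp: K_def N_def)
    also have "\<dots> < \<epsilon>/2 + \<epsilon>/2"
      using w(2) y(2) K N by (intro add_strict_mono) (simp_all add: pos_less_divide_eq mult.commute)
    finally show "\<exists>y\<in>S. cnorm A (x \<otimes> z \<ominus> y) < \<epsilon>" using S(4)[OF y(1) w(1)] by auto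
  qed (simp add: xA zA)
qed

section \<open>Truncation of matrices\<close>

text \<open>Squared norms, unlike norms, add up over a partition of F, which is what summing over
  fibres requires.\<close>

lemma mat_bounded_iff_squares:
  "mat_bounded I K t \<longleftrightarrow> 0 \<le> K \<and>
     (\<forall>E F \<xi>. finite E \<and> finite F \<and> E \<subseteq> I \<and> F \<subseteq> I \<longrightarrow>
        (\<Sum>m\<in>E. (cmod (\<Sum>q\<in>F. t m q * \<xi> q))\<^sup>2) \<le> K\<^sup>2 * (\<Sum>q\<in>F. (cmod (\<xi> q))\<^sup>2))"
proof (cases "0 \<le> K")
  case True
  have "L2_set (\<lambda>m. cmod (\<Sum>q\<in>F. t m q * \<xi> q)) E \<le> K * L2_set (\<lambda>q. cmod (\<xi> q)) F \<longleftrightarrow>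
      (\<Sum>m\<in>E. (cmod (\<Sum>q\<in>F. t m q * \<xi> q))\<^sup>2) \<le> K\<^sup>2 * (\<Sum>q\<in>F. (cmod (\<xi> q))\<^sup>2)" for E F \<xi>
  proof -
    have "K * L2_set (\<lambda>q. cmod (\<xi> q)) F = sqrt (K\<^sup>2 * (\<Sum>q\<in>F. (cmod (\<xi> q))\<^sup>2))"
      using True by (simp add: L2_set_def real_sqrt_mult)
    then show ?thesis by (simp add: L2_set_def)
  qed
  then show ?thesis by (simp add: mat_bounded_def)
qed (simp add: mat_bounded_def)

text \<open>An operator is determined by its entries, so every bound for its matrix bounds its
  norm.\<close>

lemma bop_norm_le_mat_bounded:
  assumes "T \<in> bounded_ops I" "mat_bounded I K t" "\<And>m q. m \<in> I \<Longrightarrow> q \<in> I \<Longrightarrow> entry T m q = t m q"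
  shows "bop_norm I T \<le> K"
proof -
  have "T = mat_op I t"
    using assms mat_op_bounded[OF assms(2)] by (intro bounded_ops_eq_entryI) auto
  then show ?thesis using mat_op_bounded(2)[OF assms(2)] by simp
qed

lemma mat_bounded_cong:
  "(\<And>m q. m \<in> I \<Longrightarrow> q \<in> I \<Longrightarrow> s m q = t m q) \<Longrightarrow> mat_bounded I K s \<longleftrightarrow> mat_bounded I K t"
proof -
  assume *: "\<And>m q. m \<in> I \<Longrightarrow> q \<in> I \<Longrightarrow> s m q = t m q"
  have "(\<Sum>m\<in>E. (cmod (\<Sum>q\<in>F. s m q * \<xi> q))\<^sup>2) = (\<Sum>m\<in>E. (cmod (\<Sum>q\<in>F. t m q * \<xi> q))\<^sup>2)"
    if "E \<subseteq> I" "F \<subseteq> I" for E F \<xi>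
    using that * by (intro sum.cong refl arg_cong[of _ _ "\<lambda>x. (cmod x)\<^sup>2"]) auto
  then show ?thesis by (auto simp: mat_bounded_iff_squares)
qed

lemma mat_bounded_mono:
  assumes "mat_bounded I K t" "K \<le> L"
  shows "mat_bounded I L t"
  unfolding mat_bounded_def
proof (intro conjI allI impI)
  fix E F and \<xi> :: "'a \<Rightarrow> complex" assume "finite E \<and> finite F \<and> E \<subseteq> I \<and> F \<subseteq> I"
  then show "L2_set (\<lambda>m. cmod (\<Sum>q\<in>F. t m q * \<xi> q)) E \<le> L * L2_set (\<lambda>q. cmod (\<xi> q)) F"
    using mat_boundedD[OF assms(1), of E F \<xi>] mult_right_mono[OF assms(2), of "L2_set (\<lambda>q. cmod (\<xi> q)) F"] by auto
qed (use assms in \<open>auto simp: mat_bounded_def\<close>)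

lemma mat_bounded_add:
  assumes "mat_bounded I K s" "mat_bounded I L t"
  shows "mat_bounded I (K + L) (\<lambda>m q. s m q + t m q)"
  unfolding mat_bounded_def
proof (intro conjI allI impI)
  fix E F and \<xi> :: "'a \<Rightarrow> complex" assume *: "finite E \<and> finite F \<and> E \<subseteq> I \<and> F \<subseteq> I"
  have "L2_set (\<lambda>m. cmod (\<Sum>q\<in>F. (s m q + t m q) * \<xi> q)) E
      \<le> L2_set (\<lambda>m. cmod (\<Sum>q\<in>F. s m q * \<xi> q) + cmod (\<Sum>q\<in>F. t m q * \<xi> q)) E"
    by (intro L2_set_mono) (auto simp: distrib_right sum.distrib intro: norm_triangle_ineq)
  also have "\<dots> \<le> L2_set (\<lambda>m. cmod (\<Sum>q\<in>F. s m q * \<xi> q)) E + L2_set (\<lambda>m. cmod (\<Sum>q\<in>F. t m q * \<xi> q)) E"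
    by (rule L2_set_triangle_ineq)
  also have "\<dots> \<le> K * L2_set (\<lambda>q. cmod (\<xi> q)) F + L * L2_set (\<lambda>q. cmod (\<xi> q)) F"
    using * by (intro add_mono mat_boundedD[OF assms(1)] mat_boundedD[OF assms(2)]) auto
  finally show "L2_set (\<lambda>m. cmod (\<Sum>q\<in>F. (s m q + t m q) * \<xi> q)) E \<le> (K + L) * L2_set (\<lambda>q. cmod (\<xi> q)) F"
    by (simp add: algebra_simps)
qed (use assms in \<open>auto simp: mat_bounded_def\<close>)

lemma mat_bounded_scale:
  assumes "mat_bounded I K t"
  shows "mat_bounded I (cmod s * K) (\<lambda>m q. s * t m q)"
  unfolding mat_bounded_def
proof (intro conjI allI impI)
  fix E F and \<xi> :: "'a \<Rightarrow> complex" assume *: "finite E \<and> finite F \<and> E \<subseteq> I \<and> F \<subseteq> I"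
  have "L2_set (\<lambda>m. cmod (\<Sum>q\<in>F. s * t m q * \<xi> q)) E = cmod s * L2_set (\<lambda>m. cmod (\<Sum>q\<in>F. t m q * \<xi> q)) E"
    by (simp add: L2_set_right_distrib norm_mult mult.assoc flip: sum_distrib_left)
  also have "\<dots> \<le> cmod s * (K * L2_set (\<lambda>q. cmod (\<xi> q)) F)"
    using * by (intro mult_left_mono mat_boundedD[OF assms(1)]) auto
  finally show "L2_set (\<lambda>m. cmod (\<Sum>q\<in>F. s * t m q * \<xi> q)) E \<le> cmod s * K * L2_set (\<lambda>q. cmod (\<xi> q)) F"
    by (simp add: mult.assoc)
qed (use assms in \<open>auto simp: mat_bounded_def\<close>)

text \<open>With the orthogonal projections \<open>Q\<^sub>s\<close> onto the fibres of \<open>g\<close>, Cauchy-Schwarz in \<open>s\<close> reduces the claim to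
  \<open>\<Sum>\<^sub>s \<parallel>t Q\<^sub>s \<xi>\<parallel>\<^sup>2 \<le> K\<^sup>2 \<parallel>\<xi>\<parallel>\<^sup>2\<close>.\<close>

lemma mat_bounded_weighted:
  assumes t: "mat_bounded I K t" and W: "0 \<le> W"
    and w: "\<And>m S. m \<in> I \<Longrightarrow> finite S \<Longrightarrow> (\<Sum>s\<in>S. (cmod (w m s))\<^sup>2) \<le> W\<^sup>2"
  shows "mat_bounded I (W * K) (\<lambda>m q. w m (g q) * t m q)"
  unfolding mat_bounded_iff_squares
proof (intro conjI allI impI)
  show "0 \<le> W * K" using t W by (simp add: mat_bounded_def)
  fix E F and \<xi> :: "'a \<Rightarrow> complex" assume *: "finite E \<and> finite F \<and> E \<subseteq> I \<and> F \<subseteq> I"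
  \<comment> \<open>The value at m of t applied to the part of \<xi> over the fibre s; the weight is
    constant along that fibre and factors out.\<close>
  define \<zeta> where "\<zeta> m s = (\<Sum>q\<in>{q \<in> F. g q = s}. t m q * \<xi> q)" for m s
  have pt: "(cmod (\<Sum>q\<in>F. w m (g q) * t m q * \<xi> q))\<^sup>2 \<le> W\<^sup>2 * (\<Sum>s\<in>g ` F. (cmod (\<zeta> m s))\<^sup>2)" if "m \<in> I" for m
  proof -
    have "(\<Sum>q\<in>F. w m (g q) * t m q * \<xi> q) = (\<Sum>s\<in>g ` F. \<Sum>q\<in>{q \<in> F. g q = s}. w m (g q) * t m q * \<xi> q)"
      using * by (intro sum.image_gen) auto
    also have "\<dots> = (\<Sum>s\<in>g ` F. w m s * \<zeta> m s)"
      by (intro sum.cong refl) (simp add: \<zeta>_def sum_distrib_left mult.assoc)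
    also have "cmod \<dots> \<le> (\<Sum>s\<in>g ` F. \<bar>cmod (w m s)\<bar> * \<bar>cmod (\<zeta> m s)\<bar>)"
      by (rule order_trans[OF norm_sum]) (simp add: norm_mult)
    also have "\<dots> \<le> L2_set (\<lambda>s. cmod (w m s)) (g ` F) * L2_set (\<lambda>s. cmod (\<zeta> m s)) (g ` F)"
      by (rule L2_set_mult_ineq)
    finally have "(cmod (\<Sum>q\<in>F. w m (g q) * t m q * \<xi> q))\<^sup>2
        \<le> (L2_set (\<lambda>s. cmod (w m s)) (g ` F) * L2_set (\<lambda>s. cmod (\<zeta> m s)) (g ` F))\<^sup>2"
      by (intro power_mono) auto
    also have "\<dots> = (\<Sum>s\<in>g ` F. (cmod (w m s))\<^sup>2) * (\<Sum>s\<in>g ` F. (cmod (\<zeta> m s))\<^sup>2)"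
      by (simp add: L2_set_def power_mult_distrib sum_nonneg)
    also have "\<dots> \<le> W\<^sup>2 * (\<Sum>s\<in>g ` F. (cmod (\<zeta> m s))\<^sup>2)"
      using * that by (intro mult_right_mono w sum_nonneg) auto
    finally show ?thesis .
  qed
  have "(\<Sum>m\<in>E. (cmod (\<Sum>q\<in>F. w m (g q) * t m q * \<xi> q))\<^sup>2) \<le> (\<Sum>m\<in>E. W\<^sup>2 * (\<Sum>s\<in>g ` F. (cmod (\<zeta> m s))\<^sup>2))"
    using * by (intro sum_mono pt) auto
  also have "\<dots> = W\<^sup>2 * (\<Sum>s\<in>g ` F. \<Sum>m\<in>E. (cmod (\<zeta> m s))\<^sup>2)"
    by (subst sum.swap) (simp add: sum_distrib_left)
  also have "\<dots> \<le> W\<^sup>2 * (\<Sum>s\<in>g ` F. K\<^sup>2 * (\<Sum>q\<in>{q \<in> F. g q = s}. (cmod (\<xi> q))\<^sup>2))"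
  proof (intro mult_left_mono sum_mono)
    fix s
    show "(\<Sum>m\<in>E. (cmod (\<zeta> m s))\<^sup>2) \<le> K\<^sup>2 * (\<Sum>q\<in>{q \<in> F. g q = s}. (cmod (\<xi> q))\<^sup>2)"
      using t[unfolded mat_bounded_iff_squares, THEN conjunct2, rule_format, of E "{q \<in> F. g q = s}" \<xi>] *
      by (auto simp: \<zeta>_def)
  qed simp
  also have "\<dots> = (W * K)\<^sup>2 * (\<Sum>s\<in>g ` F. \<Sum>q\<in>{q \<in> F. g q = s}. (cmod (\<xi> q))\<^sup>2)"
    by (simp add: sum_distrib_left power_mult_distrib mult.assoc)
  also have "(\<Sum>s\<in>g ` F. \<Sum>q\<in>{q \<in> F. g q = s}. (cmod (\<xi> q))\<^sup>2) = (\<Sum>q\<in>F. (cmod (\<xi> q))\<^sup>2)"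
    using * by (intro sum.image_gen[symmetric]) auto
  finally show "(\<Sum>m\<in>E. (cmod (\<Sum>q\<in>F. w m (g q) * t m q * \<xi> q))\<^sup>2) \<le> (W * K)\<^sup>2 * (\<Sum>q\<in>F. (cmod (\<xi> q))\<^sup>2)" .
qed

text \<open>Telescoping: 1 / (n + 1)^2 \<le> 1 / n - 1 / (n + 1).\<close>

lemma sum_inverse_squares_nat:
  assumes "finite S" "N > 0" "\<And>n. n \<in> S \<Longrightarrow> N < n"
  shows "(\<Sum>n\<in>S. 1 / (real n)\<^sup>2) \<le> 1 / real N"
proof -
  obtain M where M: "S \<subseteq> {..<M}" using finite_nat_bounded[OF assms(1)] by blast
  have *: "(\<Sum>n\<in>{N<..N + k}. 1 / (real n)\<^sup>2) \<le> 1 / real N - 1 / real (N + k)" for k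
  proof (induction k)
    case (Suc k)
    have x: "real (N + k) > 0" using assms(2) by simp
    have "{N<..N + Suc k} = insert (N + Suc k) {N<..N + k}" by auto
    then have "(\<Sum>n\<in>{N<..N + Suc k}. 1 / (real n)\<^sup>2) = 1 / (real (N + k) + 1)\<^sup>2 + (\<Sum>n\<in>{N<..N + k}. 1 / (real n)\<^sup>2)"
      by (simp add: add_ac)
    also have "\<dots> \<le> 1 / (real (N + k) + 1)\<^sup>2 + (1 / real N - 1 / real (N + k))" using Suc by simp
    also have "1 / (real (N + k) + 1)\<^sup>2 \<le> 1 / (real (N + k) * (real (N + k) + 1))"
      using x unfolding power2_eq_square by (intro divide_left_mono mult_right_mono mult_pos_pos) auto
    also have "1 / (real (N + k) * (real (N + k) + 1)) = 1 / real (N + k) - 1 / real (N + Suc k)"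
      using x by (simp add: field_simps)
    finally show ?case by simp
  qed simp
  have "(\<Sum>n\<in>S. 1 / (real n)\<^sup>2) \<le> (\<Sum>n\<in>{N<..N + M}. 1 / (real n)\<^sup>2)"
    using assms M by (intro sum_mono2) force+
  also have "\<dots> \<le> 1 / real N - 1 / real (N + M)" by (rule *)
  also have "\<dots> \<le> 1 / real N" by simp
  finally show ?thesis .
qed

text \<open>The two signs contribute at most 1 / N each; on either half-line the absolute value is
  injective.\<close>

lemma sum_inverse_squares_int:
  assumes "finite S" "N > 0" "\<And>n. n \<in> S \<Longrightarrow> int N < \<bar>n\<bar>"
  shows "(\<Sum>n\<in>S. 1 / (real_of_int n)\<^sup>2) \<le> 2 / real N"
proof -
  have *: "(\<Sum>n\<in>T. 1 / (real_of_int n)\<^sup>2) \<le> 1 / real N" if "T \<subseteq> S" "inj_on (\<lambda>n. nat \<bar>n\<bar>) T" for T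
  proof -
    have "(\<Sum>n\<in>T. 1 / (real_of_int n)\<^sup>2) = (\<Sum>n\<in>(\<lambda>n. nat \<bar>n\<bar>) ` T. 1 / (real n)\<^sup>2)"
      by (simp add: sum.reindex[OF that(2)])
    also have "\<dots> \<le> 1 / real N"
      using that assms(2) assms(3) finite_subset[OF that(1) assms(1)]
      by (intro sum_inverse_squares_nat) (auto simp: subset_iff zless_nat_eq_int_zless)
    finally show ?thesis .
  qed
  have "S = {n \<in> S. n \<ge> 0} \<union> {n \<in> S. n < 0}" by auto
  then have "(\<Sum>n\<in>S. 1 / (real_of_int n)\<^sup>2) = (\<Sum>n\<in>{n \<in> S. n \<ge> 0} \<union> {n \<in> S. n < 0}. 1 / (real_of_int n)\<^sup>2)" by simp
  also have "\<dots> = (\<Sum>n\<in>{n \<in> S. n \<ge> 0}. 1 / (real_of_int n)\<^sup>2) + (\<Sum>n\<in>{n \<in> S. n < 0}. 1 / (real_of_int n)\<^sup>2)"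
    using assms(1) by (intro sum.union_disjoint) auto
  also have "\<dots> \<le> 1 / real N + 1 / real N" by (intro add_mono *) (auto simp: inj_on_def)
  finally show ?thesis by simp
qed

text \<open>As a function of the value s = g q, a row of the band indicator is nonzero for at most 2
  N + 1 integers s, which bounds its l2 norm by the square root of 2 N + 1.\<close>

lemma mat_bounded_band:
  assumes "mat_bounded I K t"
  shows "mat_bounded I (sqrt (2 * real N + 1) * K) (\<lambda>m q. if \<bar>g m - g q\<bar> \<le> int N then t m q else 0)"
proof -
  have "mat_bounded I (sqrt (2 * real N + 1) * K) (\<lambda>m q. (if \<bar>g m - g q\<bar> \<le> int N then 1 else 0) * t m q)"
  proof (rule mat_bounded_weighted[OF assms])
    fix m :: 'a and S :: "int set" assume "finite S"
    have "(\<Sum>s\<in>S. (cmod (if \<bar>g m - s\<bar> \<le> int N then 1 else 0))\<^sup>2) = (\<Sum>s\<in>S. if \<bar>g m - s\<bar> \<le> int N then 1 else 0)"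
      by (intro sum.cong) auto
    also have "\<dots> = real (card {s \<in> S. \<bar>g m - s\<bar> \<le> int N})"
      using \<open>finite S\<close> by (simp add: sum.If_cases Int_def)
    also have "\<dots> \<le> real (card {g m - int N..g m + int N})"
      by (intro of_nat_mono card_mono) auto
    also have "\<dots> = 2 * real N + 1" by simp
    finally show "(\<Sum>s\<in>S. (cmod (if \<bar>g m - s\<bar> \<le> int N then 1 else 0))\<^sup>2) \<le> (sqrt (2 * real N + 1))\<^sup>2"
      by simp
  qed simp
  then show ?thesis by (rule mat_bounded_cong[THEN iffD1, rotated]) auto
qed

text \<open>Off the band t is the weight 1 / (g m - g q) times the bounded matrix, and the squares
  of these weights sum to at most 2 / N over the values of g. The weight 0 on the band also avoids
  division by zero.\<close>

lemma mat_bounded_off_band: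
  assumes "mat_bounded I K (\<lambda>m q. complex_of_int (g m - g q) * t m q)" "N > 0"
  shows "mat_bounded I (sqrt (2 / real N) * K) (\<lambda>m q. if \<bar>g m - g q\<bar> \<le> int N then 0 else t m q)"
proof -
  have "mat_bounded I (sqrt (2 / real N) * K)
      (\<lambda>m q. (if \<bar>g m - g q\<bar> \<le> int N then 0 else 1 / complex_of_int (g m - g q)) * (complex_of_int (g m - g q) * t m q))"
  proof (rule mat_bounded_weighted[OF assms(1)])
    fix m :: 'a and S :: "int set" assume S: "finite S"
    have "(\<Sum>s\<in>S. (cmod (if \<bar>g m - s\<bar> \<le> int N then 0 else 1 / complex_of_int (g m - s)))\<^sup>2) =
        (\<Sum>s\<in>{s \<in> S. \<not> \<bar>g m - s\<bar> \<le> int N}. 1 / (real_of_int (g m - s))\<^sup>2)"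
      using S by (intro sum.mono_neutral_cong_right) (auto simp: norm_divide power_divide simp del: of_int_diff)
    also have "\<dots> = (\<Sum>n\<in>(\<lambda>s. g m - s) ` {s \<in> S. \<not> \<bar>g m - s\<bar> \<le> int N}. 1 / (real_of_int n)\<^sup>2)"
      by (subst sum.reindex) (auto simp: inj_on_def)
    also have "\<dots> \<le> 2 / real N" using S assms(2) by (intro sum_inverse_squares_int) auto
    finally show "(\<Sum>s\<in>S. (cmod (if \<bar>g m - s\<bar> \<le> int N then 0 else 1 / complex_of_int (g m - s)))\<^sup>2) \<le> (sqrt (2 / real N))\<^sup>2"
      by simp
  qed simp
  then show ?thesis by (rule mat_bounded_cong[THEN iffD1, rotated]) (auto simp del: of_int_diff)
qed

text \<open>M depends on the tolerance but not on t, so one truncation serves the whole Lipschitz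
  ball. Cutting along one coordinate j leaves a remainder of size \<epsilon> / 2 and a band part
  whose derivatives along the other coordinates grow by at most the factor C; divided by C, the band
  part satisfies the hypothesis again, and the induction is applied with tolerance \<epsilon> / (2
  C).\<close>

lemma mat_bounded_multi_truncation:
  fixes g :: "'j \<Rightarrow> 'i \<Rightarrow> int"
  assumes "finite J" "\<epsilon> > 0"
  shows "\<exists>M. \<forall>t. (\<forall>j\<in>J. mat_bounded I 1 (\<lambda>m q. complex_of_int (g j m - g j q) * t m q)) \<longrightarrow>
     mat_bounded I \<epsilon> (\<lambda>m q. if \<forall>j\<in>J. \<bar>g j m - g j q\<bar> \<le> int (M j) then 0 else t m q)"
  using assms
proof (induction J arbitrary: \<epsilon> rule: finite_induct)
  case empty
  then show ?case by (auto simp: mat_bounded_iff_squares sum_nonneg)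
next
  case (insert j J)
  \<comment> \<open>From 8 / \<epsilon>^2 \<le> N follows sqrt (2 / N) \<le> \<epsilon> / 2; the
    successor keeps N positive.\<close>
  obtain N0 :: nat where N0: "8 / \<epsilon>\<^sup>2 \<le> real N0" using real_arch_simple by blast
  define N where "N = Suc N0"
  have N: "N > 0" "8 / \<epsilon>\<^sup>2 \<le> real N" using N0 by (auto simp: N_def)
  define C where "C = sqrt (2 * real N + 1)"
  have C: "C > 0" by (simp add: C_def)
  obtain M where M: "\<And>t. (\<forall>j\<in>J. mat_bounded I 1 (\<lambda>m q. complex_of_int (g j m - g j q) * t m q)) \<Longrightarrow>
     mat_bounded I (\<epsilon> / (2 * C)) (\<lambda>m q. if \<forall>j\<in>J. \<bar>g j m - g j q\<bar> \<le> int (M j) then 0 else t m q)"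
    using insert.IH[of "\<epsilon> / (2 * C)"] C insert.prems by auto
  have "mat_bounded I \<epsilon> (\<lambda>m q. if \<forall>i\<in>insert j J. \<bar>g i m - g i q\<bar> \<le> int ((M(j := N)) i) then 0 else t m q)"
    if t: "\<forall>i\<in>insert j J. mat_bounded I 1 (\<lambda>m q. complex_of_int (g i m - g i q) * t m q)" for t
  proof -
    define t1 where "t1 m q = (if \<bar>g j m - g j q\<bar> \<le> int N then t m q else 0)" for m q
    have 0: "mat_bounded I (sqrt (2 / real N) * 1) (\<lambda>m q. if \<bar>g j m - g j q\<bar> \<le> int N then 0 else t m q)"
      using t N by (intro mat_bounded_off_band) auto
    have "sqrt (2 / real N) \<le> \<epsilon> / 2"
    proof (rule real_le_lsqrt)
      show "2 / real N \<le> (\<epsilon> / 2)\<^sup>2" using N insert.prems by (simp add: field_simps power_divide)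
    qed (use insert.prems in auto)
    then have 1: "mat_bounded I (\<epsilon> / 2) (\<lambda>m q. if \<bar>g j m - g j q\<bar> \<le> int N then 0 else t m q)"
      by (intro mat_bounded_mono[OF 0]) simp
    \<comment> \<open>Cutting to the band in direction j and multiplying by the difference in
      direction i are both entrywise, so they commute.\<close>
    have "mat_bounded I 1 (\<lambda>m q. complex_of_int (g i m - g i q) * (complex_of_real (1 / C) * t1 m q))" if "i \<in> J" for i
    proof -
      have "mat_bounded I (C * 1) (\<lambda>m q. if \<bar>g j m - g j q\<bar> \<le> int N then complex_of_int (g i m - g i q) * t m q else 0)"
        unfolding C_def using t that by (intro mat_bounded_band) auto
      from mat_bounded_scale[OF this, of "complex_of_real (1 / C)"]
      have "mat_bounded I 1 (\<lambda>m q. complex_of_real (1 / C) * (if \<bar>g j m - g j q\<bar> \<le> int N then complex_of_int (g i m - g i q) * t m q else 0))"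
        using C by (simp add: norm_divide)
      then show ?thesis by (rule mat_bounded_cong[THEN iffD1, rotated]) (auto simp: t1_def)
    qed
    then have "mat_bounded I (\<epsilon> / (2 * C)) (\<lambda>m q. if \<forall>i\<in>J. \<bar>g i m - g i q\<bar> \<le> int (M i) then 0 else complex_of_real (1 / C) * t1 m q)"
      by (intro M) auto
    from mat_bounded_scale[OF this, of "complex_of_real C"]
    have "mat_bounded I (\<epsilon> / 2) (\<lambda>m q. complex_of_real C * (if \<forall>i\<in>J. \<bar>g i m - g i q\<bar> \<le> int (M i) then 0 else complex_of_real (1 / C) * t1 m q))"
      using C by simp
    from mat_bounded_add[OF 1 this]
    have "mat_bounded I \<epsilon> (\<lambda>m q. (if \<bar>g j m - g j q\<bar> \<le> int N then 0 else t m q) +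
       complex_of_real C * (if \<forall>i\<in>J. \<bar>g i m - g i q\<bar> \<le> int (M i) then 0 else complex_of_real (1 / C) * t1 m q))"
      by simp
    then show ?thesis
    proof (rule mat_bounded_cong[THEN iffD1, rotated])
      fix m q
      have "(\<forall>i\<in>insert j J. \<bar>g i m - g i q\<bar> \<le> int ((M(j := N)) i)) \<longleftrightarrow>
          \<bar>g j m - g j q\<bar> \<le> int N \<and> (\<forall>i\<in>J. \<bar>g i m - g i q\<bar> \<le> int (M i))"
        using insert.hyps(2) by auto
      then show "(if \<bar>g j m - g j q\<bar> \<le> int N then 0 else t m q) +
          complex_of_real C * (if \<forall>i\<in>J. \<bar>g i m - g i q\<bar> \<le> int (M i) then 0 else complex_of_real (1 / C) * t1 m q) =
        (if \<forall>i\<in>insert j J. \<bar>g i m - g i q\<bar> \<le> int ((M(j := N)) i) then 0 else t m q)"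
        using C by (auto simp: t1_def)
    qed
  qed
  then show ?case by blast
qed

section \<open>Twisted group algebras\<close>

text \<open>Right multiplication by the unitary of m in the twisted group algebra: the cocycle has
  its arguments in the order opposite to \<open>twisted_shift\<close>.\<close>

definition right_shift ::
  "'g monoid \<Rightarrow> ('g \<times> 'g \<Rightarrow> complex) \<Rightarrow> 'g \<Rightarrow> ('g \<Rightarrow> complex) \<Rightarrow> ('g \<Rightarrow> complex)" where
  "right_shift G \<sigma> m =
     (\<lambda>\<xi>\<in>l2 (carrier G). \<lambda>p. if p \<in> carrier G
        then \<sigma> (p \<otimes>\<^bsub>G\<^esub> inv\<^bsub>G\<^esub> m, m) * \<xi> (p \<otimes>\<^bsub>G\<^esub> inv\<^bsub>G\<^esub> m) else 0)"

text \<open>The antilinear conjugation J of the standard representation, for an arbitrary group;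
  \<open>tor_J\<close> is an instance.\<close>

definition conj_inv :: "'g monoid \<Rightarrow> ('g \<Rightarrow> complex) \<Rightarrow> ('g \<Rightarrow> complex)" where
  "conj_inv G \<xi> = (\<lambda>m. if m \<in> carrier G then cnj (\<xi> (inv\<^bsub>G\<^esub> m)) else 0)"

definition restrict_op :: "'i set \<Rightarrow> 'i set \<Rightarrow> ('i \<Rightarrow> complex) \<Rightarrow> ('i \<Rightarrow> complex)" where
  "restrict_op I H = (\<lambda>\<xi>\<in>l2 I. cutoff H \<xi>)"

text \<open>Left and right translations differ only in the unimodular weight attached to the source
  point q, so both are handled at once; a bijection of the basis with unimodular weights is
  isometric.\<close>

lemma (in group) shift_op:
  assumes x: "x \<in> carrier G" and c: "\<And>q. q \<in> carrier G \<Longrightarrow> cmod (c q) = 1"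
  shows "(\<lambda>\<xi>\<in>l2 (carrier G). \<lambda>p. if p \<in> carrier G then c (p \<otimes> inv x) * \<xi> (p \<otimes> inv x) else 0)
      \<in> bounded_ops (carrier G)"
    "\<And>m q. m \<in> carrier G \<Longrightarrow> q \<in> carrier G \<Longrightarrow>
       entry (\<lambda>\<xi>\<in>l2 (carrier G). \<lambda>p. if p \<in> carrier G then c (p \<otimes> inv x) * \<xi> (p \<otimes> inv x) else 0) m q
         = (if m = q \<otimes> x then c q else 0)"
proof -
  let ?T = "(\<lambda>\<xi>\<in>l2 (carrier G). \<lambda>p. if p \<in> carrier G then c (p \<otimes> inv x) * \<xi> (p \<otimes> inv x) else 0)"
  have *: "L2_set (\<lambda>p. cmod (?T \<xi> p)) F \<le> l2_norm (carrier G) \<xi>"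
    if \<xi>: "\<xi> \<in> l2 (carrier G)" and F: "finite F" "F \<subseteq> carrier G" for \<xi> F
  proof -
    have inj: "inj_on (\<lambda>p. p \<otimes> inv x) F" using F(2) x by (auto simp: inj_on_def subset_iff)
    have "(\<Sum>p\<in>F. (cmod (?T \<xi> p))\<^sup>2) = (\<Sum>p\<in>F. (cmod (\<xi> (p \<otimes> inv x)))\<^sup>2)"
      using F(2) \<xi> x c by (intro sum.cong) (auto simp: norm_mult subset_iff)
    also have "\<dots> = (\<Sum>q\<in>(\<lambda>p. p \<otimes> inv x) ` F. (cmod (\<xi> q))\<^sup>2)" by (simp add: sum.reindex[OF inj])
    finally have "L2_set (\<lambda>p. cmod (?T \<xi> p)) F = L2_set (\<lambda>q. cmod (\<xi> q)) ((\<lambda>p. p \<otimes> inv x) ` F)"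
      by (simp add: L2_set_def)
    also have "\<dots> \<le> l2_norm (carrier G) \<xi>" using F x by (intro L2_set_le_l2_norm[OF \<xi>]) auto
    finally show ?thesis .
  qed
  have cl: "?T \<xi> \<in> l2 (carrier G)" "l2_norm (carrier G) (?T \<xi>) \<le> 1 * l2_norm (carrier G) \<xi>"
    if \<xi>: "\<xi> \<in> l2 (carrier G)" for \<xi>
  proof -
    have o: "?T \<xi> p = 0" if "p \<notin> carrier G" for p using that \<xi> by simp
    show "?T \<xi> \<in> l2 (carrier G)" "l2_norm (carrier G) (?T \<xi>) \<le> 1 * l2_norm (carrier G) \<xi>"
      using l2_boundI[of "carrier G" "?T \<xi>", OF o *[OF \<xi>]] by auto
  qed
  show "?T \<in> bounded_ops (carrier G)"
    by (rule bounded_opsI[where B = 1])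
       (use cl in \<open>auto simp: l2_add l2_scale algebra_simps\<close>)
  fix m q assume mq: "m \<in> carrier G" "q \<in> carrier G"
  have "m \<otimes> inv x = q \<longleftrightarrow> m = q \<otimes> x" using mq x by (metis inv_solve_right')
  then show "entry ?T m q = (if m = q \<otimes> x then c q else 0)"
    using mq by (simp add: entry_def) (auto simp: delta_def)
qed

lemma restrict_op:
  shows "restrict_op I H \<in> bounded_ops I"
    "\<And>m q. m \<in> I \<Longrightarrow> q \<in> I \<Longrightarrow> entry (restrict_op I H) m q = (if m = q \<and> q \<in> H then 1 else 0)"
proof -
  show "restrict_op I H \<in> bounded_ops I"
    by (rule bounded_opsI[where B = 1])
       (auto simp: restrict_op_def l2_cutoff l2_add l2_scale, auto simp: cutoff_def)
qed (simp add: restrict_op_def entry_def, auto simp: delta_def cutoff_def)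

locale twisted_group = comm_group G for G :: "'g monoid" (structure) +
  fixes \<sigma> :: "'g \<times> 'g \<Rightarrow> complex"
  assumes cocycle: "\<sigma> \<in> normalized_cocycles G"
begin

lemma sigma_norm: "x \<in> carrier G \<Longrightarrow> y \<in> carrier G \<Longrightarrow> cmod (\<sigma> (x, y)) = 1"
  and sigma_cocycle: "x \<in> carrier G \<Longrightarrow> y \<in> carrier G \<Longrightarrow> z \<in> carrier G \<Longrightarrow>
     \<sigma> (x, y) * \<sigma> (x \<otimes> y, z) = \<sigma> (x, y \<otimes> z) * \<sigma> (y, z)"
  and sigma_one: "x \<in> carrier G \<Longrightarrow> \<sigma> (\<one>, x) = 1" "x \<in> carrier G \<Longrightarrow> \<sigma> (x, \<one>) = 1"
  and sigma_inv: "x \<in> carrier G \<Longrightarrow> \<sigma> (x, inv x) = 1"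
  using cocycle by (auto simp: normalized_cocycles_def PiE_iff)

lemma sigma_inv': "x \<in> carrier G \<Longrightarrow> \<sigma> (inv x, x) = 1"
  using sigma_inv[of "inv x"] by simp

lemma sigma_mult_cnj: "x \<in> carrier G \<Longrightarrow> y \<in> carrier G \<Longrightarrow> \<sigma> (x, y) * cnj (\<sigma> (x, y)) = 1"
  using sigma_norm[of x y] complex_norm_square[of "\<sigma> (x, y)"] by simp

lemma cnj_eq_if_mult_eq_1: "x \<in> carrier G \<Longrightarrow> y \<in> carrier G \<Longrightarrow> \<sigma> (x, y) * u = 1 \<Longrightarrow> cnj (\<sigma> (x, y)) = u"
  using sigma_mult_cnj[of x y] by (metis mult_cancel_left mult_zero_left zero_neq_one)

text \<open>The cocycle identity at x, y and the inverse of y, where normalization makes the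
  right-hand side 1, displays the multiplicative inverse of \<open>\<sigma> (x, y)\<close>, which is
  its conjugate.\<close>

lemma cnj_sigma_right: "x \<in> carrier G \<Longrightarrow> y \<in> carrier G \<Longrightarrow> cnj (\<sigma> (x, y)) = \<sigma> (x \<otimes> y, inv y)"
  using sigma_cocycle[of x y "inv y"] by (intro cnj_eq_if_mult_eq_1) (auto simp: sigma_inv sigma_one)

lemma cnj_sigma_left: "x \<in> carrier G \<Longrightarrow> y \<in> carrier G \<Longrightarrow> cnj (\<sigma> (x, y)) = \<sigma> (inv x, x \<otimes> y)"
  using sigma_cocycle[of "inv x" x y]
  by (intro cnj_eq_if_mult_eq_1) (auto simp: sigma_inv' sigma_one mult.commute)

text \<open>The product x y pairs trivially with its inverse, so the cocycle identity at x y, the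
  inverse of y and the inverse of x turns the formula of \<open>cnj_sigma_right\<close> into this
  one.\<close>

lemma cnj_sigma: "x \<in> carrier G \<Longrightarrow> y \<in> carrier G \<Longrightarrow> cnj (\<sigma> (x, y)) = \<sigma> (inv y, inv x)"
proof -
  assume xy: "x \<in> carrier G" "y \<in> carrier G"
  have "inv y \<otimes> inv x = inv (x \<otimes> y)" using xy by (simp add: inv_mult_group)
  then have "\<sigma> (x \<otimes> y, inv y \<otimes> inv x) = 1" using xy by (simp add: sigma_inv)
  moreover have "x \<otimes> y \<otimes> inv y = x" using xy by (simp add: m_assoc)
  ultimately have "\<sigma> (x \<otimes> y, inv y) = \<sigma> (inv y, inv x)"
    using sigma_cocycle[of "x \<otimes> y" "inv y" "inv x"] xy by (simp add: sigma_inv)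
  then show ?thesis using cnj_sigma_right xy by simp
qed

section \<open>Left and right regular representations\<close>

abbreviation "left_op \<equiv> twisted_shift G \<sigma>"
abbreviation "right_op \<equiv> right_shift G \<sigma>"

lemma left_op_bounded: "x \<in> carrier G \<Longrightarrow> left_op x \<in> bounded_ops (carrier G)"
  and entry_left_op: "x \<in> carrier G \<Longrightarrow> m \<in> carrier G \<Longrightarrow> q \<in> carrier G \<Longrightarrow>
     entry (left_op x) m q = (if m = q \<otimes> x then \<sigma> (x, q) else 0)"
  using shift_op[of x "\<lambda>q. \<sigma> (x, q)"] by (simp_all add: twisted_shift_def sigma_norm)

lemma right_op_bounded: "x \<in> carrier G \<Longrightarrow> right_op x \<in> bounded_ops (carrier G)"
  and entry_right_op: "x \<in> carrier G \<Longrightarrow> m \<in> carrier G \<Longrightarrow> q \<in> carrier G \<Longrightarrow>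
     entry (right_op x) m q = (if m = q \<otimes> x then \<sigma> (q, x) else 0)"
  using shift_op[of x "\<lambda>q. \<sigma> (q, x)"] by (simp_all add: right_shift_def sigma_norm)

lemma adjoint_left_op: "x \<in> carrier G \<Longrightarrow> adjoint_op (carrier G) (left_op x) = left_op (inv x)"
proof (rule adjoint_op_eqI)
  fix m q assume *: "x \<in> carrier G" "m \<in> carrier G" "q \<in> carrier G"
  have "m = q \<otimes> inv x \<longleftrightarrow> q = m \<otimes> x" using * by (metis inv_solve_right)
  then show "entry (left_op (inv x)) m q = cnj (entry (left_op x) q m)"
    using * by (auto simp: entry_left_op cnj_sigma_left m_comm)
qed (auto simp: left_op_bounded)

lemma adjoint_right_op: "x \<in> carrier G \<Longrightarrow> adjoint_op (carrier G) (right_op x) = right_op (inv x)"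
proof (rule adjoint_op_eqI)
  fix m q assume *: "x \<in> carrier G" "m \<in> carrier G" "q \<in> carrier G"
  have "m = q \<otimes> inv x \<longleftrightarrow> q = m \<otimes> x" using * by (metis inv_solve_right)
  then show "entry (right_op (inv x)) m q = cnj (entry (right_op x) q m)"
    using * by (auto simp: entry_right_op cnj_sigma_right)
qed (auto simp: right_op_bounded)

lemma left_op_apply: "\<xi> \<in> l2 (carrier G) \<Longrightarrow> p \<in> carrier G \<Longrightarrow> left_op x \<xi> p = \<sigma> (x, p \<otimes> inv x) * \<xi> (p \<otimes> inv x)"
  and right_op_apply: "\<xi> \<in> l2 (carrier G) \<Longrightarrow> p \<in> carrier G \<Longrightarrow> right_op x \<xi> p = \<sigma> (p \<otimes> inv x, x) * \<xi> (p \<otimes> inv x)"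
  and left_op_outside: "\<xi> \<in> l2 (carrier G) \<Longrightarrow> p \<notin> carrier G \<Longrightarrow> left_op x \<xi> p = 0"
  and right_op_outside: "\<xi> \<in> l2 (carrier G) \<Longrightarrow> p \<notin> carrier G \<Longrightarrow> right_op x \<xi> p = 0"
  by (simp_all add: twisted_shift_def right_shift_def)

lemma left_op_left_op:
  assumes "x \<in> carrier G" "y \<in> carrier G" "\<xi> \<in> l2 (carrier G)"
  shows "left_op x (left_op y \<xi>) = (\<lambda>p. \<sigma> (x, y) * left_op (x \<otimes> y) \<xi> p)"
proof
  fix p
  note L = bounded_ops_closed[OF left_op_bounded[OF assms(2)] assms(3)]
  show "left_op x (left_op y \<xi>) p = \<sigma> (x, y) * left_op (x \<otimes> y) \<xi> p"
  proof (cases "p \<in> carrier G")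
    case True
    define q where "q = p \<otimes> inv x \<otimes> inv y"
    have q0: "q \<in> carrier G" using assms True by (simp add: q_def)
    have q: "q \<in> carrier G" "p \<otimes> inv x = y \<otimes> q" "p \<otimes> inv (x \<otimes> y) = q"
      using q0 assms True inv_solve_right[of q "p \<otimes> inv x" y] q_def m_comm[OF q0 assms(2)]
      by (simp_all add: inv_mult_group m_ac)
    then show ?thesis
      using assms True L sigma_cocycle[OF assms(1,2) q(1)]
      by (simp add: left_op_apply flip: q_def) (simp add: q_def[symmetric] q(2)[symmetric] mult.assoc[symmetric])
  qed (use assms L in \<open>simp add: left_op_outside\<close>)
qed

lemma left_op_one: "\<xi> \<in> l2 (carrier G) \<Longrightarrow> left_op \<one> \<xi> = \<xi>"
  using l2_outside by (fastforce simp: fun_eq_iff twisted_shift_def sigma_one)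

lemma left_op_inv_left_op: "x \<in> carrier G \<Longrightarrow> \<xi> \<in> l2 (carrier G) \<Longrightarrow> left_op (inv x) (left_op x \<xi>) = \<xi>"
  by (simp add: left_op_left_op sigma_inv' left_op_one)

text \<open>With q the source point, the two sides carry the two products in the cocycle identity at
  x, q, y; that identity is the associativity by which x on the left and y on the right may act in
  either order.\<close>

lemma left_right_commute:
  assumes "x \<in> carrier G" "y \<in> carrier G" "\<xi> \<in> l2 (carrier G)"
  shows "left_op x (right_op y \<xi>) = right_op y (left_op x \<xi>)"
proof
  fix p
  note L = bounded_ops_closed[OF left_op_bounded[OF assms(1)] assms(3)]
    bounded_ops_closed[OF right_op_bounded[OF assms(2)] assms(3)]
  show "left_op x (right_op y \<xi>) p = right_op y (left_op x \<xi>) p"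
  proof (cases "p \<in> carrier G")
    case True
    define q where "q = p \<otimes> inv x \<otimes> inv y"
    have q: "q \<in> carrier G" "p \<otimes> inv x = q \<otimes> y" "p \<otimes> inv y = x \<otimes> q" "q \<otimes> y \<otimes> inv y = q" "x \<otimes> q \<otimes> inv x = q"
    proof -
      show q0: "q \<in> carrier G" using assms True by (simp add: q_def)
      show "p \<otimes> inv x = q \<otimes> y" using inv_solve_right[of q "p \<otimes> inv x" y] q0 assms True q_def by simp
      have "q = p \<otimes> inv y \<otimes> inv x" using assms True by (simp add: q_def m_ac)
      then show "p \<otimes> inv y = x \<otimes> q"
        using inv_solve_right[of q "p \<otimes> inv y" x] q0 assms True m_comm[OF q0 assms(1)] by simp
      show "q \<otimes> y \<otimes> inv y = q" using q0 assms by (simp add: m_assoc)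
      show "x \<otimes> q \<otimes> inv x = q" using q0 assms by (simp add: m_comm[of x q] m_assoc)
    qed
    show ?thesis
      using assms True L sigma_cocycle[OF assms(1) q(1) assms(2)] q(1,4,5)
      by (simp add: left_op_apply right_op_apply q(2,3)) (simp add: mult.commute)
  qed (use assms L in \<open>simp add: left_op_outside right_op_outside\<close>)
qed

section \<open>The conjugation that exchanges left and right\<close>

lemma conj_inv_l2:
  assumes "\<xi> \<in> l2 (carrier G)"
  shows "conj_inv G \<xi> \<in> l2 (carrier G)"
proof (rule l2_boundI(1))
  fix F assume F: "finite F" "F \<subseteq> carrier G"
  have inj: "inj_on (\<lambda>p. inv p) F" by (rule inj_on_inverseI[where g = "\<lambda>p. inv p"]) (use F(2) in auto)
  have "(\<Sum>p\<in>F. (cmod (conj_inv G \<xi> p))\<^sup>2) = (\<Sum>p\<in>F. (cmod (\<xi> (inv p)))\<^sup>2)"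
    using F(2) by (intro sum.cong) (auto simp: conj_inv_def subset_iff)
  also have "\<dots> = (\<Sum>q\<in>(\<lambda>p. inv p) ` F. (cmod (\<xi> q))\<^sup>2)" by (simp add: sum.reindex[OF inj])
  finally have "L2_set (\<lambda>p. cmod (conj_inv G \<xi> p)) F = L2_set (\<lambda>q. cmod (\<xi> q)) ((\<lambda>p. inv p) ` F)"
    by (simp add: L2_set_def)
  also have "\<dots> \<le> l2_norm (carrier G) \<xi>" using F by (intro L2_set_le_l2_norm[OF assms]) auto
  finally show "L2_set (\<lambda>p. cmod (conj_inv G \<xi> p)) F \<le> l2_norm (carrier G) \<xi>" .
qed (auto simp: conj_inv_def)

text \<open>Since the adjoint of \<open>left_op x\<close> is \<open>left_op (inv x)\<close>, this
  says that conjugating the adjoint of a unitary by J gives right multiplication by that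
  unitary.\<close>

lemma conj_inv_left_op:
  assumes "x \<in> carrier G" "\<xi> \<in> l2 (carrier G)"
  shows "conj_inv G (left_op (inv x) (conj_inv G \<xi>)) = right_op x \<xi>"
proof
  fix p
  show "conj_inv G (left_op (inv x) (conj_inv G \<xi>)) p = right_op x \<xi> p"
  proof (cases "p \<in> carrier G")
    case True
    have "inv (inv p \<otimes> x) = p \<otimes> inv x" using True assms by (simp add: inv_mult_group m_comm)
    moreover have "cnj (\<sigma> (inv x, inv p \<otimes> x)) = \<sigma> (p \<otimes> inv x, x)"
      using True assms cnj_sigma[of "inv x" "inv p \<otimes> x"] by (simp add: inv_mult_group m_comm)
    ultimately show ?thesis
      using True assms conj_inv_l2[OF assms(2)]
      by (simp add: conj_inv_def[of _ "left_op (inv x) (conj_inv G \<xi>)"] left_op_apply right_op_apply)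
         (simp add: conj_inv_def)
  qed (use assms in \<open>simp add: conj_inv_def right_op_outside\<close>)
qed

text \<open>The vector at the identity is cyclic for the right translations, so an operator
  commuting with them is determined by its value there.\<close>

lemma right_op_delta_one: "q \<in> carrier G \<Longrightarrow> right_op q (delta \<one>) = delta q"
proof
  fix p assume q: "q \<in> carrier G"
  show "right_op q (delta \<one>) p = delta q p"
  proof (cases "p \<in> carrier G")
    case True
    then have "p \<otimes> inv q = \<one> \<longleftrightarrow> p = q" using q by (metis inv_solve_right' l_one one_closed)
    then show ?thesis using True q by (simp add: right_op_apply) (auto simp: delta_def sigma_one)
  qed (use q in \<open>simp add: right_op_outside, auto simp: delta_def\<close>)
qed

lemma left_op_delta_one: "q \<in> carrier G \<Longrightarrow> left_op q (delta \<one>) = delta q"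
proof
  fix p assume q: "q \<in> carrier G"
  show "left_op q (delta \<one>) p = delta q p"
  proof (cases "p \<in> carrier G")
    case True
    then have "p \<otimes> inv q = \<one> \<longleftrightarrow> p = q" using q by (metis inv_solve_right' l_one one_closed)
    then show ?thesis using True q by (simp add: left_op_apply) (auto simp: delta_def sigma_one)
  qed (use q in \<open>simp add: left_op_outside, auto simp: delta_def\<close>)
qed

text \<open>Commuting with all right translations characterizes the operators given by left twisted
  convolution; commuting with the projection onto l2 of H moreover confines the coefficients to H.
  The set to be commuted with is closed under adjoints, so both conditions extend from generators to
  the generated C*-algebra.\<close>

definition supported_commutant :: "'g set \<Rightarrow> (('g \<Rightarrow> complex) \<Rightarrow> 'g \<Rightarrow> complex) set" where
  "supported_commutant H =
     {T \<in> carrier (Bl2 (carrier G)). \<forall>S \<in> right_op ` carrier G \<union> {restrict_op (carrier G) H}.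
        T \<otimes>\<^bsub>Bl2 (carrier G)\<^esub> S = S \<otimes>\<^bsub>Bl2 (carrier G)\<^esub> T}"

lemma cstar_closed_supported_commutant: "cstar_closed (Bl2 (carrier G)) (supported_commutant H)"
proof -
  have "adjoint_op (carrier G) (restrict_op (carrier G) H) = restrict_op (carrier G) H"
    by (rule adjoint_op_eqI) (auto simp: restrict_op)
  then show ?thesis
    unfolding supported_commutant_def
    by (intro unital_cstar_algebra.cstar_closed_commutant unital_cstar_algebra_Bl2)
       (auto simp: right_op_bounded restrict_op adjoint_right_op)
qed

context
  fixes T H assumes T: "T \<in> supported_commutant H"
begin

lemma supported_commutant_bounded: "T \<in> bounded_ops (carrier G)"
  using T by (simp add: supported_commutant_def)

lemma supported_commutant_right_op:
  assumes "x \<in> carrier G" "\<xi> \<in> l2 (carrier G)"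
  shows "T (right_op x \<xi>) = right_op x (T \<xi>)"
proof -
  have "compose (l2 (carrier G)) T (right_op x) \<xi> = compose (l2 (carrier G)) (right_op x) T \<xi>"
    using T assms by (simp add: supported_commutant_def)
  then show ?thesis using assms by (simp add: compose_def)
qed

text \<open>The basis vector at q is the right translate of the one at the identity, so column q is
  the right translate of the column at the identity.\<close>

lemma supported_commutant_entry:
  assumes "m \<in> carrier G" "q \<in> carrier G"
  shows "entry T m q = \<sigma> (m \<otimes> inv q, q) * T (delta \<one>) (m \<otimes> inv q)"
proof -
  have "entry T m q = right_op q (T (delta \<one>)) m"
    using assms supported_commutant_right_op[of q "delta \<one>"] by (simp add: entry_def right_op_delta_one)
  then show ?thesis
    using assms bounded_ops_closed[OF supported_commutant_bounded, of "delta \<one>"] by (simp add: right_op_apply)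
qed

text \<open>The vector at the identity is fixed by the projection onto l2 of H, hence so is its
  image.\<close>

lemma supported_commutant_support:
  assumes "\<one> \<in> H" "p \<notin> H"
  shows "T (delta \<one>) p = 0"
proof -
  have "compose (l2 (carrier G)) T (restrict_op (carrier G) H) (delta \<one>) =
        compose (l2 (carrier G)) (restrict_op (carrier G) H) T (delta \<one>)"
    using T by (simp add: supported_commutant_def)
  moreover have "restrict_op (carrier G) H (delta \<one>) = delta \<one>"
    using assms(1) by (simp add: restrict_op_def fun_eq_iff) (auto simp: cutoff_def delta_def)
  ultimately have "T (delta \<one>) = restrict_op (carrier G) H (T (delta \<one>))" by (simp add: compose_def)
  moreover have "restrict_op (carrier G) H (T (delta \<one>)) = cutoff H (T (delta \<one>))"
    using bounded_ops_closed[OF supported_commutant_bounded, of "delta \<one>"] by (simp add: restrict_op_def)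
  ultimately show ?thesis using assms(2) by (metis cutoff_def)
qed

end

lemma left_op_supported_commutant:
  assumes H: "subgroup H G" and x: "x \<in> H"
  shows "left_op x \<in> supported_commutant H"
proof -
  interpret H: subgroup H G by fact
  have xG: "x \<in> carrier G" using x by simp
  have "left_op x (restrict_op (carrier G) H \<xi>) = restrict_op (carrier G) H (left_op x \<xi>)" if \<xi>: "\<xi> \<in> l2 (carrier G)" for \<xi>
  proof
    fix p
    note L = bounded_ops_closed[OF left_op_bounded[OF xG] \<xi>] bounded_ops_closed[OF restrict_op(1) \<xi>, of H]
    show "left_op x (restrict_op (carrier G) H \<xi>) p = restrict_op (carrier G) H (left_op x \<xi>) p"
    proof (cases "p \<in> carrier G")
      case True
      have "p \<otimes> inv x \<in> H \<longleftrightarrow> p \<in> H"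
      proof
        assume "p \<otimes> inv x \<in> H"
        then have "p \<otimes> inv x \<otimes> x \<in> H" using x by simp
        then show "p \<in> H" using True xG by (simp add: m_assoc)
      qed (use x in simp)
      then show ?thesis
        using True L \<xi> by (simp add: left_op_apply restrict_op_def cutoff_def)
    qed (use L \<xi> in \<open>simp add: left_op_outside restrict_op_def cutoff_def\<close>)
  qed
  then show ?thesis
    using xG by (auto simp: supported_commutant_def left_op_bounded compose_def left_right_commute intro!: restrict_ext)
qed

lemma twisted_group_algebra:
  defines "B \<equiv> twisted_group_algebra G \<sigma>"
  shows "unital_cstar_algebra B" "carrier B \<subseteq> bounded_ops (carrier G)"
    "B = Bl2 (carrier G)\<lparr>carrier := carrier B\<rparr>" "\<one>\<^bsub>Bl2 (carrier G)\<^esub> \<in> carrier B"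
    "cstar_closed (Bl2 (carrier G)) (carrier B)"
    "\<And>x. x \<in> carrier G \<Longrightarrow> left_op x \<in> carrier B"
proof -
  interpret M: unital_cstar_algebra "Bl2 (carrier G)" by (rule unital_cstar_algebra_Bl2)
  have X: "left_op ` carrier G \<subseteq> carrier (Bl2 (carrier G))" by (auto simp: left_op_bounded)
  have u: "left_op \<one> \<in> left_op ` carrier G"
    "cstar (Bl2 (carrier G)) (left_op \<one>) \<otimes>\<^bsub>Bl2 (carrier G)\<^esub> left_op \<one> = \<one>\<^bsub>Bl2 (carrier G)\<^esub>"
    by (auto simp: adjoint_left_op compose_def left_op_one intro!: restrict_ext)
  show "unital_cstar_algebra B" "\<one>\<^bsub>Bl2 (carrier G)\<^esub> \<in> carrier B"
    unfolding B_def twisted_group_algebra_def using M.unital_cstar_algebra_generated[OF X u] by auto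
  show "B = Bl2 (carrier G)\<lparr>carrier := carrier B\<rparr>"
    unfolding B_def twisted_group_algebra_def by (rule M.cstar_generated_eq)
  show "cstar_closed (Bl2 (carrier G)) (carrier B)" "\<And>x. x \<in> carrier G \<Longrightarrow> left_op x \<in> carrier B"
    unfolding B_def twisted_group_algebra_def using M.cstar_generated[OF X] by auto
  then show "carrier B \<subseteq> bounded_ops (carrier G)"
    by (simp add: cstar_closed_def M.closedin_iff)
qed

end

section \<open>The C*-algebra generated by the unitaries of a subgroup\<close>

lemma Bl2_subalgebra_minus:
  assumes "unital_cstar_algebra A" "A = Bl2 I\<lparr>carrier := carrier A\<rparr>" "carrier A \<subseteq> bounded_ops I"
    "S \<in> carrier A" "T \<in> carrier A"
  shows "S \<ominus>\<^bsub>A\<^esub> T = (\<lambda>\<xi>\<in>l2 I. \<lambda>i. S \<xi> i - T \<xi> i)"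
proof -
  interpret unital_cstar_algebra A by fact
  have r: "add A = add (Bl2 I)" "cscale A = cscale (Bl2 I)" by (subst assms(2), simp)+
  have "S \<ominus>\<^bsub>A\<^esub> T = S \<oplus>\<^bsub>A\<^esub> cscale A (-1) T" using a_inv_scale[OF assms(5)] by (simp add: a_minus_def)
  also have "\<dots> = (\<lambda>\<xi>\<in>l2 I. \<lambda>i. S \<xi> i - T \<xi> i)" unfolding r by (auto intro!: restrict_ext)
  finally show ?thesis .
qed

text \<open>Generation of H by X is expressed as minimality among subgroups, the form in which it is
  applied to the set of all h whose unitary lies in the algebra.\<close>

locale twisted_subgroup = twisted_group G \<sigma> + subgroup H G for G :: "'g monoid" (structure) and \<sigma> H +
  fixes X
  assumes X: "X \<subseteq> H" "X \<noteq> {}"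
    and X_generates: "\<And>K. subgroup K G \<Longrightarrow> X \<subseteq> K \<Longrightarrow> H \<subseteq> K"
begin

definition A :: "(('g \<Rightarrow> complex) \<Rightarrow> 'g \<Rightarrow> complex) cstar_algebra" where
  "A = cstar_generated (twisted_group_algebra G \<sigma>) (left_op ` X)"

text \<open>\<open>A_commutant\<close> bounds the algebra from above and \<open>A_left_op\<close>
  from below, which is how its elements are handled without an explicit description. In
  \<open>A_dense\<close> the set S need not lie in the algebra: its intersection with it is an
  adjoint-closed subalgebra containing the generators, so the closure of that intersection is
  everything.\<close>

lemma
  shows A_unital: "unital_cstar_algebra A"
    and A_Bl2: "A = Bl2 (carrier G)\<lparr>carrier := carrier A\<rparr>"
    and A_commutant: "carrier A \<subseteq> supported_commutant H"
    and A_bounded: "carrier A \<subseteq> bounded_ops (carrier G)"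
    and A_left_op: "\<And>h. h \<in> H \<Longrightarrow> left_op h \<in> carrier A"
    and A_dense: "\<And>S a \<epsilon>. left_op ` X \<subseteq> S \<Longrightarrow> S \<subseteq> bounded_ops (carrier G) \<Longrightarrow> \<zero>\<^bsub>Bl2 (carrier G)\<^esub> \<in> S \<Longrightarrow>
      (\<And>x y. x \<in> S \<Longrightarrow> y \<in> S \<Longrightarrow> x \<oplus>\<^bsub>Bl2 (carrier G)\<^esub> y \<in> S) \<Longrightarrow>
      (\<And>x y. x \<in> S \<Longrightarrow> y \<in> S \<Longrightarrow> x \<otimes>\<^bsub>Bl2 (carrier G)\<^esub> y \<in> S) \<Longrightarrow>
      (\<And>x. x \<in> S \<Longrightarrow> cstar (Bl2 (carrier G)) x \<in> S) \<Longrightarrow>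
      (\<And>x s. x \<in> S \<Longrightarrow> cscale (Bl2 (carrier G)) s x \<in> S) \<Longrightarrow>
      a \<in> carrier A \<Longrightarrow> \<epsilon> > 0 \<Longrightarrow> \<exists>b\<in>S \<inter> carrier A. bop_norm (carrier G) (\<lambda>\<xi>\<in>l2 (carrier G). \<lambda>i. a \<xi> i - b \<xi> i) < \<epsilon>"
proof -
  define B where "B = twisted_group_algebra G \<sigma>"
  note Bf = twisted_group_algebra[folded B_def]
  interpret B: unital_cstar_algebra B by (rule Bf)
  interpret M: unital_cstar_algebra "Bl2 (carrier G)" by (rule unital_cstar_algebra_Bl2)
  have XG: "X \<subseteq> carrier G" using X subset by blast
  have LX: "left_op ` X \<subseteq> carrier B" using XG Bf(6) by auto
  have ops: "monoid.mult B = monoid.mult (Bl2 (carrier G))" "add B = add (Bl2 (carrier G))" "one B = one (Bl2 (carrier G))"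
    "ring.zero B = ring.zero (Bl2 (carrier G))" "cstar B = cstar (Bl2 (carrier G))" "cscale B = cscale (Bl2 (carrier G))"
    "cnorm B = cnorm (Bl2 (carrier G))"
    by (subst Bf(3), simp)+
  have A: "A = cstar_generated B (left_op ` X)" by (simp add: A_def B_def)
  note gen = B.cstar_generated[OF LX, folded A]
  obtain x where x: "x \<in> X" using X(2) by auto
  have u: "left_op x \<in> left_op ` X" "cstar B (left_op x) \<otimes>\<^bsub>B\<^esub> left_op x = \<one>\<^bsub>B\<^esub>"
    using x XG by (auto simp: ops adjoint_left_op compose_def left_op_inv_left_op subset_iff intro!: restrict_ext)
  show AU: "unital_cstar_algebra A" unfolding A by (rule B.unital_cstar_algebra_generated(2)[OF LX u])
  have "A = B\<lparr>carrier := carrier A\<rparr>" unfolding A by (rule B.cstar_generated_eq)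
  then show A_eq: "A = Bl2 (carrier G)\<lparr>carrier := carrier A\<rparr>" by (subst (asm) Bf(3)) simp
  have AB: "carrier A \<subseteq> carrier B" using gen(3)[OF LX B.cstar_closed_carrier] .
  then show A_bdd: "carrier A \<subseteq> bounded_ops (carrier G)" using Bf(2) by blast
  have "cstar_closed B (supported_commutant H \<inter> carrier B)"
    using M.cstar_closed_Int_subalgebra[OF Bf(5,4) cstar_closed_supported_commutant] unfolding Bf(3)[symmetric] .
  then show "carrier A \<subseteq> supported_commutant H"
    using gen(3)[of "supported_commutant H \<inter> carrier B"] LX X(1) left_op_supported_commutant[OF subgroup_axioms] by blast
  have oneA: "\<one>\<^bsub>Bl2 (carrier G)\<^esub> \<in> carrier A"
    using B.unital_cstar_algebra_generated(1)[OF LX u] unfolding A ops .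
  have Acl: "x \<otimes>\<^bsub>Bl2 (carrier G)\<^esub> y \<in> carrier A" "x \<oplus>\<^bsub>Bl2 (carrier G)\<^esub> y \<in> carrier A"
    "cstar (Bl2 (carrier G)) x \<in> carrier A" "cscale (Bl2 (carrier G)) s x \<in> carrier A" "\<zero>\<^bsub>Bl2 (carrier G)\<^esub> \<in> carrier A"
    if "x \<in> carrier A" "y \<in> carrier A" for x y s
    using gen(1) that by (auto simp: cstar_closed_def ops)
  \<comment> \<open>The unitary of a product is a unimodular multiple of the product of the
    unitaries, so the h that qualify form a subgroup.\<close>
  have "subgroup {h \<in> carrier G. left_op h \<in> carrier A} G"
  proof (rule subgroupI)
    have "left_op \<one> = \<one>\<^bsub>Bl2 (carrier G)\<^esub>"
      by (rule bounded_ops_eqI) (auto simp: left_op_bounded left_op_one bounded_op_one)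
    then show "{h \<in> carrier G. left_op h \<in> carrier A} \<noteq> {}" using oneA by auto
    fix h assume h: "h \<in> {h \<in> carrier G. left_op h \<in> carrier A}"
    then show "inv h \<in> {h \<in> carrier G. left_op h \<in> carrier A}"
      using Acl(3)[of "left_op h" "left_op h"] by (simp add: adjoint_left_op)
    fix g assume g: "g \<in> {h \<in> carrier G. left_op h \<in> carrier A}"
    have "left_op (h \<otimes> g) = cscale (Bl2 (carrier G)) (cnj (\<sigma> (h, g))) (left_op h \<otimes>\<^bsub>Bl2 (carrier G)\<^esub> left_op g)"
    proof (rule bounded_ops_eqI[of _ "carrier G"])
      show "cscale (Bl2 (carrier G)) (cnj (\<sigma> (h, g))) (left_op h \<otimes>\<^bsub>Bl2 (carrier G)\<^esub> left_op g) \<in> bounded_ops (carrier G)"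
        unfolding Bl2_simps using h g by (intro bounded_op_cscale bounded_op_compose left_op_bounded) auto
    next
      fix \<xi> :: "'g \<Rightarrow> complex" assume "\<xi> \<in> l2 (carrier G)"
      then show "left_op (h \<otimes> g) \<xi> =
          cscale (Bl2 (carrier G)) (cnj (\<sigma> (h, g))) (left_op h \<otimes>\<^bsub>Bl2 (carrier G)\<^esub> left_op g) \<xi>"
        using h g sigma_mult_cnj[of h g]
        by (simp add: compose_def left_op_left_op) (simp add: mult.commute flip: mult.assoc)
    qed (use h g in \<open>simp add: left_op_bounded\<close>)
    then show "h \<otimes> g \<in> {h \<in> carrier G. left_op h \<in> carrier A}"
      using Acl(1)[of "left_op h" "left_op g"] Acl(4) h g by auto
  qed auto
  then show "left_op h \<in> carrier A" if "h \<in> H" for h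
    using X_generates[of "{h \<in> carrier G. left_op h \<in> carrier A}"] gen(2) XG that by blast
  fix S a and \<epsilon> :: real
  assume S: "left_op ` X \<subseteq> S" "S \<subseteq> bounded_ops (carrier G)" "\<zero>\<^bsub>Bl2 (carrier G)\<^esub> \<in> S"
      "\<And>x y. x \<in> S \<Longrightarrow> y \<in> S \<Longrightarrow> x \<oplus>\<^bsub>Bl2 (carrier G)\<^esub> y \<in> S"
      "\<And>x y. x \<in> S \<Longrightarrow> y \<in> S \<Longrightarrow> x \<otimes>\<^bsub>Bl2 (carrier G)\<^esub> y \<in> S"
      "\<And>x. x \<in> S \<Longrightarrow> cstar (Bl2 (carrier G)) x \<in> S" "\<And>x s. x \<in> S \<Longrightarrow> cscale (Bl2 (carrier G)) s x \<in> S"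
    and a: "a \<in> carrier A" "\<epsilon> > 0"
  have S': "S \<inter> carrier A \<subseteq> carrier B" using AB by auto
  \<comment> \<open>The closure is taken in B because minimality of A is known among the closed
    subalgebras of B.\<close>
  have "cstar_closed B (cstar_topology B closure_of (S \<inter> carrier A))"
    by (rule B.cstar_closed_closure[OF S'], unfold ops Int_iff)
       (simp_all only: S Acl(1,2) Acl(3,4)[OF _ oneA] Acl(5)[OF oneA oneA] simp_thms)
  moreover have "left_op ` X \<subseteq> cstar_topology B closure_of (S \<inter> carrier A)"
    using S(1) gen(2) closure_of_subset[of "S \<inter> carrier A" "cstar_topology B"] S' B.topspace_cstar by blast
  ultimately have "a \<in> cstar_topology B closure_of (S \<inter> carrier A)" using gen(3) a(1) by blast
  then obtain b where b: "b \<in> S \<inter> carrier A" "cnorm B (a \<ominus>\<^bsub>B\<^esub> b) < \<epsilon>"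
    using a(2) unfolding B.closure_of_iff[OF S'] by blast
  then show "\<exists>b\<in>S \<inter> carrier A. bop_norm (carrier G) (\<lambda>\<xi>\<in>l2 (carrier G). \<lambda>i. a \<xi> i - b \<xi> i) < \<epsilon>"
    using Bl2_subalgebra_minus[OF Bf(1,3,2) subsetD[OF AB a(1)] subsetD[OF AB IntD2[OF b(1)]]]
    by (intro bexI[of _ b]) (simp_all add: ops)
qed

end

section \<open>First-order operators on spinors\<close>

definition spinor_comp :: "'s \<Rightarrow> ('i \<Rightarrow> complex^'s) \<Rightarrow> 'i \<Rightarrow> complex" where
  "spinor_comp t \<xi> = (\<lambda>m. \<xi> m $ t)"

lemma has_sum_finite_sum:
  fixes f :: "'k \<Rightarrow> 'i \<Rightarrow> 'b::topological_comm_monoid_add"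
  assumes "\<And>k. k \<in> K \<Longrightarrow> (f k has_sum s k) A"
  shows "((\<lambda>i. \<Sum>k\<in>K. f k i) has_sum (\<Sum>k\<in>K. s k)) A"
  using assms by (induction K rule: infinite_finite_induct) (auto intro: has_sum_add)

lemma summable_on_finite_sum:
  fixes f :: "'k \<Rightarrow> 'i \<Rightarrow> 'b::topological_comm_monoid_add"
  assumes "\<And>k. k \<in> K \<Longrightarrow> f k summable_on A"
  shows "(\<lambda>i. \<Sum>k\<in>K. f k i) summable_on A"
  using assms by (induction K rule: infinite_finite_induct) (auto intro: summable_on_add)

lemma norm_le_sum_components: "norm (x :: complex^'s) \<le> (\<Sum>t\<in>UNIV. cmod (x $ t))"
  unfolding norm_vec_def by (rule L2_set_le_sum) auto

lemma l2_real_norm: "\<xi> \<in> l2 I \<Longrightarrow> (\<lambda>i. norm (\<xi> i)) \<in> l2 I"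
  by (simp add: l2_def)

lemma l2_components:
  fixes \<xi> :: "'i \<Rightarrow> complex^'s"
  shows "\<xi> \<in> l2 I \<longleftrightarrow> (\<forall>t. spinor_comp t \<xi> \<in> l2 I)"
    "\<xi> \<in> l2 I \<Longrightarrow> l2_norm I (spinor_comp t \<xi>) \<le> l2_norm I \<xi>"
    "\<xi> \<in> l2 I \<Longrightarrow> (l2_norm I \<xi>)\<^sup>2 = (\<Sum>t\<in>UNIV. (l2_norm I (spinor_comp t \<xi>))\<^sup>2)"
proof -
  have *: "spinor_comp t \<xi> \<in> l2 I \<and> l2_norm I (spinor_comp t \<xi>) \<le> 1 * l2_norm I \<xi>" if "\<xi> \<in> l2 I" for t
    using l2_dominated[OF that, of 1 "spinor_comp t \<xi>"] that
    by (auto simp: spinor_comp_def l2_outside norm_bound_component_le_cart intro: Finite_Cartesian_Product.norm_nth_le)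
  then show "\<xi> \<in> l2 I \<Longrightarrow> l2_norm I (spinor_comp t \<xi>) \<le> l2_norm I \<xi>" by auto
  have "\<xi> \<in> l2 I" if c: "\<forall>t. spinor_comp t \<xi> \<in> l2 I"
  proof -
    have "(\<lambda>m. \<Sum>t\<in>UNIV. cmod (spinor_comp t \<xi> m)) \<in> l2 I"
      using c by (intro l2_sum l2_real_norm) auto
    then show ?thesis
    proof (rule l2_dominated(1)[where c = 1])
      fix i show "norm (\<xi> i) \<le> 1 * norm (\<Sum>t\<in>UNIV. cmod (spinor_comp t \<xi> i))"
        using norm_le_sum_components[of "\<xi> i"] by (simp add: spinor_comp_def sum_nonneg abs_of_nonneg)
    next
      fix i assume "i \<notin> I"
      then show "\<xi> i = 0" using c l2_outside unfolding vec_eq_iff spinor_comp_def by fastforce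
    qed simp
  qed
  then show "\<xi> \<in> l2 I \<longleftrightarrow> (\<forall>t. spinor_comp t \<xi> \<in> l2 I)" using * by blast
  assume \<xi>: "\<xi> \<in> l2 I"
  have "(norm (\<xi> i))\<^sup>2 = (\<Sum>t\<in>UNIV. (cmod (spinor_comp t \<xi> i))\<^sup>2)" for i
    by (simp add: norm_vec_def L2_set_def sum_nonneg spinor_comp_def)
  then have "(l2_norm I \<xi>)\<^sup>2 = (\<Sum>\<^sub>\<infinity>i\<in>I. \<Sum>t\<in>UNIV. (cmod (spinor_comp t \<xi> i))\<^sup>2)"
    by (simp add: l2_norm_power2[OF \<xi>])
  also have "\<dots> = (\<Sum>t\<in>UNIV. \<Sum>\<^sub>\<infinity>i\<in>I. (cmod (spinor_comp t \<xi> i))\<^sup>2)"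
  proof (rule infsumI)
    show "((\<lambda>i. \<Sum>t\<in>UNIV. (cmod (spinor_comp t \<xi> i))\<^sup>2) has_sum (\<Sum>t\<in>UNIV. \<Sum>\<^sub>\<infinity>i\<in>I. (cmod (spinor_comp t \<xi> i))\<^sup>2)) I"
      by (rule has_sum_finite_sum) (use *[OF \<xi>] in \<open>auto simp: l2_def\<close>)
  qed
  also have "\<dots> = (\<Sum>t\<in>UNIV. (l2_norm I (spinor_comp t \<xi>))\<^sup>2)"
    using *[OF \<xi>] by (simp add: l2_norm_power2)
  finally show "(l2_norm I \<xi>)\<^sup>2 = (\<Sum>t\<in>UNIV. (l2_norm I (spinor_comp t \<xi>))\<^sup>2)" .
qed

lemma spinor_comp_amplify: "spinor_comp t (amplify T \<xi>) = T (spinor_comp t \<xi>)"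
  by (simp add: spinor_comp_def amplify_def)

text \<open>The operator acts on each spinor component separately and the squared norms of the
  components add, so no factor depending on the dimension appears.\<close>

lemma amplify_bounded:
  assumes a: "a \<in> bounded_ops I" and \<xi>: "\<xi> \<in> l2 I"
  shows "amplify a \<xi> \<in> l2 I" "l2_norm I (amplify a \<xi>) \<le> bop_norm I a * l2_norm I \<xi>"
proof -
  have c: "spinor_comp t \<xi> \<in> l2 I" for t using \<xi> l2_components(1) by blast
  then show 1: "amplify a \<xi> \<in> l2 I"
    unfolding l2_components(1)[of "amplify a \<xi>"] spinor_comp_amplify using bounded_ops_closed[OF a] by blast
  have "(l2_norm I (amplify a \<xi>))\<^sup>2 = (\<Sum>t\<in>UNIV. (l2_norm I (a (spinor_comp t \<xi>)))\<^sup>2)"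
    by (simp add: l2_components(3)[OF 1] spinor_comp_amplify)
  also have "\<dots> \<le> (\<Sum>t\<in>UNIV. (bop_norm I a * l2_norm I (spinor_comp t \<xi>))\<^sup>2)"
    by (intro sum_mono power_mono bop_norm_bound[OF a c]) auto
  also have "\<dots> = (bop_norm I a * l2_norm I \<xi>)\<^sup>2"
    by (simp add: power_mult_distrib l2_components(3)[OF \<xi>] sum_distrib_left)
  finally show "l2_norm I (amplify a \<xi>) \<le> bop_norm I a * l2_norm I \<xi>"
    by (rule power2_le_imp_le) (simp add: bop_norm_nonneg[OF a])
qed

section \<open>Domains of the coordinate derivations\<close>

definition dom1 :: "(nat \<Rightarrow> int) set \<Rightarrow> nat set \<Rightarrow> lat_fun set" where
  "dom1 I J = {\<xi> \<in> l2 I. \<forall>j\<in>J. tor_partial j \<xi> \<in> l2 I}"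

definition spinor_dom :: "(nat \<Rightarrow> int) set \<Rightarrow> nat set \<Rightarrow> ((nat \<Rightarrow> int) \<Rightarrow> complex^'s) set" where
  "spinor_dom I J = {\<xi>. \<forall>t. spinor_comp t \<xi> \<in> dom1 I J}"

text \<open>Convergence at each lattice point, with no control of norms. Combinations of
  translations respect it, and it is what survives a derivative: l2 convergence of \<xi> gives only
  pointwise convergence of its partial derivatives.\<close>

definition pointwise_continuous :: "(nat \<Rightarrow> int) set \<Rightarrow> (lat_fun \<Rightarrow> lat_fun) \<Rightarrow> bool" where
  "pointwise_continuous I T \<longleftrightarrow> (\<forall>\<xi>s \<xi> m. (\<forall>n::nat. \<xi>s n \<in> l2 I) \<and> \<xi> \<in> l2 I \<and>
     (\<forall>p. (\<lambda>n. \<xi>s n p) \<longlonglongrightarrow> \<xi> p) \<longrightarrow> (\<lambda>n. T (\<xi>s n) m) \<longlonglongrightarrow> T \<xi> m)"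

lemma weighted_summable_iff:
  fixes \<xi> :: "(nat \<Rightarrow> int) \<Rightarrow> complex^'s"
  assumes \<xi>: "\<xi> \<in> l2 I" and J: "finite J"
  shows "(\<lambda>m. (1 + (\<Sum>j\<in>J. (of_int (m j))\<^sup>2)) * (norm (\<xi> m))\<^sup>2) summable_on I \<longleftrightarrow>
     (\<forall>j\<in>J. (\<lambda>m. of_int (m j) *\<^sub>R \<xi> m) \<in> l2 I)"
proof -
  let ?w = "\<lambda>m. (1 + (\<Sum>j\<in>J. (of_int (m j))\<^sup>2)) * (norm (\<xi> m))\<^sup>2"
  have l: "(\<lambda>m. of_int (m j) *\<^sub>R \<xi> m) \<in> l2 I \<longleftrightarrow> (\<lambda>m. (of_int (m j))\<^sup>2 * (norm (\<xi> m))\<^sup>2) summable_on I" for j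
    using \<xi> by (auto simp: l2_def power_mult_distrib)
  show ?thesis
  proof
    assume s: "?w summable_on I"
    show "\<forall>j\<in>J. (\<lambda>m. of_int (m j) *\<^sub>R \<xi> m) \<in> l2 I"
      unfolding l
    proof
      fix j assume j: "j \<in> J"
      show "(\<lambda>m. (of_int (m j))\<^sup>2 * (norm (\<xi> m))\<^sup>2) summable_on I"
      proof (rule summable_on_comparison_test[OF s])
        fix m
        have "(real_of_int (m j))\<^sup>2 \<le> (\<Sum>j\<in>J. (of_int (m j))\<^sup>2)" using j J by (intro member_le_sum) auto
        then show "(of_int (m j))\<^sup>2 * (norm (\<xi> m))\<^sup>2 \<le> ?w m" by (intro mult_right_mono) auto
      qed auto
    qed
  next
    assume "\<forall>j\<in>J. (\<lambda>m. of_int (m j) *\<^sub>R \<xi> m) \<in> l2 I"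
    then have "(\<lambda>m. (\<Sum>j\<in>J. (of_int (m j))\<^sup>2 * (norm (\<xi> m))\<^sup>2)) summable_on I"
      unfolding l by (intro summable_on_finite_sum) auto
    then have "(\<lambda>m. (norm (\<xi> m))\<^sup>2 + (\<Sum>j\<in>J. (of_int (m j))\<^sup>2 * (norm (\<xi> m))\<^sup>2)) summable_on I"
      using \<xi> by (intro summable_on_add) (auto simp: l2_def)
    then show "?w summable_on I" by (simp add: distrib_right sum_distrib_right)
  qed
qed

text \<open>Turns the weighted summability in the domain of the Dirac operator into a condition on
  each scalar component, so that domains can be handled without spinors.\<close>

lemma spinor_dom_iff:
  assumes J: "finite J"
  shows "\<xi> \<in> spinor_dom I J \<longleftrightarrow> \<xi> \<in> l2 I \<and>
     (\<lambda>m. (1 + (\<Sum>j\<in>J. (of_int (m j))\<^sup>2)) * (norm (\<xi> m))\<^sup>2) summable_on I"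
proof -
  have p: "tor_partial j (spinor_comp t \<xi>) \<in> l2 I \<longleftrightarrow> spinor_comp t (\<lambda>m. of_int (m j) *\<^sub>R \<xi> m) \<in> l2 I" for j t
  proof -
    have "tor_partial j (spinor_comp t \<xi>) = (\<lambda>m. \<i> * spinor_comp t (\<lambda>m. of_int (m j) *\<^sub>R \<xi> m) m)"
      by (simp add: tor_partial_def spinor_comp_def fun_eq_iff) (simp add: scaleR_conv_of_real flip: mult.assoc)
    moreover have "spinor_comp t (\<lambda>m. of_int (m j) *\<^sub>R \<xi> m) = (\<lambda>m. (-\<i>) * tor_partial j (spinor_comp t \<xi>) m)"
      by (simp add: tor_partial_def spinor_comp_def fun_eq_iff) (simp add: scaleR_conv_of_real flip: mult.assoc)
    ultimately show ?thesis using l2_scale(1) by metis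
  qed
  have "\<xi> \<in> spinor_dom I J \<longleftrightarrow> \<xi> \<in> l2 I \<and> (\<forall>j\<in>J. (\<lambda>m. of_int (m j) *\<^sub>R \<xi> m) \<in> l2 I)"
    unfolding spinor_dom_def dom1_def l2_components(1) p[symmetric] by auto
  then show ?thesis using weighted_summable_iff[OF _ J] by blast
qed

lemma dom1_l2: "\<xi> \<in> dom1 I J \<Longrightarrow> \<xi> \<in> l2 I"
  by (simp add: dom1_def)

lemma dom1_partial: "\<xi> \<in> dom1 I J \<Longrightarrow> j \<in> J \<Longrightarrow> tor_partial j \<xi> \<in> l2 I"
  by (simp add: dom1_def)

lemma tor_partial_add: "tor_partial j (\<lambda>m. \<xi> m + \<eta> m) = (\<lambda>m. tor_partial j \<xi> m + tor_partial j \<eta> m)"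
  and tor_partial_scale: "tor_partial j (\<lambda>m. s * \<xi> m) = (\<lambda>m. s * tor_partial j \<xi> m)"
  by (simp_all add: tor_partial_def algebra_simps)

lemma dom1_add: "\<xi> \<in> dom1 I J \<Longrightarrow> \<eta> \<in> dom1 I J \<Longrightarrow> (\<lambda>m. \<xi> m + \<eta> m) \<in> dom1 I J"
  by (simp add: dom1_def l2_add tor_partial_add)

lemma dom1_scale: "\<xi> \<in> dom1 I J \<Longrightarrow> (\<lambda>m. s * \<xi> m) \<in> dom1 I J"
  by (simp add: dom1_def l2_scale tor_partial_scale)

lemma dom1_zero: "(\<lambda>_. 0) \<in> dom1 I J"
  by (simp add: dom1_def tor_partial_def)

lemma dom1_finite_support:
  assumes "finite F" "F \<subseteq> I" "\<And>m. m \<notin> F \<Longrightarrow> \<xi> m = 0"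
  shows "\<xi> \<in> dom1 I J"
  unfolding dom1_def
  using l2_norm_finite_support(1)[OF assms] l2_norm_finite_support(1)[OF assms(1,2), of "tor_partial _ \<xi>"] assms(3)
  by (auto simp: tor_partial_def)

lemma spinor_dom_comp: "\<xi> \<in> spinor_dom I J \<Longrightarrow> spinor_comp t \<xi> \<in> dom1 I J"
  by (simp add: spinor_dom_def)

lemma spinor_dom_l2: "\<xi> \<in> spinor_dom I J \<Longrightarrow> \<xi> \<in> l2 I"
  unfolding l2_components(1) using spinor_dom_comp dom1_l2 by blast

lemma amplify_spinor_dom_iff:
  fixes a :: "lat_fun \<Rightarrow> lat_fun"
  shows "amplify a ` (spinor_dom I J :: ((nat \<Rightarrow> int) \<Rightarrow> complex^'s) set) \<subseteq> spinor_dom I J \<longleftrightarrow> a ` dom1 I J \<subseteq> dom1 I J"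
proof
  assume *: "amplify a ` (spinor_dom I J :: ((nat \<Rightarrow> int) \<Rightarrow> complex^'s) set) \<subseteq> spinor_dom I J"
  show "a ` dom1 I J \<subseteq> dom1 I J"
  proof
    fix \<eta> assume "\<eta> \<in> a ` dom1 I J"
    then obtain \<xi> where \<xi>: "\<xi> \<in> dom1 I J" "\<eta> = a \<xi>" by auto
    \<comment> \<open>A spinor with every component equal to \<xi> tests a on \<xi> in all
      components at once.\<close>
    define \<zeta> :: "(nat \<Rightarrow> int) \<Rightarrow> complex^'s" where "\<zeta> m = (\<chi> t. \<xi> m)" for m
    have "spinor_comp t \<zeta> = \<xi>" for t by (simp add: spinor_comp_def \<zeta>_def)
    then have "\<zeta> \<in> spinor_dom I J" using \<xi> by (simp add: spinor_dom_def)
    then have "spinor_comp t (amplify a \<zeta>) \<in> dom1 I J" for t using * spinor_dom_comp by blast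
    then show "\<eta> \<in> dom1 I J" using \<xi>(2) \<open>\<And>t. spinor_comp t \<zeta> = \<xi>\<close> by (simp add: spinor_comp_amplify)
  qed
qed (auto simp: spinor_dom_def spinor_comp_amplify)

text \<open>What the analysis needs to know of the tori. Each \<Gamma> is bounded or a coefficient
  times a derivation, the coefficient commuting with the algebra; \<open>partial_from_Gamma\<close>
  inverts this, recovering every derivation from at most two of the \<Gamma>;
  \<open>gamma_independent\<close> is linear independence of the Clifford generators in quantitative
  form, tested on the spinor basis.\<close>

locale dirac =
  fixes I :: "(nat \<Rightarrow> int) set" and J N :: "nat set" and \<Gamma> :: "nat \<Rightarrow> lat_fun \<Rightarrow> lat_fun"
    and \<gamma> :: "nat \<Rightarrow> complex^'s^'s" and \<AA> :: "(lat_fun \<Rightarrow> lat_fun) set"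
  assumes fin: "finite J" "finite N"
    and AA: "\<AA> \<subseteq> bounded_ops I"
    and Gamma_cases: "\<And>i. i \<in> N \<Longrightarrow> \<exists>T\<in>bounded_ops I. (\<forall>\<xi>\<in>dom1 I J. \<Gamma> i \<xi> = T \<xi>) \<or>
        (pointwise_continuous I T \<and> (\<exists>j\<in>J. \<forall>\<xi>\<in>dom1 I J. \<Gamma> i \<xi> = T (tor_partial j \<xi>)) \<and>
         (\<forall>a\<in>\<AA>. \<forall>\<xi>\<in>l2 I. T (a \<xi>) = a (T \<xi>)))"
    and partial_from_Gamma: "\<And>j. j \<in> J \<Longrightarrow> \<exists>S\<^sub>1\<in>bounded_ops I. \<exists>S\<^sub>2\<in>bounded_ops I. \<exists>i\<^sub>1\<in>N. \<exists>i\<^sub>2\<in>N.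
        (\<forall>\<xi>\<in>dom1 I J. tor_partial j \<xi> = (\<lambda>m. S\<^sub>1 (\<Gamma> i\<^sub>1 \<xi>) m + S\<^sub>2 (\<Gamma> i\<^sub>2 \<xi>) m)) \<and>
        (\<forall>a\<in>\<AA>. \<forall>\<xi>\<in>l2 I. S\<^sub>1 (a \<xi>) = a (S\<^sub>1 \<xi>) \<and> S\<^sub>2 (a \<xi>) = a (S\<^sub>2 \<xi>))"
    and gamma_independent: "\<And>i z. i \<in> N \<Longrightarrow>
        (cmod (z i))\<^sup>2 \<le> (\<Sum>t\<in>UNIV. (norm (\<Sum>i\<in>N. \<gamma> i *v axis t (z i)))\<^sup>2)"
begin

abbreviation "V \<equiv> dom1 I J"
abbreviation "SV \<equiv> (spinor_dom I J :: ((nat \<Rightarrow> int) \<Rightarrow> complex^'s) set)"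

definition "Dirac \<xi> = (\<lambda>m. \<Sum>i\<in>N. \<gamma> i *v amplify (\<Gamma> i) \<xi> m)"

definition "Dirac_comm a \<xi> = (\<lambda>m. Dirac (amplify a \<xi>) m - amplify a (Dirac \<xi>) m)"

definition "comm i a \<xi> = (\<lambda>m. \<Gamma> i (a \<xi>) m - a (\<Gamma> i \<xi>) m)"

text \<open>Any admissible bound K is allowed, not only the smallest, and a need not be self-adjoint
  or belong to the algebra; sums, products and limits then require inequalities only.\<close>

definition "lip a K \<longleftrightarrow> a \<in> bounded_ops I \<and> 0 \<le> K \<and> a ` V \<subseteq> V \<and>
   (\<forall>\<xi>\<in>SV. l2_norm I (Dirac_comm a \<xi>) \<le> K * l2_norm I \<xi>)"

lemma Gamma_linear:
  assumes "i \<in> N" "\<xi> \<in> V"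
  shows "\<Gamma> i \<xi> \<in> l2 I" "\<eta> \<in> V \<Longrightarrow> \<Gamma> i (\<lambda>m. \<xi> m + \<eta> m) = (\<lambda>m. \<Gamma> i \<xi> m + \<Gamma> i \<eta> m)"
    "\<Gamma> i (\<lambda>m. s * \<xi> m) = (\<lambda>m. s * \<Gamma> i \<xi> m)"
proof -
  obtain T where T: "T \<in> bounded_ops I" "(\<forall>\<xi>\<in>V. \<Gamma> i \<xi> = T \<xi>) \<or> (\<exists>j\<in>J. \<forall>\<xi>\<in>V. \<Gamma> i \<xi> = T (tor_partial j \<xi>))"
    using Gamma_cases[OF assms(1)] by blast
  \<comment> \<open>E is the identity or a derivation, so that both kinds of \<Gamma> become a
    bounded operator after a linear map.\<close>
  then obtain E where E: "\<forall>\<xi>\<in>V. \<Gamma> i \<xi> = T (E \<xi>)" "E = id \<or> (\<exists>j\<in>J. E = tor_partial j)" by fastforce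
  have El: "E \<xi> \<in> l2 I" "E (\<lambda>m. \<xi> m + \<eta> m) = (\<lambda>m. E \<xi> m + E \<eta> m)" "E (\<lambda>m. s * \<xi> m) = (\<lambda>m. s * E \<xi> m)"
    if "\<xi> \<in> V" for \<xi> \<eta> s
    using E(2) that by (auto simp: dom1_l2 dom1_partial tor_partial_add tor_partial_scale)
  show "\<Gamma> i \<xi> \<in> l2 I" using E(1) assms(2) El(1) bounded_ops_closed[OF T(1)] by simp
  show "\<Gamma> i (\<lambda>m. \<xi> m + \<eta> m) = (\<lambda>m. \<Gamma> i \<xi> m + \<Gamma> i \<eta> m)" if "\<eta> \<in> V"
    using E(1) assms(2) that El bounded_ops_add[OF T(1)] dom1_add[OF assms(2) that] by simp
  show "\<Gamma> i (\<lambda>m. s * \<xi> m) = (\<lambda>m. s * \<Gamma> i \<xi> m)"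
    using E(1) assms(2) El bounded_ops_scale[OF T(1)] dom1_scale[OF assms(2)] by simp
qed

lemma Gamma_zero: "i \<in> N \<Longrightarrow> \<Gamma> i (\<lambda>_. 0) = (\<lambda>_. 0)"
  using Gamma_linear(3)[OF _ dom1_zero, of i 0] by simp

text \<open>As \<Gamma> may be unbounded, its values need not converge in norm; at a single lattice
  point they do, by norm continuity in the bounded case and by pointwise continuity of the
  coefficient in the other.\<close>

lemma Gamma_tendsto:
  assumes i: "i \<in> N" and \<xi>s: "\<And>n::nat. \<xi>s n \<in> V" "\<xi> \<in> V"
    and lim: "(\<lambda>n. l2_norm I (\<lambda>m. \<xi>s n m - \<xi> m)) \<longlonglongrightarrow> 0"
  shows "(\<lambda>n. \<Gamma> i (\<xi>s n) m) \<longlonglongrightarrow> \<Gamma> i \<xi> m"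
proof -
  have d: "(\<lambda>m. \<xi>s n m - \<xi> m) \<in> l2 I" for n using \<xi>s by (intro l2_diff dom1_l2)
  obtain T where T: "T \<in> bounded_ops I" "(\<forall>\<xi>\<in>V. \<Gamma> i \<xi> = T \<xi>) \<or>
     (pointwise_continuous I T \<and> (\<exists>j\<in>J. \<forall>\<xi>\<in>V. \<Gamma> i \<xi> = T (tor_partial j \<xi>)))"
    using Gamma_cases[OF i] by blast
  from T(2) show ?thesis
  proof
    assume eq: "\<forall>\<xi>\<in>V. \<Gamma> i \<xi> = T \<xi>"
    have "cmod (T (\<xi>s n) m - T \<xi> m) \<le> bop_norm I T * l2_norm I (\<lambda>m. \<xi>s n m - \<xi> m)" for n
    proof -
      have "T (\<xi>s n) m - T \<xi> m = T (\<lambda>m. \<xi>s n m - \<xi> m) m"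
        by (simp add: bounded_ops_diff[OF T(1) dom1_l2[OF \<xi>s(1)] dom1_l2[OF \<xi>s(2)]])
      then show ?thesis
        using order_trans[OF norm_le_l2_norm[OF bounded_ops_closed[OF T(1) d]] bop_norm_bound[OF T(1) d]]
        by simp
    qed
    then have "(\<lambda>n. T (\<xi>s n) m - T \<xi> m) \<longlonglongrightarrow> 0"
      by (intro Lim_null_comparison[OF _ tendsto_mult_right_zero[OF lim, of "bop_norm I T"]] always_eventually) auto
    then show ?thesis using eq \<xi>s by (simp add: LIM_zero_iff)
  next
    assume "pointwise_continuous I T \<and> (\<exists>j\<in>J. \<forall>\<xi>\<in>V. \<Gamma> i \<xi> = T (tor_partial j \<xi>))"
    then obtain j where pc: "pointwise_continuous I T" and j: "j \<in> J" and eq: "\<forall>\<xi>\<in>V. \<Gamma> i \<xi> = T (tor_partial j \<xi>)" by blast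
    have "(\<lambda>n. \<xi>s n p) \<longlonglongrightarrow> \<xi> p" for p
    proof -
      have "(\<lambda>n. \<xi>s n p - \<xi> p) \<longlonglongrightarrow> 0"
        by (rule Lim_null_comparison[OF always_eventually lim]) (use norm_le_l2_norm[OF d] in blast)
      then show ?thesis by (simp add: LIM_zero_iff)
    qed
    then have p: "(\<lambda>n. tor_partial j (\<xi>s n) p) \<longlonglongrightarrow> tor_partial j \<xi> p" for p
      unfolding tor_partial_def by (intro tendsto_mult_left)
    have "(\<lambda>n. T (tor_partial j (\<xi>s n)) m) \<longlonglongrightarrow> T (tor_partial j \<xi>) m"
      by (rule pc[unfolded pointwise_continuous_def, rule_format])
         (use p dom1_partial[OF \<xi>s(1) j] dom1_partial[OF \<xi>s(2) j] in blast)
    then show ?thesis using eq \<xi>s by simp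
  qed
qed

lemma spinor_comp_Dirac: "spinor_comp s (Dirac \<xi>) = (\<lambda>m. \<Sum>i\<in>N. \<Sum>t\<in>UNIV. \<gamma> i $ s $ t * \<Gamma> i (spinor_comp t \<xi>) m)"
  by (simp add: spinor_comp_def Dirac_def matrix_vector_mult_def amplify_def)

lemma Dirac_l2: "\<xi> \<in> SV \<Longrightarrow> Dirac \<xi> \<in> l2 I"
  unfolding l2_components(1) spinor_comp_Dirac
  using spinor_dom_comp by (intro allI l2_sum l2_scale Gamma_linear) auto

lemma amplify_SV: "a ` V \<subseteq> V \<Longrightarrow> \<xi> \<in> SV \<Longrightarrow> amplify a \<xi> \<in> SV"
  using amplify_spinor_dom_iff[where 's = 's, of a I J] by blast

lemma Dirac_comm_l2:
  assumes "a \<in> bounded_ops I" "a ` V \<subseteq> V" "\<xi> \<in> SV"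
  shows "Dirac_comm a \<xi> \<in> l2 I"
  unfolding Dirac_comm_def
  by (intro l2_diff Dirac_l2 amplify_SV amplify_bounded(1) assms)

text \<open>The operator a acts on the lattice factor and the Clifford matrices on the spinor
  factor, so they commute, and [D, a] is the sum of the \<gamma>_i tensored with
  [\<Gamma>_i, a].\<close>

lemma Dirac_comm_eq:
  assumes a: "a \<in> bounded_ops I" "a ` V \<subseteq> V" and \<xi>: "\<xi> \<in> SV"
  shows "Dirac_comm a \<xi> m = (\<Sum>i\<in>N. \<gamma> i *v (\<chi> t. comm i a (spinor_comp t \<xi>) m))"
proof (subst vec_eq_iff, rule allI)
  fix s
  have G: "\<Gamma> i (spinor_comp t \<xi>) \<in> l2 I" if "i \<in> N" for i t using Gamma_linear(1)[OF that] \<xi> by (simp add: spinor_dom_comp)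
  have "a (spinor_comp s (Dirac \<xi>)) = (\<lambda>m. \<Sum>i\<in>N. a (\<lambda>m. \<Sum>t\<in>UNIV. \<gamma> i $ s $ t * \<Gamma> i (spinor_comp t \<xi>) m) m)"
    unfolding spinor_comp_Dirac using G by (intro bounded_ops_sum[OF a(1) fin(2)] l2_sum l2_scale) auto
  also have "\<dots> = (\<lambda>m. \<Sum>i\<in>N. \<Sum>t\<in>UNIV. \<gamma> i $ s $ t * a (\<Gamma> i (spinor_comp t \<xi>)) m)"
  proof
    fix m
    have "a (\<lambda>m. \<Sum>t\<in>UNIV. \<gamma> i $ s $ t * \<Gamma> i (spinor_comp t \<xi>) m) = (\<lambda>m. \<Sum>t\<in>UNIV. \<gamma> i $ s $ t * a (\<Gamma> i (spinor_comp t \<xi>)) m)"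
      if "i \<in> N" for i
      using bounded_ops_sum[OF a(1) finite_class.finite_UNIV, of "\<lambda>t m. \<gamma> i $ s $ t * \<Gamma> i (spinor_comp t \<xi>) m"] G[OF that]
      by (simp add: l2_scale bounded_ops_scale[OF a(1)])
    then show "(\<Sum>i\<in>N. a (\<lambda>m. \<Sum>t\<in>UNIV. \<gamma> i $ s $ t * \<Gamma> i (spinor_comp t \<xi>) m) m) =
        (\<Sum>i\<in>N. \<Sum>t\<in>UNIV. \<gamma> i $ s $ t * a (\<Gamma> i (spinor_comp t \<xi>)) m)" by simp
  qed
  finally have 1: "amplify a (Dirac \<xi>) m $ s = (\<Sum>i\<in>N. \<Sum>t\<in>UNIV. \<gamma> i $ s $ t * a (\<Gamma> i (spinor_comp t \<xi>)) m)"
    by (metis spinor_comp_amplify spinor_comp_def)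
  have 2: "Dirac (amplify a \<xi>) m $ s = (\<Sum>i\<in>N. \<Sum>t\<in>UNIV. \<gamma> i $ s $ t * \<Gamma> i (a (spinor_comp t \<xi>)) m)"
    using spinor_comp_Dirac[of s "amplify a \<xi>"] by (simp add: spinor_comp_amplify) (simp add: spinor_comp_def fun_eq_iff)
  show "Dirac_comm a \<xi> m $ s = (\<Sum>i\<in>N. \<gamma> i *v (\<chi> t. comm i a (spinor_comp t \<xi>) m)) $ s"
    by (simp add: Dirac_comm_def 1 2 matrix_vector_mult_def comm_def right_diff_distrib sum_subtractf)
qed

text \<open>\<open>lip_comm_bound\<close> sums squares over as many test spinors as the spinor space
  has dimensions; this is the resulting constant.\<close>

definition "\<kappa> = sqrt (CARD('s))"

text \<open>Inserting \<xi> tensored with each basis spinor into [D, a] and adding squares bounds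
  every single commutator, by \<open>gamma_independent\<close> at each lattice point.\<close>

lemma lip_comm_bound:
  assumes a: "lip a K" and i: "i \<in> N" and \<xi>: "\<xi> \<in> V"
  shows "comm i a \<xi> \<in> l2 I" "l2_norm I (comm i a \<xi>) \<le> \<kappa> * K * l2_norm I \<xi>"
proof -
  have aB: "a \<in> bounded_ops I" "0 \<le> K" "a ` V \<subseteq> V" using a by (auto simp: lip_def)
  have cl: "comm j a \<xi> \<in> l2 I" if "j \<in> N" for j
    unfolding comm_def using aB \<xi> that by (intro l2_diff Gamma_linear bounded_ops_closed[OF aB(1)]) auto
  then show "comm i a \<xi> \<in> l2 I" using i .
  define \<zeta> where "\<zeta> t m = (axis t (\<xi> m) :: complex^'s)" for t m
  have c\<zeta>: "spinor_comp s (\<zeta> t) = (if s = t then \<xi> else (\<lambda>_. 0))" for s t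
    by (auto simp: spinor_comp_def \<zeta>_def axis_def fun_eq_iff)
  have \<zeta>: "\<zeta> t \<in> SV" for t unfolding spinor_dom_def using \<xi> dom1_zero by (auto simp: c\<zeta>)
  have "(l2_norm I (\<zeta> t))\<^sup>2 = (\<Sum>s\<in>UNIV. if s = t then (l2_norm I \<xi>)\<^sup>2 else 0)" for t
    unfolding l2_components(3)[OF spinor_dom_l2[OF \<zeta>]] by (intro sum.cong) (auto simp: c\<zeta>)
  then have n\<zeta>: "(l2_norm I (\<zeta> t))\<^sup>2 = (l2_norm I \<xi>)\<^sup>2" for t by simp
  have c0: "comm j a (\<lambda>_. 0) = (\<lambda>_. 0)" if "j \<in> N" for j
    by (simp add: comm_def bounded_ops_zero[OF aB(1)] Gamma_zero[OF that])
  have D: "Dirac_comm a (\<zeta> t) m = (\<Sum>j\<in>N. \<gamma> j *v axis t (comm j a \<xi> m))" for t m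
    unfolding Dirac_comm_eq[OF aB(1,3) \<zeta>]
    by (intro sum.cong refl arg_cong[of _ _ "\<lambda>x. _ *v x"]) (auto simp: vec_eq_iff c\<zeta> axis_def c0)
  have Dl: "Dirac_comm a (\<zeta> t) \<in> l2 I" for t by (rule Dirac_comm_l2[OF aB(1,3) \<zeta>])
  have "(cmod (comm i a \<xi> m))\<^sup>2 \<le> (\<Sum>t\<in>UNIV. (norm (Dirac_comm a (\<zeta> t) m))\<^sup>2)" for m
    unfolding D using gamma_independent[OF i, of "\<lambda>j. comm j a \<xi> m"] by simp
  then have "(l2_norm I (comm i a \<xi>))\<^sup>2 \<le> (\<Sum>\<^sub>\<infinity>m\<in>I. \<Sum>t\<in>UNIV. (norm (Dirac_comm a (\<zeta> t) m))\<^sup>2)"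
    unfolding l2_norm_power2[OF cl[OF i]]
    using cl[OF i] Dl by (intro infsum_mono summable_on_finite_sum) (auto simp: l2_def)
  also have "\<dots> = (\<Sum>t\<in>UNIV. \<Sum>\<^sub>\<infinity>m\<in>I. (norm (Dirac_comm a (\<zeta> t) m))\<^sup>2)"
  proof (rule infsumI)
    show "((\<lambda>m. \<Sum>t\<in>UNIV. (norm (Dirac_comm a (\<zeta> t) m))\<^sup>2) has_sum (\<Sum>t\<in>UNIV. \<Sum>\<^sub>\<infinity>m\<in>I. (norm (Dirac_comm a (\<zeta> t) m))\<^sup>2)) I"
      by (rule has_sum_finite_sum) (use Dl in \<open>auto simp: l2_def\<close>)
  qed
  also have "\<dots> = (\<Sum>t\<in>(UNIV :: 's set). (l2_norm I (Dirac_comm a (\<zeta> t)))\<^sup>2)"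
    by (simp add: l2_norm_power2[OF Dl])
  also have "\<dots> \<le> (\<Sum>t\<in>(UNIV :: 's set). (K * l2_norm I (\<zeta> t))\<^sup>2)"
    using a \<zeta> by (intro sum_mono power_mono) (auto simp: lip_def)
  also have "\<dots> = (\<kappa> * K * l2_norm I \<xi>)\<^sup>2" by (simp add: power_mult_distrib n\<zeta> \<kappa>_def)
  finally show "l2_norm I (comm i a \<xi>) \<le> \<kappa> * K * l2_norm I \<xi>"
    by (rule power2_le_imp_le) (simp add: aB \<kappa>_def)
qed

text \<open>A converse of \<open>lip_comm_bound\<close> with a crude constant; it serves to show
  that the unitaries satisfy \<open>lip\<close> with some bound.\<close>

lemma lip_if_comm_bounded:
  assumes a: "a \<in> bounded_ops I" "a ` V \<subseteq> V"
    and b: "\<And>i. i \<in> N \<Longrightarrow> \<exists>B. \<forall>\<xi>\<in>V. l2_norm I (comm i a \<xi>) \<le> B * l2_norm I \<xi>"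
  shows "\<exists>K. lip a K"
proof -
  obtain B where B: "\<And>i \<xi>. i \<in> N \<Longrightarrow> \<xi> \<in> V \<Longrightarrow> l2_norm I (comm i a \<xi>) \<le> B i * l2_norm I \<xi>"
    using b by metis
  have B': "l2_norm I (comm i a \<xi>) \<le> \<bar>B i\<bar> * l2_norm I \<xi>" if "i \<in> N" "\<xi> \<in> V" for i \<xi>
    using B[OF that] mult_right_mono[OF abs_ge_self l2_norm_nonneg] by (rule order_trans)
  define K where "K = (\<Sum>s\<in>(UNIV::'s set). \<Sum>i\<in>N. \<Sum>t\<in>(UNIV::'s set). cmod (\<gamma> i $ s $ t) * \<bar>B i\<bar>)"
  have "l2_norm I (Dirac_comm a \<xi>) \<le> K * l2_norm I \<xi>" if \<xi>: "\<xi> \<in> SV" for \<xi>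
  proof -
    have cl: "comm i a (spinor_comp t \<xi>) \<in> l2 I" if "i \<in> N" for i t
      unfolding comm_def using a spinor_dom_comp[OF \<xi>, of t] that by (intro l2_diff Gamma_linear bounded_ops_closed[OF a(1)]) auto
    have Dl: "Dirac_comm a \<xi> \<in> l2 I" by (rule Dirac_comm_l2[OF a \<xi>])
    have spinor_comp: "spinor_comp s (Dirac_comm a \<xi>) = (\<lambda>m. \<Sum>i\<in>N. \<Sum>t\<in>UNIV. \<gamma> i $ s $ t * comm i a (spinor_comp t \<xi>) m)" for s
      by (rule ext) (simp add: spinor_comp_def[of s "Dirac_comm a \<xi>"] Dirac_comm_eq[OF a \<xi>] matrix_vector_mult_def)
    have "l2_norm I (spinor_comp s (Dirac_comm a \<xi>)) \<le> (\<Sum>i\<in>N. \<Sum>t\<in>UNIV. cmod (\<gamma> i $ s $ t) * \<bar>B i\<bar>) * l2_norm I \<xi>" for s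
    proof -
      have "l2_norm I (spinor_comp s (Dirac_comm a \<xi>)) \<le> (\<Sum>i\<in>N. l2_norm I (\<lambda>m. \<Sum>t\<in>UNIV. \<gamma> i $ s $ t * comm i a (spinor_comp t \<xi>) m))"
        unfolding spinor_comp using cl by (intro l2_sum l2_scale) auto
      also have "\<dots> \<le> (\<Sum>i\<in>N. \<Sum>t\<in>UNIV. l2_norm I (\<lambda>m. \<gamma> i $ s $ t * comm i a (spinor_comp t \<xi>) m))"
        using cl by (intro sum_mono l2_sum l2_scale) auto
      also have "\<dots> \<le> (\<Sum>i\<in>N. \<Sum>t\<in>UNIV. cmod (\<gamma> i $ s $ t) * (\<bar>B i\<bar> * l2_norm I \<xi>))"
      proof (intro sum_mono)
        fix i t assume i: "i \<in> N"
        have "l2_norm I (comm i a (spinor_comp t \<xi>)) \<le> \<bar>B i\<bar> * l2_norm I (spinor_comp t \<xi>)"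
          by (rule B'[OF i spinor_dom_comp[OF \<xi>]])
        also have "\<dots> \<le> \<bar>B i\<bar> * l2_norm I \<xi>"
          by (intro mult_left_mono l2_components(2) spinor_dom_l2[OF \<xi>]) auto
        finally show "l2_norm I (\<lambda>m. \<gamma> i $ s $ t * comm i a (spinor_comp t \<xi>) m) \<le> cmod (\<gamma> i $ s $ t) * (\<bar>B i\<bar> * l2_norm I \<xi>)"
          using l2_scale(2)[OF cl[OF i]] by (simp add: mult_left_mono)
      qed
      finally show ?thesis by (simp add: sum_distrib_right mult.assoc)
    qed
    then have "(\<Sum>s\<in>(UNIV::'s set). l2_norm I (spinor_comp s (Dirac_comm a \<xi>))) \<le> K * l2_norm I \<xi>"
      unfolding K_def sum_distrib_right[of _ UNIV] by (intro sum_mono) auto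
    moreover have "l2_norm I (Dirac_comm a \<xi>) \<le> (\<Sum>s\<in>(UNIV::'s set). l2_norm I (spinor_comp s (Dirac_comm a \<xi>)))"
    proof -
      have "l2_norm I (Dirac_comm a \<xi>) = L2_set (\<lambda>s. l2_norm I (spinor_comp s (Dirac_comm a \<xi>))) UNIV"
        using l2_components(3)[OF Dl] l2_norm_nonneg[of I "Dirac_comm a \<xi>"] unfolding L2_set_def
        by (metis real_sqrt_unique)
      then show ?thesis using L2_set_le_sum[of UNIV "\<lambda>s. l2_norm I (spinor_comp s (Dirac_comm a \<xi>))"] by simp
    qed
    ultimately show ?thesis by simp
  qed
  moreover have "0 \<le> K" unfolding K_def by (intro sum_nonneg) auto
  ultimately have "lip a K" using a by (simp add: lip_def)
  then show ?thesis by blast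
qed

text \<open>As \<open>S\<^sub>1\<close> and \<open>S\<^sub>2\<close> commute with a, the formula for
  the derivation is inherited by commutators: its commutator with a is the same combination of the
  two commutators with \<Gamma>. Summing the constants over the finite set J makes C uniform in
  j.\<close>

lemma lip_partial_bound: "\<exists>C\<ge>0. \<forall>j\<in>J. \<forall>a\<in>\<AA>. \<forall>K. lip a K \<longrightarrow>
    (\<forall>\<xi>\<in>V. l2_norm I (\<lambda>m. tor_partial j (a \<xi>) m - a (tor_partial j \<xi>) m) \<le> C * K * l2_norm I \<xi>)"
proof -
  have "\<exists>C\<ge>0. \<forall>a\<in>\<AA>. \<forall>K. lip a K \<longrightarrow>
    (\<forall>\<xi>\<in>V. l2_norm I (\<lambda>m. tor_partial j (a \<xi>) m - a (tor_partial j \<xi>) m) \<le> C * K * l2_norm I \<xi>)"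
    if j: "j \<in> J" for j
  proof -
    obtain S\<^sub>1 S\<^sub>2 i\<^sub>1 i\<^sub>2 where S: "S\<^sub>1 \<in> bounded_ops I" "S\<^sub>2 \<in> bounded_ops I" "i\<^sub>1 \<in> N" "i\<^sub>2 \<in> N"
      and eq: "\<forall>\<xi>\<in>V. tor_partial j \<xi> = (\<lambda>m. S\<^sub>1 (\<Gamma> i\<^sub>1 \<xi>) m + S\<^sub>2 (\<Gamma> i\<^sub>2 \<xi>) m)"
      and com: "\<forall>a\<in>\<AA>. \<forall>\<xi>\<in>l2 I. S\<^sub>1 (a \<xi>) = a (S\<^sub>1 \<xi>) \<and> S\<^sub>2 (a \<xi>) = a (S\<^sub>2 \<xi>)"
      using partial_from_Gamma[OF j] by blast
    have *: "l2_norm I (\<lambda>m. tor_partial j (a \<xi>) m - a (tor_partial j \<xi>) m) \<le>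
        ((bop_norm I S\<^sub>1 + bop_norm I S\<^sub>2) * \<kappa>) * K * l2_norm I \<xi>"
      if a: "a \<in> \<AA>" and lip: "lip a K" and \<xi>: "\<xi> \<in> V" for a K \<xi>
    proof -
      have aB: "a \<in> bounded_ops I" "a \<xi> \<in> V" using lip \<xi> by (auto simp: lip_def)
      note G = Gamma_linear(1)[OF S(3) \<xi>] Gamma_linear(1)[OF S(4) \<xi>] Gamma_linear(1)[OF S(3) aB(2)] Gamma_linear(1)[OF S(4) aB(2)]
      note c = lip_comm_bound[OF lip S(3) \<xi>] lip_comm_bound[OF lip S(4) \<xi>]
      have split: "(\<lambda>m. tor_partial j (a \<xi>) m - a (tor_partial j \<xi>) m) = (\<lambda>m. S\<^sub>1 (comm i\<^sub>1 a \<xi>) m + S\<^sub>2 (comm i\<^sub>2 a \<xi>) m)"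
      proof -
        have "a (tor_partial j \<xi>) = (\<lambda>m. S\<^sub>1 (a (\<Gamma> i\<^sub>1 \<xi>)) m + S\<^sub>2 (a (\<Gamma> i\<^sub>2 \<xi>)) m)"
          using eq \<xi> com a G by (simp add: bounded_ops_add[OF aB(1)] bounded_ops_closed[OF S(1)] bounded_ops_closed[OF S(2)])
        moreover have "S\<^sub>1 (comm i\<^sub>1 a \<xi>) = (\<lambda>m. S\<^sub>1 (\<Gamma> i\<^sub>1 (a \<xi>)) m - S\<^sub>1 (a (\<Gamma> i\<^sub>1 \<xi>)) m)"
          "S\<^sub>2 (comm i\<^sub>2 a \<xi>) = (\<lambda>m. S\<^sub>2 (\<Gamma> i\<^sub>2 (a \<xi>)) m - S\<^sub>2 (a (\<Gamma> i\<^sub>2 \<xi>)) m)"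
          unfolding comm_def using G by (auto intro!: bounded_ops_diff[OF S(1)] bounded_ops_diff[OF S(2)] bounded_ops_closed[OF aB(1)])
        ultimately show ?thesis using bspec[OF eq aB(2)] by (simp only:) (simp add: algebra_simps)
      qed
      have "l2_norm I (\<lambda>m. S\<^sub>1 (comm i\<^sub>1 a \<xi>) m + S\<^sub>2 (comm i\<^sub>2 a \<xi>) m) \<le> l2_norm I (S\<^sub>1 (comm i\<^sub>1 a \<xi>)) + l2_norm I (S\<^sub>2 (comm i\<^sub>2 a \<xi>))"
        by (rule l2_add(2)[OF bounded_ops_closed[OF S(1) c(1)] bounded_ops_closed[OF S(2) c(3)]])
      also have "\<dots> \<le> bop_norm I S\<^sub>1 * (\<kappa> * K * l2_norm I \<xi>) + bop_norm I S\<^sub>2 * (\<kappa> * K * l2_norm I \<xi>)"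
        using order_trans[OF bop_norm_bound[OF S(1) c(1)] mult_left_mono[OF c(2) bop_norm_nonneg[OF S(1)]]]
          order_trans[OF bop_norm_bound[OF S(2) c(3)] mult_left_mono[OF c(4) bop_norm_nonneg[OF S(2)]]] by (rule add_mono)
      finally show ?thesis unfolding split by (simp add: algebra_simps)
    qed
    have 0: "0 \<le> (bop_norm I S\<^sub>1 + bop_norm I S\<^sub>2) * \<kappa>"
      using bop_norm_nonneg[OF S(1)] bop_norm_nonneg[OF S(2)] by (simp add: \<kappa>_def)
    show ?thesis
      by (rule exI[of _ "(bop_norm I S\<^sub>1 + bop_norm I S\<^sub>2) * \<kappa>"]) (intro conjI ballI allI impI 0 *)
  qed
  then have "\<forall>j\<in>J. \<exists>C\<ge>0. \<forall>a\<in>\<AA>. \<forall>K. lip a K \<longrightarrow>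
    (\<forall>\<xi>\<in>V. l2_norm I (\<lambda>m. tor_partial j (a \<xi>) m - a (tor_partial j \<xi>) m) \<le> C * K * l2_norm I \<xi>)"
    by (intro ballI)
  from bchoice[OF this] obtain C where C0: "\<forall>j\<in>J. 0 \<le> C j \<and> (\<forall>a\<in>\<AA>. \<forall>K. lip a K \<longrightarrow>
    (\<forall>\<xi>\<in>V. l2_norm I (\<lambda>m. tor_partial j (a \<xi>) m - a (tor_partial j \<xi>) m) \<le> C j * K * l2_norm I \<xi>))" ..
  have C: "0 \<le> C j" "\<And>a K \<xi>. a \<in> \<AA> \<Longrightarrow> lip a K \<Longrightarrow> \<xi> \<in> V \<Longrightarrow>
     l2_norm I (\<lambda>m. tor_partial j (a \<xi>) m - a (tor_partial j \<xi>) m) \<le> C j * K * l2_norm I \<xi>" if "j \<in> J" for j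
    using bspec[OF C0 that] by blast+
  have "l2_norm I (\<lambda>m. tor_partial j (a \<xi>) m - a (tor_partial j \<xi>) m) \<le> sum C J * K * l2_norm I \<xi>"
    if "j \<in> J" "a \<in> \<AA>" "lip a K" "\<xi> \<in> V" for j a K \<xi>
  proof -
    have "C j \<le> sum C J" using C(1) that(1) fin by (intro member_le_sum) auto
    moreover have "0 \<le> K" using that(3) by (simp add: lip_def)
    ultimately have "C j * K * l2_norm I \<xi> \<le> sum C J * K * l2_norm I \<xi>" by (intro mult_right_mono) auto
    then show ?thesis using C(2)[OF that] by (rule order_trans[rotated])
  qed
  note b = this
  have 0: "0 \<le> sum C J" using C(1) by (intro sum_nonneg) auto
  show ?thesis by (rule exI[of _ "sum C J"]) (intro conjI ballI allI impI 0 b)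
qed

section \<open>Calculus of elements with bounded Dirac commutator\<close>

lemma lipD: "lip a K \<Longrightarrow> a \<in> bounded_ops I" "lip a K \<Longrightarrow> 0 \<le> K" "lip a K \<Longrightarrow> a ` V \<subseteq> V"
  "lip a K \<Longrightarrow> \<xi> \<in> SV \<Longrightarrow> l2_norm I (Dirac_comm a \<xi>) \<le> K * l2_norm I \<xi>"
  by (auto simp: lip_def)

lemma lip_maps_dom: "lip a K \<Longrightarrow> \<xi> \<in> V \<Longrightarrow> a \<xi> \<in> V"
  using lipD(3) by blast

lemma lip_mono: "lip a K \<Longrightarrow> K \<le> L \<Longrightarrow> lip a L"
  unfolding lip_def using mult_right_mono[OF _ l2_norm_nonneg] by (meson order_trans)

lemma lip_add:
  assumes a: "lip a K" and b: "lip b L"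
  shows "lip (a \<oplus>\<^bsub>Bl2 I\<^esub> b) (K + L)"
proof -
  let ?c = "a \<oplus>\<^bsub>Bl2 I\<^esub> b"
  have c: "?c \<xi> = (\<lambda>m. a \<xi> m + b \<xi> m)" if "\<xi> \<in> l2 I" for \<xi> using that by simp
  have cB: "?c \<in> bounded_ops I" using bounded_op_plus(1)[OF lipD(1)[OF a] lipD(1)[OF b]] by simp
  have cV: "?c ` V \<subseteq> V"
    by (rule image_subsetI) (simp only: c[OF dom1_l2] dom1_add[OF lip_maps_dom[OF a] lip_maps_dom[OF b]])
  have comm: "comm i ?c \<xi> m = comm i a \<xi> m + comm i b \<xi> m" if "i \<in> N" "\<xi> \<in> V" for i \<xi> m
    by (simp add: comm_def dom1_l2[OF that(2)] Gamma_linear(1)[OF that]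
        Gamma_linear(2)[OF that(1) lip_maps_dom[OF a that(2)] lip_maps_dom[OF b that(2)]])
  have "l2_norm I (Dirac_comm ?c \<xi>) \<le> (K + L) * l2_norm I \<xi>" if \<xi>: "\<xi> \<in> SV" for \<xi>
  proof -
    have eq: "Dirac_comm ?c \<xi> = (\<lambda>m. Dirac_comm a \<xi> m + Dirac_comm b \<xi> m)"
    proof
      fix m
      have "(\<chi> t. comm i ?c (spinor_comp t \<xi>) m) = (\<chi> t. comm i a (spinor_comp t \<xi>) m) + (\<chi> t. comm i b (spinor_comp t \<xi>) m)" if "i \<in> N" for i
        by (simp only: vec_eq_iff vec_lambda_beta vector_add_component comm[OF that spinor_dom_comp[OF \<xi>]] simp_thms)
      then show "Dirac_comm ?c \<xi> m = Dirac_comm a \<xi> m + Dirac_comm b \<xi> m"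
        unfolding Dirac_comm_eq[OF cB cV \<xi>] Dirac_comm_eq[OF lipD(1,3)[OF a] \<xi>] Dirac_comm_eq[OF lipD(1,3)[OF b] \<xi>]
        by (simp add: matrix_vector_right_distrib sum.distrib)
    qed
    have "l2_norm I (\<lambda>m. Dirac_comm a \<xi> m + Dirac_comm b \<xi> m) \<le> l2_norm I (Dirac_comm a \<xi>) + l2_norm I (Dirac_comm b \<xi>)"
      by (rule l2_add(2)[OF Dirac_comm_l2[OF lipD(1,3)[OF a] \<xi>] Dirac_comm_l2[OF lipD(1,3)[OF b] \<xi>]])
    then show ?thesis unfolding eq using lipD(4)[OF a \<xi>] lipD(4)[OF b \<xi>] by (simp add: distrib_right)
  qed
  then show ?thesis using cB cV lipD(2)[OF a] lipD(2)[OF b] by (simp add: lip_def)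
qed

lemma lip_scale:
  assumes a: "lip a K"
  shows "lip (cscale (Bl2 I) s a) (cmod s * K)"
proof -
  let ?c = "cscale (Bl2 I) s a"
  have c: "?c \<xi> = (\<lambda>m. s * a \<xi> m)" if "\<xi> \<in> l2 I" for \<xi> using that by simp
  have cB: "?c \<in> bounded_ops I" using bounded_op_cscale(1)[OF lipD(1)[OF a]] by simp
  have cV: "?c ` V \<subseteq> V"
    by (rule image_subsetI) (simp only: c[OF dom1_l2] dom1_scale[OF lip_maps_dom[OF a]])
  have comm: "comm i ?c \<xi> m = s * comm i a \<xi> m" if "i \<in> N" "\<xi> \<in> V" for i \<xi> m
    by (simp add: comm_def dom1_l2[OF that(2)] Gamma_linear(1)[OF that]
        Gamma_linear(3)[OF that(1) lip_maps_dom[OF a that(2)]] right_diff_distrib)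
  have "l2_norm I (Dirac_comm ?c \<xi>) \<le> (cmod s * K) * l2_norm I \<xi>" if \<xi>: "\<xi> \<in> SV" for \<xi>
  proof -
    have eq: "Dirac_comm ?c \<xi> m = s *s Dirac_comm a \<xi> m" for m
    proof -
      have "(\<chi> t. comm i ?c (spinor_comp t \<xi>) m) = s *s (\<chi> t. comm i a (spinor_comp t \<xi>) m)" if "i \<in> N" for i
        by (simp only: vec_eq_iff vec_lambda_beta vector_smult_component comm[OF that spinor_dom_comp[OF \<xi>]] simp_thms)
      then show ?thesis
        unfolding Dirac_comm_eq[OF cB cV \<xi>] Dirac_comm_eq[OF lipD(1,3)[OF a] \<xi>]
        by (simp add: vector_scalar_commute vec.scale_sum_right)
    qed
    have n: "norm (s *s x) = cmod s * norm x" for x :: "complex^'s"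
      unfolding norm_vec_def by (simp add: norm_mult L2_set_right_distrib)
    have "l2_norm I (Dirac_comm ?c \<xi>) \<le> cmod s * l2_norm I (Dirac_comm a \<xi>)"
    proof (rule l2_dominated(2)[OF Dirac_comm_l2[OF lipD(1,3)[OF a] \<xi>] norm_ge_zero])
      show "Dirac_comm ?c \<xi> i = 0" if "i \<notin> I" for i
        unfolding eq l2_outside[OF Dirac_comm_l2[OF lipD(1,3)[OF a] \<xi>] that] by simp
      show "norm (Dirac_comm ?c \<xi> i) \<le> cmod s * norm (Dirac_comm a \<xi> i)" for i by (simp only: eq n)
    qed
    also have "\<dots> \<le> cmod s * (K * l2_norm I \<xi>)" by (intro mult_left_mono lipD(4)[OF a \<xi>]) auto
    finally show ?thesis by (simp add: mult.assoc)
  qed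
  then show ?thesis using cB cV lipD(2)[OF a] by (simp add: lip_def)
qed

lemma amplify_diff:
  assumes "a \<in> bounded_ops I" "\<xi> \<in> l2 I" "\<eta> \<in> l2 I"
  shows "amplify a (\<lambda>m. \<xi> m - \<eta> m) = (\<lambda>m. amplify a \<xi> m - amplify a \<eta> m)"
proof -
  have c: "spinor_comp t \<xi> \<in> l2 I" "spinor_comp t \<eta> \<in> l2 I" for t using assms(2,3) l2_components(1) by blast+
  have "spinor_comp t (amplify a (\<lambda>m. \<xi> m - \<eta> m)) = spinor_comp t (\<lambda>m. amplify a \<xi> m - amplify a \<eta> m)" for t
  proof -
    have "spinor_comp t (amplify a (\<lambda>m. \<xi> m - \<eta> m)) = a (\<lambda>m. spinor_comp t \<xi> m - spinor_comp t \<eta> m)"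
      by (simp add: spinor_comp_amplify) (simp add: spinor_comp_def)
    also have "\<dots> = (\<lambda>m. a (spinor_comp t \<xi>) m - a (spinor_comp t \<eta>) m)" by (rule bounded_ops_diff[OF assms(1) c])
    finally show ?thesis by (simp flip: spinor_comp_amplify) (simp add: spinor_comp_def)
  qed
  then show ?thesis by (simp add: spinor_comp_def fun_eq_iff vec_eq_iff)
qed

text \<open>The Leibniz rule [D, a b] = [D, a] b + a [D, b]; the intermediate vector b \<xi> is
  admissible because b preserves the domain.\<close>

lemma lip_mult:
  assumes a: "lip a K" and b: "lip b L"
  shows "lip (a \<otimes>\<^bsub>Bl2 I\<^esub> b) (bop_norm I a * L + K * bop_norm I b)"
proof -
  let ?c = "a \<otimes>\<^bsub>Bl2 I\<^esub> b"
  note aB = lipD(1)[OF a] and bB = lipD(1)[OF b]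
  have c: "?c \<xi> = a (b \<xi>)" if "\<xi> \<in> l2 I" for \<xi> using that by (simp add: compose_def)
  have cB: "?c \<in> bounded_ops I" using bounded_op_compose(1)[OF aB bB] by simp
  have cV: "?c ` V \<subseteq> V"
    by (rule image_subsetI) (simp only: c[OF dom1_l2] lip_maps_dom[OF a lip_maps_dom[OF b]])
  have amp: "amplify ?c \<xi> = amplify a (amplify b \<xi>)" if "\<xi> \<in> l2 I" for \<xi> :: "(nat \<Rightarrow> int) \<Rightarrow> complex^'s"
  proof -
    have "spinor_comp t (amplify ?c \<xi>) = spinor_comp t (amplify a (amplify b \<xi>))" for t
      using that l2_components(1)[of \<xi> I] c by (simp only: spinor_comp_amplify)
    then show ?thesis by (simp add: spinor_comp_def fun_eq_iff vec_eq_iff)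
  qed
  have "l2_norm I (Dirac_comm ?c \<xi>) \<le> (bop_norm I a * L + K * bop_norm I b) * l2_norm I \<xi>" if \<xi>: "\<xi> \<in> SV" for \<xi>
  proof -
    note b\<xi> = amplify_SV[OF lipD(3)[OF b] \<xi>]
    have l: "Dirac (amplify b \<xi>) \<in> l2 I" "amplify b (Dirac \<xi>) \<in> l2 I"
      using Dirac_l2[OF b\<xi>] amplify_bounded(1)[OF bB Dirac_l2[OF \<xi>]] by auto
    have eq: "Dirac_comm ?c \<xi> = (\<lambda>m. Dirac_comm a (amplify b \<xi>) m + amplify a (Dirac_comm b \<xi>) m)"
      unfolding Dirac_comm_def amp[OF spinor_dom_l2[OF \<xi>]] amp[OF Dirac_l2[OF \<xi>]] amplify_diff[OF aB l]
      by (rule ext) simp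
    have l': "Dirac_comm a (amplify b \<xi>) \<in> l2 I" "Dirac_comm b \<xi> \<in> l2 I"
      using Dirac_comm_l2[OF lipD(1,3)[OF a] b\<xi>] Dirac_comm_l2[OF lipD(1,3)[OF b] \<xi>] by auto
    have "l2_norm I (\<lambda>m. Dirac_comm a (amplify b \<xi>) m + amplify a (Dirac_comm b \<xi>) m) \<le>
        l2_norm I (Dirac_comm a (amplify b \<xi>)) + l2_norm I (amplify a (Dirac_comm b \<xi>))"
      by (rule l2_add(2)[OF l'(1) amplify_bounded(1)[OF aB l'(2)]])
    also have "\<dots> \<le> K * (bop_norm I b * l2_norm I \<xi>) + bop_norm I a * (L * l2_norm I \<xi>)"
    proof (rule add_mono)
      show "l2_norm I (Dirac_comm a (amplify b \<xi>)) \<le> K * (bop_norm I b * l2_norm I \<xi>)"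
        using lipD(4)[OF a b\<xi>] mult_left_mono[OF amplify_bounded(2)[OF bB spinor_dom_l2[OF \<xi>]] lipD(2)[OF a]]
        by linarith
      show "l2_norm I (amplify a (Dirac_comm b \<xi>)) \<le> bop_norm I a * (L * l2_norm I \<xi>)"
        using amplify_bounded(2)[OF aB l'(2)] mult_left_mono[OF lipD(4)[OF b \<xi>] bop_norm_nonneg[OF aB]]
        by linarith
    qed
    finally show ?thesis unfolding eq by (simp add: algebra_simps)
  qed
  then show ?thesis
    using cB cV lipD(2)[OF a] lipD(2)[OF b] bop_norm_nonneg[OF aB] bop_norm_nonneg[OF bB] by (simp add: lip_def)
qed

lemma lip_zero: "lip \<zero>\<^bsub>Bl2 I\<^esub> 0"
proof -
  have 0: "\<zero>\<^bsub>Bl2 I\<^esub> \<in> bounded_ops I" by (simp add: bounded_op_zero)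
  have V: "\<zero>\<^bsub>Bl2 I\<^esub> ` V \<subseteq> V" using dom1_l2 dom1_zero by fastforce
  have c: "comm i \<zero>\<^bsub>Bl2 I\<^esub> \<xi> m = 0" if "i \<in> N" "\<xi> \<in> V" for i \<xi> m
    using Gamma_zero[OF that(1)] Gamma_linear(1)[OF that] dom1_l2[OF that(2)] by (simp add: comm_def)
  have "Dirac_comm \<zero>\<^bsub>Bl2 I\<^esub> \<xi> = (\<lambda>_. 0)" if "\<xi> \<in> SV" for \<xi>
  proof
    fix m
    have "(\<chi> t. comm i \<zero>\<^bsub>Bl2 I\<^esub> (spinor_comp t \<xi>) m) = 0" if "i \<in> N" for i
      by (simp only: vec_eq_iff vec_lambda_beta zero_index c[OF that spinor_dom_comp[OF \<open>\<xi> \<in> SV\<close>]] simp_thms)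
    then show "Dirac_comm \<zero>\<^bsub>Bl2 I\<^esub> \<xi> m = 0" unfolding Dirac_comm_eq[OF 0 V that] by simp
  qed
  then show ?thesis using 0 V by (simp add: lip_def)
qed

text \<open>Lower semicontinuity. Approximants with the same K converge in norm to a, and the
  estimates pass to the limit on finite sets of lattice points, where pointwise convergence is
  enough. That a preserves the domain has to be shown first, from the uniform bounds on the
  commutators with derivations; only then is [D, a] defined on the whole domain.\<close>

lemma lip_closed:
  assumes a: "a \<in> bounded_ops I" and K: "0 \<le> K"
    and lim: "\<And>\<epsilon>. \<epsilon> > 0 \<Longrightarrow> \<exists>b\<in>\<AA>. lip b K \<and> bop_norm I (\<lambda>\<xi>\<in>l2 I. \<lambda>i. a \<xi> i - b \<xi> i) < \<epsilon>"
  shows "lip a K"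
proof -
  obtain C where C: "C \<ge> 0" "\<forall>j\<in>J. \<forall>a\<in>\<AA>. \<forall>K. lip a K \<longrightarrow>
    (\<forall>\<xi>\<in>V. l2_norm I (\<lambda>m. tor_partial j (a \<xi>) m - a (tor_partial j \<xi>) m) \<le> C * K * l2_norm I \<xi>)"
    using lip_partial_bound by blast
  have "\<forall>n. \<exists>b. b \<in> \<AA> \<and> lip b K \<and> bop_norm I (\<lambda>\<xi>\<in>l2 I. \<lambda>i. a \<xi> i - b \<xi> i) < 1 / real (Suc n)"
  proof
    fix n
    show "\<exists>b. b \<in> \<AA> \<and> lip b K \<and> bop_norm I (\<lambda>\<xi>\<in>l2 I. \<lambda>i. a \<xi> i - b \<xi> i) < 1 / real (Suc n)"
      using lim[of "1 / real (Suc n)"] by auto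
  qed
  from choice[OF this] obtain b where
    "\<forall>n. b n \<in> \<AA> \<and> lip (b n) K \<and> bop_norm I (\<lambda>\<xi>\<in>l2 I. \<lambda>i. a \<xi> i - b n \<xi> i) < 1 / real (Suc n)" ..
  then have b: "\<And>n. b n \<in> \<AA>" "\<And>n. lip (b n) K"
    "\<And>n. bop_norm I (\<lambda>\<xi>\<in>l2 I. \<lambda>i. a \<xi> i - b n \<xi> i) < 1 / real (Suc n)" by auto
  note bB = lipD(1)[OF b(2)]
  have dB: "(\<lambda>\<xi>\<in>l2 I. \<lambda>i. a \<xi> i - b n \<xi> i) \<in> bounded_ops I" for n
    using ring.ring_simprules(4)[OF ring_Bl2, of a I "b n"] a bB[of n] by (simp add: Bl2_minus)
  have dn: "l2_norm I (\<lambda>m. b n \<xi> m - a \<xi> m) \<le> 1 / real (Suc n) * l2_norm I \<xi>" if \<xi>: "\<xi> \<in> l2 I" for n \<xi>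
  proof -
    have "l2_norm I (\<lambda>m. a \<xi> m - b n \<xi> m) \<le> bop_norm I (\<lambda>\<xi>\<in>l2 I. \<lambda>i. a \<xi> i - b n \<xi> i) * l2_norm I \<xi>"
      using bop_norm_bound[OF dB[of n] \<xi>] \<xi> by simp
    also have "\<dots> \<le> 1 / real (Suc n) * l2_norm I \<xi>"
      by (rule mult_right_mono[OF less_imp_le[OF b(3)] l2_norm_nonneg])
    finally show ?thesis by (simp add: l2_norm_minus_commute)
  qed
  have dn0: "(\<lambda>n. l2_norm I (\<lambda>m. b n \<xi> m - a \<xi> m)) \<longlonglongrightarrow> 0" if \<xi>: "\<xi> \<in> l2 I" for \<xi>
  proof (rule Lim_null_comparison[OF always_eventually])
    show "\<forall>n. norm (l2_norm I (\<lambda>m. b n \<xi> m - a \<xi> m)) \<le> 1 / real (Suc n) * l2_norm I \<xi>" using dn[OF \<xi>] by simp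
    show "(\<lambda>n. 1 / real (Suc n) * l2_norm I \<xi>) \<longlonglongrightarrow> 0"
      by (intro tendsto_mult_left_zero) (use LIMSEQ_inverse_real_of_nat in \<open>simp add: inverse_eq_divide\<close>)
  qed
  have pt: "(\<lambda>n. b n \<xi> m) \<longlonglongrightarrow> a \<xi> m" if \<xi>: "\<xi> \<in> l2 I" for \<xi> m
  proof -
    have "(\<lambda>n. b n \<xi> m - a \<xi> m) \<longlonglongrightarrow> 0"
      by (rule Lim_null_comparison[OF always_eventually dn0[OF \<xi>]])
         (use norm_le_l2_norm[OF l2_diff(1)[OF bounded_ops_closed[OF bB \<xi>] bounded_ops_closed[OF a \<xi>]]] in blast)
    then show ?thesis by (simp add: LIM_zero_iff)
  qed
  have nb: "l2_norm I (b n \<xi>) \<le> (bop_norm I a + 1) * l2_norm I \<xi>" if \<xi>: "\<xi> \<in> l2 I" for n \<xi>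
  proof -
    have "l2_norm I (\<lambda>m. (b n \<xi> m - a \<xi> m) + a \<xi> m) \<le> l2_norm I (\<lambda>m. b n \<xi> m - a \<xi> m) + l2_norm I (a \<xi>)"
      by (rule l2_add(2)[OF l2_diff(1)[OF bounded_ops_closed[OF bB \<xi>] bounded_ops_closed[OF a \<xi>]] bounded_ops_closed[OF a \<xi>]])
    also have "\<dots> \<le> 1 * l2_norm I \<xi> + bop_norm I a * l2_norm I \<xi>"
      using dn[OF \<xi>, of n] bop_norm_bound[OF a \<xi>] mult_right_mono[of "1 / real (Suc n)" 1 "l2_norm I \<xi>"] by auto
    finally show ?thesis by (simp add: algebra_simps)
  qed
  have aV: "a ` V \<subseteq> V"
  proof
    fix \<eta> assume "\<eta> \<in> a ` V"
    then obtain \<xi> where \<xi>: "\<xi> \<in> V" "\<eta> = a \<xi>" by auto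
    have "tor_partial j (a \<xi>) \<in> l2 I" if j: "j \<in> J" for j
    proof (rule l2_boundI(1))
      \<comment> \<open>Bounds the derivative of b \<xi>, split into the commutator of the
        derivation with b and b applied to the derivative of \<xi>. It does not depend on n, since
        every approximant has norm at most that of a plus 1.\<close>
      let ?M = "C * K * l2_norm I \<xi> + (bop_norm I a + 1) * l2_norm I (tor_partial j \<xi>)"
      fix F assume F: "finite F" "F \<subseteq> I"
      have pl: "tor_partial j \<xi> \<in> l2 I" "\<And>n. tor_partial j (b n \<xi>) \<in> l2 I"
        using \<xi> j lip_maps_dom[OF b(2)] by (auto intro: dom1_partial)
      have bd: "l2_norm I (tor_partial j (b n \<xi>)) \<le> ?M" for n
      proof -
        have "l2_norm I (\<lambda>m. (tor_partial j (b n \<xi>) m - b n (tor_partial j \<xi>) m) + b n (tor_partial j \<xi>) m)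
            \<le> l2_norm I (\<lambda>m. tor_partial j (b n \<xi>) m - b n (tor_partial j \<xi>) m) + l2_norm I (b n (tor_partial j \<xi>))"
          by (rule l2_add(2)[OF l2_diff(1)[OF pl(2) bounded_ops_closed[OF bB pl(1)]] bounded_ops_closed[OF bB pl(1)]])
        moreover have "l2_norm I (\<lambda>m. tor_partial j (b n \<xi>) m - b n (tor_partial j \<xi>) m) \<le> C * K * l2_norm I \<xi>"
          using C(2) j b \<xi>(1) by blast
        ultimately show ?thesis using nb[OF pl(1), of n] by simp
      qed
      show "L2_set (\<lambda>m. norm (tor_partial j (a \<xi>) m)) F \<le> ?M"
      proof (rule LIMSEQ_le_const2)
        have t: "(\<lambda>n. tor_partial j (b n \<xi>) m) \<longlonglongrightarrow> tor_partial j (a \<xi>) m" for m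
          unfolding tor_partial_def by (intro tendsto_mult_left pt dom1_l2[OF \<xi>(1)])
        show "(\<lambda>n. L2_set (\<lambda>m. norm (tor_partial j (b n \<xi>) m)) F) \<longlonglongrightarrow> L2_set (\<lambda>m. norm (tor_partial j (a \<xi>) m)) F"
          unfolding L2_set_def by (intro tendsto_intros t)
        show "\<exists>N. \<forall>n\<ge>N. L2_set (\<lambda>m. norm (tor_partial j (b n \<xi>) m)) F \<le> ?M"
          using order_trans[OF L2_set_le_l2_norm[OF pl(2) F] bd] by blast
      qed
    next
      fix m assume "m \<notin> I"
      then show "tor_partial j (a \<xi>) m = 0"
        using bounded_ops_outside[OF a dom1_l2[OF \<xi>(1)]] by (simp add: tor_partial_def)
    qed
    then show "\<eta> \<in> V" using \<xi> bounded_ops_closed[OF a dom1_l2] by (simp add: dom1_def)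
  qed
  have "l2_norm I (Dirac_comm a \<xi>) \<le> K * l2_norm I \<xi>" if \<xi>: "\<xi> \<in> SV" for \<xi>
  proof (rule l2_boundI(2))
    fix m assume "m \<notin> I"
    then show "Dirac_comm a \<xi> m = 0" using l2_outside[OF Dirac_comm_l2[OF a aV \<xi>]] by blast
  next
    fix F assume F: "finite F" "F \<subseteq> I"
    have c: "(\<lambda>n. comm i (b n) (spinor_comp t \<xi>) m) \<longlonglongrightarrow> comm i a (spinor_comp t \<xi>) m" if i: "i \<in> N" for i t m
    proof -
      note \<xi>t = spinor_dom_comp[OF \<xi>, of t]
      have "(\<lambda>n. \<Gamma> i (b n (spinor_comp t \<xi>)) m) \<longlonglongrightarrow> \<Gamma> i (a (spinor_comp t \<xi>)) m"
        by (rule Gamma_tendsto[OF i]) (use lip_maps_dom[OF b(2) \<xi>t] aV \<xi>t dn0[OF dom1_l2[OF \<xi>t]] in auto)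
      then show ?thesis unfolding comm_def by (intro tendsto_diff pt Gamma_linear(1)[OF i \<xi>t])
    qed
    have t: "(\<lambda>n. Dirac_comm (b n) \<xi> m) \<longlonglongrightarrow> Dirac_comm a \<xi> m" for m
      unfolding Dirac_comm_eq[OF a aV \<xi>] Dirac_comm_eq[OF bB lipD(3)[OF b(2)] \<xi>] matrix_vector_mult_def
      by (intro tendsto_sum tendsto_vec_lambda tendsto_mult_left) (simp add: c)
    show "L2_set (\<lambda>m. norm (Dirac_comm a \<xi> m)) F \<le> K * l2_norm I \<xi>"
    proof (rule LIMSEQ_le_const2)
      show "(\<lambda>n. L2_set (\<lambda>m. norm (Dirac_comm (b n) \<xi> m)) F) \<longlonglongrightarrow> L2_set (\<lambda>m. norm (Dirac_comm a \<xi> m)) F"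
        unfolding L2_set_def by (intro tendsto_intros t)
      show "\<exists>N. \<forall>n\<ge>N. L2_set (\<lambda>m. norm (Dirac_comm (b n) \<xi> m)) F \<le> K * l2_norm I \<xi>"
        using order_trans[OF L2_set_le_l2_norm[OF Dirac_comm_l2[OF bB lipD(3)[OF b(2)] \<xi>] F] lipD(4)[OF b(2) \<xi>]] by blast
    qed
  qed
  then show ?thesis using a K aV by (simp add: lip_def)
qed

text \<open>The hypothesis says that the derivation has commutator s_j a with a. A \<Gamma> of first
  order with coefficient T then has commutator s_j T a, and a bounded \<Gamma> has a bounded
  commutator with every bounded operator.\<close>

lemma lip_if_partial_eigenvector:
  assumes a: "a \<in> \<AA>"
    and eig: "\<And>j \<xi>. j \<in> J \<Longrightarrow> \<xi> \<in> V \<Longrightarrow> tor_partial j (a \<xi>) = (\<lambda>m. a (tor_partial j \<xi>) m + s j * a \<xi> m)"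
  shows "\<exists>K. lip a K"
proof (rule lip_if_comm_bounded)
  show aB: "a \<in> bounded_ops I" using a AA by blast
  show aV: "a ` V \<subseteq> V"
  proof
    fix \<eta> assume "\<eta> \<in> a ` V"
    then obtain \<xi> where \<xi>: "\<xi> \<in> V" "\<eta> = a \<xi>" by auto
    have "tor_partial j (a \<xi>) \<in> l2 I" if "j \<in> J" for j
      unfolding eig[OF that \<xi>(1)]
      by (intro l2_add(1) l2_scale(1) bounded_ops_closed[OF aB] dom1_l2[OF \<xi>(1)] dom1_partial[OF \<xi>(1) that])
    then show "\<eta> \<in> V" using \<xi> bounded_ops_closed[OF aB dom1_l2] by (simp add: dom1_def)
  qed
  fix i assume i: "i \<in> N"
  obtain T where T: "T \<in> bounded_ops I" and cases: "(\<forall>\<xi>\<in>V. \<Gamma> i \<xi> = T \<xi>) \<or>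
     ((\<exists>j\<in>J. \<forall>\<xi>\<in>V. \<Gamma> i \<xi> = T (tor_partial j \<xi>)) \<and> (\<forall>a\<in>\<AA>. \<forall>\<xi>\<in>l2 I. T (a \<xi>) = a (T \<xi>)))"
    using Gamma_cases[OF i] by blast
  from cases show "\<exists>B. \<forall>\<xi>\<in>V. l2_norm I (comm i a \<xi>) \<le> B * l2_norm I \<xi>"
  proof
    assume eq: "\<forall>\<xi>\<in>V. \<Gamma> i \<xi> = T \<xi>"
    have "l2_norm I (comm i a \<xi>) \<le> (2 * bop_norm I T * bop_norm I a) * l2_norm I \<xi>" if \<xi>: "\<xi> \<in> V" for \<xi>
    proof -
      have "l2_norm I (\<lambda>m. T (a \<xi>) m - a (T \<xi>) m) \<le> l2_norm I (T (a \<xi>)) + l2_norm I (a (T \<xi>))"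
        by (rule l2_diff(2)[OF bounded_ops_closed[OF T bounded_ops_closed[OF aB dom1_l2[OF \<xi>]]]
              bounded_ops_closed[OF aB bounded_ops_closed[OF T dom1_l2[OF \<xi>]]]])
      also have "\<dots> \<le> bop_norm I T * (bop_norm I a * l2_norm I \<xi>) + bop_norm I a * (bop_norm I T * l2_norm I \<xi>)"
        using order_trans[OF bop_norm_bound[OF T bounded_ops_closed[OF aB dom1_l2[OF \<xi>]]]
            mult_left_mono[OF bop_norm_bound[OF aB dom1_l2[OF \<xi>]] bop_norm_nonneg[OF T]]]
          order_trans[OF bop_norm_bound[OF aB bounded_ops_closed[OF T dom1_l2[OF \<xi>]]]
            mult_left_mono[OF bop_norm_bound[OF T dom1_l2[OF \<xi>]] bop_norm_nonneg[OF aB]]]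
        by (rule add_mono)
      finally show ?thesis using eq \<xi> aV by (simp add: comm_def image_subset_iff algebra_simps)
    qed
    then show ?thesis by blast
  next
    assume "(\<exists>j\<in>J. \<forall>\<xi>\<in>V. \<Gamma> i \<xi> = T (tor_partial j \<xi>)) \<and> (\<forall>a\<in>\<AA>. \<forall>\<xi>\<in>l2 I. T (a \<xi>) = a (T \<xi>))"
    then obtain j where j: "j \<in> J" and eq: "\<forall>\<xi>\<in>V. \<Gamma> i \<xi> = T (tor_partial j \<xi>)"
      and com: "\<forall>\<xi>\<in>l2 I. T (a \<xi>) = a (T \<xi>)" using a by blast
    have "l2_norm I (comm i a \<xi>) \<le> (cmod (s j) * bop_norm I T * bop_norm I a) * l2_norm I \<xi>" if \<xi>: "\<xi> \<in> V" for \<xi>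
    proof -
      note a\<xi> = bounded_ops_closed[OF aB dom1_l2[OF \<xi>]] and p = dom1_partial[OF \<xi> j]
      have "\<Gamma> i (a \<xi>) = T (\<lambda>m. a (tor_partial j \<xi>) m + s j * a \<xi> m)"
        using eq \<xi> aV eig[OF j \<xi>] by (simp add: image_subset_iff)
      also have "\<dots> = (\<lambda>m. T (a (tor_partial j \<xi>)) m + T (\<lambda>m. s j * a \<xi> m) m)"
        by (rule bounded_ops_add[OF T bounded_ops_closed[OF aB p] l2_scale(1)[OF a\<xi>]])
      also have "T (\<lambda>m. s j * a \<xi> m) = (\<lambda>m. s j * T (a \<xi>) m)" by (rule bounded_ops_scale[OF T a\<xi>])
      also have "T (a (tor_partial j \<xi>)) = a (\<Gamma> i \<xi>)" using com p eq \<xi> by simp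
      finally have "comm i a \<xi> = (\<lambda>m. s j * T (a \<xi>) m)" by (simp add: comm_def)
      then have "l2_norm I (comm i a \<xi>) = cmod (s j) * l2_norm I (T (a \<xi>))"
        using l2_scale(2)[OF bounded_ops_closed[OF T a\<xi>]] by simp
      also have "\<dots> \<le> cmod (s j) * (bop_norm I T * (bop_norm I a * l2_norm I \<xi>))"
        using order_trans[OF bop_norm_bound[OF T a\<xi>] mult_left_mono[OF bop_norm_bound[OF aB dom1_l2[OF \<xi>]] bop_norm_nonneg[OF T]]]
        by (intro mult_left_mono) auto
      finally show ?thesis by (simp add: mult.assoc)
    qed
    then show ?thesis by blast
  qed
qed

text \<open>On matrices, commutation with the j-th derivation multiplies the entry at m, q by i (m_j
  - q_j). Finitely supported vectors lie in the domain, so the operator bound restricts to finite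
  sections; C does not depend on a.\<close>

lemma lip_derivative_mat_bounded: "\<exists>C\<ge>0. \<forall>j\<in>J. \<forall>a\<in>\<AA>. \<forall>K. lip a K \<longrightarrow>
    mat_bounded I (C * K) (\<lambda>m q. complex_of_int (m j - q j) * entry a m q)"
proof -
  obtain C where C: "C \<ge> 0" "\<forall>j\<in>J. \<forall>a\<in>\<AA>. \<forall>K. lip a K \<longrightarrow>
    (\<forall>\<xi>\<in>V. l2_norm I (\<lambda>m. tor_partial j (a \<xi>) m - a (tor_partial j \<xi>) m) \<le> C * K * l2_norm I \<xi>)"
    using lip_partial_bound by blast
  have "mat_bounded I (C * K) (\<lambda>m q. complex_of_int (m j - q j) * entry a m q)"
    if j: "j \<in> J" and a: "a \<in> \<AA>" and lip: "lip a K" for j a K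
    unfolding mat_bounded_def
  proof (intro conjI allI impI)
    show "0 \<le> C * K" using C(1) lipD(2)[OF lip] by simp
    fix E F and \<xi> :: lat_fun assume *: "finite E \<and> finite F \<and> E \<subseteq> I \<and> F \<subseteq> I"
    note aB = lipD(1)[OF lip]
    have V: "cutoff F \<xi> \<in> V" using * by (intro dom1_finite_support[of F]) (auto simp: cutoff_def)
    have p: "tor_partial j (cutoff F \<xi>) = cutoff F (\<lambda>m. \<i> * of_int (m j) * \<xi> m)"
      by (auto simp: tor_partial_def cutoff_def)
    let ?\<eta> = "\<lambda>m. tor_partial j (a (cutoff F \<xi>)) m - a (tor_partial j (cutoff F \<xi>)) m"
    have \<eta>: "?\<eta> m = \<i> * (\<Sum>q\<in>F. complex_of_int (m j - q j) * entry a m q * \<xi> q)" for m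
      unfolding p using * by (simp add: tor_partial_def bounded_op_cutoff[OF aB] sum_distrib_left sum_subtractf[symmetric] algebra_simps)
    have \<eta>l: "?\<eta> \<in> l2 I"
      by (rule l2_diff(1)[OF dom1_partial[OF lip_maps_dom[OF lip V] j] bounded_ops_closed[OF aB dom1_partial[OF V j]]])
    have "L2_set (\<lambda>m. cmod (\<Sum>q\<in>F. complex_of_int (m j - q j) * entry a m q * \<xi> q)) E = L2_set (\<lambda>m. norm (?\<eta> m)) E"
      unfolding \<eta> by (simp add: norm_mult)
    also have "\<dots> \<le> l2_norm I ?\<eta>" using * by (intro L2_set_le_l2_norm[OF \<eta>l]) auto
    also have "\<dots> \<le> C * K * l2_norm I (cutoff F \<xi>)" using C(2) j a lip V by blast
    also have "l2_norm I (cutoff F \<xi>) = L2_set (\<lambda>q. cmod (\<xi> q)) F"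
      using l2_norm_finite_support(2)[of F I "cutoff F \<xi>"] * by (auto simp: cutoff_def cong: L2_set_cong)
    finally show "L2_set (\<lambda>m. cmod (\<Sum>q\<in>F. complex_of_int (m j - q j) * entry a m q * \<xi> q)) E \<le> C * K * L2_set (\<lambda>q. cmod (\<xi> q)) F" .
  qed
  then show ?thesis using C(1) by (intro exI[of _ C]) auto
qed

text \<open>Ties the calculus of bounds to the supremum \<open>op_norm\<close>, which is the least
  admissible K. The homogeneity required by \<open>op_norm_bound\<close> holds once a preserves the
  domain.\<close>

lemma lip_iff_op_norm:
  assumes a: "a \<in> bounded_ops I"
  shows "amplify a ` SV \<subseteq> SV \<and> op_bounded I SV (Dirac_comm a) \<longleftrightarrow> (\<exists>K. lip a K)"
    "lip a K \<Longrightarrow> lip a (op_norm I SV (Dirac_comm a))"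
    "lip a K \<Longrightarrow> op_norm I SV (Dirac_comm a) \<le> K"
proof -
  have 0: "(\<lambda>_. 0) \<in> SV" by (simp add: spinor_dom_def spinor_comp_def dom1_zero)
  have R: "(\<lambda>i. r *\<^sub>R \<xi> i) \<in> SV" if "\<xi> \<in> SV" for r \<xi>
  proof -
    have "spinor_comp t (\<lambda>i. r *\<^sub>R \<xi> i) = (\<lambda>i. complex_of_real r * spinor_comp t \<xi> i)" for t
      by (simp add: spinor_comp_def fun_eq_iff) (simp add: scaleR_conv_of_real)
    then show ?thesis using that dom1_scale unfolding spinor_dom_def by auto
  qed
  have mv: "M *v (r *\<^sub>R x) = r *\<^sub>R (M *v x)" for M :: "complex^'s^'s" and r x
    by (simp add: vec_eq_iff matrix_vector_mult_def scaleR_sum_right)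
  have homog: "Dirac_comm a (\<lambda>i. r *\<^sub>R \<xi> i) = (\<lambda>i. r *\<^sub>R Dirac_comm a \<xi> i)" if aV: "a ` V \<subseteq> V" and \<xi>: "\<xi> \<in> SV" for r \<xi>
  proof
    fix m
    have "(\<chi> t. comm i a (spinor_comp t (\<lambda>i. r *\<^sub>R \<xi> i)) m) = r *\<^sub>R (\<chi> t. comm i a (spinor_comp t \<xi>) m)" if i: "i \<in> N" for i
    proof (subst vec_eq_iff, rule allI)
      fix t
      note \<xi>t = spinor_dom_comp[OF \<xi>, of t]
      have a\<xi>t: "a (spinor_comp t \<xi>) \<in> V" using aV \<xi>t by blast
      have "spinor_comp t (\<lambda>i. r *\<^sub>R \<xi> i) = (\<lambda>i. complex_of_real r * spinor_comp t \<xi> i)"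
        by (simp add: spinor_comp_def fun_eq_iff) (simp add: scaleR_conv_of_real)
      then have "comm i a (spinor_comp t (\<lambda>i. r *\<^sub>R \<xi> i)) m = complex_of_real r * comm i a (spinor_comp t \<xi>) m"
        by (simp add: comm_def bounded_ops_scale[OF a dom1_l2[OF \<xi>t]] Gamma_linear(3)[OF i \<xi>t] Gamma_linear(3)[OF i a\<xi>t]
            bounded_ops_scale[OF a Gamma_linear(1)[OF i \<xi>t]] right_diff_distrib)
      then show "(\<chi> t. comm i a (spinor_comp t (\<lambda>i. r *\<^sub>R \<xi> i)) m) $ t = (r *\<^sub>R (\<chi> t. comm i a (spinor_comp t \<xi>) m)) $ t"
        by simp (simp add: scaleR_conv_of_real)
    qed
    then show "Dirac_comm a (\<lambda>i. r *\<^sub>R \<xi> i) m = r *\<^sub>R Dirac_comm a \<xi> m"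
      unfolding Dirac_comm_eq[OF a aV \<xi>] Dirac_comm_eq[OF a aV R[OF \<xi>]]
      by (simp add: mv scaleR_sum_right)
  qed
  have SVl: "SV \<subseteq> l2 I" using spinor_dom_l2 by blast
  have to_lip: "lip a (op_norm I SV (Dirac_comm a))" if "a ` V \<subseteq> V" "op_bounded I SV (Dirac_comm a)"
    unfolding lip_def
    using a that op_norm_bound[OF that(2) SVl R homog[OF that(1)]] op_norm_nonneg[OF that(2) SVl 0] by blast
  have from_lip: "a ` V \<subseteq> V" "op_bounded I SV (Dirac_comm a)" if "lip a K" for K
    using lipD[OF that] Dirac_comm_l2[OF a] unfolding op_bounded_def by blast+
  show "amplify a ` SV \<subseteq> SV \<and> op_bounded I SV (Dirac_comm a) \<longleftrightarrow> (\<exists>K. lip a K)"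
    unfolding amplify_spinor_dom_iff using to_lip from_lip by blast
  show "lip a K \<Longrightarrow> lip a (op_norm I SV (Dirac_comm a))" using to_lip from_lip by blast
  show "lip a K \<Longrightarrow> op_norm I SV (Dirac_comm a) \<le> K"
    using lipD by (intro op_norm_leI 0) auto
qed

end

section \<open>Finite products of cyclic groups\<close>

context
  fixes q :: nat and k :: "nat \<Rightarrow> enat"
begin

lemma carrier_Zk: "x \<in> carrier (Zk q k) \<longleftrightarrow> x \<in> extensional {1..q} \<and>
    (\<forall>j\<in>{1..q}. k j \<noteq> \<infinity> \<longrightarrow> the_enat (k j) = 0 \<or> 0 \<le> x j \<and> x j < int (the_enat (k j)))"
  by (auto simp: Zk_def PiE_iff carrier_integer_mod_group modulus_def split: enat.splits)

lemma group_Zk: "comm_group (Zk q k)"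
proof -
  have g: "group (Zk q k)" by (simp add: Zk_def)
  show ?thesis
    by (rule group.group_comm_groupI[OF g]) (auto simp: Zk_def add.commute intro!: restrict_ext)
qed

lemma Zk_mult: "j \<in> {1..q} \<Longrightarrow> (x \<otimes>\<^bsub>Zk q k\<^esub> y) j = (x j + y j) mod int (modulus (k j))"
  and Zk_one: "j \<in> {1..q} \<Longrightarrow> \<one>\<^bsub>Zk q k\<^esub> j = 0"
  by (simp_all add: Zk_def)

lemma Zk_inv: "x \<in> carrier (Zk q k) \<Longrightarrow> j \<in> {1..q} \<Longrightarrow> (inv\<^bsub>Zk q k\<^esub> x) j = (- x j) mod int (modulus (k j))"
  unfolding Zk_def
  by (subst inv_product_group) (auto simp: PiE_iff intro!: inv_integer_mod_group)

lemma Zk_mod: "x \<in> carrier (Zk q k) \<Longrightarrow> j \<in> {1..q} \<Longrightarrow> x j mod int (modulus (k j)) = x j"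
  by (auto simp: Zk_def PiE_iff carrier_integer_mod_group Ball_def split: if_splits)

lemma Zk_eqI: "x \<in> carrier (Zk q k) \<Longrightarrow> y \<in> carrier (Zk q k) \<Longrightarrow> (\<And>j. j \<in> {1..q} \<Longrightarrow> x j = y j) \<Longrightarrow> x = y"
  by (rule extensionalityI[of _ "{1..q}"]) (auto simp: Zk_def PiE_iff)

lemma Zk_class_carrier: "Zk_class q k m \<in> carrier (Zk q k)"
  by (auto simp: Zk_def Zk_class_def carrier_integer_mod_group)

lemma Zk_class_apply: "j \<in> {1..q} \<Longrightarrow> Zk_class q k m j = m j mod int (modulus (k j))"
  by (simp add: Zk_class_def)

lemma Zk_class_mult: "Zk_class q k m \<otimes>\<^bsub>Zk q k\<^esub> Zk_class q k n = Zk_class q k (\<lambda>j. m j + n j)"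
  by (auto simp: Zk_def Zk_class_def mod_add_eq intro!: restrict_ext)

lemma Zk_class_inv: "inv\<^bsub>Zk q k\<^esub> Zk_class q k m = Zk_class q k (\<lambda>j. - m j)"
proof -
  interpret comm_group "Zk q k" by (rule group_Zk)
  show ?thesis
    by (rule Zk_eqI[OF inv_closed[OF Zk_class_carrier] Zk_class_carrier])
       (simp add: Zk_inv[OF Zk_class_carrier] Zk_class_apply mod_minus_eq)
qed

lemma Zk_class_self: "x \<in> carrier (Zk q k) \<Longrightarrow> Zk_class q k x = x"
  by (rule Zk_eqI[OF Zk_class_carrier]) (auto simp: Zk_class_apply Zk_mod)

text \<open>One coordinate is split off at a time; along a coordinate the multiples of the unit are
  reached by induction on integers in both directions. The vector m is an arbitrary integer
  representative, so no reduction modulo k interferes.\<close>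

lemma Zk_generated:
  assumes K: "subgroup K (Zk q k)" and S: "finite S" "\<And>j. j \<in> S \<Longrightarrow> Zk_unit q k j \<in> K"
    and m: "\<And>i. i \<in> {1..q} \<Longrightarrow> i \<notin> S \<Longrightarrow> m i = 0"
  shows "Zk_class q k m \<in> K"
proof -
  interpret K: subgroup K "Zk q k" by fact
  have line: "Zk_class q k (\<lambda>i. if i = j then n else 0) \<in> K" if j: "Zk_unit q k j \<in> K" for j n
  proof (induction n rule: int_induct[where k = 0])
    case base
    have "Zk_class q k (\<lambda>i. if i = j then 0 else 0) = \<one>\<^bsub>Zk q k\<^esub>"
      by (auto simp: Zk_class_def Zk_def intro!: restrict_ext)
    then show ?case using K.one_closed by simp
  next
    case (step1 n)
    have "Zk_class q k (\<lambda>i. if i = j then n + 1 else 0) =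
        Zk_class q k (\<lambda>i. if i = j then n else 0) \<otimes>\<^bsub>Zk q k\<^esub> Zk_unit q k j"
      unfolding Zk_unit_def Zk_class_mult by (rule arg_cong[of _ _ "Zk_class q k"]) auto
    then show ?case using step1 j by simp
  next
    case (step2 n)
    have "Zk_class q k (\<lambda>i. if i = j then n - 1 else 0) =
        Zk_class q k (\<lambda>i. if i = j then n else 0) \<otimes>\<^bsub>Zk q k\<^esub> inv\<^bsub>Zk q k\<^esub> (Zk_unit q k j)"
      unfolding Zk_unit_def Zk_class_inv Zk_class_mult by (rule arg_cong[of _ _ "Zk_class q k"]) auto
    then show ?case using step2 j by simp
  qed
  show ?thesis using S m
  proof (induction S arbitrary: m rule: finite_induct)
    case empty
    then have "Zk_class q k m = \<one>\<^bsub>Zk q k\<^esub>" by (auto simp: Zk_class_def Zk_def intro!: restrict_ext)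
    then show ?case using K.one_closed by simp
  next
    case (insert j S)
    have "Zk_class q k m = Zk_class q k (m(j := 0)) \<otimes>\<^bsub>Zk q k\<^esub> Zk_class q k (\<lambda>i. if i = j then m j else 0)"
      unfolding Zk_class_mult by (rule arg_cong[of _ _ "Zk_class q k"]) auto
    moreover have "Zk_class q k (m(j := 0)) \<in> K" using insert by (intro insert.IH) auto
    ultimately show ?case using line[of j "m j"] insert by simp
  qed
qed

end

section \<open>Operator identities in twisted group algebras\<close>

context twisted_group begin

lemma sigma_nonzero: "x \<in> carrier G \<Longrightarrow> y \<in> carrier G \<Longrightarrow> \<sigma> (x, y) \<noteq> 0"
  using sigma_norm[of x y] by auto

text \<open>The quotient of \<open>\<sigma> (x, y)\<close> by \<open>\<sigma> (y, x)\<close> is the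
  commutation factor of the two unitaries; three uses of the cocycle identity show it multiplicative
  in y.\<close>

lemma commutation_mult:
  assumes "x \<in> carrier G" "y \<in> carrier G" "z \<in> carrier G"
    and y: "\<sigma> (x, y) = a * \<sigma> (y, x)" and z: "\<sigma> (x, z) = b * \<sigma> (z, x)"
  shows "\<sigma> (x, y \<otimes> z) = a * b * \<sigma> (y \<otimes> z, x)"
proof -
  have "\<sigma> (x, y \<otimes> z) * \<sigma> (y, z) = a * (\<sigma> (y, x) * \<sigma> (y \<otimes> x, z))"
    using sigma_cocycle[OF assms(1-3)] y m_comm[OF assms(1,2)] by (simp add: mult.assoc)
  also have "\<dots> = a * b * (\<sigma> (y, z \<otimes> x) * \<sigma> (z, x))"
    using sigma_cocycle[OF assms(2,1,3)] z m_comm[OF assms(1,3)] by (simp add: mult_ac)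
  also have "\<dots> = a * b * \<sigma> (y \<otimes> z, x) * \<sigma> (y, z)"
    using sigma_cocycle[OF assms(2,3,1)] by (simp add: mult_ac)
  finally show ?thesis using sigma_nonzero[OF assms(2,3)] by simp
qed

text \<open>By multiplicativity, agreement of the commutation factor with a character \<Lambda> is
  stable under products and inverses, hence has to be checked on generators only.\<close>

lemma subgroup_commutation:
  assumes x: "x \<in> carrier G" and L: "\<And>y z. y \<in> carrier G \<Longrightarrow> z \<in> carrier G \<Longrightarrow> \<Lambda> (y \<otimes> z) = \<Lambda> y * \<Lambda> z"
    "\<Lambda> \<one> = (1 :: complex)"
  shows "subgroup {y \<in> carrier G. \<sigma> (x, y) = \<Lambda> y * \<sigma> (y, x)} G"
proof (rule subgroupI)
  show "{y \<in> carrier G. \<sigma> (x, y) = \<Lambda> y * \<sigma> (y, x)} \<noteq> {}"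
    using x L(2) by (auto simp: sigma_one intro!: exI[of _ \<one>])
  fix y assume "y \<in> {y \<in> carrier G. \<sigma> (x, y) = \<Lambda> y * \<sigma> (y, x)}"
  then have y: "y \<in> carrier G" "\<sigma> (x, y) = \<Lambda> y * \<sigma> (y, x)" by auto
  define b where "b = \<sigma> (x, inv y) / \<sigma> (inv y, x)"
  have b: "\<sigma> (x, inv y) = b * \<sigma> (inv y, x)" using sigma_nonzero x y by (simp add: b_def)
  from commutation_mult[OF x y(1) inv_closed[OF y(1)] y(2) b] have "\<Lambda> y * b = 1" using x y by (simp add: sigma_one)
  moreover have "\<Lambda> y * \<Lambda> (inv y) = 1" using L(1)[of y "inv y"] L(2) y by simp
  ultimately have "b = \<Lambda> (inv y)" by (metis mult_cancel_left mult_zero_left zero_neq_one)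
  then show "inv y \<in> {y \<in> carrier G. \<sigma> (x, y) = \<Lambda> y * \<sigma> (y, x)}" using b y by simp
  fix z assume "z \<in> {y \<in> carrier G. \<sigma> (x, y) = \<Lambda> y * \<sigma> (y, x)}"
  then show "y \<otimes> z \<in> {y \<in> carrier G. \<sigma> (x, y) = \<Lambda> y * \<sigma> (y, x)}"
    using commutation_mult[OF x y(1) _ y(2)] y L(1) by auto
qed auto

section \<open>Real and imaginary parts of the translations\<close>

lemma re_part_left_op: "x \<in> carrier G \<Longrightarrow> \<xi> \<in> l2 (carrier G) \<Longrightarrow>
    re_part (Bl2 (carrier G)) (left_op x) \<xi> = (\<lambda>m. 1/2 * (left_op x \<xi> m + left_op (inv x) \<xi> m))"
  and re_part_right_op: "x \<in> carrier G \<Longrightarrow> \<xi> \<in> l2 (carrier G) \<Longrightarrow>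
    re_part (Bl2 (carrier G)) (right_op x) \<xi> = (\<lambda>m. 1/2 * (right_op x \<xi> m + right_op (inv x) \<xi> m))"
  by (simp_all add: re_part_def adjoint_left_op adjoint_right_op)

lemma im_part_left_op: "x \<in> carrier G \<Longrightarrow> \<xi> \<in> l2 (carrier G) \<Longrightarrow>
    im_part (Bl2 (carrier G)) (left_op x) \<xi> = (\<lambda>m. 1/(2*\<i>) * (left_op x \<xi> m - left_op (inv x) \<xi> m))"
  and im_part_right_op: "x \<in> carrier G \<Longrightarrow> \<xi> \<in> l2 (carrier G) \<Longrightarrow>
    im_part (Bl2 (carrier G)) (right_op x) \<xi> = (\<lambda>m. 1/(2*\<i>) * (right_op x \<xi> m - right_op (inv x) \<xi> m))"
  by (simp_all add: im_part_def adjoint_left_op adjoint_right_op Bl2_minus left_op_bounded right_op_bounded)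

lemma re_im_part_bounded:
  "T \<in> bounded_ops I \<Longrightarrow> re_part (Bl2 I) T \<in> bounded_ops I \<and> adjoint_op I (re_part (Bl2 I) T) = re_part (Bl2 I) T"
  "T \<in> bounded_ops I \<Longrightarrow> im_part (Bl2 I) T \<in> bounded_ops I \<and> adjoint_op I (im_part (Bl2 I) T) = im_part (Bl2 I) T"
  using unital_cstar_algebra.re_part_sa(1)[OF unital_cstar_algebra_Bl2, of T I]
    unital_cstar_algebra.im_part_sa(1)[OF unital_cstar_algebra_Bl2, of T I] by (simp_all add: sa_def)

lemma conj_inv_re_part:
  assumes x: "x \<in> carrier G" and \<xi>: "\<xi> \<in> l2 (carrier G)"
  shows "conj_inv G (re_part (Bl2 (carrier G)) (left_op x) (conj_inv G \<xi>)) = re_part (Bl2 (carrier G)) (right_op x) \<xi>"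
proof
  fix m
  note j = conj_inv_l2[OF \<xi>]
  have "conj_inv G (re_part (Bl2 (carrier G)) (left_op x) (conj_inv G \<xi>)) m =
      1/2 * (conj_inv G (left_op (inv (inv x)) (conj_inv G \<xi>)) m + conj_inv G (left_op (inv x) (conj_inv G \<xi>)) m)"
    unfolding re_part_left_op[OF x j] using x by (simp add: conj_inv_def)
  also have "\<dots> = 1/2 * (right_op (inv x) \<xi> m + right_op x \<xi> m)"
    using x \<xi> by (simp only: conj_inv_left_op inv_closed)
  finally show "conj_inv G (re_part (Bl2 (carrier G)) (left_op x) (conj_inv G \<xi>)) m = re_part (Bl2 (carrier G)) (right_op x) \<xi> m"
    by (simp add: re_part_right_op[OF x \<xi>] add.commute)
qed

text \<open>The conjugation is antilinear and turns left translation by x into right translation by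
  its inverse: the sign from 1 / (2 i) and the sign from exchanging the two terms cancel.\<close>

lemma conj_inv_im_part:
  assumes x: "x \<in> carrier G" and \<xi>: "\<xi> \<in> l2 (carrier G)"
  shows "conj_inv G (im_part (Bl2 (carrier G)) (left_op x) (conj_inv G \<xi>)) = im_part (Bl2 (carrier G)) (right_op x) \<xi>"
proof
  fix m
  note j = conj_inv_l2[OF \<xi>]
  have "conj_inv G (im_part (Bl2 (carrier G)) (left_op x) (conj_inv G \<xi>)) m =
      - (1/(2*\<i>)) * (conj_inv G (left_op (inv (inv x)) (conj_inv G \<xi>)) m - conj_inv G (left_op (inv x) (conj_inv G \<xi>)) m)"
    unfolding im_part_left_op[OF x j] using x by (simp add: conj_inv_def)
  also have "\<dots> = - (1/(2*\<i>)) * (right_op (inv x) \<xi> m - right_op x \<xi> m)"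
    using x \<xi> by (simp only: conj_inv_left_op inv_closed)
  finally show "conj_inv G (im_part (Bl2 (carrier G)) (left_op x) (conj_inv G \<xi>)) m = im_part (Bl2 (carrier G)) (right_op x) \<xi> m"
    by (simp add: im_part_right_op[OF x \<xi>] algebra_simps)
qed

lemma left_eq_right:
  assumes x: "x \<in> carrier G" and c: "\<And>p. p \<in> carrier G \<Longrightarrow> \<sigma> (x, p) = \<sigma> (p, x)"
  shows "left_op x = right_op x"
  by (rule bounded_ops_eq_entryI[of _ "carrier G"])
    (use x c in \<open>auto simp: left_op_bounded right_op_bounded entry_left_op entry_right_op\<close>)

text \<open>For a unitary U with adjoint V the squares of real and imaginary part add up to (U V + V
  U) / 2 = 1; the sign s, squared, disappears.\<close>

lemma re_im_square:
  assumes x: "x \<in> carrier G" and \<xi>: "\<xi> \<in> l2 (carrier G)" and s: "s * s = 1"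
  defines "R \<equiv> re_part (Bl2 (carrier G)) (left_op x)"
    and "T \<equiv> cscale (Bl2 (carrier G)) s (im_part (Bl2 (carrier G)) (left_op x))"
  shows "(\<lambda>m. R (R \<xi>) m + T (T \<xi>) m) = \<xi>"
proof
  fix m
  let ?L = "left_op x" and ?M = "left_op (inv x)"
  note L = left_op_bounded[OF x] and M = left_op_bounded[OF inv_closed[OF x]]
  note lL = bounded_ops_closed[OF L \<xi>] and lM = bounded_ops_closed[OF M \<xi>]
  have inv1: "?M (?L \<xi>) = \<xi>" by (rule left_op_inv_left_op[OF x \<xi>])
  have inv2: "?L (?M \<xi>) = \<xi>" using left_op_inv_left_op[OF inv_closed[OF x] \<xi>] x by simp
  have RB: "R \<in> bounded_ops (carrier G)" "im_part (Bl2 (carrier G)) ?L \<in> bounded_ops (carrier G)"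
    unfolding R_def using re_im_part_bounded[OF L] by auto
  have R: "R \<eta> = (\<lambda>m. 1/2 * (?L \<eta> m + ?M \<eta> m))" if "\<eta> \<in> l2 (carrier G)" for \<eta>
    unfolding R_def by (rule re_part_left_op[OF x that])
  have T: "T \<eta> = (\<lambda>m. s/(2*\<i>) * (?L \<eta> m - ?M \<eta> m))" if "\<eta> \<in> l2 (carrier G)" for \<eta>
    unfolding T_def using that im_part_left_op[OF x that] by (simp add: algebra_simps)
  have Rl: "(\<lambda>m. 1/2 * (?L \<xi> m + ?M \<xi> m)) \<in> l2 (carrier G)" "(\<lambda>m. s/(2*\<i>) * (?L \<xi> m - ?M \<xi> m)) \<in> l2 (carrier G)"
    by (intro l2_scale(1) l2_add(1) l2_diff(1) lL lM)+
  have LR: "P (\<lambda>m. 1/2 * (?L \<xi> m + ?M \<xi> m)) m = 1/2 * (P (?L \<xi>) m + P (?M \<xi>) m)"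
    "P (\<lambda>m. s/(2*\<i>) * (?L \<xi> m - ?M \<xi> m)) m = s/(2*\<i>) * (P (?L \<xi>) m - P (?M \<xi>) m)"
    if "P \<in> bounded_ops (carrier G)" for P
    unfolding bounded_ops_scale[OF that l2_add(1)[OF lL lM]] bounded_ops_scale[OF that l2_diff(1)[OF lL lM]]
      bounded_ops_add[OF that lL lM] bounded_ops_diff[OF that lL lM] by simp_all
  have "R (R \<xi>) m = 1/4 * (?L (?L \<xi>) m + 2 * \<xi> m + ?M (?M \<xi>) m)"
    unfolding R[OF \<xi>] R[OF Rl(1)] LR(1)[OF L] LR(1)[OF M] by (simp add: inv2 inv1 algebra_simps)
  moreover have "T (T \<xi>) m = - 1/4 * (s * s) * (?L (?L \<xi>) m - 2 * \<xi> m + ?M (?M \<xi>) m)"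
    unfolding T[OF \<xi>] T[OF Rl(2)] LR(2)[OF L] LR(2)[OF M] inv2 inv1 by (simp add: field_simps)
  ultimately have "R (R \<xi>) m + T (T \<xi>) m = 1/4 * (?L (?L \<xi>) m + 2 * \<xi> m + ?M (?M \<xi>) m) +
      - 1/4 * (s * s) * (?L (?L \<xi>) m - 2 * \<xi> m + ?M (?M \<xi>) m)" by (simp only:)
  also have "\<dots> = \<xi> m" unfolding s by (simp add: field_simps)
  finally show "R (R \<xi>) m + T (T \<xi>) m = \<xi> m" .
qed

end

text \<open>The nested scalars a, b, c have the shape in which real and imaginary parts of a
  translation unfold, with b = 1 and c = 1 or -1.\<close>

lemma pointwise_continuous_combination:
  assumes "pointwise_continuous I S" "pointwise_continuous I T"
    "\<And>\<xi>. \<xi> \<in> l2 I \<Longrightarrow> U \<xi> = (\<lambda>m. a * (b * S \<xi> m + c * T \<xi> m))"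
  shows "pointwise_continuous I U"
  unfolding pointwise_continuous_def
proof (intro allI impI)
  fix \<xi>s :: "nat \<Rightarrow> lat_fun" and \<xi> m
  assume *: "(\<forall>n. \<xi>s n \<in> l2 I) \<and> \<xi> \<in> l2 I \<and> (\<forall>p. (\<lambda>n. \<xi>s n p) \<longlonglongrightarrow> \<xi> p)"
  then have "(\<lambda>n. S (\<xi>s n) m) \<longlonglongrightarrow> S \<xi> m" "(\<lambda>n. T (\<xi>s n) m) \<longlonglongrightarrow> T \<xi> m"
    using assms(1,2) unfolding pointwise_continuous_def by blast+
  then have "(\<lambda>n. a * (b * S (\<xi>s n) m + c * T (\<xi>s n) m)) \<longlonglongrightarrow> a * (b * S \<xi> m + c * T \<xi> m)"
    by (intro tendsto_intros)
  then show "(\<lambda>n. U (\<xi>s n) m) \<longlonglongrightarrow> U \<xi> m" using * assms(3) by simp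
qed

lemma pointwise_continuous_twisted_shift: "pointwise_continuous (carrier G) (twisted_shift G \<tau> x)"
  unfolding pointwise_continuous_def twisted_shift_def
  by (auto intro!: tendsto_mult_left)

section \<open>Linear independence of the Clifford generators\<close>

lemma matrix_frobenius: "(\<Sum>t\<in>UNIV. (norm ((M :: complex^'s^'s) *v axis t 1))\<^sup>2) = (\<Sum>t\<in>UNIV. \<Sum>s\<in>UNIV. (cmod (M $ s $ t))\<^sup>2)"
  by (intro sum.cong refl)
     (simp add: norm_vec_def L2_set_def sum_nonneg matrix_vector_mult_def axis_def if_distrib[of "(*) _"] cong: if_cong)

lemma clifford_gen_mem: "j \<in> {1..n} \<Longrightarrow> clifford_gen j \<in> clifford n"
  by (auto simp: clifford_gen_def clifford_basis_def clifford_def)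

text \<open>For the trace pairing the generators are orthogonal, being skew-adjoint and
  anticommuting, and each has squared length equal to the dimension. Projecting the sum of the z_j
  \<gamma>_j to \<gamma>_i therefore bounds z_i by the Hilbert-Schmidt norm, whose square is the sum
  over basis spinors.\<close>

lemma clifford_gens_independent:
  fixes c :: "(nat set \<Rightarrow> complex) \<Rightarrow> complex^'s^'s"
  assumes c: "faithful_clifford_rep n c" and i: "i \<in> {1..n}"
  shows "(cmod (z i))\<^sup>2 \<le> (\<Sum>t\<in>UNIV. (norm (\<Sum>j\<in>{1..n}. c (clifford_gen j) *v axis t (z j)))\<^sup>2)"
proof -
  have c_scale: "\<And>x s. x \<in> clifford n \<Longrightarrow> c (\<lambda>I. s * x I) = (\<chi> a b. s * c x $ a $ b)"
    and c_mult: "\<And>x y. x \<in> clifford n \<Longrightarrow> y \<in> clifford n \<Longrightarrow> c (clifford_mult n x y) = c x ** c y"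
    and c_one: "c (clifford_basis {}) = mat 1"
    and c_star: "\<And>x. x \<in> clifford n \<Longrightarrow> c (clifford_star x) = (\<chi> a b. cnj (c x $ b $ a))"
    using c by (auto simp: faithful_clifford_rep_def)
  define g where "g j = c (clifford_gen j)" for j
  define inner where "inner M N = (\<Sum>t\<in>UNIV. \<Sum>s\<in>UNIV. cnj (M $ s $ t) * N $ s $ t)" for M N :: "complex^'s^'s"
  have star: "cnj (g j $ t $ s) = - g j $ s $ t" if j: "j \<in> {1..n}" for j s t
  proof -
    have neg: "(\<lambda>K. - clifford_gen j K) = (\<lambda>K. (-1) * clifford_gen j K)" by simp
    have "c (clifford_star (clifford_gen j)) = (\<chi> a b. cnj (g j $ b $ a))"
      by (simp add: c_star[OF clifford_gen_mem[OF j]] g_def)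
    moreover have "c (clifford_star (clifford_gen j)) = (\<chi> a b. (-1) * g j $ a $ b)"
      unfolding clifford_gen_star neg c_scale[OF clifford_gen_mem[OF j]] g_def ..
    ultimately have "(\<chi> a b. cnj (g j $ b $ a)) $ s $ t = (\<chi> a b. (-1) * g j $ a $ b) $ s $ t" by simp
    then show ?thesis by simp
  qed
  have inner_eq: "inner (g j) (g l) = - (\<Sum>t\<in>UNIV. (g j ** g l) $ t $ t)" if "j \<in> {1..n}" for j l
    unfolding inner_def matrix_matrix_mult_def
    by (simp add: star[OF that] sum_negf)
  \<comment> \<open>The trace of a product is symmetric in the two factors while anticommutation
    changes its sign, so it vanishes.\<close>
  have anti: "inner (g j) (g l) = 0" if "j \<in> {1..n}" "l \<in> {1..n}" "j \<noteq> l" for j l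
  proof -
    have neg: "(\<lambda>K. - clifford_mult n (clifford_gen l) (clifford_gen j) K) = (\<lambda>K. (-1) * clifford_mult n (clifford_gen l) (clifford_gen j) K)"
      by simp
    have m: "clifford_mult n (clifford_gen l) (clifford_gen j) \<in> clifford n"
      unfolding clifford_mult_def clifford_def mem_Collect_eq
    proof (intro allI impI sum.neutral ballI)
      fix K I J assume "\<not> K \<subseteq> {1..n}" "I \<in> Pow {1..n}" "J \<in> Pow {1..n}"
      then have "sym_diff I J \<noteq> K" by blast
      then show "(if sym_diff I J = K then clifford_sign I J * clifford_gen l I * clifford_gen j J else 0) = 0" by simp
    qed
    have "g j ** g l = c (clifford_mult n (clifford_gen j) (clifford_gen l))"
      by (simp add: c_mult[OF clifford_gen_mem[OF that(1)] clifford_gen_mem[OF that(2)]]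
          c_mult[OF clifford_gen_mem[OF that(2)] clifford_gen_mem[OF that(1)]] g_def)
    also have "\<dots> = (\<chi> a b. (-1) * c (clifford_mult n (clifford_gen l) (clifford_gen j)) $ a $ b)"
      unfolding clifford_gen_anticommute[OF that] neg c_scale[OF m] ..
    also have "\<dots> = (\<chi> a b. (-1) * (g l ** g j) $ a $ b)"
      by (simp add: c_mult[OF clifford_gen_mem[OF that(1)] clifford_gen_mem[OF that(2)]]
          c_mult[OF clifford_gen_mem[OF that(2)] clifford_gen_mem[OF that(1)]] g_def)
    finally have "(\<Sum>t\<in>UNIV. (g j ** g l) $ t $ t) = - (\<Sum>t\<in>UNIV. (g l ** g j) $ t $ t)"
      by (simp add: sum_negf)
    moreover have "(\<Sum>t\<in>UNIV. (g l ** g j) $ t $ t) = (\<Sum>t\<in>UNIV. (g j ** g l) $ t $ t)"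
      unfolding matrix_matrix_mult_def by (simp, subst sum.swap) (simp add: mult.commute)
    ultimately show ?thesis using inner_eq[OF that(1)] by simp
  qed
  have self: "inner (g i) (g i) = of_nat CARD('s)"
  proof -
    have neg: "(\<lambda>K. - clifford_basis {} K) = (\<lambda>K. (-1) * clifford_basis {} K)" by simp
    have m: "clifford_basis {} \<in> clifford n" by (auto simp: clifford_basis_def clifford_def)
    have "g i ** g i = c (clifford_mult n (clifford_gen i) (clifford_gen i))"
      by (simp add: c_mult[OF clifford_gen_mem[OF i] clifford_gen_mem[OF i]] g_def)
    also have "\<dots> = (\<chi> a b. (-1) * c (clifford_basis {}) $ a $ b)"
      unfolding clifford_gen_square[OF i] neg c_scale[OF m] ..
    also have "c (clifford_basis {}) = mat 1" by (rule c_one)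
    finally show ?thesis using inner_eq[OF i] by (simp add: mat_def sum_negf)
  qed
  define M where "M = (\<chi> s t. \<Sum>j\<in>{1..n}. z j * g j $ s $ t)"
  have Mv: "M *v axis t 1 = (\<Sum>j\<in>{1..n}. g j *v axis t (z j))" for t
    by (simp add: vec_eq_iff M_def matrix_vector_mult_def axis_def if_distrib[of "(*) _"] cong: if_cong)
       (simp add: mult.commute)
  have "inner (g i) M = (\<Sum>j\<in>{1..n}. z j * inner (g i) (g j))"
  proof -
    have "inner (g i) M = (\<Sum>t\<in>UNIV. \<Sum>s\<in>UNIV. \<Sum>j\<in>{1..n}. z j * (cnj (g i $ s $ t) * g j $ s $ t))"
      by (simp add: inner_def M_def sum_distrib_left mult_ac)
    also have "\<dots> = (\<Sum>t\<in>UNIV. \<Sum>j\<in>{1..n}. \<Sum>s\<in>UNIV. z j * (cnj (g i $ s $ t) * g j $ s $ t))"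
      by (intro sum.cong refl sum.swap)
    also have "\<dots> = (\<Sum>j\<in>{1..n}. \<Sum>t\<in>UNIV. \<Sum>s\<in>UNIV. z j * (cnj (g i $ s $ t) * g j $ s $ t))"
      by (rule sum.swap)
    finally show ?thesis by (simp add: inner_def sum_distrib_left)
  qed
  also have "\<dots> = (\<Sum>j\<in>{1..n}. if j = i then z i * of_nat CARD('s) else 0)"
    by (intro sum.cong refl) (auto simp: self anti[OF i])
  also have "\<dots> = z i * of_nat CARD('s)" using i by simp
  finally have eq: "cmod (inner (g i) M) = cmod (z i) * CARD('s)" by (simp add: norm_mult)
  define hs where "hs N = L2_set (\<lambda>(t, s). cmod (N $ s $ t)) (UNIV \<times> UNIV)" for N :: "complex^'s^'s"
  have cs: "cmod (inner N P) \<le> hs N * hs P" for N P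
  proof -
    have "inner N P = (\<Sum>(t, s)\<in>UNIV \<times> UNIV. cnj (N $ s $ t) * P $ s $ t)"
      by (simp add: inner_def sum.cartesian_product)
    also have "cmod \<dots> \<le> (\<Sum>x\<in>UNIV \<times> UNIV. \<bar>case x of (t, s) \<Rightarrow> cmod (N $ s $ t)\<bar> * \<bar>case x of (t, s) \<Rightarrow> cmod (P $ s $ t)\<bar>)"
      by (rule order_trans[OF norm_sum]) (auto intro!: sum_mono simp: norm_mult)
    also have "\<dots> \<le> hs N * hs P" unfolding hs_def by (rule L2_set_mult_ineq)
    finally show ?thesis .
  qed
  have hs2: "(hs N)\<^sup>2 = (\<Sum>t\<in>UNIV. \<Sum>s\<in>UNIV. (cmod (N $ s $ t))\<^sup>2)" for N
    by (simp add: hs_def L2_set_def sum_nonneg case_prod_beta sum.cartesian_product)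
  have "complex_of_real ((hs (g i))\<^sup>2) = inner (g i) (g i)"
    unfolding hs2 inner_def by (simp add: complex_norm_square mult.commute del: of_real_power)
  then have hsg: "(hs (g i))\<^sup>2 = CARD('s)" unfolding self by (metis of_real_eq_iff of_real_of_nat_eq)
  have "(cmod (z i) * CARD('s))\<^sup>2 \<le> (hs (g i) * hs M)\<^sup>2"
    using cs[of "g i" M] unfolding eq by (intro power_mono) auto
  then have "(cmod (z i))\<^sup>2 * CARD('s) * CARD('s) \<le> (hs M)\<^sup>2 * CARD('s)"
    unfolding power_mult_distrib hsg by (simp add: power2_eq_square mult_ac)
  then have "(cmod (z i))\<^sup>2 * CARD('s) \<le> (hs M)\<^sup>2" by simp
  moreover have "(cmod (z i))\<^sup>2 * 1 \<le> (cmod (z i))\<^sup>2 * CARD('s)"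
    using finite_UNIV_card_ge_0[where 'a = 's] by (intro mult_left_mono) (auto simp: Suc_le_eq)
  moreover have "(hs M)\<^sup>2 = (\<Sum>t\<in>UNIV. (norm (\<Sum>j\<in>{1..n}. g j *v axis t (z j)))\<^sup>2)"
    unfolding hs2 Mv[symmetric] matrix_frobenius ..
  ultimately show ?thesis by (simp add: g_def)
qed

section \<open>The fuzzy tori\<close>

text \<open>The data at a single index. Entries of k' are at least 2, so the class of 1 is not 0 and
  \<open>e_apply\<close> holds at finite moduli too.\<close>

locale torus_pair =
  fixes d d' :: nat and f :: "nat \<Rightarrow> nat" and k k' :: "nat \<Rightarrow> enat" and \<sigma> :: cocycle
    and c :: "(nat set \<Rightarrow> complex) \<Rightarrow> complex^'s^'s"
  assumes d: "2 \<le> d" "d \<le> d'"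
    and f_involution: "\<forall>j\<in>{1..d'}. f (f j) = j \<and> f j \<noteq> j"
    and k'_ge_2: "\<And>j. j \<in> {1..d'} \<Longrightarrow> 2 \<le> k' j"
    and normalized: "\<sigma> \<in> normalized_cocycles (Zk d' k')"
    and k_k': "\<forall>j\<in>{1..d}. k' (f j) = k j \<and> k' j = k j"
    and commutation: "\<forall>j\<in>{1..d}. \<forall>s\<in>{1..d'}.
            tor_U d' k' \<sigma> (f j) \<otimes>\<^bsub>tor_B d' k' \<sigma>\<^esub> tor_U d' k' \<sigma> s =
            cscale (tor_B d' k' \<sigma>)
              (if s = j \<and> k j < \<infinity> \<and> j < f j then exp (2 * \<i> * pi / of_nat (the_enat (k j)))
               else if s = j \<and> k j < \<infinity> \<and> j > f j then exp (- 2 * \<i> * pi / of_nat (the_enat (k j)))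
               else 1)
              (tor_U d' k' \<sigma> s \<otimes>\<^bsub>tor_B d' k' \<sigma>\<^esub> tor_U d' k' \<sigma> (f j))"
    and c: "faithful_clifford_rep (d + d') c"
begin

sublocale twisted_group "Zk d' k'" \<sigma>
  by (intro twisted_group.intro twisted_group_axioms.intro group_Zk normalized)

abbreviation "G \<equiv> Zk d' k'"
abbreviation "I \<equiv> carrier (Zk d' k')"
abbreviation "e \<equiv> Zk_unit d' k'"

definition "J = {j \<in> {1..d'}. k' j = \<infinity>}"
text \<open>A copy of the group of the smaller torus inside that of the larger one; the coefficients
  of elements of the algebra live here.\<close>

definition "H = {m \<in> I. \<forall>j\<in>{d+1..d'}. m j = 0}"

section \<open>Moduli and commutation factors\<close>

lemma modulus_cases:
  assumes "j \<in> {1..d'}"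
  obtains "k' j = \<infinity>" "modulus (k' j) = 0" | n where "k' j = enat n" "modulus (k' j) = n" "2 \<le> n"
proof (cases "k' j")
  case (enat n)
  then show ?thesis using k'_ge_2[OF assms] that(2) by (auto simp: modulus_def numeral_eq_enat)
next
  case infinity
  then show ?thesis using that(1) by (simp add: modulus_def)
qed

lemma modulus_k: "j \<in> {1..d} \<Longrightarrow> k j \<noteq> \<infinity> \<Longrightarrow> modulus (k' j) = the_enat (k j) \<and> 2 \<le> the_enat (k j)"
proof -
  assume j: "j \<in> {1..d}" "k j \<noteq> \<infinity>"
  then have "j \<in> {1..d'}" "k' j = k j" using k_k' d by auto
  then show ?thesis by (cases rule: modulus_cases[of j]) (use j in auto)
qed

lemma modulus_0: "j \<in> J \<Longrightarrow> modulus (k' j) = 0"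
  by (simp add: J_def modulus_def)

lemma e_mem: "e j \<in> I"
  by (simp add: Zk_unit_def Zk_class_carrier)

lemma e_apply: "i \<in> {1..d'} \<Longrightarrow> e j i = (if i = j then 1 else 0)"
  by (rule modulus_cases[of i]) (auto simp: Zk_unit_def Zk_class_apply)

text \<open>Commutation factor of the unitaries at f j and j. The value 1 at an infinite modulus
  merges cases of the hypothesis, and f j \<noteq> j makes its two signs exhaustive.\<close>

definition lam :: "nat \<Rightarrow> complex" where
  "lam j = (if k j = \<infinity> then 1 else if j < f j then exp (2 * \<i> * pi / of_nat (the_enat (k j)))
     else exp (- 2 * \<i> * pi / of_nat (the_enat (k j))))"

lemma lam_nonzero: "lam j \<noteq> 0"
  by (simp add: lam_def)

text \<open>Both products of unitaries send the vector at the identity to a multiple of the basis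
  vector at the sum of the two units; comparing the multiples turns the operator identity into one
  between cocycle values.\<close>

lemma sigma_units:
  assumes j: "j \<in> {1..d}" and s: "s \<in> {1..d'}"
  shows "\<sigma> (e (f j), e s) = (if s = j then lam j else 1) * \<sigma> (e s, e (f j))"
proof -
  have jd: "f j \<noteq> j" using f_involution j d by auto
  let ?x = "e (f j)" and ?y = "e s"
  let ?l = "if s = j then lam j else 1"
  have "left_op ?x (left_op ?y (delta \<one>\<^bsub>G\<^esub>)) = (\<lambda>m. ?l * left_op ?y (left_op ?x (delta \<one>\<^bsub>G\<^esub>)) m)"
  proof -
    have l: "(if s = j \<and> k j < \<infinity> \<and> j < f j then exp (2 * \<i> * pi / of_nat (the_enat (k j)))
               else if s = j \<and> k j < \<infinity> \<and> j > f j then exp (- 2 * \<i> * pi / of_nat (the_enat (k j)))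
               else 1) = ?l"
      using jd by (auto simp: lam_def)
    have "compose (l2 I) (left_op ?x) (left_op ?y) = (\<lambda>\<xi>\<in>l2 I. \<lambda>m. ?l * compose (l2 I) (left_op ?y) (left_op ?x) \<xi> m)"
      using bspec[OF bspec[OF commutation j] s] unfolding l
      by (simp add: tor_B_def twisted_group_algebra_def cstar_generated_def tor_U_def)
    from fun_cong[OF this, of "delta \<one>\<^bsub>G\<^esub>"] show ?thesis by (simp add: compose_def)
  qed
  from fun_cong[OF this, of "?x \<otimes>\<^bsub>G\<^esub> ?y"] show ?thesis
    using m_comm[OF e_mem[of "f j"] e_mem[of s]]
    by (simp only: left_op_delta_one[OF e_mem] entry_def[symmetric])
       (simp add: entry_left_op e_mem)
qed

text \<open>At a finite modulus \<open>lam j\<close> is a root of unity of that order, so the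
  exponent may be reduced; at an infinite one it is 1. Powers of it are thereby characters of the
  quotient group.\<close>

lemma lam_power:
  assumes j: "j \<in> {1..d}"
  shows "lam j powi (n mod int (modulus (k' j))) = lam j powi n"
proof (cases "k j = \<infinity>")
  case True
  then show ?thesis by (simp add: lam_def)
next
  case False
  let ?M = "modulus (k' j)"
  have M: "?M = the_enat (k j)" "2 \<le> ?M" using modulus_k[OF j False] by auto
  have root: "exp (2 * \<i> * pi / of_nat ?M) ^ ?M = 1"
    using M(2) by (simp add: exp_of_nat_mult[symmetric]) (simp add: exp_two_pi_i' mult_ac)
  have "exp (- 2 * \<i> * pi / of_nat ?M) = inverse (exp (2 * \<i> * pi / of_nat ?M))"
    by (simp flip: exp_minus)
  then have "exp (- 2 * \<i> * pi / of_nat ?M) ^ ?M = 1" by (simp only: power_inverse root inverse_1)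
  with root have 1: "lam j ^ ?M = 1" using False M by (auto simp: lam_def)
  have "lam j powi n = lam j powi (int ?M * (n div int ?M) + n mod int ?M)" by simp
  also have "\<dots> = (lam j ^ ?M) powi (n div int ?M) * lam j powi (n mod int ?M)"
    using lam_nonzero by (simp only: power_int_add power_int_mult power_int_of_nat simp_thms)
  finally show ?thesis unfolding 1 by simp
qed

text \<open>Here \<open>lam j\<close> is a primitive root of unity of order k j, and p j is a
  representative between 0 and k j - 1.\<close>

lemma lam_powi_eq_1:
  assumes j: "j \<in> {1..d}" and fin: "k j \<noteq> \<infinity>" and p: "p \<in> I" "lam j powi (p j) = 1"
  shows "p j = 0"
proof -
  have M: "modulus (k' j) = the_enat (k j)" "2 \<le> the_enat (k j)" using modulus_k[OF j fin] by auto
  have jd: "j \<in> {1..d'}" using j d by auto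
  then have r: "0 \<le> p j" "p j < int (the_enat (k j))"
    using Zk_mod[OF p(1) jd] M pos_mod_sign[of "int (the_enat (k j))" "p j"] pos_mod_bound[of "int (the_enat (k j))" "p j"]
    by auto
  define n where "n = nat (p j)"
  have n: "p j = int n" "n < the_enat (k j)" using r by (auto simp: n_def)
  have *: "exp (2 * \<i> * pi / of_nat (the_enat (k j))) ^ n = 1"
  proof (cases "j < f j")
    case True
    then show ?thesis using p(2) fin n by (simp add: lam_def)
  next
    case False
    then have "exp (- (2 * \<i> * pi / of_nat (the_enat (k j)))) ^ n = 1" using p(2) fin n by (simp add: lam_def)
    then show ?thesis by (simp add: exp_minus power_inverse)
  qed
  then have "exp (2 * of_real pi * \<i> * of_nat n / of_nat (the_enat (k j))) = 1"
    by (simp add: exp_of_nat_mult[symmetric] mult_ac)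
  then have "the_enat (k j) dvd n" using M(2) by (subst (asm) complex_root_unity_eq_1) auto
  then show ?thesis using n by (auto dest: nat_dvd_not_less)
qed

text \<open>The commutation factor is multiplicative in p, and so is the power of
  \<open>lam j\<close> by \<open>lam_power\<close>; the two agree on the units by
  \<open>sigma_units\<close>, and these generate the group.\<close>

lemma sigma_commutation:
  assumes j: "j \<in> {1..d}" and p: "p \<in> I"
  shows "\<sigma> (e (f j), p) = lam j powi (p j) * \<sigma> (p, e (f j))"
proof -
  have jd: "j \<in> {1..d'}" using j d by auto
  let ?K = "{y \<in> I. \<sigma> (e (f j), y) = lam j powi (y j) * \<sigma> (y, e (f j))}"
  have "subgroup ?K G"
  proof (rule subgroup_commutation[OF e_mem])
    show "lam j powi ((y \<otimes>\<^bsub>G\<^esub> z) j) = lam j powi (y j) * lam j powi (z j)" for y z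
      by (simp only: Zk_mult[OF jd] lam_power[OF j]) (simp add: power_int_add lam_nonzero)
  qed (simp add: Zk_one[OF jd])
  then have "Zk_class d' k' p \<in> ?K"
  proof (rule Zk_generated[where S = "{1..d'}"])
    fix s assume s: "s \<in> {1..d'}"
    then show "e s \<in> ?K" using sigma_units[OF j s] by (auto simp: e_mem e_apply[OF jd])
  qed auto
  then show ?thesis by (simp add: Zk_class_self[OF p])
qed

sublocale twisted_subgroup "Zk d' k'" \<sigma> H "e ` {1..d}"
proof (intro twisted_subgroup.intro twisted_subgroup_axioms.intro twisted_group_axioms)
  show "subgroup H G"
  proof (rule subgroupI)
    show "H \<subseteq> I" by (auto simp: H_def)
    show "H \<noteq> {}" using one_closed by (auto simp: H_def Zk_one intro!: exI[of _ "\<one>\<^bsub>G\<^esub>"])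
    show "inv\<^bsub>G\<^esub> x \<in> H" if "x \<in> H" for x using that by (auto simp: H_def Zk_inv)
    show "x \<otimes>\<^bsub>G\<^esub> y \<in> H" if "x \<in> H" "y \<in> H" for x y using that by (auto simp: H_def Zk_mult)
  qed
  show "e ` {1..d} \<subseteq> H" using e_mem by (auto simp: H_def e_apply)
  show "e ` {1..d} \<noteq> {}" using d by auto
  fix K assume K: "subgroup K G" "e ` {1..d} \<subseteq> K"
  show "H \<subseteq> K"
  proof
    fix x assume x: "x \<in> H"
    have "Zk_class d' k' x \<in> K"
      by (rule Zk_generated[OF K(1), where S = "{1..d}"]) (use K(2) x in \<open>auto simp: H_def\<close>)
    then show "x \<in> K" using x by (simp add: H_def Zk_class_self)
  qed
qed

lemma tor_A_eq: "tor_A d d' k' \<sigma> = A"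
  unfolding A_def by (simp add: tor_A_def tor_B_def tor_U_def image_image)

subsection \<open>The operators \<open>\<Gamma>\<close>\<close>

text \<open>Subscripts l and r stand for left and right multiplication; [X, \<xi>] is the difference
  of the two applied to \<xi>.\<close>

definition "X\<^sub>l j = re_part (Bl2 I) (left_op (e (f j)))"
definition "X\<^sub>r j = re_part (Bl2 I) (right_op (e (f j)))"
definition "Y\<^sub>l j = cscale (Bl2 I) (if f j > j then 1 else -1) (im_part (Bl2 I) (left_op (e (f j))))"
definition "Y\<^sub>r j = cscale (Bl2 I) (if f j > j then 1 else -1) (im_part (Bl2 I) (right_op (e (f j))))"

lemma tor_XY: "tor_X d' f k' \<sigma> j = X\<^sub>l j" "tor_Y d' f k' \<sigma> j = Y\<^sub>l j"
  by (simp_all add: tor_X_def tor_Y_def tor_U_def X\<^sub>l_def Y\<^sub>l_def)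

lemma XY_bounded: "X\<^sub>l j \<in> bounded_ops I" "X\<^sub>r j \<in> bounded_ops I" "Y\<^sub>l j \<in> bounded_ops I" "Y\<^sub>r j \<in> bounded_ops I"
  using re_im_part_bounded[OF left_op_bounded[OF e_mem[of "f j"]]] re_im_part_bounded[OF right_op_bounded[OF e_mem[of "f j"]]]
  by (auto simp: X\<^sub>l_def X\<^sub>r_def Y\<^sub>l_def Y\<^sub>r_def bounded_op_cscale)

lemma tor_J_eq: "tor_J d' k' = conj_inv G"
  by (simp add: tor_J_def conj_inv_def fun_eq_iff)

lemma tor_comm_X: "\<xi> \<in> l2 I \<Longrightarrow> tor_comm d' k' (X\<^sub>l j) \<xi> = (\<lambda>m. X\<^sub>l j \<xi> m - X\<^sub>r j \<xi> m)"
  using re_im_part_bounded(1)[OF left_op_bounded[OF e_mem[of "f j"]]]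
  by (simp add: tor_comm_def tor_J_eq X\<^sub>l_def X\<^sub>r_def conj_inv_re_part[OF e_mem])

lemma tor_comm_Y:
  assumes \<xi>: "\<xi> \<in> l2 I"
  shows "tor_comm d' k' (Y\<^sub>l j) \<xi> = (\<lambda>m. Y\<^sub>l j \<xi> m - Y\<^sub>r j \<xi> m)"
proof -
  let ?P = "im_part (Bl2 I) (left_op (e (f j)))" and ?s = "if f j > j then 1 else -1 :: complex"
  have P: "?P \<in> bounded_ops I" "adjoint_op I ?P = ?P"
    using re_im_part_bounded(2)[OF left_op_bounded[OF e_mem[of "f j"]]] by auto
  have "cstar (Bl2 I) (cscale (Bl2 I) ?s ?P) = cscale (Bl2 I) (cnj ?s) (cstar (Bl2 I) ?P)"
    using unital_cstar_algebra.star_scale[OF unital_cstar_algebra_Bl2, of ?P I ?s] P(1) by simp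
  then have ad: "adjoint_op I (Y\<^sub>l j) = Y\<^sub>l j" using P(2) by (simp add: Y\<^sub>l_def)
  have "conj_inv G (Y\<^sub>l j (conj_inv G \<xi>)) = (\<lambda>m. ?s * conj_inv G (?P (conj_inv G \<xi>)) m)"
    using conj_inv_l2[OF \<xi>] by (auto simp: Y\<^sub>l_def conj_inv_def fun_eq_iff)
  also have "\<dots> = Y\<^sub>r j \<xi>" using \<xi> by (simp add: conj_inv_im_part[OF e_mem \<xi>] Y\<^sub>r_def)
  finally show ?thesis by (simp add: tor_comm_def tor_J_eq ad)
qed

section \<open>Commutation of the algebra with the coefficients of the first-order operators\<close>

lemma A_right_op: "a \<in> carrier A \<Longrightarrow> x \<in> I \<Longrightarrow> \<xi> \<in> l2 I \<Longrightarrow> a (right_op x \<xi>) = right_op x (a \<xi>)"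
  using supported_commutant_right_op A_commutant by blast

lemma A_bounded': "a \<in> carrier A \<Longrightarrow> a \<in> bounded_ops I"
  using A_bounded by blast

text \<open>The algebra acts by left multiplications, so in its commutator with a difference of a
  left and a right multiplication the right part drops out.\<close>

lemma A_commute_right:
  assumes a: "a \<in> carrier A" and \<xi>: "\<xi> \<in> l2 I"
  shows "a (X\<^sub>r j \<xi>) = X\<^sub>r j (a \<xi>)" "a (Y\<^sub>r j \<xi>) = Y\<^sub>r j (a \<xi>)"
proof -
  let ?x = "e (f j)"
  note aB = A_bounded'[OF a]
  note a\<xi> = bounded_ops_closed[OF aB \<xi>]
  have xi: "inv\<^bsub>G\<^esub> ?x \<in> I" using e_mem by simp
  note R = bounded_ops_closed[OF right_op_bounded[OF e_mem] \<xi>, of "f j"] bounded_ops_closed[OF right_op_bounded[OF xi] \<xi>]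
  show "a (X\<^sub>r j \<xi>) = X\<^sub>r j (a \<xi>)"
    unfolding X\<^sub>r_def re_part_right_op[OF e_mem \<xi>] re_part_right_op[OF e_mem a\<xi>]
      bounded_ops_scale[OF aB l2_add(1)[OF R]] bounded_ops_add[OF aB R]
    using A_right_op[OF a e_mem \<xi>] A_right_op[OF a xi \<xi>] by simp
  have "a (im_part (Bl2 I) (right_op ?x) \<xi>) = im_part (Bl2 I) (right_op ?x) (a \<xi>)"
    unfolding im_part_right_op[OF e_mem \<xi>] im_part_right_op[OF e_mem a\<xi>]
      bounded_ops_scale[OF aB l2_diff(1)[OF R]] bounded_ops_diff[OF aB R]
    using A_right_op[OF a e_mem \<xi>] A_right_op[OF a xi \<xi>] by simp
  moreover have "im_part (Bl2 I) (right_op ?x) \<xi> \<in> l2 I"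
    using re_im_part_bounded(2)[OF right_op_bounded[OF e_mem[of "f j"]]] \<xi> bounded_ops_closed by blast
  ultimately show "a (Y\<^sub>r j \<xi>) = Y\<^sub>r j (a \<xi>)"
    using \<xi> a\<xi> by (simp add: Y\<^sub>r_def bounded_ops_scale[OF aB])
qed

text \<open>At an infinite modulus the commutation factor is 1, so left and right translation by the
  unit at f j coincide; as right translations commute with the algebra, so do these
  coefficients.\<close>

lemma XY_central:
  assumes j: "j \<in> {1..d}" and inf: "k j = \<infinity>"
  shows "X\<^sub>l j = X\<^sub>r j" "Y\<^sub>l j = Y\<^sub>r j"
proof -
  have "\<sigma> (e (f j), p) = \<sigma> (p, e (f j))" if "p \<in> I" for p
    using sigma_commutation[OF j that] inf by (simp add: lam_def)
  from left_eq_right[OF e_mem this] have "left_op (e (f j)) = right_op (e (f j))" by simp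
  then show "X\<^sub>l j = X\<^sub>r j" "Y\<^sub>l j = Y\<^sub>r j" by (simp_all add: X\<^sub>l_def X\<^sub>r_def Y\<^sub>l_def Y\<^sub>r_def)
qed

lemma XY_pointwise_continuous: "pointwise_continuous I (X\<^sub>l j)" "pointwise_continuous I (Y\<^sub>l j)"
proof -
  let ?x = "e (f j)"
  note p = pointwise_continuous_twisted_shift[of G \<sigma> ?x] pointwise_continuous_twisted_shift[of G \<sigma> "inv\<^bsub>G\<^esub> ?x"]
  show "pointwise_continuous I (X\<^sub>l j)"
    by (rule pointwise_continuous_combination[OF p, where a = "1/2" and b = 1 and c = 1])
       (simp add: X\<^sub>l_def re_part_left_op[OF e_mem])
  show "pointwise_continuous I (Y\<^sub>l j)"
    by (rule pointwise_continuous_combination[OF p, where a = "(if f j > j then 1 else -1) / (2*\<i>)" and b = 1 and c = "-1"])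
       (simp add: Y\<^sub>l_def im_part_left_op[OF e_mem] fun_eq_iff)
qed

abbreviation "\<Gamma> \<equiv> tor_Gamma d d' f k k' \<sigma>"

lemma Gamma_infinite:
  assumes "j \<in> {1..d}" "k j = \<infinity>"
  shows "\<Gamma> j \<xi> = X\<^sub>l j (tor_partial j \<xi>)" "\<Gamma> (d + j) \<xi> = Y\<^sub>l j (tor_partial j \<xi>)"
  using assms by (auto simp: tor_Gamma_def tor_XY)

lemma Gamma_finite:
  assumes "j \<in> {1..d}" "k j \<noteq> \<infinity>" "\<xi> \<in> l2 I"
  shows "\<Gamma> j \<xi> = (\<lambda>m. - of_nat (the_enat (k j)) / (2 * \<i> * pi) * (Y\<^sub>l j \<xi> m - Y\<^sub>r j \<xi> m))"
    "\<Gamma> (d + j) \<xi> = (\<lambda>m. of_nat (the_enat (k j)) / (2 * \<i> * pi) * (X\<^sub>l j \<xi> m - X\<^sub>r j \<xi> m))"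
  using assms by (auto simp: tor_Gamma_def tor_XY tor_comm_X tor_comm_Y)

lemma Gamma_outer:
  assumes "j \<in> {d+1..d'}"
  shows "k' j = \<infinity> \<Longrightarrow> \<Gamma> (d + j) \<xi> = tor_partial j \<xi>"
    "k' j \<noteq> \<infinity> \<Longrightarrow> \<Gamma> (d + j) \<xi> = (\<lambda>m. of_nat (the_enat (k' j)) / (2 * \<i> * pi) *
       im_part (Bl2 I) (\<one>\<^bsub>Bl2 I\<^esub> \<ominus>\<^bsub>Bl2 I\<^esub> tor_v d' k' (tor_z d' k' j)) \<xi> m)"
  using assms by (auto simp: tor_Gamma_def)

text \<open>A diagonal operator with entries of modulus 1 is isometric.\<close>

lemma tor_v_bounded: "tor_v d' k' (tor_z d' k' j) \<in> bounded_ops I"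
proof (rule bounded_opsI[where B = 1])
  let ?w = "\<lambda>m. \<Prod>i=1..d'. tor_z d' k' j i powi m i"
  have n: "cmod (?w m) = 1" for m
  proof -
    have "cmod (tor_z d' k' j i) = 1" if "i \<in> {1..d'}" for i
    proof (cases "i = j \<and> k' j \<noteq> \<infinity>")
      case True
      have "cmod (exp (2 * \<i> * pi / of_nat (the_enat (k' j)))) = 1"
        by (simp add: norm_exp_eq_Re)
      then show ?thesis using True that by (simp add: tor_z_def)
    qed (use that in \<open>auto simp: tor_z_def\<close>)
    then show ?thesis by (simp add: prod_norm[symmetric] norm_power_int)
  qed
  show "tor_v d' k' (tor_z d' k' j) \<in> extensional (l2 I)" by (simp add: tor_v_def)
  fix \<xi> :: lat_fun assume \<xi>: "\<xi> \<in> l2 I"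
  have "tor_v d' k' (tor_z d' k' j) \<xi> = (\<lambda>m. ?w m * \<xi> m)" using \<xi> by (simp add: tor_v_def)
  then show "tor_v d' k' (tor_z d' k' j) \<xi> \<in> l2 I" "l2_norm I (tor_v d' k' (tor_z d' k' j) \<xi>) \<le> 1 * l2_norm I \<xi>"
    using l2_dominated[OF \<xi>, of 1 "\<lambda>m. ?w m * \<xi> m"] l2_outside[OF \<xi>] n by (auto simp: norm_mult)
  show "tor_v d' k' (tor_z d' k' j) (\<lambda>i. s * \<xi> i) = (\<lambda>i. s * tor_v d' k' (tor_z d' k' j) \<xi> i)" for s
    using \<xi> l2_scale(1)[OF \<xi>] by (simp add: tor_v_def mult_ac)
  fix \<eta> :: lat_fun assume \<eta>: "\<eta> \<in> l2 I"
  show "tor_v d' k' (tor_z d' k' j) (\<lambda>i. \<xi> i + \<eta> i) = (\<lambda>i. tor_v d' k' (tor_z d' k' j) \<xi> i + tor_v d' k' (tor_z d' k' j) \<eta> i)"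
    using \<xi> \<eta> l2_add(1)[OF \<xi> \<eta>] by (simp add: tor_v_def algebra_simps)
qed

lemma index_cases:
  assumes "i \<in> {1..d+d'}"
  obtains "i \<in> {1..d}" | j where "i = d + j" "j \<in> {1..d}" | j where "i = d + j" "j \<in> {d+1..d'}"
proof (cases "i \<le> d")
  case False
  then have "i = d + (i - d)" by simp
  then show ?thesis using that(2)[of "i - d"] that(3)[of "i - d"] assms False by (cases "i - d \<le> d") auto
qed (use that(1) assms in auto)

sublocale dirac I J "{1..d+d'}" "\<Gamma>" "\<lambda>i. c (clifford_gen i)" "carrier A"
proof
  show "finite J" "finite {1..d+d'}" by (auto simp: J_def)
  show "carrier A \<subseteq> bounded_ops I" by (rule A_bounded)
  show "(cmod (z i))\<^sup>2 \<le> (\<Sum>t\<in>UNIV. (norm (\<Sum>i\<in>{1..d+d'}. c (clifford_gen i) *v axis t (z i)))\<^sup>2)"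
    if "i \<in> {1..d+d'}" for i z
    by (rule clifford_gens_independent[OF c that])
  fix i assume "i \<in> {1..d+d'}"
  \<comment> \<open>The names refer to the order of the operator: \<open>first\<close> for a
    coefficient times a derivation, \<open>zeroth\<close> for a bounded operator.\<close>
  have first: "\<exists>T\<in>bounded_ops I. (\<forall>\<xi>\<in>dom1 I J. \<Gamma> i \<xi> = T \<xi>) \<or>
        (pointwise_continuous I T \<and> (\<exists>j\<in>J. \<forall>\<xi>\<in>dom1 I J. \<Gamma> i \<xi> = T (tor_partial j \<xi>)) \<and>
         (\<forall>a\<in>carrier A. \<forall>\<xi>\<in>l2 I. T (a \<xi>) = a (T \<xi>)))"
    if "T \<in> bounded_ops I" "pointwise_continuous I T" "j \<in> J" "\<And>\<xi>. \<xi> \<in> dom1 I J \<Longrightarrow> \<Gamma> i \<xi> = T (tor_partial j \<xi>)"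
      "\<And>a \<xi>. a \<in> carrier A \<Longrightarrow> \<xi> \<in> l2 I \<Longrightarrow> T (a \<xi>) = a (T \<xi>)" for T j
    using that by blast
  have zeroth: "\<exists>T\<in>bounded_ops I. (\<forall>\<xi>\<in>dom1 I J. \<Gamma> i \<xi> = T \<xi>) \<or>
        (pointwise_continuous I T \<and> (\<exists>j\<in>J. \<forall>\<xi>\<in>dom1 I J. \<Gamma> i \<xi> = T (tor_partial j \<xi>)) \<and>
         (\<forall>a\<in>carrier A. \<forall>\<xi>\<in>l2 I. T (a \<xi>) = a (T \<xi>)))"
    if "T \<in> bounded_ops I" "\<And>\<xi>. \<xi> \<in> l2 I \<Longrightarrow> \<Gamma> i \<xi> = T \<xi>" for T
    using that dom1_l2 by blast
  have JI: "j \<in> J" if "j \<in> {1..d}" "k j = \<infinity>" for j using that k_k' d by (auto simp: J_def)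
  have scaled_diff: "cscale (Bl2 I) s (P \<ominus>\<^bsub>Bl2 I\<^esub> Q) \<in> bounded_ops I"
      "\<xi> \<in> l2 I \<Longrightarrow> cscale (Bl2 I) s (P \<ominus>\<^bsub>Bl2 I\<^esub> Q) \<xi> = (\<lambda>m. s * (P \<xi> m - Q \<xi> m))"
    if "P \<in> bounded_ops I" "Q \<in> bounded_ops I" for s P Q \<xi>
    using that bounded_op_cscale(1)[of "P \<ominus>\<^bsub>Bl2 I\<^esub> Q"] ring.ring_simprules(4)[OF ring_Bl2, of P I Q]
    by (simp_all add: Bl2_minus)
  show "\<exists>T\<in>bounded_ops I. (\<forall>\<xi>\<in>dom1 I J. \<Gamma> i \<xi> = T \<xi>) \<or>
        (pointwise_continuous I T \<and> (\<exists>j\<in>J. \<forall>\<xi>\<in>dom1 I J. \<Gamma> i \<xi> = T (tor_partial j \<xi>)) \<and>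
         (\<forall>a\<in>carrier A. \<forall>\<xi>\<in>l2 I. T (a \<xi>) = a (T \<xi>)))"
    using \<open>i \<in> {1..d+d'}\<close>
  proof (cases rule: index_cases)
    case 1
    show ?thesis
    proof (cases "k i = \<infinity>")
      case True
      show ?thesis
        by (rule first[OF XY_bounded(1)[of i] XY_pointwise_continuous(1) JI[OF 1 True]])
           (use Gamma_infinite[OF 1 True] A_commute_right(1) XY_central[OF 1 True] in auto)
    next
      case False
      show ?thesis
        by (rule zeroth[OF scaled_diff(1)[OF XY_bounded(3,4)[of i], of "- of_nat (the_enat (k i)) / (2 * \<i> * pi)"]])
           (simp only: Gamma_finite[OF 1 False] scaled_diff(2)[OF XY_bounded(3,4)])
    qed
  next
    case (2 j)
    show ?thesis
    proof (cases "k j = \<infinity>")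
      case True
      show ?thesis
        by (rule first[OF XY_bounded(3)[of j] XY_pointwise_continuous(2) JI[OF 2(2) True]])
           (use 2(1) Gamma_infinite[OF 2(2) True] A_commute_right(2) XY_central[OF 2(2) True] in auto)
    next
      case False
      show ?thesis
        by (rule zeroth[OF scaled_diff(1)[OF XY_bounded(1,2)[of j], of "of_nat (the_enat (k j)) / (2 * \<i> * pi)"]])
           (simp only: 2(1) Gamma_finite[OF 2(2) False] scaled_diff(2)[OF XY_bounded(1,2)])
    qed
  next
    case (3 j)
    show ?thesis
    proof (cases "k' j = \<infinity>")
      case True
      have j: "j \<in> J" using 3 True by (auto simp: J_def)
      show ?thesis
      proof (rule first[OF bounded_op_one _ j])
        show "pointwise_continuous I (\<lambda>\<xi>\<in>l2 I. \<xi>)" by (auto simp: pointwise_continuous_def)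
        show "\<Gamma> i \<xi> = (\<lambda>\<xi>\<in>l2 I. \<xi>) (tor_partial j \<xi>)" if "\<xi> \<in> dom1 I J" for \<xi>
          using Gamma_outer(1)[OF 3(2) True] 3(1) dom1_partial[OF that j] by simp
        show "(\<lambda>\<xi>\<in>l2 I. \<xi>) (a \<xi>) = a ((\<lambda>\<xi>\<in>l2 I. \<xi>) \<xi>)" if "a \<in> carrier A" "\<xi> \<in> l2 I" for a \<xi>
          using bounded_ops_closed[OF A_bounded'[OF that(1)] that(2)] that by simp
      qed
    next
      case False
      let ?P = "im_part (Bl2 I) (\<one>\<^bsub>Bl2 I\<^esub> \<ominus>\<^bsub>Bl2 I\<^esub> tor_v d' k' (tor_z d' k' j))"
      have "\<one>\<^bsub>Bl2 I\<^esub> \<ominus>\<^bsub>Bl2 I\<^esub> tor_v d' k' (tor_z d' k' j) \<in> bounded_ops I"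
        using ring.ring_simprules(4)[OF ring_Bl2, of "\<one>\<^bsub>Bl2 I\<^esub>" I "tor_v d' k' (tor_z d' k' j)"] tor_v_bounded
        by (simp add: bounded_op_one)
      then have P: "?P \<in> bounded_ops I" using re_im_part_bounded(2) by blast
      show ?thesis
        by (rule zeroth[OF bounded_op_cscale(1)[OF P, of "of_nat (the_enat (k' j)) / (2 * \<i> * pi)"]])
           (simp add: 3(1) Gamma_outer(2)[OF 3(2) False])
    qed
  qed
next
  fix j assume j: "j \<in> J"
  show "\<exists>S\<^sub>1\<in>bounded_ops I. \<exists>S\<^sub>2\<in>bounded_ops I. \<exists>i\<^sub>1\<in>{1..d+d'}. \<exists>i\<^sub>2\<in>{1..d+d'}.
        (\<forall>\<xi>\<in>dom1 I J. tor_partial j \<xi> = (\<lambda>m. S\<^sub>1 (\<Gamma> i\<^sub>1 \<xi>) m + S\<^sub>2 (\<Gamma> i\<^sub>2 \<xi>) m)) \<and>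
        (\<forall>a\<in>carrier A. \<forall>\<xi>\<in>l2 I. S\<^sub>1 (a \<xi>) = a (S\<^sub>1 \<xi>) \<and> S\<^sub>2 (a \<xi>) = a (S\<^sub>2 \<xi>))"
  proof (cases "j \<le> d")
    case True
    then have jd: "j \<in> {1..d}" and inf: "k j = \<infinity>" using j k_k' by (auto simp: J_def)
    have "tor_partial j \<xi> = (\<lambda>m. X\<^sub>l j (\<Gamma> j \<xi>) m + Y\<^sub>l j (\<Gamma> (d + j) \<xi>) m)" if "\<xi> \<in> dom1 I J" for \<xi>
      unfolding Gamma_infinite[OF jd inf] X\<^sub>l_def Y\<^sub>l_def
      by (rule re_im_square[OF e_mem dom1_partial[OF that j], symmetric]) auto
    moreover have "X\<^sub>l j (a \<xi>) = a (X\<^sub>l j \<xi>) \<and> Y\<^sub>l j (a \<xi>) = a (Y\<^sub>l j \<xi>)" if "a \<in> carrier A" "\<xi> \<in> l2 I" for a \<xi>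
      using A_commute_right[OF that] XY_central[OF jd inf] by simp
    ultimately show ?thesis
      using jd d XY_bounded(1,3)[of j]
      by (intro bexI[of _ "X\<^sub>l j"] bexI[of _ "Y\<^sub>l j"] bexI[of _ j] bexI[of _ "d + j"] conjI ballI) auto
  next
    case False
    then have jd: "j \<in> {d+1..d'}" and inf: "k' j = \<infinity>" using j by (auto simp: J_def)
    \<comment> \<open>An outer \<Gamma> is the derivation itself; the zero operator fills the second
      slot.\<close>
    have "tor_partial j \<xi> = (\<lambda>m. (\<lambda>\<xi>\<in>l2 I. \<xi>) (\<Gamma> (d + j) \<xi>) m + (\<lambda>\<xi>\<in>l2 I. \<lambda>i. 0) (\<Gamma> (d + j) \<xi>) m)"
      if "\<xi> \<in> dom1 I J" for \<xi>
      unfolding Gamma_outer(1)[OF jd inf] using dom1_partial[OF that j] by simp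
    moreover have "(\<lambda>\<xi>\<in>l2 I. \<xi>) (a \<xi>) = a ((\<lambda>\<xi>\<in>l2 I. \<xi>) \<xi>) \<and>
        (\<lambda>\<xi>\<in>l2 I. \<lambda>i. 0) (a \<xi>) = a ((\<lambda>\<xi>\<in>l2 I. \<lambda>i. 0) \<xi>)" if "a \<in> carrier A" "\<xi> \<in> l2 I" for a \<xi>
      using bounded_ops_closed[OF A_bounded'[OF that(1)] that(2)] that bounded_ops_zero[OF A_bounded'[OF that(1)]] by simp
    ultimately show ?thesis
      using jd
      by (intro bexI[OF _ bounded_op_one] bexI[OF _ bounded_op_zero] bexI[of _ "d + j"] conjI ballI) auto
  qed
qed

end

section \<open>The quantum compact metric space\<close>

text \<open>The adjoint of a b is b a, so the Jordan and Lie products are the real and imaginary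
  parts of a b.\<close>

lemma (in unital_cstar_algebra) sa_closed_operations:
  assumes "a \<in> sa A" "b \<in> sa A"
  shows "a \<oplus> b \<in> sa A" "cscale A (complex_of_real t) a \<in> sa A"
    "cscale A (1/2) (a \<otimes> b \<oplus> b \<otimes> a) \<in> sa A" "cscale A (1 / (2 * \<i>)) (a \<otimes> b \<ominus> b \<otimes> a) \<in> sa A"
proof -
  have c: "a \<in> carrier A" "b \<in> carrier A" "cstar A a = a" "cstar A b = b" using assms by (auto simp: sa_def)
  then show "a \<oplus> b \<in> sa A" "cscale A (complex_of_real t) a \<in> sa A"
    by (auto simp: sa_def star_add star_scale scale_closed)
  have s: "cstar A (a \<otimes> b) = b \<otimes> a" using c by (simp add: star_mult)
  show "cscale A (1/2) (a \<otimes> b \<oplus> b \<otimes> a) \<in> sa A"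
    using re_part_sa(1)[of "a \<otimes> b"] c by (simp add: re_part_def s)
  show "cscale A (1 / (2 * \<i>)) (a \<otimes> b \<ominus> b \<otimes> a) \<in> sa A"
    using im_part_sa(1)[of "a \<otimes> b"] c by (simp add: im_part_def s)
qed

lemma (in unital_cstar_algebra) sa_limit:
  assumes a: "a \<in> carrier A" and lim: "\<And>\<epsilon>. \<epsilon> > 0 \<Longrightarrow> \<exists>b\<in>sa A. cnorm A (a \<ominus> b) < \<epsilon>"
  shows "a \<in> sa A"
proof -
  have "cnorm A (cstar A a \<ominus> a) \<le> 0"
  proof (rule field_le_epsilon)
    fix \<epsilon> :: real assume "\<epsilon> > 0"
    then obtain b where b: "b \<in> sa A" "cnorm A (a \<ominus> b) < \<epsilon>/2" using lim[of "\<epsilon>/2"] by auto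
    then have bA: "b \<in> carrier A" "cstar A b = b" by (auto simp: sa_def)
    have "cnorm A (cstar A (a \<ominus> b)) < \<epsilon>/2" using b a bA by (simp add: norm_star)
    then have 1: "cnorm A (cstar A a \<ominus> b) < \<epsilon>/2" using a bA by (simp add: star_minus)
    have "cstar A a \<ominus> a = (cstar A a \<ominus> b) \<ominus> (a \<ominus> b)" using a bA(1) star_closed[OF a] by algebra
    also have "cnorm A \<dots> \<le> cnorm A (cstar A a \<ominus> b) + cnorm A (a \<ominus> b)"
      using a bA(1) star_closed[OF a] by (intro norm_triangle_diff) auto
    finally show "cnorm A (cstar A a \<ominus> a) \<le> 0 + \<epsilon>" using 1 b(2) by simp
  qed
  then have "cdist A (cstar A a) a = 0"
    using a star_closed[OF a] norm_nonneg[of "cstar A a \<ominus> a"] by (simp add: cdist_def)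
  then show ?thesis using Metric_space.zero[OF metric star_closed[OF a] a] a by (simp add: sa_def)
qed

lemma mat_bounded_entry:
  assumes "mat_bounded I K t" "m \<in> I" "q \<in> I"
  shows "cmod (t m q) \<le> K"
  using mat_boundedD[OF assms(1), of "{m}" "{q}" "\<lambda>_. 1"] assms by (simp add: L2_set_def)

context torus_pair begin

declare mem_carrier [simp del] One_nat_def [simp del]

lemma one_I [simp]: "\<one>\<^bsub>G\<^esub> \<in> I"
  by (rule mem_carrier[OF one_closed])

lemma A_ops: "monoid.mult A = monoid.mult (Bl2 I)" "add A = add (Bl2 I)" "one A = one (Bl2 I)"
    "ring.zero A = ring.zero (Bl2 I)" "cstar A = cstar (Bl2 I)" "cscale A = cscale (Bl2 I)"
    "cnorm A = cnorm (Bl2 I)"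
  by (subst A_Bl2, simp)+

lemma A_minus: "a \<in> carrier A \<Longrightarrow> b \<in> carrier A \<Longrightarrow> a \<ominus>\<^bsub>A\<^esub> b = (\<lambda>\<xi>\<in>l2 I. \<lambda>i. a \<xi> i - b \<xi> i)"
  by (rule Bl2_subalgebra_minus[OF A_unital A_Bl2 A_bounded])

section \<open>Lipschitz bounds and coefficients\<close>

abbreviation "\<delta>\<^sub>0 \<equiv> delta \<one>\<^bsub>G\<^esub>"

lemma delta_dom: "\<delta>\<^sub>0 \<in> dom1 I J"
  by (rule dom1_finite_support[of "{\<one>\<^bsub>G\<^esub>}"]) (auto simp: delta_def)

lemma J_mult_inv: "j \<in> J \<Longrightarrow> m \<in> I \<Longrightarrow> q \<in> I \<Longrightarrow> (m \<otimes>\<^bsub>G\<^esub> inv\<^bsub>G\<^esub> q) j = m j - q j"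
  using modulus_0 by (simp add: J_def Zk_mult Zk_inv)

text \<open>Translation by x shifts the eigenvalues of the j-th derivation by i x_j.\<close>

lemma lip_left_op:
  assumes x: "x \<in> H"
  shows "\<exists>K. lip (left_op x) K"
proof (rule lip_if_partial_eigenvector[where s = "\<lambda>j. \<i> * of_int (x j)", OF A_left_op[OF x]])
  fix j \<xi> assume j: "j \<in> J" and \<xi>: "\<xi> \<in> dom1 I J"
  have xI: "x \<in> I" using x by (simp add: H_def)
  note l = dom1_l2[OF \<xi>] dom1_partial[OF \<xi> j]
  show "tor_partial j (left_op x \<xi>) = (\<lambda>m. left_op x (tor_partial j \<xi>) m + \<i> * of_int (x j) * left_op x \<xi> m)"
  proof
    fix m show "tor_partial j (left_op x \<xi>) m = left_op x (tor_partial j \<xi>) m + \<i> * of_int (x j) * left_op x \<xi> m"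
    proof (cases "m \<in> I")
      case True
      then show ?thesis using J_mult_inv[OF j True xI] l
        by (simp add: tor_partial_def left_op_apply) (simp add: algebra_simps)
    qed (use l in \<open>simp add: tor_partial_def left_op_outside\<close>)
  qed
qed

lemma left_op_XY:
  assumes \<eta>: "\<eta> \<in> l2 I"
  shows "left_op (e (f j)) \<eta> m = X\<^sub>l j \<eta> m + \<i> * (if f j > j then 1 else -1) * Y\<^sub>l j \<eta> m"
  using \<eta> by (simp add: X\<^sub>l_def Y\<^sub>l_def re_part_left_op[OF e_mem \<eta>] im_part_left_op[OF e_mem \<eta>])
    (simp add: field_simps)

text \<open>An element of H other than the identity has a nonzero coordinate j \<le> d, which is
  detected by the derivation if its modulus is infinite, and otherwise by the commutation factor
  with the unitary at f j.\<close>

lemma lip_coefficient_bound: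
  assumes p: "p \<in> H" "p \<noteq> \<one>\<^bsub>G\<^esub>"
  shows "\<exists>C\<ge>0. \<forall>a\<in>carrier A. \<forall>K. lip a K \<longrightarrow> cmod (a \<delta>\<^sub>0 p) \<le> C * K"
proof -
  have pI: "p \<in> I" using p by (simp add: H_def)
  have "\<exists>j\<in>{1..d}. p j \<noteq> 0"
  proof (rule ccontr)
    assume "\<not> (\<exists>j\<in>{1..d}. p j \<noteq> 0)"
    then have 0: "p j = 0" if "j \<in> {1..d}" for j using that by blast
    have "p = \<one>\<^bsub>G\<^esub>"
    proof (rule Zk_eqI[OF pI one_I])
      fix j assume j: "j \<in> {1..d'}"
      show "p j = \<one>\<^bsub>G\<^esub> j"
        using 0[of j] p(1) j by (cases "j \<le> d") (auto simp: Zk_one[OF j] H_def)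
    qed
    then show False using p by simp
  qed
  then obtain j where j: "j \<in> {1..d}" "p j \<noteq> 0" by blast
  show ?thesis
  proof (cases "k j = \<infinity>")
    case True
    then have jJ: "j \<in> J" using j k_k' d by (auto simp: J_def)
    obtain C where C: "C \<ge> 0" "\<forall>j\<in>J. \<forall>a\<in>carrier A. \<forall>K. lip a K \<longrightarrow>
        mat_bounded I (C * K) (\<lambda>m q. complex_of_int (m j - q j) * entry a m q)"
      using lip_derivative_mat_bounded by blast
    have "cmod (a \<delta>\<^sub>0 p) \<le> C * K" if a: "a \<in> carrier A" "lip a K" for a K
    proof -
      have "mat_bounded I (C * K) (\<lambda>m q. complex_of_int (m j - q j) * entry a m q)" using C(2) jJ a by blast
      from mat_bounded_entry[OF this pI one_I]
      have "\<bar>real_of_int (p j)\<bar> * cmod (a \<delta>\<^sub>0 p) \<le> C * K"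
        using jJ by (simp add: Zk_one J_def entry_def norm_mult)
      moreover have "1 * cmod (a \<delta>\<^sub>0 p) \<le> \<bar>real_of_int (p j)\<bar> * cmod (a \<delta>\<^sub>0 p)"
        using j(2) by (intro mult_right_mono[OF _ norm_ge_zero]) linarith
      ultimately show ?thesis by simp
    qed
    then show ?thesis using C(1) by blast
  next
    case fin: False
    let ?x = "e (f j)" and ?s = "if f j > j then 1 else -1 :: complex"
    \<comment> \<open>M is the modulus of the factor in front of \<Gamma>, and w the distance from 1
      of the commutation factor at p, positive since \<open>lam j\<close> is a primitive root of
      unity.\<close>
    define M where "M = real (the_enat (k j)) / (2 * pi)"
    have M: "M > 0" using modulus_k[OF j(1) fin] by (simp add: M_def)
    define w where "w = cmod (lam j powi (p j) - 1)"
    have w: "w > 0" using lam_powi_eq_1[OF j(1) fin pI] j(2) by (auto simp: w_def)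
    have "cmod (a \<delta>\<^sub>0 p) \<le> (2 * \<kappa> / (M * w)) * K" if a: "a \<in> carrier A" "lip a K" for a K
    proof -
      note aB = A_bounded'[OF a(1)] and \<delta> = delta_l2[OF one_I] and dd = delta_dom
      note adV = lip_maps_dom[OF a(2) dd]
      note ad = dom1_l2[OF adV]
      have n\<delta>: "l2_norm I \<delta>\<^sub>0 = 1" by (simp add: l2_norm_delta)
      \<comment> \<open>The point to which translation by x moves the coefficient at p.\<close>
      let ?m = "p \<otimes>\<^bsub>G\<^esub> ?x"
      have mI: "?m \<in> I" "?m \<otimes>\<^bsub>G\<^esub> inv\<^bsub>G\<^esub> ?x = p" using pI e_mem by (auto simp: m_assoc)
      \<comment> \<open>The right multiplications cancel by \<open>A_commute_right\<close>, leaving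
        the commutator with the left one.\<close>
      have cY: "comm j a \<delta>\<^sub>0 m = - of_nat (the_enat (k j)) / (2 * \<i> * pi) * (Y\<^sub>l j (a \<delta>\<^sub>0) m - a (Y\<^sub>l j \<delta>\<^sub>0) m)" for m
      proof -
        note Yd = bounded_ops_closed[OF XY_bounded(3)[of j] \<delta>] bounded_ops_closed[OF XY_bounded(4)[of j] \<delta>]
        show ?thesis
          unfolding comm_def Gamma_finite(1)[OF j(1) fin ad] Gamma_finite(1)[OF j(1) fin \<delta>]
            bounded_ops_scale[OF aB l2_diff(1)[OF Yd]] bounded_ops_diff[OF aB Yd] A_commute_right(2)[OF a(1) \<delta>]
          by (simp add: algebra_simps)
      qed
      have cX: "comm (d + j) a \<delta>\<^sub>0 m = of_nat (the_enat (k j)) / (2 * \<i> * pi) * (X\<^sub>l j (a \<delta>\<^sub>0) m - a (X\<^sub>l j \<delta>\<^sub>0) m)" for m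
      proof -
        note Xd = bounded_ops_closed[OF XY_bounded(1)[of j] \<delta>] bounded_ops_closed[OF XY_bounded(2)[of j] \<delta>]
        show ?thesis
          unfolding comm_def Gamma_finite(2)[OF j(1) fin ad] Gamma_finite(2)[OF j(1) fin \<delta>]
            bounded_ops_scale[OF aB l2_diff(1)[OF Xd]] bounded_ops_diff[OF aB Xd] A_commute_right(1)[OF a(1) \<delta>]
          by (simp add: algebra_simps)
      qed
      have jN: "j \<in> {1..d+d'}" "d + j \<in> {1..d+d'}" using j(1) d by auto
      have "M * cmod (Y\<^sub>l j (a \<delta>\<^sub>0) ?m - a (Y\<^sub>l j \<delta>\<^sub>0) ?m) = cmod (comm j a \<delta>\<^sub>0 ?m)"
        unfolding cY M_def by (simp add: norm_mult norm_divide)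
      also have "\<dots> \<le> \<kappa> * K"
        using norm_le_l2_norm[OF lip_comm_bound(1)[OF a(2) jN(1) dd], of ?m] lip_comm_bound(2)[OF a(2) jN(1) dd] n\<delta> by simp
      finally have bY: "cmod (Y\<^sub>l j (a \<delta>\<^sub>0) ?m - a (Y\<^sub>l j \<delta>\<^sub>0) ?m) \<le> \<kappa> * K / M" using M by (simp add: field_simps)
      have "M * cmod (X\<^sub>l j (a \<delta>\<^sub>0) ?m - a (X\<^sub>l j \<delta>\<^sub>0) ?m) = cmod (comm (d + j) a \<delta>\<^sub>0 ?m)"
        unfolding cX M_def by (simp add: norm_mult norm_divide)
      also have "\<dots> \<le> \<kappa> * K"
        using norm_le_l2_norm[OF lip_comm_bound(1)[OF a(2) jN(2) dd], of ?m] lip_comm_bound(2)[OF a(2) jN(2) dd] n\<delta> by simp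
      finally have bX: "cmod (X\<^sub>l j (a \<delta>\<^sub>0) ?m - a (X\<^sub>l j \<delta>\<^sub>0) ?m) \<le> \<kappa> * K / M" using M by (simp add: field_simps)
      note XYd = bounded_ops_closed[OF XY_bounded(1)[of j] \<delta>] bounded_ops_closed[OF XY_bounded(3)[of j] \<delta>]
      have "left_op ?x \<delta>\<^sub>0 = (\<lambda>m. X\<^sub>l j \<delta>\<^sub>0 m + (\<i> * ?s) * Y\<^sub>l j \<delta>\<^sub>0 m)"
        using left_op_XY[OF \<delta>] by auto
      then have "a (left_op ?x \<delta>\<^sub>0) = (\<lambda>m. a (X\<^sub>l j \<delta>\<^sub>0) m + (\<i> * ?s) * a (Y\<^sub>l j \<delta>\<^sub>0) m)"
        by (simp only: bounded_ops_add[OF aB XYd(1) l2_scale(1)[OF XYd(2)]] bounded_ops_scale[OF aB XYd(2)])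
      then have "left_op ?x (a \<delta>\<^sub>0) ?m - a (left_op ?x \<delta>\<^sub>0) ?m =
          (X\<^sub>l j (a \<delta>\<^sub>0) ?m - a (X\<^sub>l j \<delta>\<^sub>0) ?m) + (\<i> * ?s) * (Y\<^sub>l j (a \<delta>\<^sub>0) ?m - a (Y\<^sub>l j \<delta>\<^sub>0) ?m)"
        using left_op_XY[OF ad, of j ?m] by (simp add: algebra_simps)
      then have "cmod (left_op ?x (a \<delta>\<^sub>0) ?m - a (left_op ?x \<delta>\<^sub>0) ?m) \<le>
          cmod (X\<^sub>l j (a \<delta>\<^sub>0) ?m - a (X\<^sub>l j \<delta>\<^sub>0) ?m) + cmod ((\<i> * ?s) * (Y\<^sub>l j (a \<delta>\<^sub>0) ?m - a (Y\<^sub>l j \<delta>\<^sub>0) ?m))"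
        by (simp only: norm_triangle_ineq)
      also have "cmod ((\<i> * ?s) * (Y\<^sub>l j (a \<delta>\<^sub>0) ?m - a (Y\<^sub>l j \<delta>\<^sub>0) ?m)) = cmod (Y\<^sub>l j (a \<delta>\<^sub>0) ?m - a (Y\<^sub>l j \<delta>\<^sub>0) ?m)"
        by (simp add: norm_mult)
      finally have 1: "cmod (left_op ?x (a \<delta>\<^sub>0) ?m - a (left_op ?x \<delta>\<^sub>0) ?m) \<le> 2 * \<kappa> * K / M"
        using add_mono[OF bX bY] by (simp only: mult_2 distrib_right add_divide_distrib)
      \<comment> \<open>Left and right translation agree on the vector at the identity, which
        converts the commutator with the unitary into the difference between left and right
        translation of the coefficients.\<close>
      have "a (left_op ?x \<delta>\<^sub>0) = right_op ?x (a \<delta>\<^sub>0)"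
        using A_right_op[OF a(1) e_mem \<delta>, of "f j"] by (simp add: left_op_delta_one right_op_delta_one e_mem)
      then have "left_op ?x (a \<delta>\<^sub>0) ?m - a (left_op ?x \<delta>\<^sub>0) ?m = (lam j powi (p j) - 1) * \<sigma> (p, ?x) * a \<delta>\<^sub>0 p"
        using mI ad sigma_commutation[OF j(1) pI] by (simp add: left_op_apply right_op_apply algebra_simps)
      then have "w * cmod (a \<delta>\<^sub>0 p) \<le> 2 * \<kappa> * K / M"
        using 1 sigma_norm[OF pI e_mem] by (simp add: norm_mult w_def)
      then show ?thesis using w M by (simp add: field_simps)
    qed
    moreover have "0 \<le> 2 * \<kappa> / (M * w)" using M w by (simp add: \<kappa>_def)
    ultimately show ?thesis by blast
  qed
qed

subsection \<open>The seminorm\<close>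

abbreviation "L \<equiv> tor_L d d' f k k' \<sigma> c"

lemma tor_domD_eq: "tor_domD d' k' = (spinor_dom I J :: ((nat \<Rightarrow> int) \<Rightarrow> complex^'s) set)"
proof -
  have "finite J" by (simp add: J_def)
  then show ?thesis unfolding tor_domD_def set_eq_iff mem_Collect_eq spinor_dom_iff[OF \<open>finite J\<close>]
    by (simp add: tor_sqlen_def J_def)
qed

lemma tor_D_comm_eq: "tor_D_comm d d' f k k' \<sigma> c = Dirac_comm"
  by (simp add: fun_eq_iff tor_D_comm_def tor_D_def Dirac_comm_def Dirac_def)

lemma tor_domL_iff: "a \<in> tor_domL d d' f k k' \<sigma> c \<longleftrightarrow> a \<in> sa A \<and> (\<exists>K. lip a K)"
proof -
  have "a \<in> bounded_ops I" if "a \<in> sa A" using that A_bounded by (auto simp: sa_def)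
  then show ?thesis
    unfolding tor_domL_def tor_A_eq tor_domD_eq tor_D_comm_eq using lip_iff_op_norm(1) by blast
qed

lemma lip_dom_iff: "a \<in> lip_dom A L \<longleftrightarrow> a \<in> sa A \<and> (\<exists>K. lip a K)"
  using tor_domL_iff[of a] by (auto simp: lip_dom_def tor_L_def)

text \<open>Reduces statements on the extended real valued L to the calculus of \<open>lip\<close>;
  in particular, L a \<le> 1 becomes \<open>lip a 1\<close>.\<close>

lemma L_le_iff:
  assumes "a \<in> sa A" "0 \<le> K"
  shows "L a \<le> ennreal K \<longleftrightarrow> lip a K"
proof -
  have aB: "a \<in> bounded_ops I" using assms A_bounded by (auto simp: sa_def)
  show ?thesis
  proof
    assume le: "L a \<le> ennreal K"
    then have dom: "a \<in> tor_domL d d' f k k' \<sigma> c" by (auto simp: tor_L_def top_unique split: if_splits)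
    then obtain K' where K': "lip a K'" using tor_domL_iff by blast
    have "ennreal (op_norm I (spinor_dom I J) (Dirac_comm a)) \<le> ennreal K"
      using le dom by (simp add: tor_L_def tor_domD_eq tor_D_comm_eq)
    then have "op_norm I (spinor_dom I J) (Dirac_comm a) \<le> K" using assms(2) by (simp add: ennreal_le_iff)
    then show "lip a K" using lip_mono[OF lip_iff_op_norm(2)[OF aB K']] by blast
  next
    assume "lip a K"
    then show "L a \<le> ennreal K"
      using lip_iff_op_norm(3)[OF aB] assms(1) tor_domL_iff[of a]
      by (auto simp: tor_L_def tor_domD_eq tor_D_comm_eq intro: ennreal_leI)
  qed
qed

lemma L_lip:
  assumes "a \<in> lip_dom A L"
  obtains K where "0 \<le> K" "L a = ennreal K" "lip a K" "a \<in> sa A"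
proof -
  have "L a < \<infinity>" "a \<in> sa A" using assms by (auto simp: lip_dom_def)
  then obtain K where K: "0 \<le> K" "L a = ennreal K" by (cases "L a") auto
  then have "lip a K" using L_le_iff[OF \<open>a \<in> sa A\<close> K(1)] by simp
  then show ?thesis using that K \<open>a \<in> sa A\<close> by blast
qed

lemma lip_one: "lip \<one>\<^bsub>Bl2 I\<^esub> 0"
proof -
  have B: "\<one>\<^bsub>Bl2 I\<^esub> \<in> bounded_ops I" by (simp add: bounded_op_one)
  have V: "\<one>\<^bsub>Bl2 I\<^esub> ` dom1 I J \<subseteq> dom1 I J" using dom1_l2 by fastforce
  have c: "comm i \<one>\<^bsub>Bl2 I\<^esub> \<xi> m = 0" if "i \<in> {1..d+d'}" "\<xi> \<in> dom1 I J" for i \<xi> m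
    using Gamma_linear(1)[OF that] dom1_l2[OF that(2)] by (simp add: comm_def)
  have "Dirac_comm \<one>\<^bsub>Bl2 I\<^esub> \<xi> = (\<lambda>_. 0)" if \<xi>: "\<xi> \<in> spinor_dom I J" for \<xi> :: "(nat \<Rightarrow> int) \<Rightarrow> complex^'s"
  proof
    fix m
    have "(\<chi> t. comm i \<one>\<^bsub>Bl2 I\<^esub> (spinor_comp t \<xi>) m) = 0" if "i \<in> {1..d+d'}" for i
      by (simp only: vec_eq_iff vec_lambda_beta zero_index c[OF that spinor_dom_comp[OF \<xi>]] simp_thms)
    then show "Dirac_comm \<one>\<^bsub>Bl2 I\<^esub> \<xi> m = 0" unfolding Dirac_comm_eq[OF B V \<xi>] by simp
  qed
  then show ?thesis using B V by (simp add: lip_def)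
qed

text \<open>With K = 0 the coefficient bounds leave only the coefficient at the identity, and
  \<open>supported_commutant_entry\<close> rebuilds the operator from it.\<close>

lemma lip_0_scalar:
  assumes a: "a \<in> carrier A" "lip a 0"
  shows "a = cscale (Bl2 I) (a \<delta>\<^sub>0 \<one>\<^bsub>G\<^esub>) \<one>\<^bsub>Bl2 I\<^esub>"
proof -
  have aC: "a \<in> supported_commutant H" using a(1) A_commutant by blast
  have 0: "a \<delta>\<^sub>0 p = 0" if "p \<noteq> \<one>\<^bsub>G\<^esub>" for p
  proof (cases "p \<in> H")
    case True
    then show ?thesis using lip_coefficient_bound[OF True that] a by fastforce
  next
    case False
    then show ?thesis using supported_commutant_support[OF aC one_closed] by blast
  qed
  show ?thesis
  proof (rule bounded_ops_eq_entryI[OF A_bounded'[OF a(1)]])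
    show "cscale (Bl2 I) (a \<delta>\<^sub>0 \<one>\<^bsub>G\<^esub>) \<one>\<^bsub>Bl2 I\<^esub> \<in> bounded_ops I"
      using bounded_op_cscale(1)[OF bounded_op_one] by simp
    fix m q assume mq: "m \<in> I" "q \<in> I"
    show "entry a m q = entry (cscale (Bl2 I) (a \<delta>\<^sub>0 \<one>\<^bsub>G\<^esub>) \<one>\<^bsub>Bl2 I\<^esub>) m q"
    proof (cases "m = q")
      case True
      then show ?thesis using supported_commutant_entry[OF aC mq] mq
        by (simp add: sigma_one) (simp add: entry_def, simp add: delta_def)
    next
      case False
      have "m \<otimes>\<^bsub>G\<^esub> inv\<^bsub>G\<^esub> q \<otimes>\<^bsub>G\<^esub> q = m" using mq by (simp add: m_assoc)
      then have "m \<otimes>\<^bsub>G\<^esub> inv\<^bsub>G\<^esub> q \<noteq> \<one>\<^bsub>G\<^esub>" using mq False by auto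
      then show ?thesis using supported_commutant_entry[OF aC mq] mq 0 False
        by (simp add: entry_def) (simp add: delta_def)
    qed
  qed
qed

text \<open>The finite sum is built by induction inside the algebra and described by its entries and
  its values at states, the two aspects in which it is used.\<close>

lemma combination_in_A:
  assumes "finite F" "F \<subseteq> H"
  shows "\<exists>b\<in>carrier A. (\<forall>m\<in>I. \<forall>q\<in>I. entry b m q = (\<Sum>p\<in>F. z p * entry (left_op p) m q)) \<and>
    (\<forall>\<phi>\<in>states A. \<phi> b = (\<Sum>p\<in>F. z p * \<phi> (left_op p)))"
proof -
  interpret A: unital_cstar_algebra A by (rule A_unital)
  show ?thesis using assms
  proof (induction F rule: finite_induct)
    case empty
    have "entry \<zero>\<^bsub>A\<^esub> m q = 0" if "q \<in> I" for m q using that by (simp add: A_ops entry_def)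
    moreover have "\<phi> \<zero>\<^bsub>A\<^esub> = 0" if "\<phi> \<in> states A" for \<phi>
      using A.state_scale[OF that A.zero_closed, of 0] A.scale_zero_left[OF A.zero_closed] by simp
    ultimately show ?case using A.zero_closed by auto
  next
    case (insert p F)
    then obtain b where b: "b \<in> carrier A" "\<forall>m\<in>I. \<forall>q\<in>I. entry b m q = (\<Sum>p\<in>F. z p * entry (left_op p) m q)"
      "\<forall>\<phi>\<in>states A. \<phi> b = (\<Sum>p\<in>F. z p * \<phi> (left_op p))" by auto
    have p: "left_op p \<in> carrier A" using insert A_left_op by auto
    let ?b = "cscale A (z p) (left_op p) \<oplus>\<^bsub>A\<^esub> b"
    have "entry ?b m q = z p * entry (left_op p) m q + entry b m q" if "q \<in> I" for m q
      using that by (simp add: A_ops entry_def)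
    moreover have "\<phi> ?b = z p * \<phi> (left_op p) + \<phi> b" if "\<phi> \<in> states A" for \<phi>
      using p b(1) by (simp add: A.state_add[OF that] A.state_scale[OF that] A.scale_closed)
    ultimately show ?case using b insert.hyps p by (intro bexI[of _ ?b]) (auto simp: A.scale_closed)
  qed
qed

text \<open>Coordinates beyond d vanish on H, those of finite modulus take finitely many values
  anyway, and the remaining ones are bounded by M.\<close>

lemma finite_truncated_support: "finite {p \<in> H. \<forall>j\<in>J \<inter> {1..d}. \<bar>p j\<bar> \<le> int (M j)}"
proof (rule finite_subset)
  let ?P = "\<Pi>\<^sub>E j\<in>{1..d'}. if k' j = \<infinity> then {- int (M j)..int (M j)} else {0..<int (the_enat (k' j))}"
  show "finite ?P" by (intro finite_PiE) auto
  show "{p \<in> H. \<forall>j\<in>J \<inter> {1..d}. \<bar>p j\<bar> \<le> int (M j)} \<subseteq> ?P"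
  proof
    fix p assume "p \<in> {p \<in> H. \<forall>j\<in>J \<inter> {1..d}. \<bar>p j\<bar> \<le> int (M j)}"
    then have p: "p \<in> I" "\<And>j. j \<in> {d+1..d'} \<Longrightarrow> p j = 0" "\<And>j. j \<in> J \<Longrightarrow> j \<in> {1..d} \<Longrightarrow> \<bar>p j\<bar> \<le> int (M j)"
      by (auto simp: H_def)
    show "p \<in> ?P"
    proof (rule PiE_I)
      fix j assume j: "j \<in> {1..d'}"
      show "p j \<in> (if k' j = \<infinity> then {- int (M j)..int (M j)} else {0..<int (the_enat (k' j))})"
      proof (cases "k' j = \<infinity>")
        case True
        show ?thesis
        proof (cases "j \<le> d")
          case True
          then show ?thesis using p(3)[of j] j \<open>k' j = \<infinity>\<close> by (auto simp: J_def abs_le_iff)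
        qed (use p(2)[of j] j True in simp)
      next
        case False
        then obtain n where n: "k' j = enat n" "modulus (k' j) = n" "2 \<le> n" using modulus_cases[OF j] by metis
        then show ?thesis using Zk_mod[OF p(1) j] pos_mod_sign[of "int n" "p j"] pos_mod_bound[of "int n" "p j"] by simp
      qed
    next
      fix j assume "j \<notin> {1..d'}"
      then show "p j = undefined" using p(1) by (auto simp: carrier_Zk extensional_def)
    qed
  qed
qed

lemma state_approximation:
  assumes \<epsilon>: "\<epsilon> > 0"
  shows "\<exists>F C. finite F \<and> F \<subseteq> carrier A \<and> 0 \<le> C \<and>
    (\<forall>a\<in>lip_dom A L. L a \<le> 1 \<longrightarrow> (\<forall>\<phi>\<in>states A. \<forall>\<psi>\<in>states A.
       cmod (\<phi> a - \<psi> a) \<le> \<epsilon> + C * (\<Sum>x\<in>F. cmod (\<phi> x - \<psi> x))))"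
proof -
  interpret A: unital_cstar_algebra A by (rule A_unital)
  obtain C1 where C1: "C1 \<ge> 0" "\<forall>j\<in>J. \<forall>a\<in>carrier A. \<forall>K. lip a K \<longrightarrow>
      mat_bounded I (C1 * K) (\<lambda>m q. complex_of_int (m j - q j) * entry a m q)"
    using lip_derivative_mat_bounded by blast
  \<comment> \<open>C1 may be 0; adding 1 allows dividing by K1.\<close>
  define K1 where "K1 = C1 + 1"
  have K1: "K1 > 0" "C1 \<le> K1" using C1(1) by (auto simp: K1_def)
  have fJ: "finite (J \<inter> {1..d})" by simp
  \<comment> \<open>Scaling back by K1 leaves \<epsilon> / 4 for the norm of a - b;
    \<open>state_diff_bound\<close> doubles it for each of the two states, which makes \<epsilon> in
    total.\<close>
  obtain M where M: "\<forall>t. (\<forall>j\<in>J \<inter> {1..d}. mat_bounded I 1 (\<lambda>m q. complex_of_int (m j - q j) * t m q)) \<longrightarrow>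
     mat_bounded I (\<epsilon> / (4 * K1)) (\<lambda>m q. if \<forall>j\<in>J \<inter> {1..d}. \<bar>m j - q j\<bar> \<le> int (M j) then 0 else t m q)"
    using mat_bounded_multi_truncation[OF fJ, of "\<epsilon> / (4 * K1)" I "\<lambda>j m. m j"] \<epsilon> K1 by auto
  define F where "F = {p \<in> H. \<forall>j\<in>J \<inter> {1..d}. \<bar>p j\<bar> \<le> int (M j)}"
  have F: "finite F" "F \<subseteq> H" unfolding F_def using finite_truncated_support by auto
  have FI: "p \<in> I" if "p \<in> F" for p using that F by (auto simp: H_def)
  have "\<forall>p\<in>H - {\<one>\<^bsub>G\<^esub>}. \<exists>C\<ge>0. \<forall>a\<in>carrier A. \<forall>K. lip a K \<longrightarrow> cmod (a \<delta>\<^sub>0 p) \<le> C * K"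
    using lip_coefficient_bound by blast
  from bchoice[OF this] obtain Cf where Cf: "\<forall>p\<in>H - {\<one>\<^bsub>G\<^esub>}. Cf p \<ge> 0 \<and>
    (\<forall>a\<in>carrier A. \<forall>K. lip a K \<longrightarrow> cmod (a \<delta>\<^sub>0 p) \<le> Cf p * K)" ..
  define C where "C = (\<Sum>p\<in>F - {\<one>\<^bsub>G\<^esub>}. Cf p)"
  have CfC: "0 \<le> Cf p" "Cf p \<le> C" if "p \<in> F - {\<one>\<^bsub>G\<^esub>}" for p
  proof -
    show "0 \<le> Cf p" using Cf F(2) that by blast
    show "Cf p \<le> C" unfolding C_def using Cf F that by (intro member_le_sum) blast+
  qed
  have C0: "0 \<le> C" unfolding C_def using CfC(1) by (intro sum_nonneg)
  have inj: "inj_on left_op F"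
  proof (rule inj_onI)
    fix p q assume pq: "p \<in> F" "q \<in> F" "left_op p = left_op q"
    then have "delta p = delta q" using left_op_delta_one[OF FI[OF pq(1)]] left_op_delta_one[OF FI[OF pq(2)]] by simp
    then show "p = q" by (metis delta_def zero_neq_one)
  qed
  have "cmod (\<phi> a - \<psi> a) \<le> \<epsilon> + C * (\<Sum>x\<in>left_op ` F. cmod (\<phi> x - \<psi> x))"
    if a: "a \<in> lip_dom A L" "L a \<le> 1" and st: "\<phi> \<in> states A" "\<psi> \<in> states A" for a \<phi> \<psi>
  proof -
    have aA: "a \<in> sa A" "a \<in> carrier A" using a(1) by (auto simp: lip_dom_def sa_def)
    have lip: "lip a 1" using L_le_iff[OF aA(1), of 1] a(2) by simp
    have aC: "a \<in> supported_commutant H" using aA(2) A_commutant by blast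
    obtain b where b: "b \<in> carrier A" "\<forall>m\<in>I. \<forall>q\<in>I. entry b m q = (\<Sum>p\<in>F. a \<delta>\<^sub>0 p * entry (left_op p) m q)"
      "\<forall>\<phi>\<in>states A. \<phi> b = (\<Sum>p\<in>F. a \<delta>\<^sub>0 p * \<phi> (left_op p))"
      using combination_in_A[OF F, of "\<lambda>p. a \<delta>\<^sub>0 p"] by blast
    \<comment> \<open>The coefficient at p occupies exactly the entries with m - q = p, so b has the
      entries of a cut down to F.\<close>
    have eb: "entry b m q = (if m \<otimes>\<^bsub>G\<^esub> inv\<^bsub>G\<^esub> q \<in> F then entry a m q else 0)" if mq: "m \<in> I" "q \<in> I" for m q
    proof -
      have "m = q \<otimes>\<^bsub>G\<^esub> p \<longleftrightarrow> p = m \<otimes>\<^bsub>G\<^esub> inv\<^bsub>G\<^esub> q" if "p \<in> F" for p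
        using mq FI[OF that] by (metis inv_solve_right m_comm)
      then have "entry b m q = (\<Sum>p\<in>F. if p = m \<otimes>\<^bsub>G\<^esub> inv\<^bsub>G\<^esub> q then a \<delta>\<^sub>0 p * \<sigma> (p, q) else 0)"
        using b(2) mq FI by (auto simp: entry_left_op intro!: sum.cong)
      then show ?thesis using F(1) supported_commutant_entry[OF aC mq] by (simp add: mult.commute)
    qed
    have "mat_bounded I 1 (\<lambda>m q. complex_of_int (m j - q j) * (complex_of_real (1/K1) * entry a m q))"
      if "j \<in> J \<inter> {1..d}" for j
    proof -
      have "mat_bounded I (C1 * 1) (\<lambda>m q. complex_of_int (m j - q j) * entry a m q)"
        using C1(2) that aA(2) lip by blast
      from mat_bounded_scale[OF this, of "complex_of_real (1/K1)"]
      have "mat_bounded I (C1 / K1) (\<lambda>m q. complex_of_real (1/K1) * (complex_of_int (m j - q j) * entry a m q))"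
        using K1 by (simp add: norm_divide)
      then have "mat_bounded I 1 (\<lambda>m q. complex_of_real (1/K1) * (complex_of_int (m j - q j) * entry a m q))"
        by (rule mat_bounded_mono) (use K1 in simp)
      then show ?thesis by (simp add: mult.left_commute)
    qed
    then have "mat_bounded I (\<epsilon> / (4 * K1))
        (\<lambda>m q. if \<forall>j\<in>J \<inter> {1..d}. \<bar>m j - q j\<bar> \<le> int (M j) then 0 else complex_of_real (1/K1) * entry a m q)"
      by (intro M[rule_format]) simp
    from mat_bounded_scale[OF this, of "complex_of_real K1"]
    have mb: "mat_bounded I (\<epsilon> / 4) (\<lambda>m q. complex_of_real K1 *
        (if \<forall>j\<in>J \<inter> {1..d}. \<bar>m j - q j\<bar> \<le> int (M j) then 0 else complex_of_real (1/K1) * entry a m q))"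
      using K1 by simp
    have "bop_norm I (a \<ominus>\<^bsub>A\<^esub> b) \<le> \<epsilon> / 4"
    proof (rule bop_norm_le_mat_bounded[OF A_bounded' mb])
      show "a \<ominus>\<^bsub>A\<^esub> b \<in> carrier A" using aA b by simp
      fix m q assume mq: "m \<in> I" "q \<in> I"
      let ?p = "m \<otimes>\<^bsub>G\<^esub> inv\<^bsub>G\<^esub> q"
      have e1: "entry (a \<ominus>\<^bsub>A\<^esub> b) m q = entry a m q - entry b m q"
        using mq by (simp add: A_minus[OF aA(2) b(1)] entry_def)
      \<comment> \<open>Membership in F splits into membership in H, outside which the entries of a
        vanish, and the bounds on the infinite coordinates; the cut-off matrix provided by
        \<open>M\<close> is therefore that of a - b.\<close>
      have "?p \<in> F \<longleftrightarrow> ?p \<in> H \<and> (\<forall>j\<in>J \<inter> {1..d}. \<bar>m j - q j\<bar> \<le> int (M j))"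
        using J_mult_inv[OF _ mq] by (auto simp: F_def)
      moreover have "entry a m q = 0" if "?p \<notin> H"
        using supported_commutant_entry[OF aC mq] supported_commutant_support[OF aC one_closed that] by simp
      ultimately show "entry (a \<ominus>\<^bsub>A\<^esub> b) m q = complex_of_real K1 *
        (if \<forall>j\<in>J \<inter> {1..d}. \<bar>m j - q j\<bar> \<le> int (M j) then 0 else complex_of_real (1/K1) * entry a m q)"
        unfolding e1 eb[OF mq] using K1 by auto
    qed
    then have nab: "cnorm A (a \<ominus>\<^bsub>A\<^esub> b) \<le> \<epsilon> / 4" by (simp add: A_ops)
    have "cmod (\<phi> b - \<psi> b) = cmod (\<Sum>p\<in>F. a \<delta>\<^sub>0 p * (\<phi> (left_op p) - \<psi> (left_op p)))"
      using b(3) st by (simp add: sum_subtractf right_diff_distrib)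
    also have "\<dots> \<le> (\<Sum>p\<in>F. C * cmod (\<phi> (left_op p) - \<psi> (left_op p)))"
    proof (rule order_trans[OF norm_sum sum_mono])
      fix p assume p: "p \<in> F"
      show "cmod (a \<delta>\<^sub>0 p * (\<phi> (left_op p) - \<psi> (left_op p))) \<le> C * cmod (\<phi> (left_op p) - \<psi> (left_op p))"
      \<comment> \<open>L gives no bound on the coefficient at the identity, but there the unitary
        is the unit, at which the two states agree.\<close>
      proof (cases "p = \<one>\<^bsub>G\<^esub>")
        case True
        have "left_op p = \<one>\<^bsub>A\<^esub>"
          unfolding A_ops True by (rule bounded_ops_eqI) (auto simp: left_op_bounded left_op_one bounded_op_one)
        then show ?thesis using A.state_one[OF st(1)] A.state_one[OF st(2)] by simp
      next
        case False
        have "cmod (a \<delta>\<^sub>0 p) \<le> Cf p * 1" using Cf F(2) p False aA(2) lip by blast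
        then show ?thesis
          using CfC[of p] p False by (simp add: norm_mult mult_right_mono)
      qed
    qed
    also have "\<dots> = C * (\<Sum>x\<in>left_op ` F. cmod (\<phi> x - \<psi> x))"
      by (simp add: sum.reindex[OF inj] sum_distrib_left)
    finally have 1: "cmod (\<phi> b - \<psi> b) \<le> C * (\<Sum>x\<in>left_op ` F. cmod (\<phi> x - \<psi> x))" .
    have 2: "cmod (\<phi> a - \<phi> b) \<le> \<epsilon> / 2" "cmod (\<psi> b - \<psi> a) \<le> \<epsilon> / 2"
      using A.state_diff_bound[OF st(1) aA(2) b(1)] A.state_diff_bound[OF st(2) aA(2) b(1)] nab
      by (auto simp: norm_minus_commute)
    have "\<phi> a - \<psi> a = (\<phi> a - \<phi> b) + (\<phi> b - \<psi> b) + (\<psi> b - \<psi> a)" by simp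
    then have "cmod (\<phi> a - \<psi> a) \<le> cmod (\<phi> a - \<phi> b) + cmod (\<phi> b - \<psi> b) + cmod (\<psi> b - \<psi> a)"
      by (metis norm_triangle_mono norm_triangle_ineq order_refl)
    then show ?thesis using 1 2 by linarith
  qed
  moreover have "left_op ` F \<subseteq> carrier A" using F(2) A_left_op by auto
  ultimately show ?thesis using F(1) C0 by (intro exI[of _ "left_op ` F"] exI[of _ C]) auto
qed

text \<open>Requiring a bound for b and for its adjoint makes S stable under adjoints; the
  generators qualify because their adjoints are again unitaries of H. The real part of an element of
  S is then a self-adjoint approximant at no cost in norm.\<close>

lemma lipschitz_dense:
  assumes a: "a \<in> sa A" and \<epsilon>: "\<epsilon> > 0"
  shows "\<exists>b\<in>lip_dom A L. cnorm A (a \<ominus>\<^bsub>A\<^esub> b) < \<epsilon>"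
proof -
  interpret A: unital_cstar_algebra A by (rule A_unital)
  interpret M: unital_cstar_algebra "Bl2 I" by (rule unital_cstar_algebra_Bl2)
  define S where "S = {b \<in> carrier (Bl2 I). (\<exists>K. lip b K) \<and> (\<exists>K. lip (cstar (Bl2 I) b) K)}"
  have aA: "a \<in> carrier A" "cstar A a = a" using a by (auto simp: sa_def)
  have "\<exists>b\<in>S \<inter> carrier A. bop_norm I (\<lambda>\<xi>\<in>l2 I. \<lambda>i. a \<xi> i - b \<xi> i) < \<epsilon>"
  proof (rule A_dense[OF _ _ _ _ _ _ _ aA(1) \<epsilon>])
    have H: "e j \<in> H" if "j \<in> {1..d}" for j using X that by blast
    have "left_op (e j) \<in> S" if j: "j \<in> {1..d}" for j
      using lip_left_op[OF H[OF j]] lip_left_op[OF m_inv_closed[OF H[OF j]]]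
      by (simp add: S_def left_op_bounded e_mem adjoint_left_op)
    then show "left_op ` e ` {1..d} \<subseteq> S" by auto
    show "S \<subseteq> bounded_ops I" by (auto simp: S_def)
    show "\<zero>\<^bsub>Bl2 I\<^esub> \<in> S" using lip_zero by (auto simp: S_def M.star_zero simp del: Bl2_simps)
    fix x assume "x \<in> S"
    then obtain K K' where x: "x \<in> carrier (Bl2 I)" "lip x K" "lip (cstar (Bl2 I) x) K'" unfolding S_def by blast
    show "cstar (Bl2 I) x \<in> S" unfolding S_def mem_Collect_eq M.star_star[OF x(1)] using x M.star_closed by blast
    show "cscale (Bl2 I) s x \<in> S" for s
      unfolding S_def mem_Collect_eq M.star_scale[OF x(1)] using x M.scale_closed lip_scale by blast
    fix y assume "y \<in> S"
    then obtain N N' where y: "y \<in> carrier (Bl2 I)" "lip y N" "lip (cstar (Bl2 I) y) N'" unfolding S_def by blast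
    show "x \<oplus>\<^bsub>Bl2 I\<^esub> y \<in> S"
      unfolding S_def mem_Collect_eq M.star_add[OF x(1) y(1)] using x y M.add.m_closed lip_add by blast
    show "x \<otimes>\<^bsub>Bl2 I\<^esub> y \<in> S"
      unfolding S_def mem_Collect_eq M.star_mult[OF x(1) y(1)] using x y M.m_closed lip_mult by blast
  qed
  then obtain b where b: "b \<in> S" "b \<in> carrier A" "bop_norm I (\<lambda>\<xi>\<in>l2 I. \<lambda>i. a \<xi> i - b \<xi> i) < \<epsilon>" by blast
  have nb: "cnorm A (a \<ominus>\<^bsub>A\<^esub> b) < \<epsilon>" using b(3) by (simp add: A_minus[OF aA(1) b(2)] A_ops)
  obtain K K' where K: "lip b K" "lip (cstar (Bl2 I) b) K'" using b(1) unfolding S_def by blast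
  have "\<exists>K. lip (re_part A b) K"
    unfolding re_part_def A_ops using lip_scale[OF lip_add[OF K]] by blast
  then have "re_part A b \<in> lip_dom A L" using lip_dom_iff A.re_part_sa(1)[OF b(2)] by blast
  \<comment> \<open>Being self-adjoint, a equals its own real part, and taking real parts does not
    increase norms.\<close>
  moreover have "a \<ominus>\<^bsub>A\<^esub> re_part A b = re_part A (a \<ominus>\<^bsub>A\<^esub> b)"
  proof -
    note c = aA(1) b(2) A.star_closed[OF b(2)]
    have "a = cscale A (1/2 + 1/2) a" using A.scale_one[OF aA(1)] by simp
    also have "\<dots> = cscale A (1/2) (a \<oplus>\<^bsub>A\<^esub> a)"
      using aA(1) by (simp only: A.scale_add_left A.scale_add_right)
    finally have "a \<ominus>\<^bsub>A\<^esub> re_part A b = cscale A (1/2) ((a \<oplus>\<^bsub>A\<^esub> a) \<ominus>\<^bsub>A\<^esub> (b \<oplus>\<^bsub>A\<^esub> cstar A b))"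
      using c by (simp add: re_part_def A.scale_minus_right)
    also have "(a \<oplus>\<^bsub>A\<^esub> a) \<ominus>\<^bsub>A\<^esub> (b \<oplus>\<^bsub>A\<^esub> cstar A b) = (a \<ominus>\<^bsub>A\<^esub> b) \<oplus>\<^bsub>A\<^esub> (a \<ominus>\<^bsub>A\<^esub> cstar A b)"
      using c by algebra
    finally show ?thesis using c aA(2) by (simp add: re_part_def A.star_minus)
  qed
  ultimately show ?thesis
    using A.re_part_sa(2)[of "a \<ominus>\<^bsub>A\<^esub> b"] aA(1) b(2) nb by (intro bexI[of _ "re_part A b"]) auto
qed

theorem quantum_compact_metric_space_tori: "quantum_compact_metric_space A L"
proof -
  interpret A: unital_cstar_algebra A by (rule A_unital)
  note lipd = lip_dom_iff[THEN iffD2, OF conjI]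
  show ?thesis
  proof (rule A.quantum_compact_metric_spaceI)
    fix a b assume "a \<in> lip_dom A L" "b \<in> lip_dom A L"
    then obtain K N where K: "0 \<le> K" "L a = ennreal K" "lip a K" "a \<in> sa A"
      and N: "0 \<le> N" "L b = ennreal N" "lip b N" "b \<in> sa A"
      by (metis L_lip)
    have c: "a \<in> carrier A" "b \<in> carrier A" using K N by (auto simp: sa_def)
    note sa = A.sa_closed_operations[OF K(4) N(4)]
    have "lip (a \<oplus>\<^bsub>A\<^esub> b) (K + N)" unfolding A_ops by (rule lip_add[OF K(3) N(3)])
    then show "a \<oplus>\<^bsub>A\<^esub> b \<in> lip_dom A L \<and> L (a \<oplus>\<^bsub>A\<^esub> b) \<le> L a + L b"
      using L_le_iff[OF sa(1), of "K + N"] lipd[OF sa(1)] K N by (auto simp: ennreal_plus)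
    let ?B = "cnorm A a * N + K * cnorm A b"
    have B: "0 \<le> ?B" using K N A.norm_nonneg c by simp
    have eB: "ennreal ?B = ennreal (cnorm A a) * L b + L a * ennreal (cnorm A b)"
      using K N A.norm_nonneg c by (simp add: ennreal_plus ennreal_mult)
    have ab: "lip (a \<otimes>\<^bsub>A\<^esub> b) ?B" unfolding A_ops using lip_mult[OF K(3) N(3)] by simp
    have ba: "lip (b \<otimes>\<^bsub>A\<^esub> a) ?B" unfolding A_ops using lip_mult[OF N(3) K(3)] by (simp add: mult.commute add.commute)
    \<comment> \<open>The prefactors 1 / 2 and 1 / (2 i) compensate the two products a b and b a,
      both of which obey the same Leibniz bound.\<close>
    have half: "cmod (1/2) * (x + x) = x" "cmod (1/(2*\<i>)) * (x + x) = x" for x :: real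
      by (simp_all add: norm_divide norm_mult)
    have "lip (cscale A (1/2) (a \<otimes>\<^bsub>A\<^esub> b \<oplus>\<^bsub>A\<^esub> b \<otimes>\<^bsub>A\<^esub> a)) (cmod (1/2) * (?B + ?B))"
      using lip_scale[OF lip_add[OF ab ba], of "1/2"] unfolding A_ops .
    then have "lip (cscale A (1/2) (a \<otimes>\<^bsub>A\<^esub> b \<oplus>\<^bsub>A\<^esub> b \<otimes>\<^bsub>A\<^esub> a)) ?B" unfolding half .
    then show "cscale A (1 / 2) (a \<otimes>\<^bsub>A\<^esub> b \<oplus>\<^bsub>A\<^esub> b \<otimes>\<^bsub>A\<^esub> a) \<in> lip_dom A L \<and>
        L (cscale A (1 / 2) (a \<otimes>\<^bsub>A\<^esub> b \<oplus>\<^bsub>A\<^esub> b \<otimes>\<^bsub>A\<^esub> a)) \<le> ennreal (cnorm A a) * L b + L a * ennreal (cnorm A b)"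
      using L_le_iff[OF sa(3) B] lipd[OF sa(3)] unfolding eB[symmetric] by blast
    have m: "a \<otimes>\<^bsub>A\<^esub> b \<ominus>\<^bsub>A\<^esub> b \<otimes>\<^bsub>A\<^esub> a = a \<otimes>\<^bsub>A\<^esub> b \<oplus>\<^bsub>A\<^esub> cscale A (-1) (b \<otimes>\<^bsub>A\<^esub> a)"
      using c by (simp add: a_minus_def A.a_inv_scale)
    have "lip (cscale A (-1) (b \<otimes>\<^bsub>A\<^esub> a)) (cmod (-1) * ?B)" using lip_scale[OF ba, of "-1"] unfolding A_ops .
    then have nba: "lip (cscale A (-1) (b \<otimes>\<^bsub>A\<^esub> a)) ?B" by simp
    have "lip (cscale A (1/(2*\<i>)) (a \<otimes>\<^bsub>A\<^esub> b \<ominus>\<^bsub>A\<^esub> b \<otimes>\<^bsub>A\<^esub> a)) (cmod (1/(2*\<i>)) * (?B + ?B))"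
      using lip_scale[OF lip_add[OF ab nba], of "1/(2*\<i>)"] unfolding m unfolding A_ops .
    then have "lip (cscale A (1/(2*\<i>)) (a \<otimes>\<^bsub>A\<^esub> b \<ominus>\<^bsub>A\<^esub> b \<otimes>\<^bsub>A\<^esub> a)) ?B" unfolding half .
    then show "cscale A (1 / (2 * \<i>)) (a \<otimes>\<^bsub>A\<^esub> b \<ominus>\<^bsub>A\<^esub> b \<otimes>\<^bsub>A\<^esub> a) \<in> lip_dom A L \<and>
        L (cscale A (1 / (2 * \<i>)) (a \<otimes>\<^bsub>A\<^esub> b \<ominus>\<^bsub>A\<^esub> b \<otimes>\<^bsub>A\<^esub> a)) \<le> ennreal (cnorm A a) * L b + L a * ennreal (cnorm A b)"
      using L_le_iff[OF sa(4) B] lipd[OF sa(4)] unfolding eB[symmetric] by blast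
  next
    fix a and t :: real assume a: "a \<in> lip_dom A L"
    then obtain K where K: "0 \<le> K" "L a = ennreal K" "lip a K" "a \<in> sa A" by (rule L_lip)
    let ?b = "cscale A (complex_of_real t) a"
    have aA: "a \<in> carrier A" using K by (simp add: sa_def)
    have sa: "?b \<in> sa A" by (rule A.sa_closed_operations(2)[OF K(4) K(4)])
    have lb: "lip ?b (\<bar>t\<bar> * K)" using lip_scale[OF K(3), of "complex_of_real t"] by (simp add: A_ops)
    then have b: "?b \<in> lip_dom A L" using lipd[OF sa] by blast
    then obtain N where N: "0 \<le> N" "L ?b = ennreal N" "lip ?b N" by (rule L_lip)
    have "N \<le> \<bar>t\<bar> * K" using L_le_iff[OF sa, of "\<bar>t\<bar> * K"] lb K N by (simp add: ennreal_le_iff)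
    \<comment> \<open>\<open>lip_scale\<close> yields only an upper bound; the reverse one comes
      from scaling back by 1 / t.\<close>
    moreover have "\<bar>t\<bar> * K \<le> N"
    proof (cases "t = 0")
      case False
      have "lip (cscale A (complex_of_real (1/t)) ?b) (cmod (complex_of_real (1/t)) * N)"
        using lip_scale[OF N(3), of "complex_of_real (1/t)"] unfolding A_ops .
      moreover have "cscale A (complex_of_real (1/t)) ?b = a"
        using False by (simp add: A.scale_scale[OF aA] A.scale_one[OF aA] flip: of_real_mult)
      ultimately have "lip a (N / \<bar>t\<bar>)" by (simp add: norm_divide)
      then have "ennreal K \<le> ennreal (N / \<bar>t\<bar>)" using L_le_iff[OF K(4), of "N / \<bar>t\<bar>"] N K by simp
      then show ?thesis using N False by (simp add: ennreal_le_iff field_simps)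
    qed (use N in simp)
    ultimately have "L ?b = ennreal (\<bar>t\<bar> * K)" using N by simp
    then show "?b \<in> lip_dom A L \<and> L ?b = ennreal \<bar>t\<bar> * L a" using b K by (simp add: ennreal_mult)
  next
    fix a assume a: "a \<in> lip_dom A L"
    then obtain K where K: "0 \<le> K" "L a = ennreal K" "lip a K" "a \<in> sa A" by (rule L_lip)
    then have aA: "a \<in> carrier A" "adjoint_op I a = a" by (auto simp: sa_def A_ops)
    show "L a = 0 \<longleftrightarrow> (\<exists>t::real. a = cscale A (complex_of_real t) \<one>\<^bsub>A\<^esub>)"
    proof
      assume "L a = 0"
      then have "lip a 0" using L_le_iff[OF K(4), of 0] by simp
      from lip_0_scalar[OF aA(1) this] have eq: "a = cscale A (a \<delta>\<^sub>0 \<one>\<^bsub>G\<^esub>) \<one>\<^bsub>A\<^esub>" unfolding A_ops .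
      \<comment> \<open>Self-adjointness of a makes its diagonal entries real, so the scalar found
        by \<open>lip_0_scalar\<close> is a real one.\<close>
      have "a \<delta>\<^sub>0 \<one>\<^bsub>G\<^esub> = cnj (a \<delta>\<^sub>0 \<one>\<^bsub>G\<^esub>)"
        using adjoint_op_bounded(3)[OF A_bounded'[OF aA(1)] one_I one_I] aA(2) by (simp add: entry_def)
      then have "a \<delta>\<^sub>0 \<one>\<^bsub>G\<^esub> \<in> \<real>" by (simp add: Reals_cnj_iff)
      then obtain t where "a \<delta>\<^sub>0 \<one>\<^bsub>G\<^esub> = complex_of_real t" by (auto elim: Reals_cases)
      then show "\<exists>t::real. a = cscale A (complex_of_real t) \<one>\<^bsub>A\<^esub>" using eq by metis
    next
      assume "\<exists>t::real. a = cscale A (complex_of_real t) \<one>\<^bsub>A\<^esub>"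
      then obtain t where t: "a = cscale A (complex_of_real t) \<one>\<^bsub>A\<^esub>" ..
      have "lip a 0" using lip_scale[OF lip_one, of "complex_of_real t"] unfolding t A_ops by simp
      then have "L a \<le> ennreal 0" using L_le_iff[OF K(4), of 0] by blast
      then show "L a = 0" by simp
    qed
  next
    fix a assume a: "a \<in> carrier A"
      and lim: "\<And>\<epsilon>. \<epsilon> > 0 \<Longrightarrow> \<exists>b\<in>lip_dom A L. L b \<le> 1 \<and> cnorm A (a \<ominus>\<^bsub>A\<^esub> b) < \<epsilon>"
    have sa: "a \<in> sa A"
      by (rule A.sa_limit[OF a]) (use lim in \<open>meson lip_dom_def lip_dom_iff\<close>)
    have "lip a 1"
    proof (rule lip_closed[OF A_bounded'[OF a]])
      fix \<epsilon> :: real assume "\<epsilon> > 0"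
      then obtain b where b: "b \<in> lip_dom A L" "L b \<le> 1" "cnorm A (a \<ominus>\<^bsub>A\<^esub> b) < \<epsilon>" using lim by blast
      then have bsa: "b \<in> sa A" "b \<in> carrier A" by (auto simp: lip_dom_def sa_def)
      then have "lip b 1" using L_le_iff[of b 1] b(2) by simp
      then show "\<exists>b\<in>carrier A. lip b 1 \<and> bop_norm I (\<lambda>\<xi>\<in>l2 I. \<lambda>i. a \<xi> i - b \<xi> i) < \<epsilon>"
        using bsa(2) b(3) A_minus[OF a bsa(2)] by (intro bexI[of _ b]) (auto simp: A_ops)
    qed simp
    then show "a \<in> lip_dom A L \<and> L a \<le> 1" using L_le_iff[OF sa, of 1] lipd[OF sa] by auto
  qed (use lipschitz_dense state_approximation in blast)+
qed

end

theorem theorem3p22: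
  fixes d d' :: nat
    and f :: "nat \<Rightarrow> nat"
    and k k' :: "enat \<Rightarrow> nat \<Rightarrow> enat"
    and \<sigma> \<sigma>' :: "enat \<Rightarrow> cocycle"
    and c :: "(nat set \<Rightarrow> complex) \<Rightarrow> complex^'s^'s"
  assumes d: "2 \<le> d" "d \<le> d'"
    and f_perm: "f permutes {1..d'}"
    and f_involution: "\<forall>j\<in>{1..d'}. f (f j) = j \<and> f j \<noteq> j"
    and f_range: "{d+1..d'} \<subseteq> f ` {1..d}"
    and Xi: "\<forall>n. (k n, \<sigma> n) \<in> Xi d" "\<forall>n. (k' n, \<sigma>' n) \<in> Xi d'"
    and lim: "limitin (Xi_topology d) (\<lambda>n::nat. (k (enat n), \<sigma> (enat n))) (k \<infinity>, \<sigma> \<infinity>) sequentially"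
    and lim': "limitin (Xi_topology d') (\<lambda>n::nat. (k' (enat n), \<sigma>' (enat n))) (k' \<infinity>, \<sigma>' \<infinity>) sequentially"
    and k_inf: "\<forall>j\<in>{1..d}. k \<infinity> j = \<infinity>"
    and k'_inf: "\<forall>j\<in>{1..d'}. k' \<infinity> j = \<infinity>"
    and k_uniform: "\<forall>j\<in>{1..d}. (\<forall>n::nat. k (enat n) j < \<infinity>) \<or> (\<forall>n::nat. k (enat n) j = \<infinity>)"
    and k_k': "\<forall>n. \<forall>j\<in>{1..d}. k' n (f j) = k n j \<and> k' n j = k n j"
    and \<sigma>_restrict: "\<forall>n. \<forall>x\<in>carrier (Zk d (k n)). \<forall>y\<in>carrier (Zk d (k n)).
            \<sigma> n (x, y) = \<sigma>' n (Zk_embed d d' x, Zk_embed d d' y)"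
    and commutation: "\<forall>n. \<forall>j\<in>{1..d}. \<forall>s\<in>{1..d'}.
            tor_U d' (k' n) (\<sigma>' n) (f j) \<otimes>\<^bsub>tor_B d' (k' n) (\<sigma>' n)\<^esub> tor_U d' (k' n) (\<sigma>' n) s =
            cscale (tor_B d' (k' n) (\<sigma>' n))
              (if s = j \<and> k n j < \<infinity> \<and> j < f j then exp (2 * \<i> * pi / of_nat (the_enat (k n j)))
               else if s = j \<and> k n j < \<infinity> \<and> j > f j then exp (- 2 * \<i> * pi / of_nat (the_enat (k n j)))
               else 1)
              (tor_U d' (k' n) (\<sigma>' n) s \<otimes>\<^bsub>tor_B d' (k' n) (\<sigma>' n)\<^esub> tor_U d' (k' n) (\<sigma>' n) (f j))"
    and c: "faithful_clifford_rep (d + d') c"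
  shows "\<forall>n::enat. quantum_compact_metric_space
           (tor_A d d' (k' n) (\<sigma>' n))
           (tor_L d d' f (k n) (k' n) (\<sigma>' n) c)"
proof
  fix n
  have "torus_pair d d' f (k n) (k' n) (\<sigma>' n) c"
  proof
    show "2 \<le> k' n j" if "j \<in> {1..d'}" for j
      using spec[OF Xi(2), of n] that by (auto simp: Xi_def PiE_iff)
    show "\<sigma>' n \<in> normalized_cocycles (Zk d' (k' n))" using spec[OF Xi(2), of n] by (simp add: Xi_def)
  qed (use d f_involution spec[OF k_k', of n] spec[OF commutation, of n] c in blast)+
  then interpret torus_pair d d' f "k n" "k' n" "\<sigma>' n" c .
  show "quantum_compact_metric_space (tor_A d d' (k' n) (\<sigma>' n)) (tor_L d d' f (k n) (k' n) (\<sigma>' n) c)"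
    unfolding tor_A_eq by (rule quantum_compact_metric_space_tori)
qed

end
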